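(* Let $\rho$ be the localized density described in the context. For every $\mu\in(0,2/3)$ there is a constant $c>0$ (depending only on $\mu$ and on the quantities listed in the context) such that $$\|\Psi_\mu\|_{L^2(\mathbb R^4)}\le c,\qquad \|G_\mu\|_{L^2(\mathbb R^4)}\le c,\qquad \|\Sigma_\mu\|_{L^2(\mathbb R^4)}\le c,$$ where $$\Psi_\mu(x,t)=\int_{\mathbb R^3}\frac{(1+|\ln|x-y||)^\mu}{|x-y|^2}\,\rho(y,t)^{5/4}\,dy,\qquad G_\mu(x,t)=\int_{\mathbb R^3}\frac{1}{|x-y|^2}\,\rho(y,t)^{5/4}\big(\ln(1+\rho(y,t))\big)^\mu\,dy,$$ $$\Sigma_\mu=G_0\,(1+|\ln G_0|)^\mu,\qquad G_0(x,t)=\int_{\mathbb R^3}\frac{1}{|x-y|^2}\,\rho(y,t)^{5/4}\,dy$$ (with $\Sigma_\mu=0$ where $G_0=0$).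
   Context: $\Omega\subset\mathbb R^3$ is a bounded domain with $C^2$ boundary, $T>0$, $Q_T=\Omega\times(0,T)$, $\nu_1>0$, $\nu_1+\nu_2\ge0$, $\mathbb S=\mathbb S(\mathbf u_\varepsilon)=\nu_1(\nabla\mathbf u_\varepsilon+\nabla\mathbf u_\varepsilon^\top)+\nu_2\,\mathrm{div}\,\mathbf u_\varepsilon\,\mathbb I$, $\mathbf f\in L^\infty(Q_T)$, $m>1$, $\varepsilon\in(0,1]$, and $P_\varepsilon$ denotes the function $P_\varepsilon(x,t)=1+\varepsilon\varrho_\varepsilon(x,t)^m$. The pair $\varrho_\varepsilon\ge0$, $\mathbf u_\varepsilon$ on $Q_T$ satisfies $$\|\varrho_\varepsilon^{3/2}P_\varepsilon\|_{L^\infty(0,T;L^1(\Omega))}+\|\varrho_\varepsilon|\mathbf u_\varepsilon|^2\|_{L^\infty(0,T;L^1(\Omega))}+\|\mathbf u_\varepsilon\|_{L^2(0,T;W^{1,2}(\Omega))}\le E$$ and, for all $\boldsymbol\xi\in C_0^\infty(Q_T;\mathbb R^3)$, $\psi\in C_0^\infty(Q_T)$, $$\int_{Q_T}\varrho_\varepsilon\mathbf u_\varepsilon\cdot\partial_t\boldsymbol\xi\,dxdt+\int_{Q_T}\big(\varrho_\varepsilon\mathbf u_\varepsilon\otimes\mathbf u_\varepsilon+\varrho_\varepsilon^{3/2}P_\varepsilon\mathbb I-\mathbb S\big):\nabla\boldsymbol\xi\,dxdt+\int_{Q_T}\varrho_\varepsilon\mathbf f\cdot\boldsymbol\xi\,dxdt=0,$$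 $$\int_{Q_T}\big(\varrho_\varepsilon\partial_t\psi+\varrho_\varepsilon\mathbf u_\varepsilon\cdot\nabla\psi\big)\,dxdt=0.$$ Fix a compact set $K\subset Q_T$ and a nonnegative $\lambda\in C_0^\infty(\mathbb R^4)$ with $\mathrm{supp}\,\lambda\subset Q_T$ and $\lambda=1$ in a neighborhood of $K$. Set $\rho=\lambda^4\varrho_\varepsilon$, $\mathbf v=\lambda\mathbf u_\varepsilon$, all functions being extended by zero to $\mathbb R^4=\mathbb R^3\times\mathbb R$. Constants $c$ depend only on $E$, $\Omega$, $T$, $\lambda$, $\nu_1,\nu_2$, $\|\mathbf f\|_{L^\infty(Q_T)}$ and the parameters indicated; they are independent of $\varepsilon$ and of the solution. *)

theory Defs
  imports "HOL-Analysis.Analysis" "HOL-Probability.Essential_Supremum"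
begin

section \<open>Smooth functions and domains\<close>

primrec Ck :: "nat \<Rightarrow> ('a::euclidean_space \<Rightarrow> 'b::real_normed_vector) \<Rightarrow> bool" where
  "Ck 0 f \<longleftrightarrow> continuous_on UNIV f"
| "Ck (Suc k) f \<longleftrightarrow> (\<forall>x. f differentiable (at x)) \<and>
     (\<forall>v. Ck k (\<lambda>x. frechet_derivative f (at x) v))"

definition supp :: "('a::topological_space \<Rightarrow> 'b::zero) \<Rightarrow> 'a set" where
  "supp f = closure {x. f x \<noteq> 0}"

text \<open>Elements of \<open>C\<^sub>0\<^sup>\<infinity>(S)\<close>, extended by zero to the whole space.\<close>

definition test_function :: "'a::euclidean_space set \<Rightarrow> ('a \<Rightarrow> 'b::real_normed_vector) \<Rightarrow> bool" where
  "test_function S \<phi> \<longleftrightarrow> (\<forall>k. Ck k \<phi>) \<and> compact (supp \<phi>) \<and> supp \<phi> \<subseteq> S"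

definition C2_boundary :: "(real^3) set \<Rightarrow> bool" where
  "C2_boundary \<Omega> \<longleftrightarrow> (\<forall>p\<in>frontier \<Omega>. \<exists>r>0. \<exists>A h.
     orthogonal_transformation (A :: real^3 \<Rightarrow> real^3) \<and> Ck 2 (h :: real \<times> real \<Rightarrow> real) \<and>
     \<Omega> \<inter> ball p r = {x \<in> ball p r. A (x - p) $ 3 > h (A (x - p) $ 1, A (x - p) $ 2)})"

definition bounded_C2_domain :: "(real^3) set \<Rightarrow> bool" where
  "bounded_C2_domain \<Omega> \<longleftrightarrow>
     open \<Omega> \<and> connected \<Omega> \<and> \<Omega> \<noteq> {} \<and> bounded \<Omega> \<and> C2_boundary \<Omega>"

definition Q :: "(real^3) set \<Rightarrow> real \<Rightarrow> ((real^3) \<times> real) set" where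
  "Q \<Omega> T = \<Omega> \<times> {0<..<T}"

definition dt :: "((real^3) \<times> real \<Rightarrow> 'b::real_normed_vector) \<Rightarrow> (real^3) \<times> real \<Rightarrow> 'b" where
  "dt g z = frechet_derivative g (at z) (0, 1)"

definition grad :: "((real^3) \<times> real \<Rightarrow> real) \<Rightarrow> (real^3) \<times> real \<Rightarrow> real^3" where
  "grad g z = (\<chi> j. frechet_derivative g (at z) (axis j 1, 0))"

definition Grad :: "((real^3) \<times> real \<Rightarrow> real^3) \<Rightarrow> (real^3) \<times> real \<Rightarrow> real^3^3" where
  "Grad g z = (\<chi> i j. (frechet_derivative g (at z) (axis j 1, 0)) $ i)"

section \<open>Function spaces and their norms\<close>

definition ennreal_sqrt :: "ennreal \<Rightarrow> ennreal" where
  "ennreal_sqrt a = (if a = \<infinity> then \<infinity> else ennreal (sqrt (enn2real a)))"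

text \<open>As for \<^const>\<open>esssup\<close>, the norm of a non-measurable function is infinite, so that a
  finite bound expresses membership in the space.\<close>

definition L2_norm :: "((real^3) \<times> real \<Rightarrow> ennreal) \<Rightarrow> ennreal" where
  "L2_norm g = (if g \<in> borel_measurable lebesgue
     then ennreal_sqrt (\<integral>\<^sup>+z. (g z)\<^sup>2 \<partial>lebesgue) else \<infinity>)"

definition Linf_norm :: "(real^3) set \<Rightarrow> real \<Rightarrow> ((real^3) \<times> real \<Rightarrow> real^3) \<Rightarrow> ennreal" where
  "Linf_norm \<Omega> T g = esssup (lebesgue_on (Q \<Omega> T)) (\<lambda>z. ennreal (norm (g z)))"

definition Linf_L1_norm :: "(real^3) set \<Rightarrow> real \<Rightarrow> ((real^3) \<times> real \<Rightarrow> real) \<Rightarrow> ennreal" where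
  "Linf_L1_norm \<Omega> T g =
     esssup (lebesgue_on {0<..<T}) (\<lambda>t. \<integral>\<^sup>+x\<in>\<Omega>. ennreal \<bar>g (x, t)\<bar> \<partial>lebesgue)"

definition locally_integrable :: "(real^3) set \<Rightarrow> (real^3 \<Rightarrow> 'b::euclidean_space) \<Rightarrow> bool" where
  "locally_integrable \<Omega> v \<longleftrightarrow> (\<forall>C. compact C \<and> C \<subseteq> \<Omega> \<longrightarrow> set_integrable lebesgue C v)"

definition weak_gradient :: "(real^3) set \<Rightarrow> (real^3 \<Rightarrow> real^3) \<Rightarrow> (real^3 \<Rightarrow> real^3^3) \<Rightarrow> bool" where
  "weak_gradient \<Omega> v Dv \<longleftrightarrow> locally_integrable \<Omega> v \<and> locally_integrable \<Omega> Dv \<and>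
     (\<forall>\<phi> :: real^3 \<Rightarrow> real. test_function \<Omega> \<phi> \<longrightarrow> (\<forall>i j.
        (LINT x:\<Omega>|lebesgue. v x $ i * frechet_derivative \<phi> (at x) (axis j 1)) =
        - (LINT x:\<Omega>|lebesgue. Dv x $ i $ j * \<phi> x)))"

text \<open>Here \<open>Dv\<close> stands for the weak gradient of \<open>v\<close>; the norm on matrices is the Frobenius norm.\<close>

definition W12_norm :: "(real^3) set \<Rightarrow> (real^3 \<Rightarrow> real^3) \<Rightarrow> (real^3 \<Rightarrow> real^3^3) \<Rightarrow> ennreal" where
  "W12_norm \<Omega> v Dv =
     ennreal_sqrt (\<integral>\<^sup>+x\<in>\<Omega>. ennreal ((norm (v x))\<^sup>2 + (norm (Dv x))\<^sup>2) \<partial>lebesgue)"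

definition spatial_weak_gradient ::
    "(real^3) set \<Rightarrow> real \<Rightarrow> ((real^3) \<times> real \<Rightarrow> real^3) \<Rightarrow> ((real^3) \<times> real \<Rightarrow> real^3^3) \<Rightarrow> bool" where
  "spatial_weak_gradient \<Omega> T u Du \<longleftrightarrow>
     u \<in> borel_measurable (lebesgue_on (Q \<Omega> T)) \<and>
     Du \<in> borel_measurable (lebesgue_on (Q \<Omega> T)) \<and>
     (AE t in lebesgue_on {0<..<T}. weak_gradient \<Omega> (\<lambda>x. u (x, t)) (\<lambda>x. Du (x, t)))"

definition L2_W12_norm ::
    "(real^3) set \<Rightarrow> real \<Rightarrow> ((real^3) \<times> real \<Rightarrow> real^3) \<Rightarrow> ((real^3) \<times> real \<Rightarrow> real^3^3) \<Rightarrow> ennreal" where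
  "L2_W12_norm \<Omega> T u Du =
     ennreal_sqrt (\<integral>\<^sup>+t\<in>{0<..<T}. (W12_norm \<Omega> (\<lambda>x. u (x, t)) (\<lambda>x. Du (x, t)))\<^sup>2 \<partial>lebesgue)"

section \<open>The regularised equations\<close>

definition Pfun :: "real \<Rightarrow> real \<Rightarrow> ((real^3) \<times> real \<Rightarrow> real) \<Rightarrow> (real^3) \<times> real \<Rightarrow> real" where
  "Pfun \<epsilon> m \<rho> z = 1 + \<epsilon> * \<rho> z powr m"

definition stress :: "real \<Rightarrow> real \<Rightarrow> real^3^3 \<Rightarrow> real^3^3" where
  "stress \<nu>1 \<nu>2 D = \<nu>1 *\<^sub>R (D + transpose D) + (\<nu>2 * trace D) *\<^sub>R mat 1"

definition tensor :: "real^3 \<Rightarrow> real^3 \<Rightarrow> real^3^3" where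
  "tensor a b = (\<chi> i j. a $ i * b $ j)"

definition energy_bound ::
    "(real^3) set \<Rightarrow> real \<Rightarrow> real \<Rightarrow> real \<Rightarrow> real \<Rightarrow>
     ((real^3) \<times> real \<Rightarrow> real) \<Rightarrow> ((real^3) \<times> real \<Rightarrow> real^3) \<Rightarrow> ((real^3) \<times> real \<Rightarrow> real^3^3) \<Rightarrow> bool" where
  "energy_bound \<Omega> T \<epsilon> m E \<rho> u Du \<longleftrightarrow>
     Linf_L1_norm \<Omega> T (\<lambda>z. \<rho> z powr (3/2) * Pfun \<epsilon> m \<rho> z) +
     Linf_L1_norm \<Omega> T (\<lambda>z. \<rho> z * (norm (u z))\<^sup>2) +
     L2_W12_norm \<Omega> T u Du \<le> ennreal E"

definition momentum_equation ::
    "(real^3) set \<Rightarrow> real \<Rightarrow> real \<Rightarrow> real \<Rightarrow> real \<Rightarrow> real \<Rightarrow> ((real^3) \<times> real \<Rightarrow> real^3) \<Rightarrow>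
     ((real^3) \<times> real \<Rightarrow> real) \<Rightarrow> ((real^3) \<times> real \<Rightarrow> real^3) \<Rightarrow> ((real^3) \<times> real \<Rightarrow> real^3^3) \<Rightarrow> bool" where
  "momentum_equation \<Omega> T \<nu>1 \<nu>2 \<epsilon> m f \<rho> u Du \<longleftrightarrow>
     (\<forall>\<xi> :: (real^3) \<times> real \<Rightarrow> real^3. test_function (Q \<Omega> T) \<xi> \<longrightarrow>
        (LINT z:Q \<Omega> T|lebesgue. (\<rho> z *\<^sub>R u z) \<bullet> dt \<xi> z) +
        (LINT z:Q \<Omega> T|lebesgue.
           (\<rho> z *\<^sub>R tensor (u z) (u z) + (\<rho> z powr (3/2) * Pfun \<epsilon> m \<rho> z) *\<^sub>R mat 1
              - stress \<nu>1 \<nu>2 (Du z)) \<bullet> Grad \<xi> z) +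
        (LINT z:Q \<Omega> T|lebesgue. (\<rho> z *\<^sub>R f z) \<bullet> \<xi> z) = 0)"

definition continuity_equation ::
    "(real^3) set \<Rightarrow> real \<Rightarrow> ((real^3) \<times> real \<Rightarrow> real) \<Rightarrow> ((real^3) \<times> real \<Rightarrow> real^3) \<Rightarrow> bool" where
  "continuity_equation \<Omega> T \<rho> u \<longleftrightarrow>
     (\<forall>\<psi> :: (real^3) \<times> real \<Rightarrow> real. test_function (Q \<Omega> T) \<psi> \<longrightarrow>
        (LINT z:Q \<Omega> T|lebesgue. \<rho> z * dt \<psi> z + (\<rho> z *\<^sub>R u z) \<bullet> grad \<psi> z) = 0)"

definition bounded_solution ::
    "(real^3) set \<Rightarrow> real \<Rightarrow> real \<Rightarrow> real \<Rightarrow> real \<Rightarrow> real \<Rightarrow> real \<Rightarrow>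
     ((real^3) \<times> real \<Rightarrow> real^3) \<Rightarrow> ((real^3) \<times> real \<Rightarrow> real) \<Rightarrow> ((real^3) \<times> real \<Rightarrow> real^3) \<Rightarrow> bool" where
  "bounded_solution \<Omega> T \<nu>1 \<nu>2 \<epsilon> m E f \<rho> u \<longleftrightarrow>
     \<rho> \<in> borel_measurable (lebesgue_on (Q \<Omega> T)) \<and>
     (AE z in lebesgue_on (Q \<Omega> T). 0 \<le> \<rho> z) \<and>
     (\<exists>Du. spatial_weak_gradient \<Omega> T u Du \<and>
        energy_bound \<Omega> T \<epsilon> m E \<rho> u Du \<and>
        momentum_equation \<Omega> T \<nu>1 \<nu>2 \<epsilon> m f \<rho> u Du) \<and>
     continuity_equation \<Omega> T \<rho> u"

section \<open>Localisation and potentials\<close>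

definition localized_density ::
    "(real^3) set \<Rightarrow> real \<Rightarrow> ((real^3) \<times> real \<Rightarrow> real) \<Rightarrow> ((real^3) \<times> real \<Rightarrow> real) \<Rightarrow> (real^3) \<times> real \<Rightarrow> real" where
  "localized_density \<Omega> T l \<rho> z = (if z \<in> Q \<Omega> T then l z ^ 4 * \<rho> z else 0)"

text \<open>The potentials are extended-real integrals of nonnegative functions, so a divergent
  integral has the value \<open>\<infinity>\<close>.\<close>

definition Psi :: "real \<Rightarrow> ((real^3) \<times> real \<Rightarrow> real) \<Rightarrow> (real^3) \<times> real \<Rightarrow> ennreal" where
  "Psi \<mu> \<rho> = (\<lambda>(x, t). \<integral>\<^sup>+y. ennreal
     ((1 + \<bar>ln (dist x y)\<bar>) powr \<mu> / (dist x y)\<^sup>2 * \<rho> (y, t) powr (5/4)) \<partial>lebesgue)"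

definition G :: "real \<Rightarrow> ((real^3) \<times> real \<Rightarrow> real) \<Rightarrow> (real^3) \<times> real \<Rightarrow> ennreal" where
  "G \<mu> \<rho> = (\<lambda>(x, t). \<integral>\<^sup>+y. ennreal
     (1 / (dist x y)\<^sup>2 * \<rho> (y, t) powr (5/4) * ln (1 + \<rho> (y, t)) powr \<mu>) \<partial>lebesgue)"

definition G0 :: "((real^3) \<times> real \<Rightarrow> real) \<Rightarrow> (real^3) \<times> real \<Rightarrow> ennreal" where
  "G0 \<rho> = (\<lambda>(x, t). \<integral>\<^sup>+y. ennreal (1 / (dist x y)\<^sup>2 * \<rho> (y, t) powr (5/4)) \<partial>lebesgue)"

definition Sigma_pot :: "real \<Rightarrow> ((real^3) \<times> real \<Rightarrow> real) \<Rightarrow> (real^3) \<times> real \<Rightarrow> ennreal" where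
  "Sigma_pot \<mu> \<rho> z =
     (if G0 \<rho> z = 0 then 0
      else if G0 \<rho> z = \<infinity> then \<infinity>
      else ennreal (enn2real (G0 \<rho> z) * (1 + \<bar>ln (enn2real (G0 \<rho> z))\<bar>) powr \<mu>))"

end

theory Submission
  imports Defs
begin

text \<open>The momentum equation is tested with \<open>l\<^sup>2 V\<close>, where
  \<open>V(x,t) = \<integral>\<integral> \<eta>(t - s) K(x - y) (l\<^sup>2 \<rho>)(y,s) dy ds\<close>. Here \<open>\<eta>\<close> is an even approximate identity in time and
  \<open>K(z) = z \<kappa>(|z|\<^sup>2 + d)\<close> with \<open>\<kappa>(s) = ln(e\<^sup>3 + 1/s)\<close> to the power \<open>4/3\<close>, divided by \<open>s\<close> to the power \<open>1/2\<close>. The continuity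
  equation removes \<open>\<partial>\<^sub>t V\<close>. After symmetrisation in the two points \<open>z = (x,t)\<close> and \<open>z' = (y,s)\<close> the kinetic part is a
  quadratic form in \<open>u(z) - u(z')\<close> that is nonnegative up to a factor of lower logarithmic order, and the pressure part dominates
  \<open>\<rho>(z)\<close> to the power \<open>3/2\<close> times \<open>\<rho>(z') \<kappa>\<close>. The kinetic defect is absorbed by the pressure, except where \<open>\<rho>\<close> is so small
  compared with \<open>|u|\<^sup>2\<close> that the energy and the Sobolev inequality for \<open>l u\<close> control it. When \<open>\<eta>\<close> concentrates and
  \<open>d\<close> tends to \<open>0\<close>, this bounds the time integral of the interaction energy of \<open>\<rho>\<close> to the power \<open>5/4\<close> with respect to the
  kernel \<open>|x - y|\<^sup>-\<^sup>1\<close> with the logarithmic weight of power \<open>4/3\<close>. The kernel of \<open>\<Psi>\<^sub>\<mu>\<close> convolved with itself has this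
  form, whence the estimate of \<open>\<Psi>\<^sub>\<mu>\<close> up to \<open>\<mu> = 2/3\<close>. In \<open>G\<^sub>\<mu>\<close> and \<open>\<Sigma>\<^sub>\<mu>\<close> the logarithms of \<open>\<rho>\<close> and of \<open>G\<^sub>0\<close> are
  dominated by \<open>|ln |x - y||\<close> up to contributions bounded by the mass.\<close>

text \<open>The exponent 4/3 is the largest this argument admits. For a weight ell^a s^(-1/2) the
  kinetic defect carries the derivative of the logarithm, hence has size ell^(a-1) s^(-1/2). In
  three dimensions the cube of this is borderline: cut off where ell <= \<Lambda>, its integral is
  of order \<Lambda>^(3a-2). Where the pressure fails to absorb the defect, ell <= \<Lambda> holds
  with \<Lambda> comparable to |u|^2 / rho^(1/2), and Young's inequality against the integral of
  rho^(3/2) leaves rho |u|^2 \<Lambda>^(a-2/3). Hoelder's inequality splits this between rho |u|^2,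
  whose spatial integral is bounded in time, and |u|^6, of whose spatial integral only the power 1/3
  is integrable in time by Sobolev's inequality; this works exactly for a <= 4/3. The
  arithmetic-geometric mean of rho^(3/2) rho' and its mirror image produces the power 5/4. No
  regularity of rho in time is available, so V is smoothed in time, every bound is made uniform in
  \<eta>, and equal times are reached for truncated densities, where continuity of translations in
  L^1 suffices.\<close>

type_synonym point = "(real^3) \<times> real"

abbreviation Borel :: "('a::topological_space \<Rightarrow> 'b::topological_space) \<Rightarrow> bool" where
  "Borel f \<equiv> f \<in> borel_measurable borel"

abbreviation nn_lborel :: "('a::euclidean_space \<Rightarrow> ennreal) \<Rightarrow> ennreal" (binder "\<integral>\<^sub>+" 10) where
  "nn_lborel f \<equiv> nn_integral lborel f"

abbreviation lint_lborel :: "('a::euclidean_space \<Rightarrow> 'b::{banach,second_countable_topology}) \<Rightarrow> 'b" (binder "\<integral>\<^sub>1" 10) where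
  "lint_lborel f \<equiv> lebesgue_integral lborel f"

section \<open>Smooth functions and convolution\<close>

definition smooth :: "('a::euclidean_space \<Rightarrow> 'b::real_normed_vector) \<Rightarrow> bool" where
  "smooth f \<longleftrightarrow> (\<forall>k. Ck k f)"

text \<open>Uniqueness of the derivative lets any explicit family \<open>f'\<close> stand in for
  \<open>frechet_derivative\<close>; this is the form in which the inductions below produce
  derivatives of sums, products and compositions.\<close>

lemma Ck_Suc_iff:
  "Ck (Suc k) f \<longleftrightarrow> (\<exists>f'. (\<forall>x. (f has_derivative f' x) (at x)) \<and> (\<forall>v. Ck k (\<lambda>x. f' x v)))"
proof
  assume "Ck (Suc k) f"
  then show "\<exists>f'. (\<forall>x. (f has_derivative f' x) (at x)) \<and> (\<forall>v. Ck k (\<lambda>x. f' x v))"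
    by (intro exI[of _ "\<lambda>x. frechet_derivative f (at x)"]) (auto simp: frechet_derivative_works)
next
  assume "\<exists>f'. (\<forall>x. (f has_derivative f' x) (at x)) \<and> (\<forall>v. Ck k (\<lambda>x. f' x v))"
  then obtain f' where f': "\<And>x. (f has_derivative f' x) (at x)" "\<And>v. Ck k (\<lambda>x. f' x v)" by blast
  have "frechet_derivative f (at x) = f' x" for x
    using frechet_derivative_at[OF f'(1)] by simp
  then show "Ck (Suc k) f" using f' by (auto simp: differentiable_def)
qed

lemma Ck_SucI:
  assumes "\<And>x. (f has_derivative f' x) (at x)" "\<And>v. Ck k (\<lambda>x. f' x v)"
  shows "Ck (Suc k) f"
  unfolding Ck_Suc_iff using assms by blast

lemma Ck_SucD: "Ck (Suc k) f \<Longrightarrow> Ck k f"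
proof (induction k arbitrary: f)
  case 0
  then show ?case by (auto intro!: continuous_at_imp_continuous_on differentiable_imp_continuous_within)
next
  case (Suc k)
  then show ?case by (metis Ck.simps(2))
qed

lemma smooth_derivative:
  assumes "smooth f"
  shows "(f has_derivative frechet_derivative f (at x)) (at x)" "smooth (\<lambda>x. frechet_derivative f (at x) v)"
  using assms unfolding smooth_def by (metis Ck.simps(2) frechet_derivative_works)+

lemma smooth_continuous: "smooth f \<Longrightarrow> continuous_on S f"
  unfolding smooth_def using continuous_on_subset by (metis Ck.simps(1) subset_UNIV)

lemma Ck_const: "Ck k (\<lambda>x. c)"
proof (induction k arbitrary: c)
  case (Suc k)
  then show ?case by (intro Ck_SucI[where f'="\<lambda>x v. 0"]) auto
qed simp

lemma smooth_const: "smooth (\<lambda>x. c)"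
  by (simp add: smooth_def Ck_const)

lemma Ck_add: "Ck k f \<Longrightarrow> Ck k g \<Longrightarrow> Ck k (\<lambda>x. f x + g x)"
proof (induction k arbitrary: f g)
  case 0
  then show ?case by (auto intro: continuous_intros)
next
  case (Suc k)
  obtain f' where f': "\<And>x. (f has_derivative f' x) (at x)" "\<And>v. Ck k (\<lambda>x. f' x v)"
    using Suc.prems(1) unfolding Ck_Suc_iff by blast
  obtain g' where g': "\<And>x. (g has_derivative g' x) (at x)" "\<And>v. Ck k (\<lambda>x. g' x v)"
    using Suc.prems(2) unfolding Ck_Suc_iff by blast
  show ?case
    by (rule Ck_SucI[where f'="\<lambda>x v. f' x v + g' x v"]) (auto intro!: Suc.IH f' g' derivative_intros)
qed

lemma Ck_bounded_linear:
  fixes L :: "'a::euclidean_space \<Rightarrow> 'b::real_normed_vector"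
  assumes "bounded_linear L" shows "Ck k L"
proof (cases k)
  case 0
  then show ?thesis using bounded_linear.continuous_on[OF assms continuous_on_id] by simp
next
  case (Suc j)
  show ?thesis unfolding Suc
    by (rule Ck_SucI[where f'="\<lambda>x v. L v"]) (auto intro!: Ck_const bounded_linear.has_derivative[OF assms] derivative_eq_intros)
qed

lemma Ck_bilinear:
  assumes "bounded_bilinear B" shows "Ck k f \<Longrightarrow> Ck k g \<Longrightarrow> Ck k (\<lambda>x. B (f x) (g x))"
proof (induction k arbitrary: f g)
  case 0
  then show ?case using assms by (auto intro: bounded_bilinear.continuous_on)
next
  case (Suc k)
  obtain f' where f': "\<And>x. (f has_derivative f' x) (at x)" "\<And>v. Ck k (\<lambda>x. f' x v)"
    using Suc.prems(1) unfolding Ck_Suc_iff by blast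
  obtain g' where g': "\<And>x. (g has_derivative g' x) (at x)" "\<And>v. Ck k (\<lambda>x. g' x v)"
    using Suc.prems(2) unfolding Ck_Suc_iff by blast
  have fg: "Ck k f" "Ck k g" using Suc.prems Ck_SucD by blast+
  show ?case
    by (rule Ck_SucI[where f'="\<lambda>x v. B (f x) (g' x v) + B (f' x v) (g x)"])
      (auto intro!: Suc.IH f' g' Ck_add fg bounded_bilinear.FDERIV[OF assms])
qed

lemma Ck_affine_comp:
  fixes L :: "'a::euclidean_space \<Rightarrow> 'b::euclidean_space"
  assumes "bounded_linear L" shows "Ck k f \<Longrightarrow> Ck k (\<lambda>x. f (L x + c))"
proof (induction k arbitrary: f)
  case 0
  have "continuous_on UNIV (\<lambda>x. L x + c)"
    by (intro continuous_intros bounded_linear.continuous_on[OF assms])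
  then show ?case using 0 continuous_on_compose2[of UNIV f UNIV "\<lambda>x. L x + c"] by auto
next
  case (Suc k)
  obtain f' where f': "\<And>x. (f has_derivative f' x) (at x)" "\<And>v. Ck k (\<lambda>x. f' x v)"
    using Suc.prems(1) unfolding Ck_Suc_iff by blast
  have "((\<lambda>x. L x + c) has_derivative L) (at x)" for x
    using bounded_linear_imp_has_derivative[OF assms] has_derivative_add_const by blast
  then have "((\<lambda>x. f (L x + c)) has_derivative (\<lambda>v. f' (L x + c) (L v))) (at x)" for x
    using has_derivative_compose f'(1) by blast
  then show ?case
    by (rule Ck_SucI) (intro Suc.IH f')
qed

text \<open>The derivative of 1/f contains 1/f again, so the induction hypothesis for the same f
  supplies that factor, one order lower.\<close>

lemma Ck_inverse:
  fixes f :: "'a::euclidean_space \<Rightarrow> real"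
  assumes pos: "\<And>x. f x > 0"
  shows "Ck k f \<Longrightarrow> Ck k (\<lambda>x. inverse (f x))"
proof (induction k)
  case 0
  have "f x \<noteq> 0" for x using pos[of x] by simp
  then show ?case using 0 by (simp add: continuous_on_inverse)
next
  case (Suc k)
  obtain f' where f': "\<And>x. (f has_derivative f' x) (at x)" "\<And>v. Ck k (\<lambda>x. f' x v)"
    using Suc.prems(1) unfolding Ck_Suc_iff by blast
  have C: "Ck k (\<lambda>x. inverse (f x))" using Suc Ck_SucD by blast
  have n: "f x \<noteq> 0" for x using pos[of x] by simp
  show ?case
    apply (rule Ck_SucI[where f'="\<lambda>x v. (-1) *\<^sub>R (f' x v * (inverse (f x) * inverse (f x)))"])
     apply (use n in \<open>auto intro!: derivative_eq_intros f' simp: mult_ac\<close>)[1]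
    apply (intro Ck_bilinear[OF bounded_bilinear_scaleR] Ck_bilinear[OF bounded_bilinear_mult] Ck_const f' C)
    done
qed

lemma Ck_ln:
  fixes f :: "'a::euclidean_space \<Rightarrow> real"
  assumes pos: "\<And>x. f x > 0" and "Ck k f"
  shows "Ck k (\<lambda>x. ln (f x))"
proof (cases k)
  case 0
  have "f x \<noteq> 0" for x using pos[of x] by simp
  then show ?thesis using \<open>Ck k f\<close> 0 by (simp add: continuous_on_ln)
next
  case (Suc j)
  obtain f' where f': "\<And>x. (f has_derivative f' x) (at x)" "\<And>v. Ck j (\<lambda>x. f' x v)"
    using \<open>Ck k f\<close> unfolding Suc Ck_Suc_iff by blast
  have C: "Ck j (\<lambda>x. inverse (f x))"
    by (rule Ck_inverse[OF pos]) (use Ck_SucD \<open>Ck k f\<close> Suc in blast)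
  show ?thesis unfolding Suc
    apply (rule Ck_SucI[where f'="\<lambda>x v. (f' x v * inverse (f x))"])
     apply (use pos in \<open>auto intro!: derivative_eq_intros f' simp: mult_ac\<close>)[1]
    apply (intro Ck_bilinear[OF bounded_bilinear_mult] f' C)
    done
qed

lemma Ck_exp:
  fixes f :: "'a::euclidean_space \<Rightarrow> real"
  shows "Ck k f \<Longrightarrow> Ck k (\<lambda>x. exp (f x))"
proof (induction k)
  case 0
  then show ?case by (auto intro!: continuous_intros)
next
  case (Suc k)
  obtain f' where f': "\<And>x. (f has_derivative f' x) (at x)" "\<And>v. Ck k (\<lambda>x. f' x v)"
    using Suc.prems(1) unfolding Ck_Suc_iff by blast
  have C: "Ck k (\<lambda>x. exp (f x))" using Suc Ck_SucD by blast
  show ?case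
    apply (rule Ck_SucI[where f'="\<lambda>x v. (f' x v * exp (f x))"])
     apply (auto intro!: derivative_eq_intros f' simp: mult_ac)[1]
    apply (intro Ck_bilinear[OF bounded_bilinear_mult] f' C)
    done
qed

lemma smooth_bounded_linear: "bounded_linear L \<Longrightarrow> smooth L"
  by (simp add: smooth_def Ck_bounded_linear)

lemma smooth_add: "smooth f \<Longrightarrow> smooth g \<Longrightarrow> smooth (\<lambda>x. f x + g x)"
  by (simp add: smooth_def Ck_add)

lemma smooth_bilinear: "bounded_bilinear B \<Longrightarrow> smooth f \<Longrightarrow> smooth g \<Longrightarrow> smooth (\<lambda>x. B (f x) (g x))"
  by (simp add: smooth_def Ck_bilinear)

lemmas smooth_mult = smooth_bilinear[OF bounded_bilinear_mult]
  and smooth_scaleR = smooth_bilinear[OF bounded_bilinear_scaleR]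
  and smooth_inner = smooth_bilinear[OF bounded_bilinear_inner]

lemma smooth_affine_comp:
  fixes L :: "'a::euclidean_space \<Rightarrow> 'b::euclidean_space"
  shows "bounded_linear L \<Longrightarrow> smooth f \<Longrightarrow> smooth (\<lambda>x. f (L x + c))"
  by (simp add: smooth_def Ck_affine_comp)

lemma smooth_ln: "(\<And>x. f x > (0::real)) \<Longrightarrow> smooth f \<Longrightarrow> smooth (\<lambda>x. ln (f x))"
  unfolding smooth_def by (intro allI Ck_ln) auto

lemma smooth_inverse: "(\<And>x. f x > (0::real)) \<Longrightarrow> smooth f \<Longrightarrow> smooth (\<lambda>x. inverse (f x))"
  unfolding smooth_def by (intro allI Ck_inverse) auto

lemma smooth_exp: "smooth f \<Longrightarrow> smooth (\<lambda>x. exp (f x :: real))"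
  unfolding smooth_def by (intro allI Ck_exp) auto

lemma smooth_powr:
  assumes f: "\<And>x. f x > (0::real)" "smooth f"
  shows "smooth (\<lambda>x. f x powr a)"
proof -
  have "smooth (\<lambda>x. exp (a * ln (f x)))"
    by (rule smooth_exp, rule smooth_mult[OF smooth_const smooth_ln[OF f]])
  moreover have "f x powr a = exp (a * ln (f x))" for x
    using f(1)[of x] by (simp add: powr_def)
  ultimately show ?thesis by simp
qed

text \<open>The derivative is uniformly continuous in each basis direction on a compact
  neighbourhood of \<open>S\<close>, and the mean value inequality on a small ball turns this into a
  first-order remainder uniform in the base point. It serves to differentiate convolutions under the
  integral.\<close>

lemma has_derivative_uniform_remainder:
  fixes f :: "'a::euclidean_space \<Rightarrow> 'b::euclidean_space"
  assumes f': "\<And>x. (f has_derivative f' x) (at x)" and cont: "\<And>v. continuous_on UNIV (\<lambda>x. f' x v)"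
    and S: "compact S" and e: "e > 0"
  shows "\<exists>d>0. \<forall>x\<in>S. \<forall>h. norm h < d \<longrightarrow> norm (f (x + h) - f x - f' x h) \<le> e * norm h"
proof -
  \<comment> \<open>Enlarging by the closed unit ball keeps \<open>x + y\<close> in a compact set
    for all steps shorter than \<open>D\<close>, which is at most 1.\<close>
  define S1 where "S1 = {x + y |x y. x \<in> S \<and> y \<in> cball (0::'a) 1}"
  have S1: "compact S1" unfolding S1_def by (intro compact_sums S compact_cball)
  \<comment> \<open>The directional bounds are summed over \<open>Basis\<close>, so half of
    \<open>e\<close> is shared equally among the directions.\<close>
  define e1 where "e1 = e / (2 * real DIM('a))"
  have e1: "e1 > 0" using e by (simp add: e1_def)
  have "\<exists>d>0. \<forall>x\<in>S1. \<forall>y\<in>S1. dist y x < d \<longrightarrow> dist (f' y b) (f' x b) < e1" for b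
    using compact_uniformly_continuous[OF continuous_on_subset[OF cont subset_UNIV] S1] e1
    unfolding uniformly_continuous_on_def by blast
  then obtain d where d: "\<And>b. d b > 0" "\<And>b x y. x \<in> S1 \<Longrightarrow> y \<in> S1 \<Longrightarrow> dist y x < d b \<Longrightarrow> dist (f' y b) (f' x b) < e1"
    by metis
  define D where "D = min 1 (Min (d ` Basis))"
  have D: "D > 0" unfolding D_def using d(1) by (simp add: Min_gr_iff)
  have onb: "onorm (\<lambda>v. f' y v - f' x v) \<le> e" if "x \<in> S1" "y \<in> S1" "dist y x < D" for x y
  proof -
    have bl: "bounded_linear (f' z)" for z using f' has_derivative_bounded_linear by blast
    have lin: "linear (\<lambda>v. f' y v - f' x v)"
      using bounded_linear_sub[OF bl bl] bounded_linear.linear by blast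
    have "norm (f' y b - f' x b) \<le> e1" if "b \<in> Basis" for b
    proof -
      have "dist y x < d b" using \<open>dist y x < D\<close> that unfolding D_def by (auto simp: Min_gr_iff)
      then show ?thesis using d(2)[of x y b] \<open>x \<in> S1\<close> \<open>y \<in> S1\<close> by (simp add: dist_norm less_imp_le)
    qed
    then have "norm (f' y v - f' x v) \<le> e * norm v" for v
    proof -
      have "f' y v - f' x v = (\<lambda>v. f' y v - f' x v) (\<Sum>b\<in>Basis. (v \<bullet> b) *\<^sub>R b)"
        by (simp add: euclidean_representation)
      also have "\<dots> = (\<Sum>b\<in>Basis. (v \<bullet> b) *\<^sub>R (f' y b - f' x b))"
        using linear_sum[OF lin, of "\<lambda>b. (v \<bullet> b) *\<^sub>R b" Basis] linear_scale[OF lin] by simp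
      also have "norm \<dots> \<le> (\<Sum>b\<in>Basis. norm ((v \<bullet> b) *\<^sub>R (f' y b - f' x b)))"
        by (rule norm_sum)
      also have "\<dots> \<le> (\<Sum>b\<in>(Basis :: 'a set). norm v * e1)"
        unfolding norm_scaleR
        by (intro sum_mono mult_mono \<open>\<And>b. b \<in> Basis \<Longrightarrow> norm (f' y b - f' x b) \<le> e1\<close>)
          (auto simp: Basis_le_norm)
      also have "\<dots> = e / 2 * norm v" by (simp add: e1_def)
      also have "\<dots> \<le> e * norm v" using e by (intro mult_right_mono) auto
      finally show ?thesis .
    qed
    then show ?thesis by (intro onorm_le) (auto simp: mult.commute)
  qed
  show ?thesis
  proof (intro exI conjI ballI allI impI)
    show "D > 0" by fact
    fix x h assume x: "x \<in> S" and h: "norm (h::'a) < D"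
    have in1: "x + y \<in> S1" if "norm y < D" for y
    proof -
      have "D \<le> 1" unfolding D_def by simp
      then have "y \<in> cball 0 1" using that by simp
      then show ?thesis using x unfolding S1_def by blast
    qed
    have "norm (f (x + h) - f x - f' x (x + h - x)) \<le> norm (x + h - x) * e"
    proof (rule differentiable_bound_linearization[where f=f and f'=f' and S="ball x D"])
      show "x + t *\<^sub>R (x + h - x) \<in> ball x D" if "t \<in> {0..1}" for t
      proof -
        have "\<bar>t\<bar> * norm h \<le> norm h" using that by (intro mult_left_le_one_le) auto
        then show ?thesis using h by (simp add: dist_norm)
      qed
      show "(f has_derivative f' z) (at z within ball x D)" for z
        using f' has_derivative_at_withinI by blast
      fix z assume "z \<in> ball x D"
      then show "onorm (f' z - f' x) \<le> e" unfolding fun_diff_def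
        using in1[of "z - x"] in1[of 0] D by (intro onb) (auto simp: dist_commute dist_norm norm_minus_commute)
    next
      show "x \<in> ball x D" using D by simp
    qed
    then show "norm (f (x + h) - f x - f' x h) \<le> e * norm h" by (simp add: mult.commute)
  qed
qed

lemma integrable_scaleR_continuous:
  fixes \<phi> :: "'a::euclidean_space \<Rightarrow> 'b::euclidean_space" and g :: "'a \<Rightarrow> real"
  assumes g: "integrable lborel g" and W: "bounded W" "\<And>w. w \<notin> W \<Longrightarrow> g w = 0"
    and \<phi>: "continuous_on UNIV \<phi>"
  shows "integrable lborel (\<lambda>w. g w *\<^sub>R \<phi> w)"
proof -
  have "compact (closure W)" using W by simp
  then have "bounded (\<phi> ` closure W)"
    by (intro compact_imp_bounded compact_continuous_image continuous_on_subset[OF \<phi>]) auto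
  then obtain B where B: "\<And>w. w \<in> closure W \<Longrightarrow> norm (\<phi> w) \<le> B"
    unfolding bounded_iff by auto
  have [measurable]: "Borel \<phi>" using \<phi> by (rule borel_measurable_continuous_onI)
  have [measurable]: "Borel g" using g by auto
  show ?thesis
  proof (rule Bochner_Integration.integrable_bound)
    show "integrable lborel (\<lambda>w. B * g w)" using g by simp
    have "norm (g w *\<^sub>R \<phi> w) \<le> norm (B * g w)" for w
    proof (cases "w \<in> W")
      case True
      then have "norm (\<phi> w) \<le> B" using B closure_subset by blast
      then have "norm (\<phi> w) \<le> \<bar>B\<bar>" by linarith
      then show ?thesis using mult_left_mono[of "norm (\<phi> w)" "\<bar>B\<bar>" "\<bar>g w\<bar>"] by (simp add: abs_mult mult.commute)
    qed (use W in auto)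
    then show "AE w in lborel. norm (g w *\<^sub>R \<phi> w) \<le> norm (B * g w)" by simp
  qed simp
qed

lemma continuous_on_reflect:
  "continuous_on UNIV \<phi> \<Longrightarrow> continuous_on UNIV (\<lambda>w. \<phi> (z - w :: 'a::real_normed_vector))"
  by (rule continuous_on_compose2[of UNIV \<phi>]) (auto intro!: continuous_intros)

section \<open>Differentiation of convolutions with an integrable function of bounded
  support\<close>

definition conv :: "('a::euclidean_space \<Rightarrow> 'b::euclidean_space) \<Rightarrow> ('a \<Rightarrow> real) \<Rightarrow> 'a \<Rightarrow> 'b" where
  "conv \<phi> g z = (\<integral>\<^sub>1w. g w *\<^sub>R \<phi> (z - w))"

text \<open>Since \<open>g\<close> lives on a bounded set, \<phi> is expanded only at points of the
  compact set z - closure W. The uniform remainder there, multiplied by the integral of |g|, bounds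
  the remainder of the convolution.\<close>

lemma conv_has_derivative:
  fixes \<phi> :: "'a::euclidean_space \<Rightarrow> 'b::euclidean_space"
  assumes g: "integrable lborel g" and W: "bounded W" "\<And>w. w \<notin> W \<Longrightarrow> g w = 0"
    and d: "\<And>x. (\<phi> has_derivative \<phi>' x) (at x)" and cont: "\<And>v. continuous_on UNIV (\<lambda>x. \<phi>' x v)"
  shows "(conv \<phi> g has_derivative (\<lambda>v. conv (\<lambda>x. \<phi>' x v) g z)) (at z)"
proof -
  have cphi: "continuous_on UNIV \<phi>"
    by (intro continuous_at_imp_continuous_on ballI has_derivative_continuous[OF d])
  have I0: "integrable lborel (\<lambda>w. g w *\<^sub>R \<phi> (x - w))" for x
    by (intro integrable_scaleR_continuous[OF g W] continuous_on_reflect cphi)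
  have I1: "integrable lborel (\<lambda>w. g w *\<^sub>R \<phi>' (x - w) v)" for x v
    by (intro integrable_scaleR_continuous[OF g W] continuous_on_reflect[OF cont])
  have bl: "bounded_linear (\<phi>' x)" for x using d has_derivative_bounded_linear by blast
  have "linear (\<lambda>v. conv (\<lambda>x. \<phi>' x v) g z)"
  proof (rule linearI)
    show "conv (\<lambda>x. \<phi>' x (b1 + b2)) g z = conv (\<lambda>x. \<phi>' x b1) g z + conv (\<lambda>x. \<phi>' x b2) g z" for b1 b2
      unfolding conv_def linear_add[OF bounded_linear.linear[OF bl]] scaleR_add_right
      by (rule Bochner_Integration.integral_add[OF I1 I1])
    show "conv (\<lambda>x. \<phi>' x (r *\<^sub>R b)) g z = r *\<^sub>R conv (\<lambda>x. \<phi>' x b) g z" for r b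
      unfolding conv_def linear_scale[OF bounded_linear.linear[OF bl]]
      by (subst integral_scaleR_right[symmetric]) (rule Bochner_Integration.integral_cong, auto simp: mult.commute)
  qed
  then have BL: "bounded_linear (\<lambda>v. conv (\<lambda>x. \<phi>' x v) g z)" by (simp add: linear_conv_bounded_linear)
  show ?thesis unfolding has_derivative_at_alt
  proof (intro conjI BL allI impI)
    fix e :: real assume e: "e > 0"
    \<comment> \<open>The summand 1 keeps the divisor positive when \<open>g\<close> vanishes almost
      everywhere.\<close>
    define M where "M = (\<integral>\<^sub>1w. \<bar>g w\<bar>) + 1"
    have M: "M > 0" unfolding M_def by (simp add: add_nonneg_pos)
    define S where "S = {x - y |x y. x \<in> {z} \<and> y \<in> closure W}"
    have "compact S" unfolding S_def using W by (intro compact_differences) auto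
    from has_derivative_uniform_remainder[OF d cont this, of "e / M"] e M
    obtain D where D: "D > 0" "\<And>x h. x \<in> S \<Longrightarrow> norm h < D \<Longrightarrow> norm (\<phi> (x + h) - \<phi> x - \<phi>' x h) \<le> e / M * norm h"
      by auto
    show "\<exists>d>0. \<forall>y. norm (y - z) < d \<longrightarrow> norm (conv \<phi> g y - conv \<phi> g z - conv (\<lambda>x. \<phi>' x (y - z)) g z) \<le> e * norm (y - z)"
    proof (intro exI[of _ D] conjI D(1) allI impI)
      fix y assume y: "norm (y - z) < D"
      define h where "h = y - z"
      have "conv \<phi> g y - conv \<phi> g z - conv (\<lambda>x. \<phi>' x (y - z)) g z
          = (\<integral>\<^sub>1w. g w *\<^sub>R \<phi> (y - w) - g w *\<^sub>R \<phi> (z - w) - g w *\<^sub>R \<phi>' (z - w) h)"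
        unfolding conv_def h_def
        by (subst Bochner_Integration.integral_diff; (intro Bochner_Integration.integrable_diff I0 I1)?)
           (simp add: Bochner_Integration.integral_diff I0 I1)
      also have "norm \<dots> \<le> (\<integral>\<^sub>1w. e / M * norm h * \<bar>g w\<bar>)"
      proof (rule Bochner_Integration.integral_norm_bound_integral)
        fix w
        show "norm (g w *\<^sub>R \<phi> (y - w) - g w *\<^sub>R \<phi> (z - w) - g w *\<^sub>R \<phi>' (z - w) h) \<le> e / M * norm h * \<bar>g w\<bar>"
        proof (cases "w \<in> W")
          case True
          then have "z - w \<in> S" unfolding S_def using closure_subset by force
          from D(2)[OF this, of h] y have "norm (\<phi> (y - w) - \<phi> (z - w) - \<phi>' (z - w) h) \<le> e / M * norm h"
            by (simp add: h_def algebra_simps)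
          then have "\<bar>g w\<bar> * norm (\<phi> (y - w) - \<phi> (z - w) - \<phi>' (z - w) h) \<le> \<bar>g w\<bar> * (e / M * norm h)"
            by (rule mult_left_mono) simp
          then show ?thesis by (simp add: mult.commute flip: scaleR_diff_right)
        qed (use W in auto)
      qed (intro Bochner_Integration.integrable_diff I0 I1 integrable_mult_right integrable_abs g)+
      also have "\<dots> = e / M * norm h * (M - 1)" by (simp add: M_def)
      also have "\<dots> \<le> e / M * norm h * M" using M e by (intro mult_left_mono) auto
      also have "\<dots> = e * norm h" using M by simp
      finally show "norm (conv \<phi> g y - conv \<phi> g z - conv (\<lambda>x. \<phi>' x (y - z)) g z) \<le> e * norm (y - z)" unfolding h_def .
    qed
  qed
qed

lemma smooth_conv_has_derivative:
  fixes \<phi> :: "'a::euclidean_space \<Rightarrow> 'b::euclidean_space"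
  assumes "integrable lborel g" "bounded W" "\<And>w. w \<notin> W \<Longrightarrow> g w = 0" "smooth \<phi>"
  shows "(conv \<phi> g has_derivative (\<lambda>v. conv (\<lambda>x. frechet_derivative \<phi> (at x) v) g z)) (at z)"
  using assms by (intro conv_has_derivative smooth_derivative smooth_continuous) 

text \<open>A derivative of the convolution is a convolution of the same \<open>g\<close> with a
  derivative of \<phi>, which is again smooth; the induction therefore runs over all smooth kernels
  at once.\<close>

lemma smooth_conv:
  fixes \<phi> :: "'a::euclidean_space \<Rightarrow> 'b::euclidean_space"
  assumes g: "integrable lborel g" "bounded W" "\<And>w. w \<notin> W \<Longrightarrow> g w = 0" and "smooth \<phi>"
  shows "smooth (conv \<phi> g)"
  unfolding smooth_def
proof
  fix k show "Ck k (conv \<phi> g)" using \<open>smooth \<phi>\<close>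
  proof (induction k arbitrary: \<phi>)
    case 0
    have "continuous (at z) (conv \<phi> g)" for z
      using has_derivative_continuous[OF smooth_conv_has_derivative[OF g 0]] .
    then show ?case by (auto intro: continuous_at_imp_continuous_on)
  next
    case (Suc k)
    have d: "(conv \<phi> g has_derivative (\<lambda>v. conv (\<lambda>x. frechet_derivative \<phi> (at x) v) g z)) (at z)" for z
      by (rule smooth_conv_has_derivative[OF g Suc.prems])
    have "Ck k (conv (\<lambda>x. frechet_derivative \<phi> (at x) v) g)" for v
      by (rule Suc.IH[OF smooth_derivative(2)[OF Suc.prems]])
    with d show ?case by (rule Ck_SucI)
  qed
qed

section \<open>Continuity of translations in the mean\<close>

lemma integrable_translation:
  fixes f :: "'a::euclidean_space \<Rightarrow> 'b::{banach,second_countable_topology}"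
  assumes "integrable lborel f" shows "integrable lborel (\<lambda>x. f (x + h))"
proof -
  have "integrable (distr lborel borel ((+) h)) f" using assms by (simp add: lborel_distr_plus)
  then show ?thesis using integrable_distr[of "(+) h" lborel borel f] by (simp add: add.commute)
qed

lemma integral_translation:
  fixes f :: "'a::euclidean_space \<Rightarrow> 'b::{banach,second_countable_topology}"
  assumes "Borel f" shows "(\<integral>\<^sub>1x. f (x + h)) = (\<integral>\<^sub>1x. f x)"
  using integral_distr[of "(+) h" lborel borel f] assms
  by (simp add: lborel_distr_plus add.commute)

lemma nn_integral_translation:
  fixes f :: "'a::euclidean_space \<Rightarrow> ennreal"
  assumes "Borel f" shows "(\<integral>\<^sub>+x. f (x + h)) = (\<integral>\<^sub>+x. f x)"
  using nn_integral_distr[of "(+) h" lborel borel f] assms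
  by (simp add: lborel_distr_plus add.commute)

definition L1_continuous :: "('a::euclidean_space \<Rightarrow> real) \<Rightarrow> bool" where
  "L1_continuous f \<longleftrightarrow> (\<forall>h. h \<longlonglongrightarrow> 0 \<longrightarrow> (\<lambda>n. \<integral>\<^sub>1x. \<bar>f (x + h n) - f x\<bar>) \<longlonglongrightarrow> 0)"

text \<open>Three-term estimate: the distance from f to g enters once translated and once
  untranslated, and the two contributions agree by translation invariance.\<close>

lemma L1_continuous_approx:
  fixes f :: "'a::euclidean_space \<Rightarrow> real"
  assumes f: "integrable lborel f"
    and approx: "\<And>e. e > 0 \<Longrightarrow> \<exists>g. integrable lborel g \<and> L1_continuous g \<and> (\<integral>\<^sub>1x. \<bar>f x - g x\<bar>) \<le> e"
  shows "L1_continuous f"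
  unfolding L1_continuous_def
proof (intro allI impI)
  fix h :: "nat \<Rightarrow> 'a" assume h: "h \<longlonglongrightarrow> 0"
  show "(\<lambda>n. \<integral>\<^sub>1x. \<bar>f (x + h n) - f x\<bar>) \<longlonglongrightarrow> 0"
  proof (rule LIMSEQ_I)
    fix e :: real assume e: "e > 0"
    obtain g where g: "integrable lborel g" "L1_continuous g" "(\<integral>\<^sub>1x. \<bar>f x - g x\<bar>) \<le> e / 4"
      using approx[of "e/4"] e by auto
    from g(2) h have "(\<lambda>n. \<integral>\<^sub>1x. \<bar>g (x + h n) - g x\<bar>) \<longlonglongrightarrow> 0" unfolding L1_continuous_def by blast
    from LIMSEQ_D[OF this, of "e/4"] e obtain N where
      N: "\<And>n. n \<ge> N \<Longrightarrow> (\<integral>\<^sub>1x. \<bar>g (x + h n) - g x\<bar>) < e / 4" by fastforce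
    show "\<exists>no. \<forall>n\<ge>no. norm ((\<integral>\<^sub>1x. \<bar>f (x + h n) - f x\<bar>) - 0) < e"
    proof (intro exI[of _ N] allI impI)
      fix n assume n: "N \<le> n"
      note I = integrable_translation[OF f] integrable_translation[OF g(1)] f g(1)
      have [measurable]: "Borel f" "Borel g" using f g by auto
      have "(\<integral>\<^sub>1x. \<bar>f (x + h n) - f x\<bar>)
          \<le> (\<integral>\<^sub>1x. \<bar>f (x + h n) - g (x + h n)\<bar> + \<bar>g (x + h n) - g x\<bar> + \<bar>f x - g x\<bar>)"
        by (rule integral_mono; (intro integrable_abs Bochner_Integration.integrable_diff Bochner_Integration.integrable_add I)?) auto
      also have "\<dots> = (\<integral>\<^sub>1x. \<bar>f (x + h n) - g (x + h n)\<bar>) + (\<integral>\<^sub>1x. \<bar>g (x + h n) - g x\<bar>) + (\<integral>\<^sub>1x. \<bar>f x - g x\<bar>)"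
        by (subst Bochner_Integration.integral_add; (intro I integrable_abs Bochner_Integration.integrable_diff Bochner_Integration.integrable_add)?)+ simp
      also have "(\<integral>\<^sub>1x. \<bar>f (x + h n) - g (x + h n)\<bar>) = (\<integral>\<^sub>1x. \<bar>f x - g x\<bar>)"
        by (rule integral_translation[where f="\<lambda>x. \<bar>f x - g x\<bar>"]) measurable
      finally show "norm ((\<integral>\<^sub>1x. \<bar>f (x + h n) - f x\<bar>) - 0) < e"
        using g(3) N[OF n] e by simp
    qed
  qed
qed

text \<open>Openness gives pointwise convergence on T, since a point of T stays in T under small
  translations. Points that enter T are accounted for by those that leave it, because the translate
  has the same measure; hence the factor 2.\<close>

lemma L1_continuous_indicator_open:
  fixes T :: "'a::euclidean_space set"
  assumes T: "open T" and fin: "emeasure lborel T < \<infinity>"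
  shows "L1_continuous (indicat_real T)"
  unfolding L1_continuous_def
proof (intro allI impI)
  fix h :: "nat \<Rightarrow> 'a" assume h: "h \<longlonglongrightarrow> 0"
  have [measurable]: "T \<in> sets borel" using T by simp
  have I: "integrable lborel (indicat_real T)" using fin by (simp add: integrable_indicator_iff)
  note I2 = integrable_translation[OF I]
  define d where "d = (\<lambda>n x. indicat_real T x * (1 - indicat_real T (x + h n)))"
  have dint: "integrable lborel (d n)" for n
    by (rule Bochner_Integration.integrable_bound[OF I]) (auto simp: d_def indicator_def)
  have "(\<lambda>n. \<integral>\<^sub>1x. d n x) \<longlonglongrightarrow> (\<integral>x. 0 \<partial>(lborel :: 'a measure))"
  proof (rule integral_dominated_convergence[where w="indicat_real T"])
    show "AE x in lborel. (\<lambda>n. d n x) \<longlonglongrightarrow> 0"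
    proof (rule AE_I2)
      fix x
      show "(\<lambda>n. d n x) \<longlonglongrightarrow> 0"
      proof (cases "x \<in> T")
        case True
        have "(\<lambda>n. x + h n) \<longlonglongrightarrow> x + 0" by (intro tendsto_intros h)
        then have "\<forall>\<^sub>F n in sequentially. x + h n \<in> T" using T True topological_tendstoD by fastforce
        then have "\<forall>\<^sub>F n in sequentially. d n x = 0" by eventually_elim (simp add: d_def)
        then show ?thesis by (rule tendsto_eventually)
      qed (simp add: d_def)
    qed
  qed (auto simp: I d_def indicator_def)
  then have lim: "(\<lambda>n. 2 * (\<integral>\<^sub>1x. d n x)) \<longlonglongrightarrow> 0" using tendsto_mult_right_zero by fastforce
  have "(\<integral>\<^sub>1x. \<bar>indicat_real T (x + h n) - indicat_real T x\<bar>) = 2 * (\<integral>\<^sub>1x. d n x)" for n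
  proof -
    have "(\<integral>\<^sub>1x. \<bar>indicat_real T (x + h n) - indicat_real T x\<bar>)
        = (\<integral>\<^sub>1x. 2 * d n x + (indicat_real T (x + h n) - indicat_real T x))"
      by (rule Bochner_Integration.integral_cong) (auto simp: d_def indicator_def)
    also have "\<dots> = 2 * (\<integral>\<^sub>1x. d n x) + ((\<integral>\<^sub>1x. indicat_real T (x + h n)) - (\<integral>\<^sub>1x. indicat_real T x))"
      by (simp add: I I2 dint)
    also have "(\<integral>\<^sub>1x. indicat_real T (x + h n)) = (\<integral>\<^sub>1x. indicat_real T x)"
      by (rule integral_translation) measurable
    finally show ?thesis by simp
  qed
  then show "(\<lambda>n. \<integral>\<^sub>1x. \<bar>indicat_real T (x + h n) - indicat_real T x\<bar>) \<longlonglongrightarrow> 0"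
    using lim by simp
qed

lemma L1_continuous_add:
  fixes f g :: "'a::euclidean_space \<Rightarrow> real"
  assumes "integrable lborel f" "integrable lborel g" "L1_continuous f" "L1_continuous g"
  shows "L1_continuous (\<lambda>x. f x + g x)"
  unfolding L1_continuous_def
proof (intro allI impI)
  fix h :: "nat \<Rightarrow> 'a" assume h: "h \<longlonglongrightarrow> 0"
  note I = integrable_translation[OF assms(1)] integrable_translation[OF assms(2)] assms(1,2)
  have [measurable]: "Borel f" "Borel g" using assms by auto
  have lim: "(\<lambda>n. (\<integral>\<^sub>1x. \<bar>f (x + h n) - f x\<bar>) + (\<integral>\<^sub>1x. \<bar>g (x + h n) - g x\<bar>)) \<longlonglongrightarrow> 0"
    using assms(3,4) h unfolding L1_continuous_def by (intro tendsto_add_zero) auto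
  have "(\<integral>\<^sub>1x. \<bar>f (x + h n) + g (x + h n) - (f x + g x)\<bar>)
      \<le> (\<integral>\<^sub>1x. \<bar>f (x + h n) - f x\<bar> + \<bar>g (x + h n) - g x\<bar>)" for n
    by (rule integral_mono; (intro integrable_abs Bochner_Integration.integrable_diff Bochner_Integration.integrable_add I)?) auto
  then have *: "(\<integral>\<^sub>1x. \<bar>f (x + h n) + g (x + h n) - (f x + g x)\<bar>)
      \<le> (\<integral>\<^sub>1x. \<bar>f (x + h n) - f x\<bar>) + (\<integral>\<^sub>1x. \<bar>g (x + h n) - g x\<bar>)" for n
    by (subst (asm) Bochner_Integration.integral_add) (auto intro!: I)
  show "(\<lambda>n. \<integral>\<^sub>1x. \<bar>f (x + h n) + g (x + h n) - (f x + g x)\<bar>) \<longlonglongrightarrow> 0"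
    by (rule tendsto_sandwich[OF _ _ tendsto_const lim]) (auto intro!: always_eventually *)
qed

text \<open>Measurable sets are reached from open sets by outer regularity, sums by
  \<open>L1_continuous_add\<close>, and dominated limits by
  \<open>L1_continuous_approx\<close>.\<close>

lemma integrable_L1_continuous:
  fixes f :: "'a::euclidean_space \<Rightarrow> real"
  assumes "integrable lborel f" shows "L1_continuous f"
  using assms
proof (induction rule: integrable_induct)
  case (base A c)
  have ind: "L1_continuous (indicat_real A)"
  proof (rule L1_continuous_approx)
    have A: "A \<in> sets borel" "emeasure lborel A < \<infinity>" using base by auto
    show IA: "integrable lborel (indicat_real A)" using A by (simp add: integrable_indicator_iff)
    fix e :: real assume e: "e > 0"
    obtain T where T: "open T" "A \<subseteq> T" "emeasure lborel (T - A) < ennreal e"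
      using outer_regular_lborel[OF A(1) e] by blast
    have [measurable]: "T \<in> sets borel" "A \<in> sets borel" using T A by auto
    have "emeasure lborel T = emeasure lborel A + emeasure lborel (T - A)"
      using T(2) by (subst plus_emeasure) (auto intro!: arg_cong[where f="emeasure lborel"])
    then have fin: "emeasure lborel T < \<infinity>" using A T(3) by (metis ennreal_add_eq_top ennreal_less_top less_top order_less_trans infinity_ennreal_def)
    have "(\<integral>\<^sub>1x. \<bar>indicat_real A x - indicat_real T x\<bar>) = (\<integral>\<^sub>1x. indicat_real (T - A) x)"
      using T(2) by (intro Bochner_Integration.integral_cong) (auto simp: indicator_def)
    also have "\<dots> = measure lborel (T - A)" by simp
    also have "\<dots> \<le> e" using T(3) e unfolding measure_def by (intro enn2real_leI) auto
    finally show "\<exists>g. integrable lborel g \<and> L1_continuous g \<and> (\<integral>\<^sub>1x. \<bar>indicat_real A x - g x\<bar>) \<le> e"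
      using T(1) fin L1_continuous_indicator_open[OF T(1) fin] by (intro exI[of _ "indicat_real T"]) (auto simp: integrable_indicator_iff)
  qed
  show ?case unfolding L1_continuous_def
  proof (intro allI impI)
    fix h :: "nat \<Rightarrow> 'a" assume h: "h \<longlonglongrightarrow> 0"
    have "(\<lambda>n. (\<integral>\<^sub>1x. \<bar>indicat_real A (x + h n) - indicat_real A x\<bar>) * \<bar>c\<bar>) \<longlonglongrightarrow> 0"
      using ind h unfolding L1_continuous_def by (intro tendsto_mult_left_zero) auto
    moreover have "\<bar>indicat_real A (x + h n) *\<^sub>R c - indicat_real A x *\<^sub>R c\<bar> = \<bar>indicat_real A (x + h n) - indicat_real A x\<bar> * \<bar>c\<bar>" for x n
      by (simp add: left_diff_distrib abs_mult flip: left_diff_distrib)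
    ultimately show "(\<lambda>n. \<integral>\<^sub>1x. \<bar>indicat_real A (x + h n) *\<^sub>R c - indicat_real A x *\<^sub>R c\<bar>) \<longlonglongrightarrow> 0"
      by simp
  qed
next
  case (add f g)
  then show ?case by (intro L1_continuous_add)
next
  case (lim f s)
  have fm: "f \<in> borel_measurable lborel" "\<And>i. s i \<in> borel_measurable lborel" using lim by auto
  show ?case
  proof (rule L1_continuous_approx[OF lim(4)])
    fix e :: real assume e: "e > 0"
    have "(\<lambda>i. \<integral>\<^sub>1x. \<bar>f x - s i x\<bar>) \<longlonglongrightarrow> (\<integral>x. 0 \<partial>(lborel :: 'a measure))"
    proof (rule integral_dominated_convergence[where w="\<lambda>x. 3 * \<bar>f x\<bar>"])
      show "AE x in lborel. (\<lambda>i. \<bar>f x - s i x\<bar>) \<longlonglongrightarrow> 0"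
      proof (rule AE_I2)
        fix x :: 'a assume "x \<in> space lborel"
        from lim(2)[OF this] have "(\<lambda>i. \<bar>f x - s i x\<bar>) \<longlonglongrightarrow> \<bar>f x - f x\<bar>" by (intro tendsto_intros)
        then show "(\<lambda>i. \<bar>f x - s i x\<bar>) \<longlonglongrightarrow> 0" by simp
      qed
      show "AE x in lborel. norm \<bar>f x - s i x\<bar> \<le> 3 * \<bar>f x\<bar>" for i
      proof (rule AE_I2)
        fix x :: 'a assume "x \<in> space lborel"
        from lim(3)[OF this, of i] show "norm \<bar>f x - s i x\<bar> \<le> 3 * \<bar>f x\<bar>" by auto
      qed
    qed (use lim fm in auto)
    then have "(\<lambda>i. \<integral>\<^sub>1x. \<bar>f x - s i x\<bar>) \<longlonglongrightarrow> 0" by simp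
    from LIMSEQ_D[OF this e] obtain i where "(\<integral>\<^sub>1x. \<bar>f x - s i x\<bar>) < e" by fastforce
    then show "\<exists>g. integrable lborel g \<and> L1_continuous g \<and> (\<integral>\<^sub>1x. \<bar>f x - g x\<bar>) \<le> e"
      using lim by (intro exI[of _ "s i"]) auto
  qed
qed

section \<open>The Sobolev inequality\<close>

lemma ennreal_sqrt_power2: "ennreal_sqrt (a\<^sup>2) = a"
proof (cases a)
  case (real r)
  then show ?thesis by (simp add: ennreal_sqrt_def ennreal_power)
qed (simp add: ennreal_sqrt_def power2_eq_square)

lemma power2_ennreal_sqrt: "(ennreal_sqrt a)\<^sup>2 = a"
proof (cases a)
  case (real r)
  then show ?thesis by (simp add: ennreal_sqrt_def ennreal_power)
qed (simp add: ennreal_sqrt_def power2_eq_square)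

lemma ennreal_sqrt_mult: "ennreal_sqrt (a * b) = ennreal_sqrt a * ennreal_sqrt b"
  by (metis ennreal_sqrt_power2 power2_ennreal_sqrt power_mult_distrib)

lemma ennreal_sqrt_mono: "a \<le> b \<Longrightarrow> ennreal_sqrt a \<le> ennreal_sqrt b"
  unfolding ennreal_sqrt_def
  by (auto simp: top_unique intro!: ennreal_leI real_sqrt_le_mono enn2real_mono) (simp add: less_top)

lemma measurable_ennreal_sqrt[measurable]: "Borel ennreal_sqrt"
  unfolding ennreal_sqrt_def[abs_def] by measurable

lemma nn_integral_Cauchy_Schwarz_sqrt:
  assumes [measurable]: "f \<in> borel_measurable M" "g \<in> borel_measurable M"
  shows "(\<integral>\<^sup>+x. ennreal_sqrt (f x) * ennreal_sqrt (g x) \<partial>M) \<le> ennreal_sqrt (\<integral>\<^sup>+x. f x \<partial>M) * ennreal_sqrt (\<integral>\<^sup>+x. g x \<partial>M)"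
proof -
  have "(\<integral>\<^sup>+x. ennreal_sqrt (f x) * ennreal_sqrt (g x) \<partial>M)\<^sup>2
      \<le> (\<integral>\<^sup>+x. (ennreal_sqrt (f x))\<^sup>2 \<partial>M) * (\<integral>\<^sup>+x. (ennreal_sqrt (g x))\<^sup>2 \<partial>M)"
    by (rule Cauchy_Schwarz_nn_integral) measurable
  from ennreal_sqrt_mono[OF this] show ?thesis
    by (simp add: ennreal_sqrt_power2 ennreal_sqrt_mult power2_ennreal_sqrt)
qed

text \<open>Cauchy-Schwarz is applied three times, in z, then in y, then in x, each time to the two
  factors that contain the variable.\<close>

lemma Loomis_Whitney:
  fixes A B C :: "real \<times> real \<Rightarrow> ennreal"
  assumes [measurable]: "Borel A" "Borel B" "Borel C"
  shows "(\<integral>\<^sub>+x y z. ennreal_sqrt (A (y, z)) * (ennreal_sqrt (B (x, z)) * ennreal_sqrt (C (x, y))))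
    \<le> ennreal_sqrt (\<integral>\<^sub>+y z. A (y, z)) * (ennreal_sqrt (\<integral>\<^sub>+x z. B (x, z))
      * ennreal_sqrt (\<integral>\<^sub>+x y. C (x, y)))"
proof -
  have m[measurable]: "A \<in> borel_measurable (lborel \<Otimes>\<^sub>M lborel)" "B \<in> borel_measurable (lborel \<Otimes>\<^sub>M lborel)" "C \<in> borel_measurable (lborel \<Otimes>\<^sub>M lborel)"
    by (auto simp: lborel_prod)
  let ?a = "\<lambda>y. \<integral>\<^sub>+z. A (y, z)" and ?b = "\<lambda>x. \<integral>\<^sub>+z. B (x, z)" and ?c = "\<lambda>x. \<integral>\<^sub>+y. C (x, y)"
  have "(\<integral>\<^sub>+x y z. ennreal_sqrt (A (y, z)) * (ennreal_sqrt (B (x, z)) * ennreal_sqrt (C (x, y))))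
     = (\<integral>\<^sub>+x y. (\<integral>\<^sub>+z. ennreal_sqrt (A (y, z)) * ennreal_sqrt (B (x, z))) * ennreal_sqrt (C (x, y)))"
    by (simp add: nn_integral_multc[symmetric] mult.assoc)
  also have "\<dots> \<le> (\<integral>\<^sub>+x y. (ennreal_sqrt (?a y) * ennreal_sqrt (?b x)) * ennreal_sqrt (C (x, y)))"
    by (intro nn_integral_mono mult_right_mono nn_integral_Cauchy_Schwarz_sqrt) (auto)
  also have "\<dots> = (\<integral>\<^sub>+x. ennreal_sqrt (?b x) * (\<integral>\<^sub>+y. ennreal_sqrt (?a y) * ennreal_sqrt (C (x, y))))"
    by (subst nn_integral_cmult[symmetric]) (auto simp: mult_ac)
  also have "\<dots> \<le> (\<integral>\<^sub>+x. ennreal_sqrt (?b x) * (ennreal_sqrt (\<integral>\<^sub>+y. ?a y) * ennreal_sqrt (?c x)))"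
    by (intro nn_integral_mono mult_left_mono nn_integral_Cauchy_Schwarz_sqrt) auto
  also have "\<dots> = ennreal_sqrt (\<integral>\<^sub>+y. ?a y) * (\<integral>\<^sub>+x. ennreal_sqrt (?b x) * ennreal_sqrt (?c x))"
    by (subst nn_integral_cmult[symmetric]) (auto simp: mult_ac)
  also have "\<dots> \<le> ennreal_sqrt (\<integral>\<^sub>+y. ?a y) * (ennreal_sqrt (\<integral>\<^sub>+x. ?b x) * ennreal_sqrt (\<integral>\<^sub>+x. ?c x))"
    by (intro mult_left_mono nn_integral_Cauchy_Schwarz_sqrt) auto
  finally show ?thesis .
qed

definition vec3 :: "real \<times> real \<times> real \<Rightarrow> real^3" where
  "vec3 = (\<lambda>(a, b, c). a *\<^sub>R axis 1 1 + b *\<^sub>R axis 2 1 + c *\<^sub>R axis 3 1)"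

lemma vec3_nth [simp]: "vec3 (a, b, c) $ 1 = a" "vec3 (a, b, c) $ 2 = b" "vec3 (a, b, c) $ 3 = c"
  by (simp_all add: vec3_def axis_def)

lemma vec3_shift:
  "vec3 (a, b, c) + (t - a) *\<^sub>R axis 1 1 = vec3 (t, b, c)"
  "vec3 (a, b, c) + (t - b) *\<^sub>R axis 2 1 = vec3 (a, t, c)"
  "vec3 (a, b, c) + (t - c) *\<^sub>R axis 3 1 = vec3 (a, b, t)"
  by (simp_all add: vec3_def algebra_simps)

lemma measurable_vec3[measurable]: "Borel vec3"
  unfolding vec3_def split_beta' by (intro borel_measurable_continuous_onI continuous_intros)

lemma measurable_vec3_compose[measurable (raw)]:
  assumes [measurable]: "f \<in> borel_measurable M" "g \<in> borel_measurable M" "h \<in> borel_measurable M"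
  shows "(\<lambda>p. vec3 (f p, g p, h p)) \<in> borel_measurable M"
  unfolding vec3_def by simp

lemma Basis_real3: "(Basis :: (real^3) set) = {axis 1 1, axis 2 1, axis 3 1}"
  by (auto simp: Basis_vec_def UNIV_3)

text \<open>Carries iterated integration over to \<open>real^3\<close>, where the Loomis-Whitney
  inequality calls for one integral per coordinate. A measure that gives boxes their volume is
  Lebesgue measure.\<close>

lemma lborel_vec3: "(lborel :: (real^3) measure) = distr lborel borel vec3"
proof (rule lborel_eqI)
  fix l u :: "real^3" assume le: "\<And>b. b \<in> Basis \<Longrightarrow> l \<bullet> b \<le> u \<bullet> b"
  have lei: "l $ i \<le> u $ i" for i using le[of "axis i 1"] by (simp add: inner_axis axis_in_Basis_iff)
  have ne: "axis i 1 \<noteq> (axis j 1 :: real^3)" if "i \<noteq> j" for i j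
    using that by (simp add: axis_eq_axis)
  have "vec3 -` box l u = {l$1<..<u$1} \<times> ({l$2<..<u$2} \<times> {l$3<..<u$3})"
    by (auto simp: mem_box_cart forall_3)
  then have "emeasure (distr lborel borel vec3) (box l u) = emeasure lborel ({l$1<..<u$1} \<times> ({l$2<..<u$2} \<times> {l$3<..<u$3}))"
    by (subst emeasure_distr) auto
  also have "\<dots> = emeasure (lborel \<Otimes>\<^sub>M (lborel \<Otimes>\<^sub>M lborel)) ({l$1<..<u$1} \<times> ({l$2<..<u$2} \<times> {l$3<..<u$3}))"
    by (simp add: lborel_prod)
  also have "\<dots> = emeasure lborel {l$1<..<u$1} * emeasure (lborel \<Otimes>\<^sub>M lborel) ({l$2<..<u$2} \<times> {l$3<..<u$3})"
    by (subst lborel_pair.emeasure_pair_measure_Times | subst lborel_prod)+ (auto simp: lborel_prod)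
  also have "emeasure (lborel \<Otimes>\<^sub>M lborel) ({l$2<..<u$2} \<times> {l$3<..<u$3}) = emeasure lborel {l$2<..<u$2} * emeasure lborel {l$3<..<u$3}"
    by (subst lborel.emeasure_pair_measure_Times) auto
  also have "emeasure lborel {l$1<..<u$1} * (emeasure lborel {l$2<..<u$2} * emeasure lborel {l$3<..<u$3})
      = ennreal ((u$1 - l$1) * ((u$2 - l$2) * (u$3 - l$3)))"
    using lei by (simp add: ennreal_mult)
  also have "(u$1 - l$1) * ((u$2 - l$2) * (u$3 - l$3)) = (\<Prod>b\<in>Basis. (u - l) \<bullet> b)"
    unfolding Basis_real3 by (simp add: ne inner_axis)
  finally show "emeasure (distr lborel borel vec3) (box l u) = (\<Prod>b\<in>Basis. (u - l) \<bullet> b)" .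
qed simp

lemma nn_integral_real3:
  fixes f :: "real^3 \<Rightarrow> ennreal"
  assumes [measurable]: "Borel f"
  shows "(\<integral>\<^sub>+x. f x) = (\<integral>\<^sub>+a b c. f (vec3 (a, b, c)))"
proof -
  have "(\<integral>\<^sub>+x. f x) = (\<integral>\<^sub>+p. f (vec3 p))"
    by (subst lborel_vec3, subst nn_integral_distr) auto
  also have "\<dots> = (\<integral>\<^sup>+p. f (vec3 p) \<partial>(lborel \<Otimes>\<^sub>M lborel))" by (simp add: lborel_prod)
  also have "\<dots> = (\<integral>\<^sub>+a q. f (vec3 (a, q)))"
    by (subst lborel.nn_integral_fst[symmetric]) (auto simp: lborel_prod)
  also have "\<dots> = (\<integral>\<^sub>+a. \<integral>\<^sup>+q. f (vec3 (a, q)) \<partial>(lborel \<Otimes>\<^sub>M lborel))" by (simp add: lborel_prod)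
  also have "\<dots> = (\<integral>\<^sub>+a b c. f (vec3 (a, b, c)))"
    by (subst lborel.nn_integral_fst[symmetric]) (auto simp: lborel_prod)
  finally show ?thesis .
qed

lemma abs_le_nn_integral_deriv:
  fixes \<phi> :: "real \<Rightarrow> real"
  assumes d: "\<And>t. (\<phi> has_real_derivative \<phi>' t) (at t)" and c: "continuous_on UNIV \<phi>'"
    and z: "\<And>t. t \<le> a \<Longrightarrow> \<phi> t = 0"
  shows "ennreal \<bar>\<phi> b\<bar> \<le> (\<integral>\<^sub>+t. ennreal \<bar>\<phi>' t\<bar>)"
proof (cases "b \<le> a")
  case False
  have "(\<integral>\<^sub>1x. \<phi>' x * indicator {a..b} x) = \<phi> b - \<phi> a" "has_bochner_integral lborel (\<lambda>x. \<phi>' x * indicator {a..b} x) (\<phi> b - \<phi> a)"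
    using False d c by (auto intro!: integral_FTC_Icc_real has_bochner_integral_FTC_Icc_real simp: continuous_on_eq_continuous_at)
  then have "\<phi> b = (\<integral>\<^sub>1x. \<phi>' x * indicator {a..b} x)" and I: "integrable lborel (\<lambda>x. \<phi>' x * indicator {a..b} x)"
    using z[of a] by (auto intro: integrable.intros)
  then have "ennreal \<bar>\<phi> b\<bar> \<le> (\<integral>\<^sub>+x. norm (\<phi>' x * indicator {a..b} x))"
    using integral_norm_bound_ennreal[OF I] by simp
  also have "\<dots> \<le> (\<integral>\<^sub>+t. ennreal \<bar>\<phi>' t\<bar>)"
    by (intro nn_integral_mono) (auto simp: indicator_def)
  finally show ?thesis .
qed (use z in simp)

text \<open>At each point |g| is at most the integral of a partial derivative along the line through
  the point, in each of the three directions. The product of the square roots of the three bounds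
  dominates |g|^(3/2), and Loomis-Whitney integrates it.\<close>

lemma Gagliardo_Nirenberg_L1:
  fixes g :: "real^3 \<Rightarrow> real"
  assumes d: "\<And>x. (g has_derivative g' x) (at x)" and c: "\<And>v. continuous_on UNIV (\<lambda>x. g' x v)"
    and W: "bounded W" "\<And>x. x \<notin> W \<Longrightarrow> g x = 0"
  shows "(\<integral>\<^sub>+x. ennreal_sqrt (ennreal \<bar>g x\<bar>) ^ 3)
    \<le> ennreal_sqrt (\<integral>\<^sub>+x. ennreal \<bar>g' x (axis 1 1)\<bar>) * (ennreal_sqrt (\<integral>\<^sub>+x. ennreal \<bar>g' x (axis 2 1)\<bar>)
        * ennreal_sqrt (\<integral>\<^sub>+x. ennreal \<bar>g' x (axis 3 1)\<bar>))"
proof -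
  obtain N where N: "\<And>x. x \<in> W \<Longrightarrow> norm x \<le> N" using W(1) by (auto simp: bounded_iff)
  \<comment> \<open>Points whose coordinate is at most -N - 1 lie outside W, so integration along a
    line can start from the value 0.\<close>
  have small: "g x = 0" if "x $ i \<le> - N - 1" for x i
    using N[of x] W(2)[of x] component_le_norm_cart[of x i] that by fastforce
  have cg: "continuous_on UNIV g"
    by (intro continuous_at_imp_continuous_on ballI has_derivative_continuous[OF d])
  have [measurable]: "Borel g" "\<And>v. (\<lambda>x. g' x v) \<in> borel_measurable borel"
    using cg c by (auto intro: borel_measurable_continuous_onI)
  have line: "ennreal \<bar>g x\<bar> \<le> (\<integral>\<^sub>+t. ennreal \<bar>g' (x + (t - x $ i) *\<^sub>R axis i 1) (axis i 1)\<bar>)" for x i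
  proof -
    let ?L = "\<lambda>t. x + (t - x $ i) *\<^sub>R axis i 1"
    have "((\<lambda>t. g (?L t)) has_derivative (\<lambda>s. g' (?L t) (s *\<^sub>R axis i 1))) (at t)" for t
      by (rule has_derivative_compose[OF _ d]) (auto intro!: derivative_eq_intros)
    moreover have "g' y (s *\<^sub>R axis i 1) = g' y (axis i 1) * s" for y s
      using linear_scale[OF has_derivative_linear[OF d]] by simp
    ultimately have D: "((\<lambda>t. g (?L t)) has_real_derivative g' (?L t) (axis i 1)) (at t)" for t
      unfolding has_field_derivative_def by simp
    have "continuous_on UNIV (\<lambda>t. g' (?L t) (axis i 1))"
      by (rule continuous_on_compose2[OF c]) (auto intro!: continuous_intros)
    from abs_le_nn_integral_deriv[OF D this, of "-N - 1" "x $ i"] show ?thesis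
      using small[of "?L _" i] by (simp add: axis_def)
  qed
  define A where "A = (\<lambda>(b, c). \<integral>\<^sub>+t. ennreal \<bar>g' (vec3 (t, b, c)) (axis 1 1)\<bar>)"
  define B where "B = (\<lambda>(a, c). \<integral>\<^sub>+t. ennreal \<bar>g' (vec3 (a, t, c)) (axis 2 1)\<bar>)"
  define C where "C = (\<lambda>(a, b). \<integral>\<^sub>+t. ennreal \<bar>g' (vec3 (a, b, t)) (axis 3 1)\<bar>)"
  have [measurable]: "Borel A" "Borel B" "Borel C"
    unfolding A_def B_def C_def borel_prod[symmetric] by measurable
  have l1: "ennreal \<bar>g (vec3 (a, b, c))\<bar> \<le> A (b, c)" for a b c
    using line[of "vec3 (a, b, c)" 1] by (simp add: A_def vec3_shift)
  have l2: "ennreal \<bar>g (vec3 (a, b, c))\<bar> \<le> B (a, c)" for a b c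
    using line[of "vec3 (a, b, c)" 2] by (simp add: B_def vec3_shift)
  have l3: "ennreal \<bar>g (vec3 (a, b, c))\<bar> \<le> C (a, b)" for a b c
    using line[of "vec3 (a, b, c)" 3] by (simp add: C_def vec3_shift)
  have "(\<integral>\<^sub>+x. ennreal_sqrt (ennreal \<bar>g x\<bar>) ^ 3)
      = (\<integral>\<^sub>+a b c. ennreal_sqrt (ennreal \<bar>g (vec3 (a, b, c))\<bar>) ^ 3)"
    by (rule nn_integral_real3) measurable
  also have "\<dots> \<le> (\<integral>\<^sub>+a b c. ennreal_sqrt (A (b, c)) * (ennreal_sqrt (B (a, c)) * ennreal_sqrt (C (a, b))))"
    unfolding power3_eq_cube mult.assoc
    by (intro nn_integral_mono mult_mono ennreal_sqrt_mono l1 l2 l3) auto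
  also have "\<dots> \<le> ennreal_sqrt (\<integral>\<^sub>+y z. A (y, z)) * (ennreal_sqrt (\<integral>\<^sub>+x z. B (x, z))
      * ennreal_sqrt (\<integral>\<^sub>+x y. C (x, y)))"
    by (rule Loomis_Whitney) measurable
  also have "(\<integral>\<^sub>+x y. C (x, y)) = (\<integral>\<^sub>+x. ennreal \<bar>g' x (axis 3 1)\<bar>)"
    unfolding C_def by (subst nn_integral_real3) auto
  also have "(\<integral>\<^sub>+x z. B (x, z)) = (\<integral>\<^sub>+x. ennreal \<bar>g' x (axis 2 1)\<bar>)"
    unfolding B_def
    by (subst nn_integral_real3) (auto intro!: nn_integral_cong lborel_pair.Fubini')
  also have "(\<integral>\<^sub>+y z. A (y, z)) = (\<integral>\<^sub>+x. ennreal \<bar>g' x (axis 1 1)\<bar>)"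
  proof -
    have "(\<integral>\<^sub>+x. ennreal \<bar>g' x (axis 1 1)\<bar>) = (\<integral>\<^sub>+b a c. ennreal \<bar>g' (vec3 (a, b, c)) (axis 1 1)\<bar>)"
      by (subst nn_integral_real3) (auto intro!: lborel_pair.Fubini')
    also have "\<dots> = (\<integral>\<^sub>+b c a. ennreal \<bar>g' (vec3 (a, b, c)) (axis 1 1)\<bar>)"
      by (intro nn_integral_cong lborel_pair.Fubini') auto
    finally show ?thesis by (simp add: A_def)
  qed
  finally show ?thesis .
qed

lemma integral_scale:
  fixes f :: "'a::euclidean_space \<Rightarrow> 'b::{banach,second_countable_topology}"
  assumes [measurable]: "Borel f" and c: "c \<noteq> 0"
  shows "(\<integral>\<^sub>1x. f x) = \<bar>c\<bar> ^ DIM('a) *\<^sub>R (\<integral>\<^sub>1x. f (t + c *\<^sub>R x))"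
  by (subst lborel_affine[OF c, of t]) (simp add: integral_density integral_distr)

lemma nn_integral_scale:
  fixes f :: "'a::euclidean_space \<Rightarrow> ennreal"
  assumes [measurable]: "Borel f" and c: "c \<noteq> 0"
  shows "(\<integral>\<^sub>+x. f x) = ennreal (\<bar>c\<bar> ^ DIM('a)) * (\<integral>\<^sub>+x. f (t + c *\<^sub>R x))"
  by (subst lborel_affine[OF c, of t]) (simp add: nn_integral_density nn_integral_distr nn_integral_cmult)

lemma integrable_scale:
  fixes f :: "'a::euclidean_space \<Rightarrow> 'b::{banach,second_countable_topology}"
  assumes f: "integrable lborel f" and c: "c \<noteq> 0"
  shows "integrable lborel (\<lambda>x. f (t + c *\<^sub>R x))"
proof -
  have [measurable]: "Borel f" using f by auto
  have "integrable (density (distr lborel borel (\<lambda>x. t + c *\<^sub>R x)) (\<lambda>_. ennreal (\<bar>c\<bar> ^ DIM('a)))) f"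
    using f lborel_affine[OF c, of t] by simp
  then have "integrable (distr lborel borel (\<lambda>x. t + c *\<^sub>R x)) (\<lambda>x. \<bar>c\<bar> ^ DIM('a) *\<^sub>R f x)"
    by (subst (asm) integrable_density) auto
  then have "integrable lborel (\<lambda>x. \<bar>c\<bar> ^ DIM('a) *\<^sub>R f (t + c *\<^sub>R x))"
    by (subst (asm) integrable_distr_eq) auto
  from integrable_scaleR_right[of "inverse (\<bar>c\<bar> ^ DIM('a))", OF this] show ?thesis using c by simp
qed

lemma nn_integral_reflect:
  fixes f :: "'a::euclidean_space \<Rightarrow> ennreal"
  assumes [measurable]: "Borel f"
  shows "(\<integral>\<^sub>+x. f (z - x)) = (\<integral>\<^sub>+x. f x)"
  using nn_integral_scale[of f "-1" z] by simp

text \<open>Applied to v^4, the preceding inequality has v^6 on the left, and Cauchy-Schwarz on 4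
  v^3 v' brings the integral n of v^6 back on the right. Comparing powers gives n^4 <= 4^6 n^3 S^3,
  which may be divided by n^3 because bounded support makes n finite. This is the origin of
  4096.\<close>

lemma Sobolev_smooth:
  fixes v :: "real^3 \<Rightarrow> real"
  assumes v: "smooth v" and W: "bounded W" "\<And>x. x \<notin> W \<Longrightarrow> v x = 0" and S: "S \<ge> 0"
    and le: "\<And>i. (\<integral>\<^sub>+x. ennreal ((frechet_derivative v (at x) (axis i 1))\<^sup>2)) \<le> ennreal S"
  shows "(\<integral>\<^sub>+x. ennreal (v x ^ 6)) \<le> ennreal (4096 * S ^ 3)"
proof -
  define v' where "v' = (\<lambda>x. frechet_derivative v (at x))"
  have d: "(v has_derivative v' x) (at x)" for x unfolding v'_def by (rule smooth_derivative(1)[OF v])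
  have cv': "continuous_on UNIV (\<lambda>x. v' x h)" for h
    unfolding v'_def by (intro smooth_continuous smooth_derivative v)
  have cv: "continuous_on UNIV v" by (rule smooth_continuous[OF v])
  have [measurable]: "Borel v" "\<And>h. (\<lambda>x. v' x h) \<in> borel_measurable borel"
    using cv cv' by (auto intro: borel_measurable_continuous_onI)
  define N where "N = (\<integral>\<^sub>+x. ennreal (v x ^ 6))"
  have "integrable lborel (\<lambda>x. indicator (closure W) x *\<^sub>R v x ^ 6)"
    using W by (intro borel_integrable_compact continuous_intros continuous_on_subset[OF cv]) auto
  moreover have "(\<lambda>x. indicator (closure W) x *\<^sub>R v x ^ 6) = (\<lambda>x. v x ^ 6)"
    using W(2) closure_subset[of W] by (auto simp: indicator_def fun_eq_iff)
  ultimately have "integrable lborel (\<lambda>x. v x ^ 6)" by simp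
  then have "N < \<infinity>" unfolding N_def
    by (subst (asm) integrable_iff_bounded) auto
  then obtain n where n: "N = ennreal n" "n \<ge> 0" by (cases N) auto
  have ei: "(\<integral>\<^sub>+x. ennreal \<bar>4 * v x ^ 3 * v' x (axis i 1)\<bar>) \<le> ennreal (4 * (sqrt n * sqrt S))" for i :: 3
  proof -
    have "ennreal \<bar>4 * v x ^ 3 * v' x (axis i 1)\<bar> = 4 * (ennreal_sqrt (ennreal (v x ^ 6)) * ennreal_sqrt (ennreal ((v' x (axis i 1))\<^sup>2)))" for x
    proof -
      have "(\<bar>v x\<bar> ^ 3)\<^sup>2 = v x ^ 6" by (simp flip: power_mult)
      then have "sqrt (v x ^ 6) = \<bar>v x\<bar> ^ 3" by (intro real_sqrt_unique) auto
      then have "ennreal_sqrt (ennreal (v x ^ 6)) = ennreal (\<bar>v x\<bar> ^ 3)"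
        by (simp add: ennreal_sqrt_def)
      moreover have "ennreal_sqrt (ennreal ((v' x (axis i 1))\<^sup>2)) = ennreal \<bar>v' x (axis i 1)\<bar>"
        by (simp add: ennreal_sqrt_def)
      ultimately show ?thesis by (simp add: abs_mult power_abs ennreal_mult mult.assoc)
    qed
    then have "(\<integral>\<^sub>+x. ennreal \<bar>4 * v x ^ 3 * v' x (axis i 1)\<bar>)
        = 4 * (\<integral>\<^sub>+x. ennreal_sqrt (ennreal (v x ^ 6)) * ennreal_sqrt (ennreal ((v' x (axis i 1))\<^sup>2)))"
      by (simp add: nn_integral_cmult)
    also have "\<dots> \<le> 4 * (ennreal_sqrt N * ennreal_sqrt (\<integral>\<^sub>+x. ennreal ((v' x (axis i 1))\<^sup>2)))"
      unfolding N_def by (intro mult_left_mono nn_integral_Cauchy_Schwarz_sqrt) auto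
    also have "\<dots> \<le> 4 * (ennreal_sqrt N * ennreal_sqrt (ennreal S))"
      using le[of i] unfolding v'_def by (intro mult_left_mono ennreal_sqrt_mono) auto
    also have "\<dots> = ennreal (4 * (sqrt n * sqrt S))"
      using n S by (simp add: ennreal_sqrt_def ennreal_mult)
    finally show ?thesis .
  qed
  have dg: "((\<lambda>x. v x ^ 4) has_derivative (\<lambda>h. 4 * v x ^ 3 * v' x h)) (at x)" for x
    using d[of x] by (auto intro!: derivative_eq_intros simp: mult_ac)
  have "N = (\<integral>\<^sub>+x. ennreal_sqrt (ennreal \<bar>v x ^ 4\<bar>) ^ 3)"
  proof -
    have "ennreal_sqrt (ennreal \<bar>v x ^ 4\<bar>) ^ 3 = ennreal (v x ^ 6)" for x
    proof -
      have "((v x)\<^sup>2)\<^sup>2 = v x ^ 4" by (simp flip: power_mult)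
      then have "sqrt (v x ^ 4) = (v x)\<^sup>2" by (intro real_sqrt_unique) auto
      then have "ennreal_sqrt (ennreal \<bar>v x ^ 4\<bar>) = ennreal ((v x)\<^sup>2)" by (simp add: ennreal_sqrt_def)
      then show ?thesis by (simp add: ennreal_power flip: power_mult)
    qed
    then show ?thesis by (simp add: N_def)
  qed
  also have "\<dots> \<le> ennreal_sqrt (\<integral>\<^sub>+x. ennreal \<bar>4 * v x ^ 3 * v' x (axis 1 1)\<bar>)
      * (ennreal_sqrt (\<integral>\<^sub>+x. ennreal \<bar>4 * v x ^ 3 * v' x (axis 2 1)\<bar>)
        * ennreal_sqrt (\<integral>\<^sub>+x. ennreal \<bar>4 * v x ^ 3 * v' x (axis 3 1)\<bar>))"
    using W(2) by (intro Gagliardo_Nirenberg_L1[OF dg _ W(1)] continuous_intros cv cv') auto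
  also have "\<dots> \<le> ennreal_sqrt (ennreal (4 * (sqrt n * sqrt S))) * (ennreal_sqrt (ennreal (4 * (sqrt n * sqrt S)))
      * ennreal_sqrt (ennreal (4 * (sqrt n * sqrt S))))"
    by (intro mult_mono ennreal_sqrt_mono ei) auto
  also have "\<dots> = ennreal (sqrt (4 * (sqrt n * sqrt S)) ^ 3)"
    using n S by (simp add: ennreal_sqrt_def power3_eq_cube flip: ennreal_mult)
  finally have "ennreal n \<le> ennreal (sqrt (4 * (sqrt n * sqrt S)) ^ 3)" using n by simp
  then have "n \<le> sqrt (4 * (sqrt n * sqrt S)) ^ 3" using n S by (subst (asm) ennreal_le_iff) auto
  then have "n ^ 4 \<le> (sqrt (4 * (sqrt n * sqrt S)) ^ 3) ^ 4" using n by (intro power_mono) auto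
  also have "\<dots> = ((sqrt (4 * (sqrt n * sqrt S)))\<^sup>2) ^ 6" by (simp flip: power_mult)
  also have "\<dots> = (4 * (sqrt n * sqrt S)) ^ 6" using n S by simp
  also have "\<dots> = 4096 * ((sqrt n)\<^sup>2) ^ 3 * ((sqrt S)\<^sup>2) ^ 3" by (simp add: power_mult_distrib flip: power_mult)
  also have "\<dots> = n ^ 3 * (4096 * S ^ 3)" using n S by simp
  finally have "n * n ^ 3 \<le> n ^ 3 * (4096 * S ^ 3)" by (simp add: eval_nat_numeral)
  then have "n \<le> 4096 * S ^ 3"
    using n(2) S by (cases "n = 0") (auto simp: mult.commute[of n] mult_le_cancel_left)
  then show ?thesis using n S by (simp add: N_def[symmetric] ennreal_leI)
qed

text \<open>Mollification reduces to smooth functions. The weak formula with the reflected mollifier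
  as test function shows that the derivative of the mollified \<open>v\<close> is the mollified
  \<open>D\<close>, so the L^2 bound survives by Cauchy-Schwarz with respect to a probability
  density. The mollifications converge in L^1, hence almost everywhere along a subsequence, and
  Fatou's lemma concludes.\<close>

lemma Sobolev_weak:
  fixes v :: "real^3 \<Rightarrow> real" and D :: "3 \<Rightarrow> real^3 \<Rightarrow> real" and \<phi> :: "real^3 \<Rightarrow> real"
  assumes \<phi>: "smooth \<phi>" "\<And>x. \<phi> x \<ge> 0" "bounded B" "\<And>x. x \<notin> B \<Longrightarrow> \<phi> x = 0" "integrable lborel \<phi>" "(\<integral>\<^sub>1x. \<phi> x) = 1"
    and v: "integrable lborel v" and W: "bounded W" "\<And>x. x \<notin> W \<Longrightarrow> v x = 0"
    and [measurable]: "\<And>i. D i \<in> borel_measurable borel" and S: "S \<ge> 0"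
    and le: "\<And>i. (\<integral>\<^sub>+x. ennreal ((D i x)\<^sup>2)) \<le> ennreal S"
    and weak: "\<And>\<psi> i. smooth \<psi> \<Longrightarrow> (\<integral>\<^sub>1y. v y * frechet_derivative \<psi> (at y) (axis i 1)) = - (\<integral>\<^sub>1y. D i y * \<psi> y)"
  shows "(\<integral>\<^sub>+x. ennreal (v x ^ 6)) \<le> ennreal (4096 * S ^ 3)"
proof -
  have [measurable]: "Borel v" using v by auto
  have [measurable]: "Borel \<phi>" using \<phi>(5) by auto
  have nn1: "(\<integral>\<^sub>+x. ennreal (\<phi> x)) = 1"
    using \<phi> by (simp add: nn_integral_eq_integral)
  define r where "r = (\<lambda>n. real (Suc n))"
  have r: "r n > 0" for n by (simp add: r_def)
  define p where "p = (\<lambda>n x. r n ^ 3 * \<phi> (r n *\<^sub>R x))"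
  have sp: "smooth (p n)" for n unfolding p_def
    using smooth_mult[OF smooth_const smooth_affine_comp[OF bounded_linear_scaleR_right \<phi>(1), of _ 0]] by simp
  have cp: "continuous_on UNIV (p n)" for n using smooth_continuous[OF sp] .
  have [measurable]: "Borel (p n)" for n unfolding p_def by measurable
  have pnn: "p n x \<ge> 0" for n x using \<phi>(2) r[of n] by (simp add: p_def)
  have p1: "(\<integral>\<^sub>+x. ennreal (p n x)) = 1" for n
    using nn_integral_scale[of "\<lambda>x. ennreal (\<phi> x)" "r n" 0] r[of n] nn1
    by (simp add: p_def ennreal_mult \<phi>(2) nn_integral_cmult)
  define V where "V = (\<lambda>n. conv (p n) v)"
  have sV: "smooth (V n)" for n unfolding V_def by (rule smooth_conv[OF v W sp])
  have [measurable]: "Borel (V n)" for n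
    by (intro borel_measurable_continuous_onI smooth_continuous sV)
  have dV: "frechet_derivative (V n) (at z) (axis i 1) = (\<integral>\<^sub>1w. D i w * p n (z - w))" for n z i
  proof -
    have *: "((\<lambda>w. p n (z - w)) has_derivative (\<lambda>h. frechet_derivative (p n) (at (z - w)) (- h))) (at w)" for w
      by (rule has_derivative_compose[OF _ smooth_derivative(1)[OF sp]]) (auto intro!: derivative_eq_intros)
    have **: "frechet_derivative (\<lambda>w. p n (z - w)) (at w) (axis i 1) = - frechet_derivative (p n) (at (z - w)) (axis i 1)" for w
      using frechet_derivative_at[OF *, symmetric] linear_neg[OF has_derivative_linear[OF smooth_derivative(1)[OF sp]]] by simp
    have s: "smooth (\<lambda>w. p n (z - w))"
      using smooth_affine_comp[OF bounded_linear_minus[OF bounded_linear_ident] sp[of n], of z] by simp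
    have "frechet_derivative (V n) (at z) (axis i 1) = conv (\<lambda>x. frechet_derivative (p n) (at x) (axis i 1)) v z"
      unfolding V_def using frechet_derivative_at[OF smooth_conv_has_derivative[OF v W sp], symmetric] by simp
    also have "\<dots> = - (\<integral>\<^sub>1w. v w * frechet_derivative (\<lambda>w. p n (z - w)) (at w) (axis i 1))"
      unfolding ** conv_def by simp
    also have "\<dots> = (\<integral>\<^sub>1w. D i w * p n (z - w))" unfolding weak[OF s] by simp
    finally show ?thesis .
  qed
  have L2: "(\<integral>\<^sub>+x. ennreal ((frechet_derivative (V n) (at x) (axis i 1))\<^sup>2)) \<le> ennreal S" for n i
  proof -
    have "ennreal ((frechet_derivative (V n) (at z) (axis i 1))\<^sup>2) \<le> (\<integral>\<^sub>+w. ennreal ((D i w)\<^sup>2) * ennreal (p n (z - w)))" for z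
    proof -
      have m: "Borel (\<lambda>w. p n (z - w))" by measurable
      have 1: "ennreal \<bar>\<integral>w. D i w * p n (z - w) \<partial>lborel\<bar> \<le> (\<integral>\<^sub>+w. ennreal \<bar>D i w * p n (z - w)\<bar>)"
        using integral_norm_bound_ennreal[of lborel "\<lambda>w. D i w * p n (z - w)"]
        by (cases "integrable lborel (\<lambda>w. D i w * p n (z - w))") (auto simp: not_integrable_integral_eq)
      have "ennreal ((frechet_derivative (V n) (at z) (axis i 1))\<^sup>2) = (ennreal \<bar>\<integral>w. D i w * p n (z - w) \<partial>lborel\<bar>)\<^sup>2"
        unfolding dV by (simp add: ennreal_power)
      also have "\<dots> \<le> (\<integral>\<^sub>+w. ennreal (\<bar>D i w\<bar> * sqrt (p n (z - w))) * ennreal (sqrt (p n (z - w))))\<^sup>2"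
        using 1 pnn by (intro power_mono) (auto simp: abs_mult mult.assoc simp flip: ennreal_mult)
      also have "\<dots> \<le> (\<integral>\<^sub>+w. (ennreal (\<bar>D i w\<bar> * sqrt (p n (z - w))))\<^sup>2) * (\<integral>\<^sub>+w. (ennreal (sqrt (p n (z - w))))\<^sup>2)"
        by (rule Cauchy_Schwarz_nn_integral) measurable
      also have "(\<integral>\<^sub>+w. (ennreal (sqrt (p n (z - w))))\<^sup>2) = (\<integral>\<^sub>+w. ennreal (p n (z - w)))"
        using pnn by (simp add: ennreal_power)
      also have "\<dots> = 1" using nn_integral_reflect[of "\<lambda>w. ennreal (p n w)" z] p1[of n] by simp
      also have "(\<integral>\<^sub>+w. (ennreal (\<bar>D i w\<bar> * sqrt (p n (z - w))))\<^sup>2) = (\<integral>\<^sub>+w. ennreal ((D i w)\<^sup>2) * ennreal (p n (z - w)))"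
        using pnn by (simp add: ennreal_power power_mult_distrib flip: ennreal_mult)
      finally show ?thesis by simp
    qed
    then have "(\<integral>\<^sub>+x. ennreal ((frechet_derivative (V n) (at x) (axis i 1))\<^sup>2))
       \<le> (\<integral>\<^sub>+z w. ennreal ((D i w)\<^sup>2) * ennreal (p n (z - w)))" by (intro nn_integral_mono)
    also have "\<dots> = (\<integral>\<^sub>+w z. ennreal ((D i w)\<^sup>2) * ennreal (p n (z - w)))"
      by (rule lborel_pair.Fubini') measurable
    also have "\<dots> = (\<integral>\<^sub>+w. ennreal ((D i w)\<^sup>2) * 1)"
      using p1[of n] nn_integral_translation[of "\<lambda>z. ennreal (p n z)"] 
      by (intro nn_integral_cong) (subst nn_integral_cmult, auto simp: diff_conv_add_uminus simp del: add_uminus_conv_diff)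
    finally show ?thesis using le[of i] by (simp add: order_trans)
  qed
  have supp: "\<exists>U. bounded U \<and> (\<forall>x. x \<notin> U \<longrightarrow> V n x = 0)" for n
  proof (intro exI conjI allI impI)
    let ?U = "{w + y |w y. w \<in> W \<and> y \<in> (\<lambda>b. (1 / r n) *\<^sub>R b) ` B}"
    show "bounded ?U" using bounded_plus[OF W(1) bounded_scaling[OF \<phi>(3)]]
      by (rule bounded_subset) force
    fix x assume x: "x \<notin> ?U"
    have "v w *\<^sub>R p n (x - w) = 0" for w
    proof (rule ccontr)
      assume "v w *\<^sub>R p n (x - w) \<noteq> 0"
      then have "w \<in> W" "r n *\<^sub>R (x - w) \<in> B" using W(2) \<phi>(4) by (auto simp: p_def)
      moreover have "x = w + (1 / r n) *\<^sub>R (r n *\<^sub>R (x - w))" using r[of n] by simp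
      ultimately show False using x by blast
    qed
    then have "(\<lambda>w. v w *\<^sub>R p n (x - w)) = (\<lambda>w. 0)" by blast
    then show "V n x = 0" unfolding V_def conv_def by (metis Bochner_Integration.integral_zero)
  qed
  have V6: "(\<integral>\<^sub>+x. ennreal (V n x ^ 6)) \<le> ennreal (4096 * S ^ 3)" for n
    using supp[of n] Sobolev_smooth[OF sV _ _ S L2] by blast
  \<comment> \<open>The substitution w = z - y / r moves the scale from the mollifier into the
    argument of \<open>v\<close>, where continuity of translations applies.\<close>
  have Veq: "V n z = (\<integral>\<^sub>1y. \<phi> y * v (z - (1 / r n) *\<^sub>R y))" for n z
  proof -
    have "V n z = (\<integral>\<^sub>1w. v w * p n (z - w))" by (simp add: V_def conv_def)
    also have "\<dots> = \<bar>- 1 / r n\<bar> ^ 3 *\<^sub>R (\<integral>\<^sub>1y. v (z + (- 1 / r n) *\<^sub>R y) * p n (z - (z + (- 1 / r n) *\<^sub>R y)))"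
      using integral_scale[of "\<lambda>w. v w * p n (z - w)" "- 1 / r n" z] r[of n] by simp
    also have "\<dots> = \<bar>- 1 / r n\<bar> ^ 3 *\<^sub>R (\<integral>\<^sub>1y. r n ^ 3 * (\<phi> y * v (z - (1 / r n) *\<^sub>R y)))"
      using r[of n] by (simp add: p_def mult_ac)
    also have "\<dots> = (\<integral>\<^sub>1y. \<phi> y * v (z - (1 / r n) *\<^sub>R y))" using r[of n] by (simp add: power_divide)
    finally show ?thesis .
  qed
  define T where "T = (\<lambda>n y. \<integral>\<^sub>1z. \<bar>v (z - (1 / r n) *\<^sub>R y) - v z\<bar>)"
  have vt: "integrable lborel (\<lambda>z. v (z - h))" for h using integrable_translation[OF v, of "-h"] by simp
  have "T n y \<le> 2 * (\<integral>\<^sub>1z. \<bar>v z\<bar>)" "T n y \<ge> 0" for n y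
  proof -
    have "T n y \<le> (\<integral>\<^sub>1z. \<bar>v (z - (1 / r n) *\<^sub>R y)\<bar> + \<bar>v z\<bar>)"
      unfolding T_def by (rule integral_mono) (auto intro!: vt v integrable_abs)
    also have "\<dots> = (\<integral>\<^sub>1z. \<bar>v (z - (1 / r n) *\<^sub>R y)\<bar>) + (\<integral>\<^sub>1z. \<bar>v z\<bar>)"
      by (rule Bochner_Integration.integral_add) (auto intro!: vt v integrable_abs)
    also have "(\<integral>\<^sub>1z. \<bar>v (z - (1 / r n) *\<^sub>R y)\<bar>) = (\<integral>\<^sub>1z. \<bar>v z\<bar>)"
      using integral_translation[of "\<lambda>z. \<bar>v z\<bar>" "- (1 / r n) *\<^sub>R y"] by simp
    finally show "T n y \<le> 2 * (\<integral>\<^sub>1z. \<bar>v z\<bar>)" by simp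
    show "T n y \<ge> 0" unfolding T_def by simp
  qed note T = this
  have [measurable]: "Borel (T n)" for n
    unfolding T_def[abs_def] by measurable
  have T0: "(\<lambda>n. T n y) \<longlonglongrightarrow> 0" for y
  proof -
    have "(\<lambda>n. - (1 / r n) *\<^sub>R y) \<longlonglongrightarrow> - 0 *\<^sub>R y"
      unfolding r_def by (intro tendsto_intros LIMSEQ_Suc[OF lim_1_over_n])
    then show ?thesis using integrable_L1_continuous[OF v] unfolding L1_continuous_def T_def by fastforce
  qed
  have lim0: "(\<lambda>n. \<integral>\<^sub>1y. \<phi> y * T n y) \<longlonglongrightarrow> (\<integral>y. 0 \<partial>(lborel :: (real^3) measure))"
  proof (rule integral_dominated_convergence[where w="\<lambda>y. \<phi> y * (2 * (\<integral>\<^sub>1z. \<bar>v z\<bar>))"])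
    show "AE y in lborel. (\<lambda>n. \<phi> y * T n y) \<longlonglongrightarrow> 0"
      using T0 by (auto intro!: tendsto_mult_right_zero)
    show "AE y in lborel. norm (\<phi> y * T n y) \<le> \<phi> y * (2 * (\<integral>\<^sub>1z. \<bar>v z\<bar>))" for n
      using T(2)[of n] \<phi>(2) by (auto simp: abs_mult intro!: mult_left_mono T)
  qed (auto intro!: integrable_mult_left \<phi>)
  have iT: "integrable lborel (\<lambda>y. \<phi> y * T n y)" for n
    by (rule Bochner_Integration.integrable_bound[of _ "\<lambda>y. \<phi> y * (2 * (\<integral>\<^sub>1z. \<bar>v z\<bar>))"])
      (use T[of n] \<phi>(2,5) in \<open>auto simp: abs_mult intro!: mult_left_mono\<close>)
  have V1: "(\<integral>\<^sub>+z. ennreal \<bar>V n z - v z\<bar>) \<le> ennreal (\<integral>\<^sub>1y. \<phi> y * T n y)" for n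
  proof -
    have "ennreal \<bar>V n z - v z\<bar> \<le> (\<integral>\<^sub>+y. ennreal (\<phi> y * \<bar>v (z - (1 / r n) *\<^sub>R y) - v z\<bar>))" for z
    proof (cases "integrable lborel (\<lambda>y. \<phi> y * v (z - (1 / r n) *\<^sub>R y))")
      case True
      have "V n z - v z = (\<integral>\<^sub>1y. \<phi> y * v (z - (1 / r n) *\<^sub>R y) - \<phi> y * v z)"
        unfolding Veq by (subst Bochner_Integration.integral_diff) (auto intro!: True integrable_mult_left \<phi> simp: \<phi>(6))
      also have "\<dots> = (\<integral>\<^sub>1y. \<phi> y * (v (z - (1 / r n) *\<^sub>R y) - v z))" by (simp add: right_diff_distrib)
      finally have e: "V n z - v z = \<dots>" .
      have "integrable lborel (\<lambda>y. \<phi> y * (v (z - (1 / r n) *\<^sub>R y) - v z))"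
        unfolding right_diff_distrib by (intro Bochner_Integration.integrable_diff True integrable_mult_left \<phi>)
      from integral_norm_bound_ennreal[OF this] show ?thesis unfolding e by (simp add: abs_mult \<phi>(2))
    next
      \<comment> \<open>Contradictory: \<open>v\<close> has bounded support and \<open>p n\<close>
        is continuous, so the product is integrable.\<close>
      case False
      have "integrable lborel (\<lambda>w. v w *\<^sub>R p n (z - w))"
        by (intro integrable_scaleR_continuous[OF v W] continuous_on_reflect cp)
      from integrable_scale[OF this, of "- 1 / r n" z] r[of n]
      have "integrable lborel (\<lambda>y. r n ^ 3 * (\<phi> y * v (z - (1 / r n) *\<^sub>R y)))" by (simp add: p_def mult_ac)
      then show ?thesis using False r[of n] by simp
    qed
    then have "(\<integral>\<^sub>+z. ennreal \<bar>V n z - v z\<bar>) \<le> (\<integral>\<^sub>+z y. ennreal (\<phi> y * \<bar>v (z - (1 / r n) *\<^sub>R y) - v z\<bar>))"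
      by (intro nn_integral_mono)
    also have "\<dots> = (\<integral>\<^sub>+y z. ennreal (\<phi> y * \<bar>v (z - (1 / r n) *\<^sub>R y) - v z\<bar>))"
      by (rule lborel_pair.Fubini') measurable
    also have "\<dots> = (\<integral>\<^sub>+y. ennreal (\<phi> y * T n y))"
    proof (rule nn_integral_cong)
      fix y
      have "(\<integral>\<^sub>+z. ennreal (\<phi> y * \<bar>v (z - (1 / r n) *\<^sub>R y) - v z\<bar>)) = ennreal (\<integral>\<^sub>1z. \<phi> y * \<bar>v (z - (1 / r n) *\<^sub>R y) - v z\<bar>)"
        using \<phi>(2) by (intro nn_integral_eq_integral) (auto intro!: integrable_mult_right integrable_abs Bochner_Integration.integrable_diff vt v)
      then show "(\<integral>\<^sub>+z. ennreal (\<phi> y * \<bar>v (z - (1 / r n) *\<^sub>R y) - v z\<bar>)) = ennreal (\<phi> y * T n y)"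
        by (simp add: T_def)
    qed
    also have "\<dots> = ennreal (\<integral>\<^sub>1y. \<phi> y * T n y)"
      using T(2) \<phi>(2) by (intro nn_integral_eq_integral iT) auto
    finally show ?thesis .
  qed
  have Vint: "integrable lborel (\<lambda>z. V n z - v z)" for n
    unfolding integrable_iff_bounded using V1[of n] by (auto intro: le_less_trans ennreal_less_top)
  have "(\<integral>\<^sub>1z. norm (V n z - v z)) \<le> (\<integral>\<^sub>1y. \<phi> y * T n y)" for n
  proof -
    have "ennreal (\<integral>\<^sub>1z. norm (V n z - v z)) = (\<integral>\<^sub>+z. ennreal \<bar>V n z - v z\<bar>)"
      by (subst nn_integral_eq_integral) (auto intro!: integrable_abs Vint)
    then have "ennreal (\<integral>\<^sub>1z. norm (V n z - v z)) \<le> ennreal (\<integral>\<^sub>1y. \<phi> y * T n y)"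
      using V1[of n] by simp
    then show ?thesis using T(2) \<phi>(2) by (subst (asm) ennreal_le_iff) auto
  qed
  note le1 = this
  have "(\<lambda>n. \<integral>\<^sub>1z. norm (V n z - v z)) \<longlonglongrightarrow> 0"
  proof (rule tendsto_sandwich[where f="\<lambda>_. 0"])
    show "(\<lambda>n. \<integral>\<^sub>1y. \<phi> y * T n y) \<longlonglongrightarrow> 0" using lim0 by simp
  qed (use le1 in \<open>simp_all add: always_eventually\<close>)
  from tendsto_L1_AE_subseq[OF Vint this] obtain s where
    s: "AE z in lborel. (\<lambda>n. V (s n) z - v z) \<longlonglongrightarrow> 0" by auto
  have "(\<integral>\<^sub>+x. ennreal (v x ^ 6)) = (\<integral>\<^sub>+x. liminf (\<lambda>n. ennreal (V (s n) x ^ 6)))"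
  proof (rule nn_integral_cong_AE, use s in eventually_elim)
    case (elim x)
    have "(\<lambda>n. ennreal ((V (s n) x - v x + v x) ^ 6)) \<longlonglongrightarrow> ennreal ((0 + v x) ^ 6)"
      by (intro tendsto_intros elim)
    then have "(\<lambda>n. ennreal (V (s n) x ^ 6)) \<longlonglongrightarrow> ennreal (v x ^ 6)"
      unfolding diff_add_cancel add_0 .
    from lim_imp_Liminf[OF trivial_limit_sequentially this] show ?case by (rule sym)
  qed
  also have "\<dots> \<le> liminf (\<lambda>n. \<integral>\<^sub>+x. ennreal (V (s n) x ^ 6))"
    by (rule nn_integral_liminf) measurable
  also have "\<dots> \<le> liminf (\<lambda>n::nat. ennreal (4096 * S ^ 3))"
    by (intro Liminf_mono always_eventually allI V6)
  also have "\<dots> = ennreal (4096 * S ^ 3)" by (simp add: Liminf_const)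
  finally show ?thesis .
qed

section \<open>Radial integrals and logarithmic kernels\<close>

text \<open>The half-lines {..a} generate the Borel sets and are stable under intersection, and on
  each of them both measures give the ball volume 4/3 pi a^3.\<close>

lemma distr_norm_real3:
  "distr (lborel :: (real^3) measure) borel norm = density lborel (\<lambda>r. ennreal (4 * pi * r\<^sup>2) * indicator {0..} r)"
proof (rule measure_eqI_generator_eq[where E="range (\<lambda>a::real. {..a})" and \<Omega>=UNIV and A="\<lambda>n. {..real n}"])
  have e1: "emeasure (distr (lborel :: (real^3) measure) borel norm) {..a} = (if a < 0 then 0 else ennreal (4/3 * pi * a ^ 3))" for a :: real
  proof -
    have "emeasure (distr (lborel :: (real^3) measure) borel norm) {..a} = emeasure lborel {x :: real^3. norm x \<le> a}"
      by (subst emeasure_distr) (auto simp: vimage_def)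
    also have "{x :: real^3. norm x \<le> a} = cball 0 a" by (auto simp: mem_cball_0)
    finally show ?thesis using emeasure_cball[of a "0 :: real^3"] by (auto simp: unit_ball_vol_3 mult_ac)
  qed
  have e2: "emeasure (density lborel (\<lambda>r. ennreal (4 * pi * r\<^sup>2) * indicator {0..} r)) {..a} = (if a < 0 then 0 else ennreal (4/3 * pi * a ^ 3))" for a :: real
  proof -
    have "emeasure (density lborel (\<lambda>r. ennreal (4 * pi * r\<^sup>2) * indicator {0..} r)) {..a}
        = (\<integral>\<^sub>+r. ennreal (4 * pi * r\<^sup>2) * indicator {0..a} r)"
      by (subst emeasure_density) (auto intro!: nn_integral_cong simp: indicator_def)
    also have "\<dots> = (if a < 0 then 0 else ennreal (4/3 * pi * a ^ 3))"
    proof (cases "a < 0")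
      case False
      have "(\<integral>\<^sub>+r. ennreal (4 * pi * r\<^sup>2) * indicator {0..a} r) = ennreal (4/3 * pi * a ^ 3 - 4/3 * pi * 0 ^ 3)"
        using False by (intro nn_integral_FTC_Icc) (auto intro!: derivative_eq_intros)
      then show ?thesis using False by simp
    qed simp
    finally show ?thesis .
  qed
  show "emeasure (distr (lborel :: (real^3) measure) borel norm) X = emeasure (density lborel (\<lambda>r. ennreal (4 * pi * r\<^sup>2) * indicator {0..} r)) X"
    if "X \<in> range (\<lambda>a::real. {..a})" for X using that e1 e2 by auto
  show "emeasure (distr (lborel :: (real^3) measure) borel norm) {..real i} \<noteq> \<infinity>" for i
    unfolding e1 by simp
  show "Int_stable (range (\<lambda>a::real. {..a}))" by (auto simp: Int_stable_def)
  show "sets (distr (lborel :: (real^3) measure) borel norm) = sigma_sets UNIV (range (\<lambda>a::real. {..a}))"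
    "sets (density lborel (\<lambda>r. ennreal (4 * pi * r\<^sup>2) * indicator {0..} r)) = sigma_sets UNIV (range (\<lambda>a::real. {..a}))"
    by (simp_all add: borel_eq_atMost)
  show "(\<Union>i. {..real i}) = UNIV" by (auto intro: real_arch_simple)
qed auto

lemma nn_integral_radial:
  assumes [measurable]: "Borel F"
  shows "(\<integral>\<^sub>+(z::real^3). F (norm z)) = (\<integral>\<^sub>+r. ennreal (4 * pi * r\<^sup>2) * indicator {0..} r * F r)"
proof -
  have "(\<integral>\<^sub>+(z::real^3). F (norm z)) = (\<integral>\<^sup>+r. F r \<partial>distr (lborel :: (real^3) measure) borel norm)"
    by (simp add: nn_integral_distr)
  then show ?thesis unfolding distr_norm_real3 by (simp add: nn_integral_density)
qed

lemma nn_integral_shell_powr: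
  assumes "0 < a" "a \<le> b" "p < 3"
  shows "(\<integral>\<^sub>+(z::real^3). ennreal (norm z powr - p) * indicator {a..b} (norm z)) \<le> ennreal (4 * pi * b powr (3 - p) / (3 - p))"
proof -
  have "(\<integral>\<^sub>+(z::real^3). ennreal (norm z powr - p) * indicator {a..b} (norm z))
      = (\<integral>\<^sub>+r. ennreal (4 * pi * r\<^sup>2) * indicator {0..} r * (ennreal (r powr - p) * indicator {a..b} r))"
    by (rule nn_integral_radial) measurable
  also have "\<dots> = (\<integral>\<^sub>+r. ennreal (4 * pi * r powr (2 - p)) * indicator {a..b} r)"
  proof (rule nn_integral_cong)
    fix r :: real
    show "ennreal (4 * pi * r\<^sup>2) * indicator {0..} r * (ennreal (r powr - p) * indicator {a..b} r) = ennreal (4 * pi * r powr (2 - p)) * indicator {a..b} r"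
      using assms by (auto simp: indicator_def powr_diff powr_minus divide_simps ennreal_mult[symmetric])
  qed
  also have "\<dots> = ennreal (4 * pi * b powr (3 - p) / (3 - p) - 4 * pi * a powr (3 - p) / (3 - p))"
    using assms by (intro nn_integral_FTC_Icc) (auto intro!: derivative_eq_intros)
  also have "\<dots> \<le> ennreal (4 * pi * b powr (3 - p) / (3 - p))"
    using assms by (intro ennreal_leI) auto
  finally show ?thesis .
qed

text \<open>The bound on shells does not involve the inner radius, so Fatou's lemma lets that radius
  tend to 0.\<close>

lemma nn_integral_ball_powr:
  assumes "0 < D" "p < 3"
  shows "(\<integral>\<^sub>+(z::real^3). ennreal (norm z powr - p) * indicator {..D} (norm z)) < \<infinity>"
proof -
  let ?f = "\<lambda>(n::nat) (z::real^3). ennreal (norm z powr - p) * indicator {D / Suc n..D} (norm z)"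
  have "(\<integral>\<^sub>+(z::real^3). ennreal (norm z powr - p) * indicator {..D} (norm z)) = (\<integral>\<^sub>+z. liminf (\<lambda>n. ?f n z))"
  proof (rule nn_integral_cong)
    fix z :: "real^3"
    have "\<forall>\<^sub>F n in sequentially. ?f n z = ennreal (norm z powr - p) * indicator {..D} (norm z)"
    proof (cases "z = 0")
      case False
      then obtain N where N: "real N > D / norm z" using reals_Archimedean2 by blast
      have "D / Suc n \<le> norm z" if "n \<ge> N" for n
      proof -
        have "D / norm z \<le> real (Suc n)" using N that by simp
        then show ?thesis using False assms by (simp add: divide_simps mult.commute)
      qed
      then show ?thesis unfolding eventually_sequentially by (intro exI[of _ N]) (auto simp: indicator_def)
    qed (simp)
    then have "(\<lambda>n. ?f n z) \<longlonglongrightarrow> ennreal (norm z powr - p) * indicator {..D} (norm z)" by (rule tendsto_eventually)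
    from lim_imp_Liminf[OF _ this] show "ennreal (norm z powr - p) * indicator {..D} (norm z) = liminf (\<lambda>n. ?f n z)" by simp
  qed
  also have "\<dots> \<le> liminf (\<lambda>n. \<integral>\<^sub>+z. ?f n z)" by (rule nn_integral_liminf) measurable
  also have "\<dots> \<le> liminf (\<lambda>n::nat. ennreal (4 * pi * D powr (3 - p) / (3 - p)))"
    using assms by (intro Liminf_mono always_eventually allI nn_integral_shell_powr) (auto simp: divide_simps)
  also have "\<dots> < \<infinity>" by (simp add: Liminf_const)
  finally show ?thesis .
qed

lemma nn_integral_outside_powr:
  assumes "0 < a" "p > 3"
  shows "(\<integral>\<^sub>+(z::real^3). ennreal (norm z powr - p) * indicator {a..} (norm z)) < \<infinity>"
proof -
  have "(\<integral>\<^sub>+(z::real^3). ennreal (norm z powr - p) * indicator {a..} (norm z))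
      = (\<integral>\<^sub>+r. ennreal (4 * pi * r\<^sup>2) * indicator {0..} r * (ennreal (r powr - p) * indicator {a..} r))"
    by (rule nn_integral_radial) measurable
  also have "\<dots> = (\<integral>\<^sub>+r. ennreal (4 * pi * r powr (2 - p)) * indicator {a..} r)"
  proof (rule nn_integral_cong)
    fix r :: real
    show "ennreal (4 * pi * r\<^sup>2) * indicator {0..} r * (ennreal (r powr - p) * indicator {a..} r) = ennreal (4 * pi * r powr (2 - p)) * indicator {a..} r"
      using assms by (auto simp: indicator_def powr_diff powr_minus divide_simps ennreal_mult[symmetric])
  qed
  also have "\<dots> = ennreal (0 - 4 * pi * a powr (3 - p) / (3 - p))"
  proof (rule nn_integral_FTC_atLeast)
    have "((\<lambda>r. 4 * pi * r powr (3 - p) / (3 - p)) \<longlongrightarrow> 4 * pi * 0 / (3 - p)) at_top"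
      using assms by (intro tendsto_intros tendsto_neg_powr filterlim_ident) auto
    then show "((\<lambda>r. 4 * pi * r powr (3 - p) / (3 - p)) \<longlongrightarrow> 0) at_top" by simp
  qed (use assms in \<open>auto intro!: derivative_eq_intros\<close>)
  finally show ?thesis by simp
qed

text \<open>The borderline power in dimension three: the logarithm of the ratio of radii is what
  makes the integral grow with the cutoff level in \<open>nn_integral_ell_cutoff\<close>.\<close>

lemma nn_integral_shell_inverse_cube:
  assumes "0 < a" "a \<le> b"
  shows "(\<integral>\<^sub>+(z::real^3). ennreal (1 / norm z ^ 3) * indicator {a..b} (norm z)) = ennreal (4 * pi * ln (b / a))"
proof -
  have "(\<integral>\<^sub>+(z::real^3). ennreal (1 / norm z ^ 3) * indicator {a..b} (norm z))
      = (\<integral>\<^sub>+r. ennreal (4 * pi * r\<^sup>2) * indicator {0..} r * (ennreal (1 / r ^ 3) * indicator {a..b} r))"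
    by (rule nn_integral_radial) measurable
  also have "\<dots> = (\<integral>\<^sub>+r. ennreal (4 * pi / r) * indicator {a..b} r)"
    by (rule nn_integral_cong) (use assms in \<open>auto simp: indicator_def divide_simps ennreal_mult[symmetric] power2_eq_square power3_eq_cube\<close>)
  also have "\<dots> = ennreal (4 * pi * ln b - 4 * pi * ln a)"
    using assms by (intro nn_integral_FTC_Icc) (auto intro!: derivative_eq_intros)
  finally show ?thesis using assms by (simp add: ln_div right_diff_distrib)
qed

text \<open>The summand \<open>exp 3\<close> gives \<open>ell \<ge> 3\<close>, so that derivatives of the logarithm are dominated by the weight
  \<open>kap\<close> below.\<close>

definition ell :: "real \<Rightarrow> real" where
  "ell s = ln (exp 3 + 1 / s)"

lemma measurable_ell[measurable]: "Borel ell"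
  unfolding ell_def[abs_def] by measurable

lemma ell_ge_3: "s > 0 \<Longrightarrow> ell s \<ge> 3"
proof -
  assume "s > 0"
  then have "exp 3 + 1 / s \<ge> exp 3" by simp
  then have "ln (exp 3 + 1 / s) \<ge> ln (exp 3)" by (subst ln_le_cancel_iff) (auto simp: add_pos_nonneg)
  then show ?thesis by (simp add: ell_def)
qed

lemma ell_antimono: "0 < s \<Longrightarrow> s \<le> s' \<Longrightarrow> ell s' \<le> ell s"
  unfolding ell_def by (subst ln_le_cancel_iff) (auto simp: add_pos_pos frac_le)

lemma ell_ge_ln: "s > 0 \<Longrightarrow> ln (1 / s) \<le> ell s"
  unfolding ell_def by (subst ln_le_cancel_iff) (auto simp: add_pos_pos)

text \<open>A logarithm lies below any positive power; 3/32 is taken because 4/3 of it is 1/8. With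
  1/8, for s at least |z|^2, the sixth power of ell^(4/3) is bounded by a multiple of |z|^(-3/2) and
  the square of \<open>kap\<close> by one of |z|^(-5/2), both locally integrable in dimension
  three.\<close>

lemma ell_powr_le:
  assumes "S > 0"
  obtains C where "C > 0" "\<And>s. 0 < s \<Longrightarrow> s \<le> S \<Longrightarrow> ell s powr (4/3) \<le> C * s powr (-1/8)"
proof
  define C where "C = (32/3) powr (4/3) * (exp 3 * S + 1) powr (1/8)"
  have e: "exp 3 * S + 1 > (0::real)" using assms by (simp add: add_pos_pos)
  show "C > 0" unfolding C_def using e by (intro mult_pos_pos) auto
  fix s :: real assume s: "0 < s" "s \<le> S"
  have ge1: "1 \<le> exp 3 + 1 / s" using s by (simp add: add_increasing2)
  have "ell s \<le> (exp 3 + 1 / s) powr (3/32) / (3/32)"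
    unfolding ell_def by (rule ln_powr_bound[OF ge1]) simp
  also have "\<dots> = (32/3) * (exp 3 + 1 / s) powr (3/32)" by simp
  also have "\<dots> \<le> (32/3) * ((exp 3 * S + 1) / s) powr (3/32)"
    using s ge1 by (intro mult_left_mono powr_mono2) (auto simp: field_simps)
  finally have "ell s powr (4/3) \<le> ((32/3) * ((exp 3 * S + 1) / s) powr (3/32)) powr (4/3)"
    using ell_ge_3[OF s(1)] by (intro powr_mono2) auto
  also have "\<dots> = (32/3) powr (4/3) * (((exp 3 * S + 1) / s) powr (3/32)) powr (4/3)"
    by (rule powr_mult)
  also have "\<dots> = (32/3) powr (4/3) * ((exp 3 * S + 1) / s) powr (1/8)"
    by (simp add: powr_powr)
  also have "\<dots> = C * s powr (-1/8)"
    using e s by (simp add: C_def powr_divide powr_minus divide_simps)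
  finally show "ell s powr (4/3) \<le> C * s powr (-1/8)" .
qed

text \<open>The integrand is essentially ell |z|^-3. The cutoff forces s >= exp(-L), so the scale a
  = exp(-L/2) splits the integral: outside, the shell contributes ln (D/a) = ln D + L/2; inside,
  s^(-3/2) <= a^-3 meets a ball of volume 4/3 pi a^3. The prefactor ell <= L makes the total
  quadratic in L.\<close>

lemma nn_integral_ell_cutoff:
  assumes D: "D \<ge> 1" and L: "L \<ge> 3" and d: "d > 0"
  shows "(\<integral>\<^sub>+(z::real^3). ennreal (ell ((norm z)\<^sup>2 + d) * ((norm z)\<^sup>2 + d) powr (-3/2)) * indicator {z. norm z \<le> D \<and> ell ((norm z)\<^sup>2 + d) \<le> L} z)
    \<le> ennreal (4 * pi * (ln D + 2) * L\<^sup>2)"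
proof -
  define a where "a = exp (- L / 2)"
  have a: "0 < a" "a \<le> D" using D L by (auto simp: a_def intro: order_trans[of _ 1])
  have pt: "ennreal (ell ((norm z)\<^sup>2 + d) * ((norm z)\<^sup>2 + d) powr (-3/2)) * indicator {z. norm z \<le> D \<and> ell ((norm z)\<^sup>2 + d) \<le> L} z
    \<le> ennreal L * (ennreal (1 / norm z ^ 3) * indicator {a..D} (norm z) + ennreal (1 / a ^ 3) * indicator (cball 0 a) z)" for z :: "real^3"
  proof (cases "norm z \<le> D \<and> ell ((norm z)\<^sup>2 + d) \<le> L")
    case True
    define s where "s = (norm z)\<^sup>2 + d"
    have s: "s > 0" "s \<ge> (norm z)\<^sup>2" using d by (auto simp: s_def add_nonneg_pos)
    have "ln (1 / s) \<le> L" using ell_ge_ln[OF s(1)] True by (simp add: s_def)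
    then have "- L \<le> ln s" using s by (simp add: ln_div)
    then have sL: "exp (- L) \<le> s" using s by (simp add: ln_ge_iff)
    have a2: "a\<^sup>2 = exp (- L)" by (simp add: a_def power2_eq_square flip: exp_add)
    have cube: "s powr (-3/2) \<le> 1 / q ^ 3" if "0 < q" "q\<^sup>2 \<le> s" for q
    proof -
      have "s powr (-3/2) \<le> (q\<^sup>2) powr (-3/2)" using that by (intro powr_mono2') auto
      also have "(q\<^sup>2) powr (-3/2) = q powr (-3)"
        using that by (simp add: powr_powr flip: powr_numeral)
      also have "\<dots> = 1 / q ^ 3" using that by (simp add: powr_minus divide_simps)
      finally show ?thesis .
    qed
    have el: "ell s * s powr (-3/2) \<le> L * s powr (-3/2)" "0 \<le> ell s * s powr (-3/2)"
      using True ell_ge_3[OF s(1)] by (auto simp: s_def intro!: mult_right_mono)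
    show ?thesis
    proof (cases "a \<le> norm z")
      case True2: True
      have "ennreal (ell s * s powr (-3/2)) \<le> ennreal (L * (1 / norm z ^ 3))"
        using el(1) cube[of "norm z"] True2 a s L mult_left_mono[of "s powr (-3/2)" "1 / norm z ^ 3" L] by (intro ennreal_leI) linarith
      also have "\<dots> = ennreal L * ennreal (1 / norm z ^ 3)" using L by (intro ennreal_mult) auto
      also have "\<dots> \<le> ennreal L * (ennreal (1 / norm z ^ 3) * indicator {a..D} (norm z) + ennreal (1 / a ^ 3) * indicator (cball 0 a) z)"
        using True True2 by (intro mult_left_mono) (auto simp: add_increasing2)
      finally show ?thesis using True by (simp add: s_def[symmetric])
    next
      case False
      have "ennreal (ell s * s powr (-3/2)) \<le> ennreal (L * (1 / a ^ 3))"
        using el(1) cube[of a] a sL a2 L mult_left_mono[of "s powr (-3/2)" "1 / a ^ 3" L] by (intro ennreal_leI) linarith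
      also have "\<dots> = ennreal L * ennreal (1 / a ^ 3)" using L a by (intro ennreal_mult) auto
      finally show ?thesis using True False by (simp add: s_def[symmetric])
    qed
  qed simp
  have "(\<integral>\<^sub>+(z::real^3). ennreal (ell ((norm z)\<^sup>2 + d) * ((norm z)\<^sup>2 + d) powr (-3/2)) * indicator {z. norm z \<le> D \<and> ell ((norm z)\<^sup>2 + d) \<le> L} z)
    \<le> (\<integral>\<^sub>+(z::real^3). ennreal L * (ennreal (1 / norm z ^ 3) * indicator {a..D} (norm z) + ennreal (1 / a ^ 3) * indicator (cball 0 a) z))"
    by (intro nn_integral_mono pt)
  also have "\<dots> = ennreal L * ((\<integral>\<^sub>+(z::real^3). ennreal (1 / norm z ^ 3) * indicator {a..D} (norm z))
      + ennreal (1 / a ^ 3) * emeasure lborel (cball (0::real^3) a))"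
  proof -
    have [measurable]: "cball (0::real^3) a \<in> sets borel" by simp
    have "(\<integral>\<^sub>+(z::real^3). ennreal (1 / norm z ^ 3) * indicator {a..D} (norm z) + ennreal (1 / a ^ 3) * indicator (cball 0 a) z)
        = (\<integral>\<^sub>+(z::real^3). ennreal (1 / norm z ^ 3) * indicator {a..D} (norm z))
          + (\<integral>\<^sub>+z. ennreal (1 / a ^ 3) * indicator (cball (0::real^3) a) z)"
      by (rule nn_integral_add) measurable
    also have "(\<integral>\<^sub>+z. ennreal (1 / a ^ 3) * indicator (cball (0::real^3) a) z) = ennreal (1 / a ^ 3) * emeasure lborel (cball (0::real^3) a)"
      by (rule nn_integral_cmult_indicator) simp
    finally show ?thesis by (subst nn_integral_cmult) auto
  qed
  also have "\<dots> = ennreal L * (ennreal (4 * pi * ln (D / a)) + ennreal (1 / a ^ 3) * ennreal (4 / 3 * pi * a ^ 3))"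
    using a by (simp add: nn_integral_shell_inverse_cube emeasure_cball unit_ball_vol_3)
  also have "\<dots> = ennreal (L * (4 * pi * ln (D / a) + 4 / 3 * pi))"
    using a L by (simp add: ennreal_mult[symmetric] ennreal_plus[symmetric] del: ennreal_plus)
  also have "\<dots> \<le> ennreal (4 * pi * (ln D + 2) * L\<^sup>2)"
  proof (rule ennreal_leI)
    have lnDa: "ln (D / a) = ln D + L / 2" using D a by (simp add: ln_div a_def)
    have "4 * pi * ln (D / a) + 4 / 3 * pi = 4 * pi * (ln D + L / 2 + 1 / 3)" unfolding lnDa by (simp add: algebra_simps)
    also have "ln D + L / 2 + 1 / 3 \<le> (ln D + 2) * L"
    proof -
      have "ln D * 1 \<le> ln D * L" using D L by (intro mult_left_mono) auto
      then show ?thesis using L by (simp add: distrib_right)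
    qed
    then have "4 * pi * (ln D + L / 2 + 1 / 3) \<le> 4 * pi * ((ln D + 2) * L)" by (intro mult_left_mono) auto
    finally show "L * (4 * pi * ln (D / a) + 4 / 3 * pi) \<le> 4 * pi * (ln D + 2) * L\<^sup>2"
      using L mult_left_mono[of _ _ L] by (fastforce simp: power2_eq_square mult_ac)
  qed
  finally show ?thesis .
qed

section \<open>The kernel of \<open>Psi\<close> and its convolution with itself\<close>

definition log_kernel :: "real \<Rightarrow> real^3 \<Rightarrow> real" where
  "log_kernel \<mu> z = (1 + \<bar>ln (norm z)\<bar>) powr \<mu> / (norm z)\<^sup>2"

lemma measurable_log_kernel[measurable]: "Borel (log_kernel \<mu>)"
  unfolding log_kernel_def[abs_def] by measurable

lemma log_kernel_nonneg: "log_kernel \<mu> z \<ge> 0"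
  by (simp add: log_kernel_def)

lemma abs_ln_le_powr: "r > 0 \<Longrightarrow> 1 + \<bar>ln r\<bar> \<le> 5 * (r powr (1/4) + r powr (-1/4))" for r :: real
proof -
  assume r: "r > 0"
  have *: "1 + ln x \<le> 5 * x powr (1/4)" if "x \<ge> 1" for x :: real
    using ln_powr_bound[of x "1/4"] that ge_one_powr_ge_zero[of x "1/4"] by simp
  show ?thesis
  proof (cases "r \<ge> 1")
    case True
    then have "1 + \<bar>ln r\<bar> \<le> 5 * r powr (1/4)" using *[of r] by simp
    then show ?thesis by (smt (verit) powr_ge_zero)
  next
    case False
    then have "1 + ln (1 / r) \<le> 5 * (1 / r) powr (1/4)" using *[of "1/r"] r by simp
    moreover have "(1 / r) powr (1/4) = r powr (-1/4)" using r by (simp add: powr_divide powr_minus divide_simps)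
    moreover have "ln (1 / r) = \<bar>ln r\<bar>" using r False by (simp add: ln_div abs_if)
    ultimately have "1 + \<bar>ln r\<bar> \<le> 5 * r powr (-1/4)" by simp
    then show ?thesis by (smt (verit) powr_ge_zero)
  qed
qed

text \<open>The logarithm costs a quarter of a power on each side of |z| = 1. The exponents 7/4 and
  9/4 still leave the kernel locally integrable and its square integrable at infinity.\<close>

lemma log_kernel_le:
  assumes "0 \<le> \<mu>" "\<mu> \<le> 1"
  shows "log_kernel \<mu> z \<le> 5 * (norm z powr (-7/4) + norm z powr (-9/4))"
proof (cases "z = 0")
  case False
  define r where "r = norm z"
  have r: "r > 0" using False by (simp add: r_def)
  have "(1 + \<bar>ln r\<bar>) powr \<mu> \<le> (1 + \<bar>ln r\<bar>) powr 1" using assms by (intro powr_mono) auto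
  also have "\<dots> \<le> 5 * (r powr (1/4) + r powr (-1/4))" using abs_ln_le_powr[OF r] by simp
  finally have "log_kernel \<mu> z \<le> 5 * (r powr (1/4) + r powr (-1/4)) / r\<^sup>2"
    unfolding log_kernel_def r_def[symmetric] by (rule divide_right_mono) simp
  also have "\<dots> = 5 * (r powr (1/4) * r powr (-2) + r powr (-1/4) * r powr (-2))"
    using r by (simp add: powr_minus divide_simps distrib_right)
  also have "\<dots> = 5 * (r powr (-7/4) + r powr (-9/4))" by (simp flip: powr_add)
  finally show ?thesis by (simp add: r_def)
qed (simp add: log_kernel_def)

text \<open>The singularities 0 and e are a unit apart. Within distance 1/2 of one of them the
  factor belonging to the other is at most \<open>b\<close>, and away from both the product is
  dominated by the sum of the squares, which decay like |x|^(-7/2).\<close>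

lemma log_kernel_conv_unit:
  obtains C where "C \<ge> 0" "\<And>\<mu> e. 0 \<le> \<mu> \<Longrightarrow> \<mu> \<le> 1 \<Longrightarrow> norm e = 1 \<Longrightarrow>
    (\<integral>\<^sub>+x. ennreal (log_kernel \<mu> x * log_kernel \<mu> (x - e))) \<le> ennreal C"
proof -
  define B where "B = (\<lambda>x::real^3. 5 * (norm x powr (-7/4) + norm x powr (-9/4)))"
  have [measurable]: "Borel B" unfolding B_def by measurable
  have B0: "B x \<ge> 0" for x by (simp add: B_def)
  define b where "b = 5 * ((1/2) powr (-7/4) + (1/2) powr (-9/4) :: real)"
  have b: "B x \<le> b" if "norm x \<ge> 1/2" for x
    unfolding B_def b_def using that by (intro mult_left_mono add_mono powr_mono2') auto
  have b0: "b \<ge> 0" by (simp add: b_def)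
  define I1 where "I1 = (\<integral>\<^sub>+x. ennreal (B x) * indicator {..1/2} (norm x))"
  define I2 where "I2 = (\<integral>\<^sub>+x. ennreal (B x * B x) * indicator {1/2..} (norm x))"
  have I1: "I1 < \<infinity>"
  proof -
    have "I1 = 5 * ((\<integral>\<^sub>+(x::real^3). ennreal (norm x powr - (7/4)) * indicator {..1/2} (norm x))
        + (\<integral>\<^sub>+(x::real^3). ennreal (norm x powr - (9/4)) * indicator {..1/2} (norm x)))"
      unfolding I1_def B_def
      by (simp add: ennreal_mult distrib_left distrib_right nn_integral_add nn_integral_cmult mult.assoc)
    then show ?thesis using nn_integral_ball_powr[of "1/2" "7/4"] nn_integral_ball_powr[of "1/2" "9/4"]
      by (simp add: ennreal_mult_less_top)
  qed
  have I2: "I2 < \<infinity>"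
  proof -
    \<comment> \<open>For |x| >= 1/2 the power -9/4 is at most twice the power -7/4, so B <= 15
      |x|^(-7/4), and 225 = 15^2.\<close>
    have pt: "ennreal (B x * B x) * indicator {1/2..} (norm x) \<le> ennreal 225 * (ennreal (norm x powr - (7/2)) * indicator {1/2..} (norm x))" for x
    proof (cases "norm x \<ge> 1/2")
      case True
      have "norm x powr (-9/4) = norm x powr (-1/2) * norm x powr (-7/4)" by (simp flip: powr_add)
      also have "\<dots> \<le> (1/2) powr (-1/2) * norm x powr (-7/4)" using True by (intro mult_right_mono powr_mono2') auto
      also have "(1/2::real) powr (-1/2) = sqrt 2" by (simp add: powr_minus powr_half_sqrt real_sqrt_divide divide_simps)
      also have "sqrt 2 * norm x powr (-7/4) \<le> 2 * norm x powr (-7/4)"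
        by (intro mult_right_mono) (auto simp: real_le_lsqrt)
      finally have "B x \<le> 15 * norm x powr (-7/4)" by (simp add: B_def)
      then have "B x * B x \<le> (15 * norm x powr (-7/4)) * (15 * norm x powr (-7/4))" using B0 by (intro mult_mono) auto
      also have "\<dots> = 225 * (norm x powr (-7/4) * norm x powr (-7/4))" by simp
      also have "\<dots> = 225 * norm x powr - (7/2)" by (simp flip: powr_add)
      finally show ?thesis using True by (simp add: ennreal_mult[symmetric] ennreal_leI flip: ennreal_numeral)
    qed simp
    have "I2 \<le> (\<integral>\<^sub>+(x::real^3). ennreal 225 * (ennreal (norm x powr - (7/2)) * indicator {1/2..} (norm x)))"
      unfolding I2_def by (intro nn_integral_mono pt)
    also have "\<dots> = ennreal 225 * (\<integral>\<^sub>+(x::real^3). ennreal (norm x powr - (7/2)) * indicator {1/2..} (norm x))"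
      by (rule nn_integral_cmult) measurable
    also have "\<dots> < \<infinity>" using nn_integral_outside_powr[of "1/2" "7/2"] by (simp add: ennreal_mult_less_top)
    finally show ?thesis .
  qed
  define C where "C = enn2real (ennreal b * I1 + ennreal b * I1 + I2 + I2)"
  have C: "ennreal C = ennreal b * I1 + ennreal b * I1 + I2 + I2"
    unfolding C_def using I1 I2 by (intro ennreal_enn2real) (simp add: ennreal_mult_less_top)
  show ?thesis
  proof (rule that[of C])
    show "C \<ge> 0" by (simp add: C_def)
    fix \<mu> :: real and e :: "real^3" assume \<mu>: "0 \<le> \<mu>" "\<mu> \<le> 1" and e: "norm e = 1"
    have le: "log_kernel \<mu> x * log_kernel \<mu> (x - e) \<le> B x * B (x - e)" for x
      unfolding B_def by (intro mult_mono log_kernel_le \<mu> log_kernel_nonneg) auto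
    define J where "J = (\<lambda>x::real^3. ennreal (B x) * indicator {..1/2} (norm x))"
    define H where "H = (\<lambda>x::real^3. ennreal (B x * B x) * indicator {1/2..} (norm x))"
    have [measurable]: "Borel J" "Borel H" unfolding J_def H_def by measurable
    have pt: "ennreal (B x * B (x - e)) \<le> ennreal b * J x + ennreal b * J (x - e) + H x + H (x - e)" for x
    proof -
      consider "norm x < 1/2" | "norm (x - e) < 1/2" | "norm x \<ge> 1/2" "norm (x - e) \<ge> 1/2" by linarith
      then show ?thesis
      proof cases
        case 1
        then have "norm (x - e) \<ge> 1/2" using e norm_triangle_ineq2[of e x] by (simp add: norm_minus_commute)
        then have "ennreal (B x * B (x - e)) \<le> ennreal (b * B x)" using mult_left_mono[OF b[of "x - e"] B0[of x]] by (intro ennreal_leI) (simp add: mult.commute)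
        also have "\<dots> = ennreal b * J x" using 1 B0 b0 by (simp add: J_def ennreal_mult)
        finally show ?thesis by (simp add: add_increasing2)
      next
        case 2
        then have "norm x \<ge> 1/2" using e norm_triangle_ineq2[of e "e - x"] by (simp add: norm_minus_commute)
        then have "ennreal (B x * B (x - e)) \<le> ennreal (b * B (x - e))" using b[of x] B0[of "x - e"] by (intro ennreal_leI) (simp add: mult_right_mono)
        also have "\<dots> = ennreal b * J (x - e)" using 2 B0 b0 by (simp add: J_def ennreal_mult)
        finally show ?thesis by (simp add: add_increasing2 add_increasing)
      next
        case 3
        have "B x * B (x - e) \<le> B x * B x + B (x - e) * B (x - e)"
          using sum_squares_bound[of "B x" "B (x - e)"] mult_nonneg_nonneg[OF B0 B0, of x "x - e"] by (simp add: power2_eq_square)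
        then have "ennreal (B x * B (x - e)) \<le> ennreal (B x * B x) + ennreal (B (x - e) * B (x - e))"
          using B0 by (simp add: ennreal_leI flip: ennreal_plus)
        also have "\<dots> = H x + H (x - e)" using 3 by (simp add: H_def)
        finally show ?thesis by (simp add: add_increasing add.assoc)
      qed
    qed
    have "(\<integral>\<^sub>+x. ennreal (log_kernel \<mu> x * log_kernel \<mu> (x - e)))
        \<le> (\<integral>\<^sub>+x. ennreal b * J x + ennreal b * J (x - e) + H x + H (x - e))"
      by (intro nn_integral_mono order_trans[OF ennreal_leI[OF le] pt])
    also have "\<dots> = ennreal b * (\<integral>\<^sub>+x. J x) + ennreal b * (\<integral>\<^sub>+x. J (x - e)) + (\<integral>\<^sub>+x. H x) + (\<integral>\<^sub>+x. H (x - e))"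
      by (simp add: nn_integral_add nn_integral_cmult)
    also have "\<dots> = ennreal C"
      using nn_integral_translation[of J "-e"] nn_integral_translation[of H "-e"]
      unfolding C I1_def I2_def J_def[symmetric] H_def[symmetric] by simp
    finally show "(\<integral>\<^sub>+x. ennreal (log_kernel \<mu> x * log_kernel \<mu> (x - e))) \<le> ennreal C" .
  qed
qed

text \<open>The scaling \<open>x \<mapsto> \<bar>z\<bar> x\<close> reduces to unit vectors, because
  \<open>1 + \<bar>ln (d r)\<bar> \<le> (1 + \<bar>ln d\<bar>) (1 + \<bar>ln r\<bar>)\<close>.\<close>

lemma log_kernel_conv:
  obtains C where "C \<ge> 0" "\<And>\<mu> z. 0 \<le> \<mu> \<Longrightarrow> \<mu> \<le> 1 \<Longrightarrow> z \<noteq> 0 \<Longrightarrow>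
    (\<integral>\<^sub>+x. ennreal (log_kernel \<mu> x * log_kernel \<mu> (x - z))) \<le> ennreal (C * ((1 + \<bar>ln (norm z)\<bar>) powr (2 * \<mu>) / norm z))"
proof -
  obtain C where C: "C \<ge> 0" "\<And>\<mu> e. 0 \<le> \<mu> \<Longrightarrow> \<mu> \<le> 1 \<Longrightarrow> norm e = 1 \<Longrightarrow>
    (\<integral>\<^sub>+x. ennreal (log_kernel \<mu> x * log_kernel \<mu> (x - e))) \<le> ennreal C"
    using log_kernel_conv_unit by blast
  show ?thesis
  proof (rule that[OF C(1)])
    fix \<mu> :: real and z :: "real^3" assume \<mu>: "0 \<le> \<mu>" "\<mu> \<le> 1" and z: "z \<noteq> 0"
    define d where "d = norm z"
    define e where "e = (1 / d) *\<^sub>R z"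
    define q where "q = (1 + \<bar>ln d\<bar>) powr \<mu> / d\<^sup>2"
    have d: "d > 0" using z by (simp add: d_def)
    have e: "norm e = 1" "z = d *\<^sub>R e" using d by (auto simp: e_def d_def)
    have q: "q \<ge> 0" by (simp add: q_def)
    have sc: "log_kernel \<mu> (d *\<^sub>R x) \<le> q * log_kernel \<mu> x" for x
    proof (cases "x = 0")
      case False
      then have "ln (norm (d *\<^sub>R x)) = ln d + ln (norm x)" using d by (simp add: ln_mult)
      then have "1 + \<bar>ln (norm (d *\<^sub>R x))\<bar> \<le> 1 + \<bar>ln d\<bar> + \<bar>ln (norm x)\<bar> + \<bar>ln d\<bar> * \<bar>ln (norm x)\<bar>"
        by (simp add: add_increasing2 abs_triangle_ineq)
      also have "\<dots> = (1 + \<bar>ln d\<bar>) * (1 + \<bar>ln (norm x)\<bar>)" by (simp add: algebra_simps)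
      finally have "(1 + \<bar>ln (norm (d *\<^sub>R x))\<bar>) powr \<mu> \<le> ((1 + \<bar>ln d\<bar>) * (1 + \<bar>ln (norm x)\<bar>)) powr \<mu>"
        using \<mu> by (intro powr_mono2) auto
      also have "\<dots> = (1 + \<bar>ln d\<bar>) powr \<mu> * (1 + \<bar>ln (norm x)\<bar>) powr \<mu>" by (rule powr_mult)
      finally show ?thesis using d False by (simp add: log_kernel_def q_def power_mult_distrib divide_right_mono)
    qed (simp add: log_kernel_def)
    have "(\<integral>\<^sub>+x. ennreal (log_kernel \<mu> x * log_kernel \<mu> (x - z)))
        = ennreal (d ^ 3) * (\<integral>\<^sub>+x. ennreal (log_kernel \<mu> (d *\<^sub>R x) * log_kernel \<mu> (d *\<^sub>R (x - e))))"
      using nn_integral_scale[of "\<lambda>x. ennreal (log_kernel \<mu> x * log_kernel \<mu> (x - z))" d 0] d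
      by (simp add: e(2) scaleR_diff_right)
    also have "\<dots> \<le> ennreal (d ^ 3) * (\<integral>\<^sub>+x. ennreal (q * q) * ennreal (log_kernel \<mu> x * log_kernel \<mu> (x - e)))"
    proof (intro mult_left_mono nn_integral_mono)
      fix x
      have "log_kernel \<mu> (d *\<^sub>R x) * log_kernel \<mu> (d *\<^sub>R (x - e)) \<le> (q * log_kernel \<mu> x) * (q * log_kernel \<mu> (x - e))"
        by (intro mult_mono sc mult_nonneg_nonneg q log_kernel_nonneg)
      also have "\<dots> = q * q * (log_kernel \<mu> x * log_kernel \<mu> (x - e))" by simp
      finally show "ennreal (log_kernel \<mu> (d *\<^sub>R x) * log_kernel \<mu> (d *\<^sub>R (x - e))) \<le> ennreal (q * q) * ennreal (log_kernel \<mu> x * log_kernel \<mu> (x - e))"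
        using q by (simp add: ennreal_leI log_kernel_nonneg flip: ennreal_mult)
    qed simp
    also have "\<dots> = ennreal (d ^ 3) * (ennreal (q * q) * (\<integral>\<^sub>+x. ennreal (log_kernel \<mu> x * log_kernel \<mu> (x - e))))"
      by (subst nn_integral_cmult) auto
    also have "\<dots> \<le> ennreal (d ^ 3) * (ennreal (q * q) * ennreal C)"
      by (intro mult_left_mono C(2)[OF \<mu> e(1)]) simp_all
    also have "\<dots> = ennreal (d ^ 3 * (q * q * C))"
    proof -
      have "ennreal (d ^ 3 * (q * q * C)) = ennreal (d ^ 3) * ennreal (q * q * C)"
        using q d C(1) by (intro ennreal_mult) auto
      also have "ennreal (q * q * C) = ennreal (q * q) * ennreal C"
        using q C(1) by (intro ennreal_mult) auto
      finally show ?thesis by simp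
    qed
    also have "d ^ 3 * (q * q * C) = C * ((1 + \<bar>ln d\<bar>) powr (2 * \<mu>) / d)"
    proof -
      have "(1 + \<bar>ln d\<bar>) powr (2 * \<mu>) = (1 + \<bar>ln d\<bar>) powr \<mu> * (1 + \<bar>ln d\<bar>) powr \<mu>"
        by (simp flip: powr_add)
      then show ?thesis using d by (simp add: q_def power2_eq_square power3_eq_cube)
    qed
    finally show "(\<integral>\<^sub>+x. ennreal (log_kernel \<mu> x * log_kernel \<mu> (x - z))) \<le> ennreal (C * ((1 + \<bar>ln (norm z)\<bar>) powr (2 * \<mu>) / norm z))"
      by (simp add: d_def)
  qed
qed

text \<open>For r < 1 one has 2 |ln r| = ln (1/r^2) <= ell, and \<open>ell >= 3\<close> absorbs the
  summand 1; for r >= 1 the logarithm is at most ln D.\<close>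

lemma one_plus_abs_ln_le_ell:
  assumes "D \<ge> 1" "0 < r" "r \<le> D"
  shows "1 + \<bar>ln r\<bar> \<le> (1 + ln D) * ell (r\<^sup>2)"
proof -
  have r2: "r\<^sup>2 > 0" using assms by simp
  have l3: "ell (r\<^sup>2) \<ge> 3" by (rule ell_ge_3[OF r2])
  have D0: "ln D \<ge> 0" using assms by simp
  show ?thesis
  proof (cases "r \<ge> 1")
    case True
    then have "1 + \<bar>ln r\<bar> \<le> (1 + ln D) * 1" using assms by simp
    also have "\<dots> \<le> (1 + ln D) * ell (r\<^sup>2)" using D0 l3 by (intro mult_left_mono) auto
    finally show ?thesis .
  next
    case False
    have "2 * \<bar>ln r\<bar> = ln (1 / r\<^sup>2)" using False assms by (simp add: ln_div ln_realpow)
    also have "\<dots> \<le> ell (r\<^sup>2)" by (rule ell_ge_ln[OF r2])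
    finally have "1 + \<bar>ln r\<bar> \<le> 1 * ell (r\<^sup>2)" using l3 by simp
    also have "\<dots> \<le> (1 + ln D) * ell (r\<^sup>2)" using D0 l3 by (intro mult_right_mono) auto
    finally show ?thesis .
  qed
qed

definition kap :: "real \<Rightarrow> real" where
  "kap s = ell s powr (4/3) * s powr (-1/2)"

lemma measurable_kap[measurable]: "Borel kap"
  unfolding kap_def[abs_def] by measurable

lemma kap_nonneg: "kap s \<ge> 0"
  by (simp add: kap_def)

lemma kap_square: "r > 0 \<Longrightarrow> kap (r\<^sup>2) = ell (r\<^sup>2) powr (4/3) / r"
  by (simp add: kap_def powr_minus powr_half_sqrt divide_simps)

text \<open>Expanding the square and interchanging the integrals leaves the autocorrelation of the
  kernel at the difference of the two source points.\<close>

lemma nn_integral_conv_square: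
  fixes M :: "'a::euclidean_space \<Rightarrow> real" and f :: "'a \<Rightarrow> real"
  assumes [measurable]: "Borel M" "Borel f"
    and nn: "\<And>x. M x \<ge> 0" "\<And>x. f x \<ge> 0"
  shows "(\<integral>\<^sub>+x. (\<integral>\<^sub>+y. ennreal (M (x - y) * f y))\<^sup>2)
    = (\<integral>\<^sub>+y y'. ennreal (f y * f y') * (\<integral>\<^sub>+x. ennreal (M x * M (x - (y' - y)))))"
proof -
  have "(\<integral>\<^sub>+x. (\<integral>\<^sub>+y. ennreal (M (x - y) * f y))\<^sup>2)
      = (\<integral>\<^sub>+x y y'. ennreal (M (x - y) * f y) * ennreal (M (x - y') * f y'))"
    by (simp add: power2_eq_square nn_integral_cmult nn_integral_multc)
  also have "\<dots> = (\<integral>\<^sub>+y x y'. ennreal (M (x - y) * f y) * ennreal (M (x - y') * f y'))"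
    by (rule lborel_pair.Fubini') measurable
  also have "\<dots> = (\<integral>\<^sub>+y y' x. ennreal (M (x - y) * f y) * ennreal (M (x - y') * f y'))"
    by (intro nn_integral_cong lborel_pair.Fubini') measurable
  also have "\<dots> = (\<integral>\<^sub>+y y'. ennreal (f y * f y') * (\<integral>\<^sub>+x. ennreal (M x * M (x - (y' - y)))))"
  proof (intro nn_integral_cong)
    fix y y'
    have "(\<integral>\<^sub>+x. ennreal (M (x - y) * f y) * ennreal (M (x - y') * f y'))
        = (\<integral>\<^sub>+x. ennreal (f y * f y') * ennreal (M (x - y) * M (x - y')))"
      using nn by (intro nn_integral_cong) (simp add: mult_ac flip: ennreal_mult)
    also have "\<dots> = ennreal (f y * f y') * (\<integral>\<^sub>+x. ennreal (M (x - y) * M (x - y')))"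
      by (rule nn_integral_cmult) measurable
    also have "(\<integral>\<^sub>+x. ennreal (M (x - y) * M (x - y'))) = (\<integral>\<^sub>+x. ennreal (M x * M (x - (y' - y))))"
      using nn_integral_translation[of "\<lambda>x. ennreal (M (x - y) * M (x - y'))" y] by (simp add: algebra_simps)
    finally show "(\<integral>\<^sub>+x. ennreal (M (x - y) * f y) * ennreal (M (x - y') * f y'))
      = ennreal (f y * f y') * (\<integral>\<^sub>+x. ennreal (M x * M (x - (y' - y))))" .
  qed
  finally show ?thesis .
qed

text \<open>The self-convolution of the kernel is an inverse first power with the logarithm squared,
  so the L^2 norm of a potential becomes an interaction energy. The estimate of the convolution
  excludes y = y', which is a null set.\<close>

lemma log_potential_square:
  obtains C where "C > 0" "\<And>\<mu> f. 0 \<le> \<mu> \<Longrightarrow> \<mu> \<le> 1 \<Longrightarrow> f \<in> borel_measurable borel \<Longrightarrow> (\<And>x. f x \<ge> 0) \<Longrightarrow>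
    (\<integral>\<^sub>+x. (\<integral>\<^sub>+y. ennreal (log_kernel \<mu> (x - y) * f y))\<^sup>2)
    \<le> ennreal C * (\<integral>\<^sub>+y y'. ennreal (f y * f y' * ((1 + \<bar>ln (norm (y - y'))\<bar>) powr (2 * \<mu>) / norm (y - y'))))"
proof -
  obtain C where C: "C \<ge> 0" "\<And>\<mu> z. 0 \<le> \<mu> \<Longrightarrow> \<mu> \<le> 1 \<Longrightarrow> z \<noteq> 0 \<Longrightarrow>
    (\<integral>\<^sub>+x. ennreal (log_kernel \<mu> x * log_kernel \<mu> (x - z))) \<le> ennreal (C * ((1 + \<bar>ln (norm z)\<bar>) powr (2 * \<mu>) / norm z))"
    using log_kernel_conv by blast
  show ?thesis
  proof (rule that[of "C + 1"])
    show "C + 1 > 0" using C by simp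
    fix \<mu> :: real and f :: "real^3 \<Rightarrow> real"
    assume \<mu>: "0 \<le> \<mu>" "\<mu> \<le> 1" and [measurable]: "Borel f" and f: "\<And>x. f x \<ge> 0"
    let ?k = "\<lambda>y y'. (1 + \<bar>ln (norm (y - y'))\<bar>) powr (2 * \<mu>) / norm (y - y' :: real^3)"
    have "(\<integral>\<^sub>+x. (\<integral>\<^sub>+y. ennreal (log_kernel \<mu> (x - y) * f y))\<^sup>2)
      = (\<integral>\<^sub>+y y'. ennreal (f y * f y') * (\<integral>\<^sub>+x. ennreal (log_kernel \<mu> x * log_kernel \<mu> (x - (y' - y)))))"
      by (rule nn_integral_conv_square) (auto simp: f log_kernel_nonneg)
    also have "\<dots> \<le> (\<integral>\<^sub>+y y'. ennreal (C + 1) * ennreal (f y * f y' * ?k y y'))"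
    proof (rule nn_integral_mono, rule nn_integral_mono_AE)
      fix y :: "real^3"
      have "AE y' in lborel. y' \<noteq> y" by (rule AE_lborel_singleton)
      then show "AE y' in lborel. ennreal (f y * f y') * (\<integral>\<^sub>+x. ennreal (log_kernel \<mu> x * log_kernel \<mu> (x - (y' - y))))
         \<le> ennreal (C + 1) * ennreal (f y * f y' * ?k y y')"
      proof eventually_elim
        case (elim y')
        have k0: "0 \<le> ?k y y'" by simp
        have "ennreal (f y * f y') * (\<integral>\<^sub>+x. ennreal (log_kernel \<mu> x * log_kernel \<mu> (x - (y' - y))))
          \<le> ennreal (f y * f y') * ennreal (C * ?k y y')"
          using C(2)[OF \<mu>, of "y' - y"] elim by (intro mult_left_mono) (auto simp: norm_minus_commute)
        also have "\<dots> = ennreal ((f y * f y') * (C * ?k y y'))" using f C(1) k0 by (intro ennreal_mult[symmetric]) auto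
        also have "\<dots> \<le> ennreal ((C + 1) * (f y * f y' * ?k y y'))"
        proof (rule ennreal_leI)
          have "C * (f y * f y' * ?k y y') \<le> (C + 1) * (f y * f y' * ?k y y')"
            using f k0 by (intro mult_right_mono mult_nonneg_nonneg) auto
          then show "f y * f y' * (C * ?k y y') \<le> (C + 1) * (f y * f y' * ?k y y')" by (simp only: mult_ac)
        qed
        also have "\<dots> = ennreal (C + 1) * ennreal (f y * f y' * ?k y y')"
          using f C(1) k0 by (intro ennreal_mult mult_nonneg_nonneg) auto
        finally show ?case .
      qed
    qed
    also have "\<dots> = ennreal (C + 1) * (\<integral>\<^sub>+y y'. ennreal (f y * f y' * ?k y y'))"
      by (simp add: nn_integral_cmult)
    finally show "(\<integral>\<^sub>+x. (\<integral>\<^sub>+y. ennreal (log_kernel \<mu> (x - y) * f y))\<^sup>2)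
      \<le> ennreal (C + 1) * (\<integral>\<^sub>+y y'. ennreal (f y * f y' * ?k y y'))" .
  qed
qed

section \<open>From the interaction energy to the potentials\<close>

text \<open>The last condition is the logarithmic interaction energy at the endpoint \<open>2 \<mu> = 4/3\<close>.\<close>

definition density_bounds :: "real \<Rightarrow> real \<Rightarrow> real \<Rightarrow> real \<Rightarrow> (point \<Rightarrow> real) \<Rightarrow> bool" where
  "density_bounds B T E Z R \<longleftrightarrow> R \<in> borel_measurable borel \<and> (\<forall>z. R z \<ge> 0) \<and>
     (\<forall>x t. norm x > B \<or> t \<notin> {0..T} \<longrightarrow> R (x, t) = 0) \<and>
     (AE t in lborel. (\<integral>\<^sub>+x. ennreal (R (x, t) powr (3/2))) \<le> ennreal E) \<and>
     (\<integral>\<^sub>+t x y. ennreal (R (x, t) powr (5/4) * R (y, t) powr (5/4) * kap ((norm (x - y))\<^sup>2))) \<le> ennreal Z"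

lemma nn_integral_time_slices:
  fixes f :: "point \<Rightarrow> ennreal"
  assumes [measurable]: "Borel f"
  shows "(\<integral>\<^sub>+z. f z) = (\<integral>\<^sub>+t x. f (x, t))"
proof -
  have "(\<integral>\<^sub>+t x. f (x, t)) = (\<integral>\<^sup>+z. f z \<partial>(lborel \<Otimes>\<^sub>M lborel))"
    by (rule lborel_pair.nn_integral_snd) (simp add: lborel_prod)
  then show ?thesis by (simp add: lborel_prod)
qed

lemma Psi_Borel:
  assumes "Borel R"
  shows "Psi \<mu> R (x, t) = (\<integral>\<^sub>+y. ennreal (log_kernel \<mu> (x - y) * R (y, t) powr (5/4)))"
proof -
  have [measurable]: "Borel (\<lambda>y. R (y, t))"
    using measurable_compose[OF _ assms, of "\<lambda>y. (y, t)"] by simp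
  show ?thesis unfolding Psi_def log_kernel_def dist_norm prod.case
    by (subst nn_integral_completion) auto
qed

lemma G_Borel:
  assumes "Borel R"
  shows "G \<mu> R (x, t) = (\<integral>\<^sub>+y. ennreal (log_kernel 0 (x - y) * (R (y, t) powr (5/4) * ln (1 + R (y, t)) powr \<mu>)))"
proof -
  have [measurable]: "Borel (\<lambda>y. R (y, t))"
    using measurable_compose[OF _ assms, of "\<lambda>y. (y, t)"] by simp
  have [simp]: "1 + \<bar>u\<bar> \<noteq> 0" for u :: real by linarith
  show ?thesis unfolding G_def log_kernel_def dist_norm prod.case
    by (subst nn_integral_completion) (auto simp: mult.assoc)
qed

lemma G0_Borel:
  assumes "Borel R"
  shows "G0 R (x, t) = (\<integral>\<^sub>+y. ennreal (log_kernel 0 (x - y) * R (y, t) powr (5/4)))"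
proof -
  have [measurable]: "Borel (\<lambda>y. R (y, t))"
    using measurable_compose[OF _ assms, of "\<lambda>y. (y, t)"] by simp
  have [simp]: "1 + \<bar>u\<bar> \<noteq> 0" for u :: real by linarith
  show ?thesis unfolding G0_def log_kernel_def dist_norm prod.case
    by (subst nn_integral_completion) (auto simp: mult.assoc)
qed

lemma measurable_potentials:
  assumes [measurable]: "Borel R"
  shows "Borel (Psi \<mu> R)" "Borel (G \<mu> R)" "Borel (G0 R)"
    "Borel (Sigma_pot \<mu> R)"
proof -
  have [measurable]: "R \<in> borel_measurable (borel \<Otimes>\<^sub>M borel)" by (simp add: borel_prod)
  have "Psi \<mu> R = (\<lambda>(x, t). \<integral>\<^sub>+y. ennreal (log_kernel \<mu> (x - y) * R (y, t) powr (5/4)))"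
    using Psi_Borel[OF assms] by auto
  also have "Borel \<dots>" unfolding borel_prod[symmetric] by measurable
  finally show "Borel (Psi \<mu> R)" .
  have "G \<mu> R = (\<lambda>(x, t). \<integral>\<^sub>+y. ennreal (log_kernel 0 (x - y) * (R (y, t) powr (5/4) * ln (1 + R (y, t)) powr \<mu>)))"
    using G_Borel[OF assms] by auto
  also have "Borel \<dots>" unfolding borel_prod[symmetric] by measurable
  finally show "Borel (G \<mu> R)" .
  have "G0 R = (\<lambda>(x, t). \<integral>\<^sub>+y. ennreal (log_kernel 0 (x - y) * R (y, t) powr (5/4)))"
    using G0_Borel[OF assms] by auto
  also have "Borel \<dots>" unfolding borel_prod[symmetric] by measurable
  finally show [measurable]: "Borel (G0 R)" .
  show "Borel (Sigma_pot \<mu> R)"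
    unfolding Sigma_pot_def[abs_def] by measurable
qed

lemma density_boundsD:
  assumes "density_bounds B T E Z R"
  shows "Borel R" "R z \<ge> 0" "R (x, t) \<noteq> 0 \<Longrightarrow> norm x \<le> B \<and> t \<in> {0..T}"
    "AE t in lborel. (\<integral>\<^sub>+x. ennreal (R (x, t) powr (3/2))) \<le> ennreal E"
    "(\<integral>\<^sub>+t x y. ennreal (R (x, t) powr (5/4) * R (y, t) powr (5/4) * kap ((norm (x - y))\<^sup>2))) \<le> ennreal Z"
  using assms unfolding density_bounds_def by (blast, blast, meson not_less, blast, blast)

text \<open>For \<mu> <= 2/3 the exponent 2 \<mu> of the energy is at most 4/3. Points of the
  support are at most 2B apart, so the logarithm of their distance is controlled by
  \<open>ell\<close>, and the energy bound in \<open>density_bounds\<close> applies.\<close>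

lemma Psi_square_bound:
  assumes B: "B \<ge> 1" and \<mu>: "0 \<le> \<mu>" "\<mu> \<le> 2/3" and Z: "Z \<ge> 0"
  obtains c where "c > 0" "\<And>T E R. density_bounds B T E Z R \<Longrightarrow> (\<integral>\<^sub>+z. (Psi \<mu> R z)\<^sup>2) \<le> ennreal c"
proof -
  obtain C where C: "C > 0" "\<And>\<mu> f. 0 \<le> \<mu> \<Longrightarrow> \<mu> \<le> 1 \<Longrightarrow> f \<in> borel_measurable borel \<Longrightarrow> (\<And>x. f x \<ge> 0) \<Longrightarrow>
    (\<integral>\<^sub>+x. (\<integral>\<^sub>+y. ennreal (log_kernel \<mu> (x - y) * f y))\<^sup>2)
    \<le> ennreal C * (\<integral>\<^sub>+y y'. ennreal (f y * f y' * ((1 + \<bar>ln (norm (y - y'))\<bar>) powr (2 * \<mu>) / norm (y - y'))))"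
    using log_potential_square by blast
  define L where "L = (1 + ln (2 * B)) powr (4/3)"
  have L: "L \<ge> 0" by (simp add: L_def)
  show ?thesis
  proof (rule that[of "C * (L * Z) + 1"])
    show "C * (L * Z) + 1 > 0" using C L Z by (intro add_nonneg_pos mult_nonneg_nonneg) auto
    fix T E R assume d: "density_bounds B T E Z R"
    note [measurable] = density_boundsD(1)[OF d]
    have [measurable]: "Borel (\<lambda>y. R (y, t))" for t
      using measurable_compose[OF _ density_boundsD(1)[OF d], of "\<lambda>y. (y, t)"] by simp
    have [measurable]: "R \<in> borel_measurable (borel \<Otimes>\<^sub>M borel)" by (simp add: borel_prod)
    note [measurable] = measurable_potentials(1)[OF density_boundsD(1)[OF d]]
    let ?F = "\<lambda>t x. R (x, t) powr (5/4)"
    have pt: "?F t y * ?F t y' * ((1 + \<bar>ln (norm (y - y'))\<bar>) powr (2 * \<mu>) / norm (y - y')) \<le> L * (?F t y * ?F t y' * kap ((norm (y - y'))\<^sup>2))" for t y y'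
    proof (cases "R (y, t) = 0 \<or> R (y', t) = 0 \<or> y = y'")
      case False
      define r where "r = norm (y - y')"
      have "norm y \<le> B" "norm y' \<le> B" using False density_boundsD(3)[OF d] by blast+
      then have r: "0 < r" "r \<le> 2 * B" using False norm_triangle_ineq4[of y y'] by (auto simp: r_def)
      have l3: "ell (r\<^sup>2) \<ge> 3" using r by (intro ell_ge_3) simp
      have "(1 + \<bar>ln r\<bar>) powr (2 * \<mu>) \<le> (1 + \<bar>ln r\<bar>) powr (4/3)" using \<mu> by (intro powr_mono) auto
      also have "\<dots> \<le> ((1 + ln (2 * B)) * ell (r\<^sup>2)) powr (4/3)"
        using one_plus_abs_ln_le_ell[of "2 * B" r] B r by (intro powr_mono2) auto
      also have "\<dots> = L * ell (r\<^sup>2) powr (4/3)" unfolding L_def by (rule powr_mult)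
      finally have "(1 + \<bar>ln r\<bar>) powr (2 * \<mu>) / r \<le> L * ell (r\<^sup>2) powr (4/3) / r" using r by (intro divide_right_mono) auto
      then have "?F t y * ?F t y' * ((1 + \<bar>ln r\<bar>) powr (2 * \<mu>) / r) \<le> ?F t y * ?F t y' * (L * kap (r\<^sup>2))"
        using r by (intro mult_left_mono) (auto simp: kap_square)
      then show ?thesis by (simp add: r_def mult_ac)
    qed (auto simp: L kap_nonneg)
    have "(\<integral>\<^sub>+z. (Psi \<mu> R z)\<^sup>2) = (\<integral>\<^sub>+t x. (Psi \<mu> R (x, t))\<^sup>2)"
      by (rule nn_integral_time_slices) measurable
    also have "\<dots> \<le> (\<integral>\<^sub>+t. ennreal C * (\<integral>\<^sub>+y y'. ennreal (?F t y * ?F t y' * ((1 + \<bar>ln (norm (y - y'))\<bar>) powr (2 * \<mu>) / norm (y - y')))))"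
      unfolding Psi_Borel[OF density_boundsD(1)[OF d]] using \<mu> by (intro nn_integral_mono C(2)) auto
    also have "\<dots> \<le> (\<integral>\<^sub>+t. ennreal C * (\<integral>\<^sub>+y y'. ennreal L * ennreal (?F t y * ?F t y' * kap ((norm (y - y'))\<^sup>2))))"
    proof (intro nn_integral_mono mult_left_mono)
      fix t y y'
      have "ennreal L * ennreal (?F t y * ?F t y' * kap ((norm (y - y'))\<^sup>2)) = ennreal (L * (?F t y * ?F t y' * kap ((norm (y - y'))\<^sup>2)))"
        using L kap_nonneg by (intro ennreal_mult[symmetric]) auto
      then show "ennreal (?F t y * ?F t y' * ((1 + \<bar>ln (norm (y - y'))\<bar>) powr (2 * \<mu>) / norm (y - y')))
          \<le> ennreal L * ennreal (?F t y * ?F t y' * kap ((norm (y - y'))\<^sup>2))"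
        using ennreal_leI[OF pt] by simp
    qed simp
    also have "\<dots> = ennreal C * (ennreal L * (\<integral>\<^sub>+t y y'. ennreal (?F t y * ?F t y' * kap ((norm (y - y'))\<^sup>2))))"
      by (simp add: nn_integral_cmult)
    also have "\<dots> \<le> ennreal C * (ennreal L * ennreal Z)"
      by (intro mult_left_mono density_boundsD(5)[OF d]) auto
    also have "\<dots> = ennreal (C * (L * Z))" using C L Z by (simp add: ennreal_mult)
    also have "\<dots> \<le> ennreal (C * (L * Z) + 1)" by (intro ennreal_leI) simp
    finally show "(\<integral>\<^sub>+z. (Psi \<mu> R z)\<^sup>2) \<le> ennreal (C * (L * Z) + 1)" .
  qed
qed

text \<open>For finite \<open>Y\<close> the term x/2 is subtracted in the reals; for infinite
  \<open>Y\<close> the claim is trivial.\<close>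

lemma ennreal_absorb_half:
  assumes "x \<ge> 0" "ennreal x \<le> Y + ennreal (x / 2)" shows "ennreal x \<le> 2 * Y"
proof (cases Y)
  case (real y)
  then have "x \<le> y + x / 2" using assms by (simp add: ennreal_le_iff flip: ennreal_plus)
  then have "ennreal x \<le> ennreal (2 * y)" by (intro ennreal_leI) simp
  then show ?thesis using real by (simp add: ennreal_mult)
qed simp

lemma ennreal_add_square_le: "(a + b)\<^sup>2 \<le> 4 * a\<^sup>2 + 4 * (b::ennreal)\<^sup>2"
proof -
  have "a + b \<le> 2 * max a b" by (simp add: mult_2 add_mono max.cobounded1 max.cobounded2)
  then have "(a + b)\<^sup>2 \<le> (2 * max a b)\<^sup>2" by (intro power_mono) auto
  also have "\<dots> = 4 * (max a b)\<^sup>2" by (simp add: power_mult_distrib)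
  also have "\<dots> \<le> 4 * a\<^sup>2 + 4 * b\<^sup>2" by (auto simp: max_def add_increasing add_increasing2)
  finally show ?thesis .
qed

text \<open>Common majorant of the contributions controlled by mass alone. The exponent 7/4 makes it
  square integrable at infinity; it is what |x|^-2 becomes under the power 7/8 to which small values
  of \<open>G0\<close> are raised.\<close>

definition tail :: "real \<Rightarrow> real^3 \<Rightarrow> real" where
  "tail B x = (if norm x \<le> 2 * B then 1 else norm x powr (-7/4))"

lemma measurable_tail[measurable]: "Borel (tail B)"
  unfolding tail_def[abs_def] by measurable

lemma tail_nonneg: "tail B x \<ge> 0"
  by (simp add: tail_def)

lemma tail_square_finite:
  assumes B: "B \<ge> 1" shows "(\<integral>\<^sub>+x. ennreal ((tail B x)\<^sup>2)) < \<infinity>"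
proof -
  have [measurable]: "cball (0::real^3) (2 * B) \<in> sets borel" by simp
  have sq: "(norm x powr - (7/4))\<^sup>2 = norm x powr - (7/2)" for x :: "real^3" by (simp add: power2_eq_square flip: powr_add)
  have "(\<integral>\<^sub>+x. ennreal ((tail B x)\<^sup>2))
    \<le> (\<integral>\<^sub>+(x::real^3). indicator (cball 0 (2 * B)) x + ennreal (norm x powr - (7/2)) * indicator {2 * B..} (norm x))"
    by (rule nn_integral_mono) (auto simp: tail_def sq indicator_def)
  also have "\<dots> = emeasure lborel (cball (0::real^3) (2 * B)) + (\<integral>\<^sub>+(x::real^3). ennreal (norm x powr - (7/2)) * indicator {2 * B..} (norm x))"
    by (simp add: nn_integral_add)
  also have "\<dots> < \<infinity>"
    using nn_integral_outside_powr[of "2 * B" "7/2"] emeasure_cball[of "2 * B" "0::real^3"] B by simp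
  finally show ?thesis .
qed

lemma inverse_square_le_tail:
  fixes x y :: "real^3"
  assumes "B \<ge> 1" "norm y \<le> B" "norm x > 2 * B"
  shows "1 / (norm (x - y))\<^sup>2 \<le> 4 / (norm x)\<^sup>2" "4 / (norm x)\<^sup>2 \<le> 4 * tail B x"
proof -
  have x0: "norm x \<ge> 1" using assms by linarith
  have "norm x / 2 \<le> norm (x - y)" using assms norm_triangle_ineq2[of x y] by linarith
  then have "1 / (norm (x - y))\<^sup>2 \<le> 1 / (norm x / 2)\<^sup>2" using x0 by (intro frac_le power_mono) auto
  then show "1 / (norm (x - y))\<^sup>2 \<le> 4 / (norm x)\<^sup>2" by (simp add: power_divide)
  have "1 / (norm x)\<^sup>2 = norm x powr (-2)" using x0 by (simp add: powr_minus_divide powr_numeral)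
  also have "\<dots> \<le> norm x powr (-7/4)" using x0 by (intro powr_mono) auto
  finally show "4 / (norm x)\<^sup>2 \<le> 4 * tail B x" using assms by (simp add: tail_def)
qed

text \<open>Far out |x - y| is at least |x|/2; nearby the minimum is at most 1.\<close>

lemma min_inverse_square_le_tail:
  fixes x y :: "real^3"
  assumes "B \<ge> 1" "norm y \<le> B" shows "min 1 (1 / (norm (x - y))\<^sup>2) \<le> 4 * tail B x"
proof (cases "norm x \<le> 2 * B")
  case False
  then show ?thesis using inverse_square_le_tail[OF assms, of x] by linarith
qed (simp add: tail_def)

text \<open>The threshold is a = r^-16. For 1 < a <= r^-16 one has ln a <= 16 |ln r|, whence 17 and
  a term of the type of \<open>Psi\<close>. Above the threshold 1/r^2 <= a^(1/8), and a further
  a^(1/8) pays for the logarithm, so that 5/4 + 1/8 + 1/8 = 3/2 is reached. The minimum is retained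
  for its decay in r.\<close>

lemma log_density_split:
  fixes a r \<mu> :: real
  assumes a: "a \<ge> 0" and r: "r > 0" and \<mu>: "0 \<le> \<mu>" "\<mu> \<le> 1"
  shows "a powr (5/4) * ln (1 + a) powr \<mu> / r\<^sup>2
    \<le> 17 * ((1 + \<bar>ln r\<bar>) powr \<mu> / r\<^sup>2 * a powr (5/4)) + 9 * (a powr (3/2) * min 1 (1 / r\<^sup>2))"
proof -
  have nn: "0 \<le> 17 * ((1 + \<bar>ln r\<bar>) powr \<mu> / r\<^sup>2 * a powr (5/4))" "0 \<le> 9 * (a powr (3/2) * min 1 (1 / r\<^sup>2))" by auto
  have near: ?thesis if "ln (1 + a) \<le> 17 * (1 + \<bar>ln r\<bar>)"
  proof -
    have "ln (1 + a) powr \<mu> \<le> (17 * (1 + \<bar>ln r\<bar>)) powr \<mu>" using that a \<mu> by (intro powr_mono2) auto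
    also have "\<dots> = 17 powr \<mu> * (1 + \<bar>ln r\<bar>) powr \<mu>" by (rule powr_mult)
    also have "\<dots> \<le> 17 powr 1 * (1 + \<bar>ln r\<bar>) powr \<mu>" using \<mu> by (intro mult_right_mono powr_mono) auto
    finally have "a powr (5/4) / r\<^sup>2 * ln (1 + a) powr \<mu> \<le> a powr (5/4) / r\<^sup>2 * (17 * (1 + \<bar>ln r\<bar>) powr \<mu>)" by (intro mult_left_mono) auto
    then have "a powr (5/4) * ln (1 + a) powr \<mu> / r\<^sup>2 \<le> 17 * ((1 + \<bar>ln r\<bar>) powr \<mu> / r\<^sup>2 * a powr (5/4))" by (simp add: mult_ac)
    with nn(2) show ?thesis by linarith
  qed
  show ?thesis
  proof (cases "a \<le> 1")
    case True
    then have "ln (1 + a) \<le> 1" using ln_add_one_self_le_self[OF a] by linarith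
    then have "ln (1 + a) \<le> 17 + 17 * \<bar>ln r\<bar>" by simp
    then show ?thesis by (intro near) (simp add: distrib_left)
  next
    case False
    then have a1: "a > 1" by simp
    have "ln (1 + a) \<le> ln (2 * a)" using a1 by (subst ln_le_cancel_iff) auto
    also have "\<dots> \<le> 1 + ln a" using a1 ln_2_less_1 by (simp add: ln_mult)
    finally have la: "ln (1 + a) \<le> 1 + ln a" .
    show ?thesis
    proof (cases "a \<le> r powr (-16)")
      case True
      then have "ln a \<le> ln (r powr (-16))" using a1 r by (subst ln_le_cancel_iff) auto
      then show ?thesis using la r by (intro near) (simp add: ln_powr)
    next
      case False
      have "ln (1 + a) powr \<mu> \<le> (1 + ln a) powr \<mu>" using la a1 \<mu> by (intro powr_mono2) auto
      also have "\<dots> \<le> (1 + ln a) powr 1" using a1 \<mu> by (intro powr_mono) auto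
      also have "\<dots> \<le> 9 * a powr (1/8)" using ln_powr_bound[of a "1/8"] ge_one_powr_ge_zero[of a "1/8"] a1 by simp
      finally have L: "ln (1 + a) powr \<mu> \<le> 9 * a powr (1/8)" .
      have "1 / r\<^sup>2 = r powr (-16 * (1/8))" using r by (simp add: powr_minus_divide powr_numeral)
      also have "\<dots> = (r powr (-16)) powr (1/8)" by (rule powr_powr[symmetric])
      also have "\<dots> \<le> a powr (1/8)" using False by (intro powr_mono2) auto
      finally have r2: "1 / r\<^sup>2 \<le> a powr (1/8)" .
      have "1 / r\<^sup>2 \<le> a powr (1/8) * min 1 (1 / r\<^sup>2)"
        using r2 mult_right_mono[OF ge_one_powr_ge_zero[of a "1/8"], of "1 / r\<^sup>2"] a1 by (auto simp: min_def)
      then have "a powr (5/4) * ln (1 + a) powr \<mu> * (1 / r\<^sup>2) \<le> a powr (5/4) * (9 * a powr (1/8)) * (a powr (1/8) * min 1 (1 / r\<^sup>2))"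
        using L by (intro mult_mono) auto
      also have "\<dots> = 9 * ((a powr (5/4) * a powr (1/8) * a powr (1/8)) * min 1 (1 / r\<^sup>2))" by simp
      also have "a powr (5/4) * a powr (1/8) * a powr (1/8) = a powr (3/2)" unfolding powr_add[symmetric] by simp
      finally have "a powr (5/4) * ln (1 + a) powr \<mu> / r\<^sup>2 \<le> 9 * (a powr (3/2) * min 1 (1 / r\<^sup>2))" by simp
      with nn(1) show ?thesis by linarith
    qed
  qed
qed

text \<open>Here g stands for a value of \<open>G0\<close>. If r < g^(-1/4), the logarithm of g is
  at most 4 |ln r|; otherwise 1/r^2 <= sqrt g, a contribution that can be absorbed when g is
  large.\<close>

lemma log_value_split:
  fixes g r \<mu> :: real
  assumes g: "g \<ge> 1" and \<mu>: "0 \<le> \<mu>" "\<mu> \<le> 1" and r: "r > 0"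
  shows "(1 + ln g) powr \<mu> / r\<^sup>2 \<le> 4 * ((1 + \<bar>ln r\<bar>) powr \<mu> / r\<^sup>2) + (1 + ln g) powr \<mu> * sqrt g"
proof (cases "r < g powr (-1/4)")
  case True
  have l0: "ln g \<ge> 0" using g by simp
  have "ln r \<le> ln (g powr (-1/4))" using r g True by (subst ln_le_cancel_iff) auto
  then have "1 + ln g \<le> 4 * (1 + \<bar>ln r\<bar>)" using g by (simp add: ln_powr)
  then have "(1 + ln g) powr \<mu> \<le> (4 * (1 + \<bar>ln r\<bar>)) powr \<mu>" using l0 \<mu> by (intro powr_mono2) auto
  also have "\<dots> = 4 powr \<mu> * (1 + \<bar>ln r\<bar>) powr \<mu>" by (rule powr_mult)
  also have "\<dots> \<le> 4 powr 1 * (1 + \<bar>ln r\<bar>) powr \<mu>" using \<mu> by (intro mult_right_mono powr_mono) auto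
  finally have "(1 + ln g) powr \<mu> / r\<^sup>2 \<le> 4 * (1 + \<bar>ln r\<bar>) powr \<mu> / r\<^sup>2" by (intro divide_right_mono) auto
  then show ?thesis using g by (simp add: add_increasing2)
next
  case False
  have "g powr (-1/2) = (g powr (-1/4))\<^sup>2" by (simp add: power2_eq_square flip: powr_add)
  also have "\<dots> \<le> r\<^sup>2" using False by (intro power_mono) auto
  finally have "1 / r\<^sup>2 \<le> 1 / g powr (-1/2)" using r g by (intro frac_le) auto
  also have "\<dots> = sqrt g" using g by (simp add: powr_minus_divide powr_half_sqrt)
  finally have "(1 + ln g) powr \<mu> * (1 / r\<^sup>2) \<le> (1 + ln g) powr \<mu> * sqrt g" by (intro mult_left_mono) auto
  then show ?thesis by (simp add: add_increasing)
qed

text \<open>An eighth of a power pays for the logarithm: ln (1/g) <= 8 g^(-1/8), and 9 = 1 +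
  8.\<close>

lemma small_log_powr:
  fixes g \<mu> :: real
  assumes "0 < g" "g \<le> 1" "0 \<le> \<mu>" "\<mu> \<le> 1"
  shows "g * (1 + \<bar>ln g\<bar>) powr \<mu> \<le> 9 * g powr (7/8)"
proof -
  have i: "1 \<le> 1 / g" using assms frac_le[of 1 1 g 1] by simp
  have abs_ln: "\<bar>ln g\<bar> = ln (1 / g)" using assms ln_le_zero_iff[of g] by (simp add: ln_div)
  have "(1 + \<bar>ln g\<bar>) powr \<mu> \<le> (1 + \<bar>ln g\<bar>) powr 1" using assms by (intro powr_mono) auto
  also have "\<dots> = 1 + \<bar>ln g\<bar>" by simp
  also have "\<dots> \<le> 9 * (1 / g) powr (1/8)"
    unfolding abs_ln using ln_powr_bound[OF i, of "1/8"] ge_one_powr_ge_zero[OF i, of "1/8"] by simp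
  finally have "g * (1 + \<bar>ln g\<bar>) powr \<mu> \<le> g * (9 * (1 / g) powr (1/8))" using assms by (intro mult_left_mono) auto
  also have "(1 / g) powr (1/8) = g powr (-1/8)" using assms by (simp add: powr_divide powr_minus divide_simps)
  also have "g * (9 * g powr (-1/8)) = 9 * (g powr 1 * g powr (-1/8))" using assms by simp
  also have "\<dots> = 9 * g powr (7/8)" unfolding powr_add[symmetric] by simp
  finally show ?thesis .
qed

text \<open>Data of a single time slice. One constant \<open>m\<close> bounds two integrals: that of
  the power 5/4, which is the source of \<open>G0\<close>, and that of the power 3/2, which
  \<open>log_density_split\<close> produces.\<close>

locale density_slice =
  fixes R :: "point \<Rightarrow> real" and t B m \<mu> :: real
  assumes R[measurable]: "Borel R" and R0: "\<And>z. R z \<ge> 0"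
    and supp: "\<And>x. R (x, t) \<noteq> 0 \<Longrightarrow> norm x \<le> B" and B: "B \<ge> 1" and m: "m \<ge> 0"
    and mass: "(\<integral>\<^sub>+y. ennreal (R (y, t) powr (5/4))) \<le> ennreal m" "(\<integral>\<^sub>+y. ennreal (R (y, t) powr (3/2))) \<le> ennreal m"
    and \<mu>: "0 \<le> \<mu>" "\<mu> \<le> 1"
begin

lemma slice_measurable[measurable]: "Borel (\<lambda>y. R (y, t))"
  using measurable_compose[OF _ R, of "\<lambda>y. (y, t)"] by simp

lemma log_kernel_norm: "log_kernel 0 z = 1 / (norm z)\<^sup>2" "log_kernel \<mu> z = (1 + \<bar>ln (norm z)\<bar>) powr \<mu> / (norm z)\<^sup>2"
proof -
  have "1 + \<bar>u\<bar> \<noteq> 0" for u :: real by linarith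
  then show "log_kernel 0 z = 1 / (norm z)\<^sup>2" "log_kernel \<mu> z = (1 + \<bar>ln (norm z)\<bar>) powr \<mu> / (norm z)\<^sup>2" by (simp_all add: log_kernel_def)
qed

text \<open>The constant 36 = 9 * 4 combines those of \<open>log_density_split\<close> and
  \<open>min_inverse_square_le_tail\<close>.\<close>

lemma G_le_Psi: "G \<mu> R (x, t) \<le> 17 * Psi \<mu> R (x, t) + ennreal (36 * m * tail B x)"
proof -
  let ?F = "\<lambda>y. R (y, t) powr (5/4)" and ?P = "\<lambda>y. R (y, t) powr (3/2)"
  have pt: "ennreal (log_kernel 0 (x - y) * (?F y * ln (1 + R (y, t)) powr \<mu>))
    \<le> 17 * ennreal (log_kernel \<mu> (x - y) * ?F y) + ennreal (36 * tail B x) * ennreal (?P y)" for y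
  proof (cases "R (y, t) = 0 \<or> x = y")
    case False
    have "log_kernel 0 (x - y) * (?F y * ln (1 + R (y, t)) powr \<mu>) \<le> 17 * (log_kernel \<mu> (x - y) * ?F y) + 9 * (?P y * min 1 (1 / (norm (x - y))\<^sup>2))"
      using log_density_split[OF R0 _ \<mu>, of "norm (x - y)" "(y, t)"] False by (simp add: log_kernel_norm mult_ac)
    also have "\<dots> \<le> 17 * (log_kernel \<mu> (x - y) * ?F y) + 9 * (?P y * (4 * tail B x))"
      using False supp by (intro add_left_mono mult_left_mono min_inverse_square_le_tail B) auto
    finally have "ennreal (log_kernel 0 (x - y) * (?F y * ln (1 + R (y, t)) powr \<mu>))
      \<le> ennreal (17 * (log_kernel \<mu> (x - y) * ?F y) + 36 * tail B x * ?P y)" by (intro ennreal_leI) (simp add: mult_ac)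
    then show ?thesis using log_kernel_nonneg[of \<mu> "x - y"] tail_nonneg[of B x] by (simp add: ennreal_mult ennreal_plus)
  qed (auto simp: log_kernel_def)
  have "G \<mu> R (x, t) \<le> (\<integral>\<^sub>+y. 17 * ennreal (log_kernel \<mu> (x - y) * ?F y) + ennreal (36 * tail B x) * ennreal (?P y))"
    unfolding G_Borel[OF R] by (rule nn_integral_mono) (rule pt)
  also have "\<dots> = 17 * Psi \<mu> R (x, t) + ennreal (36 * tail B x) * (\<integral>\<^sub>+y. ennreal (?P y))"
    unfolding Psi_Borel[OF R] by (simp add: nn_integral_add nn_integral_cmult)
  also have "\<dots> \<le> 17 * Psi \<mu> R (x, t) + ennreal (36 * tail B x) * ennreal m"
    by (intro add_left_mono mult_left_mono mass) simp
  also have "ennreal (36 * tail B x) * ennreal m = ennreal (36 * m * tail B x)"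
    using m tail_nonneg[of B x] by (simp add: mult_ac flip: ennreal_mult)
  finally show ?thesis .
qed

lemma G0_le_tail:
  assumes x: "norm x > 2 * B" shows "G0 R (x, t) \<le> ennreal (4 * m / (norm x)\<^sup>2)"
proof -
  have pt: "ennreal (log_kernel 0 (x - y) * R (y, t) powr (5/4)) \<le> ennreal (4 / (norm x)\<^sup>2) * ennreal (R (y, t) powr (5/4))" for y
  proof (cases "R (y, t) = 0")
    case False
    then have "log_kernel 0 (x - y) * R (y, t) powr (5/4) \<le> 4 / (norm x)\<^sup>2 * R (y, t) powr (5/4)"
      unfolding log_kernel_norm using supp x by (intro mult_right_mono inverse_square_le_tail(1)[OF B]) auto
    from ennreal_leI[OF this] show ?thesis by (subst ennreal_mult[symmetric]) auto
  qed simp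
  have "G0 R (x, t) \<le> (\<integral>\<^sub>+y. ennreal (4 / (norm x)\<^sup>2) * ennreal (R (y, t) powr (5/4)))"
    unfolding G0_Borel[OF R] by (rule nn_integral_mono) (rule pt)
  also have "\<dots> = ennreal (4 / (norm x)\<^sup>2) * (\<integral>\<^sub>+y. ennreal (R (y, t) powr (5/4)))" by (rule nn_integral_cmult) measurable
  also have "\<dots> \<le> ennreal (4 / (norm x)\<^sup>2) * ennreal m" by (intro mult_left_mono mass) auto
  also have "\<dots> = ennreal (4 * m / (norm x)\<^sup>2)" using m by (simp add: ennreal_mult[symmetric])
  finally show ?thesis .
qed

text \<open>The size of g = \<open>G0\<close> decides. Infinite values force \<open>Psi\<close> to
  be infinite; values up to 1 are covered by the tail majorant; between 1 and M the logarithm is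
  bounded; from M on the logarithm is taken under the integral, split by
  \<open>log_value_split\<close>, and the remainder is absorbed into the left side.\<close>

lemma Sigma_le_Psi:
  "Sigma_pot \<mu> R (x, t) \<le> ennreal (8 + 2 * ln (4 * m\<^sup>2 + 1)) * Psi \<mu> R (x, t) + ennreal (9 * (4 * m + 1) * tail B x)"
proof -
  \<comment> \<open>From g >= M follows 2 m <= sqrt g, which makes the remainder for large g at most
    half of the left side.\<close>
  define M where "M = 4 * m\<^sup>2 + 1"
  \<comment> \<open>The 8 is twice the factor 4 of \<open>log_value_split\<close>, doubled by the
    absorption; the logarithm covers the values between 1 and M.\<close>
  define K where "K = 8 + 2 * ln M"
  have M: "M \<ge> 1" by (simp add: M_def)
  then have K: "K \<ge> 8" by (simp add: K_def)
  have GP: "G0 R (x, t) \<le> Psi \<mu> R (x, t)"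
    unfolding G0_Borel[OF R] Psi_Borel[OF R] log_kernel_norm using \<mu>
    by (intro nn_integral_mono ennreal_leI mult_right_mono divide_right_mono) (auto intro!: ge_one_powr_ge_zero)
  have "Sigma_pot \<mu> R (x, t) \<le> ennreal K * Psi \<mu> R (x, t) \<or> Sigma_pot \<mu> R (x, t) \<le> ennreal (9 * (4 * m + 1) * tail B x)"
  proof (cases "G0 R (x, t)")
    case top
    then have "Psi \<mu> R (x, t) = top" using GP by (simp add: top_unique)
    then show ?thesis using K by (simp add: ennreal_mult_top)
  next
    case (real g)
    consider "g = 0" | "0 < g" "g \<le> 1" | "1 < g" "g < M" | "g \<ge> M" "g > 1" using real by linarith
    then show ?thesis
    proof cases
      case 1
      then show ?thesis using real by (simp add: Sigma_pot_def)
    next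
      case 2
      have "g powr (7/8) \<le> (4 * m + 1) * tail B x"
      proof (cases "norm x \<le> 2 * B")
        case True
        then show ?thesis using 2 powr_mono2[of "7/8" g 1] m by (simp add: tail_def)
      next
        case False
        then have x0: "norm x > 0" using B by linarith
        have "g \<le> 4 * m / (norm x)\<^sup>2" using G0_le_tail[of x] False real m by (simp add: ennreal_le_iff)
        also have "\<dots> \<le> (4 * m + 1) / (norm x)\<^sup>2" by (intro divide_right_mono) auto
        finally have "g powr (7/8) \<le> ((4 * m + 1) / (norm x)\<^sup>2) powr (7/8)" using 2 by (intro powr_mono2) auto
        also have "\<dots> = (4 * m + 1) powr (7/8) / ((norm x)\<^sup>2) powr (7/8)" using m by (simp add: powr_divide)
        also have "((norm x)\<^sup>2) powr (7/8) = norm x powr (7/4)" using x0 by (simp add: powr_powr flip: powr_numeral)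
        also have "(4 * m + 1) powr (7/8) / norm x powr (7/4) = (4 * m + 1) powr (7/8) * tail B x"
          using False by (simp add: tail_def powr_minus divide_simps)
        also have "(4 * m + 1) powr (7/8) \<le> (4 * m + 1) powr 1" using m by (intro powr_mono) auto
        finally show ?thesis using m tail_nonneg[of B x] by (simp add: mult_right_mono)
      qed
      with small_log_powr[OF 2 \<mu>] have "g * (1 + \<bar>ln g\<bar>) powr \<mu> \<le> 9 * (4 * m + 1) * tail B x" unfolding mult.assoc by linarith
      then show ?thesis using 2 real by (simp add: Sigma_pot_def ennreal_leI)
    next
      case 3
      have "(1 + ln g) powr \<mu> \<le> (1 + ln g) powr 1" using 3 \<mu> by (intro powr_mono) auto
      also have "\<dots> \<le> 1 + ln M" using 3 by simp
      also have "\<dots> \<le> K" using M by (simp add: K_def)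
      finally have "g * (1 + \<bar>ln g\<bar>) powr \<mu> \<le> K * g" using 3 by (simp add: mult.commute)
      then have "Sigma_pot \<mu> R (x, t) \<le> ennreal K * G0 R (x, t)"
        using 3 real K by (simp add: Sigma_pot_def ennreal_leI flip: ennreal_mult)
      also have "\<dots> \<le> ennreal K * Psi \<mu> R (x, t)" using GP by (rule mult_left_mono) simp
      finally show ?thesis by blast
    next
      case 4
      define w where "w = (1 + ln g) powr \<mu>"
      have w: "w \<ge> 0" "ln g \<ge> 0" using 4 by (simp_all add: w_def)
      have pt: "w * (log_kernel 0 (x - y) * R (y, t) powr (5/4)) \<le> 4 * (log_kernel \<mu> (x - y) * R (y, t) powr (5/4)) + w * sqrt g * R (y, t) powr (5/4)" for y
      proof (cases "x = y")
        case False
        then have "w / (norm (x - y))\<^sup>2 \<le> 4 * log_kernel \<mu> (x - y) + w * sqrt g"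
          using log_value_split[OF _ \<mu>, of g "norm (x - y)"] 4 by (simp add: w_def log_kernel_norm)
        from mult_right_mono[OF this, of "R (y, t) powr (5/4)"] show ?thesis by (simp add: log_kernel_norm algebra_simps)
      qed (use w 4 in \<open>simp add: log_kernel_def\<close>)
      have "ennreal (g * w) = (\<integral>\<^sub>+y. ennreal w * ennreal (log_kernel 0 (x - y) * R (y, t) powr (5/4)))"
        using w 4 real(2) unfolding G0_Borel[OF R] by (simp add: nn_integral_cmult ennreal_mult mult.commute)
      also have "\<dots> \<le> (\<integral>\<^sub>+y. 4 * ennreal (log_kernel \<mu> (x - y) * R (y, t) powr (5/4)) + ennreal (w * sqrt g) * ennreal (R (y, t) powr (5/4)))"
      proof (rule nn_integral_mono)
        fix y
        show "ennreal w * ennreal (log_kernel 0 (x - y) * R (y, t) powr (5/4))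
          \<le> 4 * ennreal (log_kernel \<mu> (x - y) * R (y, t) powr (5/4)) + ennreal (w * sqrt g) * ennreal (R (y, t) powr (5/4))"
          using ennreal_leI[OF pt[of y]] w 4 log_kernel_nonneg[of _ "x - y"] by (simp add: ennreal_mult ennreal_plus)
      qed
      also have "\<dots> = 4 * Psi \<mu> R (x, t) + ennreal (w * sqrt g) * (\<integral>\<^sub>+y. ennreal (R (y, t) powr (5/4)))"
        unfolding Psi_Borel[OF R] by (simp add: nn_integral_add nn_integral_cmult)
      also have "\<dots> \<le> 4 * Psi \<mu> R (x, t) + ennreal (w * sqrt g) * ennreal m"
        by (intro add_left_mono mult_left_mono mass) simp
      also have "ennreal (w * sqrt g) * ennreal m = ennreal (w * sqrt g * m)" using w 4 m by (intro ennreal_mult[symmetric]) auto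
      also have "\<dots> \<le> ennreal (g * w / 2)"
      proof (rule ennreal_leI)
        have "(2 * m)\<^sup>2 \<le> g" using 4 by (simp add: M_def power_mult_distrib)
        then have "2 * m \<le> sqrt g" using m by (intro real_le_rsqrt) auto
        then have "w * (sqrt g * (2 * m)) \<le> w * (sqrt g * sqrt g)" using 4 w by (intro mult_left_mono) auto
        then show "w * sqrt g * m \<le> g * w / 2" using 4 by (simp add: mult_ac)
      qed
      finally have "ennreal (g * w) \<le> 4 * Psi \<mu> R (x, t) + ennreal (g * w / 2)" by (simp add: add_left_mono)
      from ennreal_absorb_half[OF _ this] w 4 have "ennreal (g * w) \<le> 2 * (4 * Psi \<mu> R (x, t))" by simp
      also have "\<dots> = 8 * Psi \<mu> R (x, t)" by (simp add: mult.assoc[symmetric])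
      also have "\<dots> \<le> ennreal K * Psi \<mu> R (x, t)" using ennreal_leI[OF K] by (intro mult_right_mono) auto
      finally show ?thesis using real 4 w by (simp add: Sigma_pot_def w_def)
    qed
  qed
  then show ?thesis unfolding K_def M_def by (auto intro: add_increasing add_increasing2)
qed

end

text \<open>On the support r^(5/4) <= 1 + r^(3/2), so the volume of the ball is added to the bound
  for the power 3/2.\<close>

lemma density_slice_mass:
  assumes d: "density_bounds B T E Z R" and B: "B \<ge> 1" and E: "E \<ge> 0" and \<mu>: "0 \<le> \<mu>" "\<mu> \<le> 1"
  shows "AE t in lborel. density_slice R t B (measure lborel (cball (0::real^3) B) + E) \<mu>"
  using density_boundsD(4)[OF d]
proof eventually_elim
  case (elim t)
  define V where "V = measure lborel (cball (0::real^3) B)"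
  have V: "emeasure lborel (cball (0::real^3) B) = ennreal V" "V \<ge> 0"
    unfolding V_def using emeasure_lborel_cball_finite[of "0::real^3" B] by (auto simp: emeasure_eq_ennreal_measure)
  have [measurable]: "Borel (\<lambda>y. R (y, t))"
    using measurable_compose[OF _ density_boundsD(1)[OF d], of "\<lambda>y. (y, t)"] by simp
  have [measurable]: "cball (0::real^3) B \<in> sets borel" by simp
  have "(\<integral>\<^sub>+y. ennreal (R (y, t) powr (5/4))) \<le> (\<integral>\<^sub>+y. indicator (cball 0 B) y + ennreal (R (y, t) powr (3/2)))"
  proof (rule nn_integral_mono)
    fix y
    have "R (y, t) powr (5/4) \<le> R (y, t) powr (3/2)" if "R (y, t) > 1" using that by (intro powr_mono) auto
    moreover have "R (y, t) powr (5/4) \<le> 1" if "R (y, t) \<le> 1" using that density_boundsD(2)[OF d] powr_mono2[of "5/4" "R (y, t)" 1] by simp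
    ultimately have "R (y, t) powr (5/4) \<le> indicat_real (cball 0 B) y + R (y, t) powr (3/2)"
      using density_boundsD(3)[OF d, of y t] by (cases "R (y, t) = 0"; cases "R (y, t) \<le> 1") (auto intro: add_increasing add_increasing2)
    then have "ennreal (R (y, t) powr (5/4)) \<le> ennreal (indicat_real (cball 0 B) y + R (y, t) powr (3/2))" by (rule ennreal_leI)
    then show "ennreal (R (y, t) powr (5/4)) \<le> indicator (cball 0 B) y + ennreal (R (y, t) powr (3/2))"
      by (simp add: ennreal_plus ennreal_indicator)
  qed
  also have "\<dots> = ennreal V + (\<integral>\<^sub>+y. ennreal (R (y, t) powr (3/2)))" using V(1) by (subst nn_integral_add) auto
  also have "\<dots> \<le> ennreal (V + E)" using elim V(2) E by (simp add: ennreal_plus add_left_mono)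
  finally show ?case
    using density_boundsD(1,2,3)[OF d] elim order_trans[OF elim ennreal_leI[of E "V + E"]] B E \<mu> V(2)
    by unfold_locales (auto simp: V_def)
qed

text \<open>The mass term is bounded on each slice without decay in time; its square is integrated
  only over [0,T], outside of which \<open>X\<close> vanishes.\<close>

lemma square_bound_by_Psi:
  fixes X :: "point \<Rightarrow> ennreal"
  assumes d: "density_bounds B T E Z R" and B: "B \<ge> 1" and T: "T \<ge> 0" and [measurable]: "Borel X" and KA: "K \<ge> 0" "A \<ge> 0"
    and le: "AE t in lborel. \<forall>x. X (x, t) \<le> ennreal K * Psi \<mu> R (x, t) + ennreal (A * tail B x)"
    and out: "\<And>x t. t \<notin> {0..T} \<Longrightarrow> X (x, t) = 0"
    and c: "(\<integral>\<^sub>+z. (Psi \<mu> R z)\<^sup>2) \<le> ennreal c" "c \<ge> 0"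
  shows "(\<integral>\<^sub>+z. (X z)\<^sup>2) \<le> ennreal (4 * K\<^sup>2 * c + 4 * A\<^sup>2 * T * enn2real (\<integral>\<^sub>+x. ennreal ((tail B x)\<^sup>2)))"
proof -
  define S where "S = enn2real (\<integral>\<^sub>+x. ennreal ((tail B x)\<^sup>2))"
  have S: "(\<integral>\<^sub>+x. ennreal ((tail B x)\<^sup>2)) = ennreal S" "S \<ge> 0" using tail_square_finite[OF B] by (auto simp: S_def)
  note [measurable] = measurable_potentials(1)[OF density_boundsD(1)[OF d], of \<mu>]
  have [measurable]: "(fst :: point \<Rightarrow> _) \<in> borel_measurable borel" "(snd :: point \<Rightarrow> _) \<in> borel_measurable borel"
    by (intro borel_measurable_continuous_onI continuous_intros)+
  let ?h = "\<lambda>z. ennreal (4 * K\<^sup>2) * (Psi \<mu> R z)\<^sup>2 + ennreal (4 * A\<^sup>2) * (ennreal ((tail B (fst z))\<^sup>2) * indicator {0..T} (snd z))"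
  have "(\<integral>\<^sub>+z. (X z)\<^sup>2) = (\<integral>\<^sub>+t x. (X (x, t))\<^sup>2)"
    by (rule nn_integral_time_slices) measurable
  also have "\<dots> \<le> (\<integral>\<^sub>+t x. ?h (x, t))"
  proof (rule nn_integral_mono_AE, use le in eventually_elim, intro nn_integral_mono)
    case (elim t)
    fix x
    show "(X (x, t))\<^sup>2 \<le> ?h (x, t)"
    proof (cases "t \<in> {0..T}")
      case True
      have "(X (x, t))\<^sup>2 \<le> (ennreal K * Psi \<mu> R (x, t) + ennreal (A * tail B x))\<^sup>2" using elim by (intro power_mono) auto
      also have "\<dots> \<le> 4 * (ennreal K * Psi \<mu> R (x, t))\<^sup>2 + 4 * (ennreal (A * tail B x))\<^sup>2" by (rule ennreal_add_square_le)
      also have "\<dots> = ?h (x, t)"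
        using True KA tail_nonneg[of B x] by (simp add: power_mult_distrib ennreal_power ennreal_mult mult.assoc)
      finally show ?thesis .
    qed (simp add: out)
  qed
  also have "\<dots> = (\<integral>\<^sub>+z. ?h z)" by (rule nn_integral_time_slices[symmetric]) measurable
  also have "\<dots> = ennreal (4 * K\<^sup>2) * (\<integral>\<^sub>+z. (Psi \<mu> R z)\<^sup>2)
      + ennreal (4 * A\<^sup>2) * (\<integral>\<^sub>+z. ennreal ((tail B (fst z))\<^sup>2) * indicator {0..T} (snd z))"
    by (simp add: nn_integral_add nn_integral_cmult)
  also have "(\<integral>\<^sub>+z. ennreal ((tail B (fst z))\<^sup>2) * indicator {0..T} (snd z)) = ennreal (T * S)"
    using T S by (subst nn_integral_time_slices) (auto simp: nn_integral_multc nn_integral_cmult mult.commute ennreal_mult)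
  also have "ennreal (4 * K\<^sup>2) * (\<integral>\<^sub>+z. (Psi \<mu> R z)\<^sup>2) + ennreal (4 * A\<^sup>2) * ennreal (T * S)
      \<le> ennreal (4 * K\<^sup>2) * ennreal c + ennreal (4 * A\<^sup>2) * ennreal (T * S)"
    by (intro add_right_mono mult_left_mono c) simp
  also have "\<dots> = ennreal (4 * K\<^sup>2 * c + 4 * A\<^sup>2 * T * S)"
    using c(2) T S(2) by (simp add: ennreal_mult ennreal_plus mult.assoc)
  finally show ?thesis by (simp add: S_def)
qed

theorem potential_square_bounds:
  assumes B: "B \<ge> 1" and \<mu>: "0 \<le> \<mu>" "\<mu> \<le> 2/3" and Z: "Z \<ge> 0" and E: "E \<ge> 0" and T: "T \<ge> 0"
  obtains c where "c > 0" "\<And>R. density_bounds B T E Z R \<Longrightarrow>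
    (\<integral>\<^sub>+z. (Psi \<mu> R z)\<^sup>2) \<le> ennreal c \<and> (\<integral>\<^sub>+z. (G \<mu> R z)\<^sup>2) \<le> ennreal c \<and> (\<integral>\<^sub>+z. (Sigma_pot \<mu> R z)\<^sup>2) \<le> ennreal c"
proof -
  obtain c1 where c1: "c1 > 0" "\<And>T E R. density_bounds B T E Z R \<Longrightarrow> (\<integral>\<^sub>+z. (Psi \<mu> R z)\<^sup>2) \<le> ennreal c1"
    using Psi_square_bound[OF B \<mu> Z] by blast
  have \<mu>1: "\<mu> \<le> 1" using \<mu> by simp
  define m where "m = measure lborel (cball (0::real^3) B) + E"
  have m: "m \<ge> 0" using E by (simp add: m_def)
  define K where "K = 8 + 2 * ln (4 * m\<^sup>2 + 1)"
  have K: "K \<ge> 0" by (simp add: K_def)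
  define S where "S = enn2real (\<integral>\<^sub>+x. ennreal ((tail B x)\<^sup>2))"
  define c2 where "c2 = 4 * 17\<^sup>2 * c1 + 4 * (36 * m)\<^sup>2 * T * S"
  define c3 where "c3 = 4 * K\<^sup>2 * c1 + 4 * (9 * (4 * m + 1))\<^sup>2 * T * S"
  have c: "c2 \<ge> 0" "c3 \<ge> 0" unfolding c2_def c3_def S_def using c1(1) T by auto
  show ?thesis
  proof (rule that[of "c1 + c2 + c3"])
    show "c1 + c2 + c3 > 0" using c1(1) c by simp
    fix R assume d: "density_bounds B T E Z R"
    note R = density_boundsD(1)[OF d]
    have sl: "AE t in lborel. density_slice R t B m \<mu>" unfolding m_def by (rule density_slice_mass[OF d B E \<mu>(1) \<mu>1])
    have z: "G \<mu> R (x, t) = 0" "Sigma_pot \<mu> R (x, t) = 0" if "t \<notin> {0..T}" for x t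
    proof -
      have "R (y, t) = 0" for y using density_boundsD(3)[OF d, of y t] that by blast
      then show "G \<mu> R (x, t) = 0" "Sigma_pot \<mu> R (x, t) = 0" by (simp_all add: G_Borel[OF R] G0_Borel[OF R] Sigma_pot_def)
    qed
    have "(\<integral>\<^sub>+z. (G \<mu> R z)\<^sup>2) \<le> ennreal c2"
      unfolding c2_def S_def
    proof (rule square_bound_by_Psi[OF d B T measurable_potentials(2)[OF R] _ _ _ z(1) c1(2)[OF d]])
      show "AE t in lborel. \<forall>x. G \<mu> R (x, t) \<le> ennreal 17 * Psi \<mu> R (x, t) + ennreal (36 * m * tail B x)"
        using sl by eventually_elim (simp add: density_slice.G_le_Psi)
    qed (use m c1 in auto)
    moreover have "(\<integral>\<^sub>+z. (Sigma_pot \<mu> R z)\<^sup>2) \<le> ennreal c3"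
      unfolding c3_def S_def
    proof (rule square_bound_by_Psi[OF d B T measurable_potentials(4)[OF R] K _ _ z(2) c1(2)[OF d]])
      show "AE t in lborel. \<forall>x. Sigma_pot \<mu> R (x, t) \<le> ennreal K * Psi \<mu> R (x, t) + ennreal (9 * (4 * m + 1) * tail B x)"
        using sl unfolding K_def by eventually_elim (intro allI density_slice.Sigma_le_Psi)
    qed (use m c1 in auto)
    moreover have "ennreal c1 \<le> ennreal (c1 + c2 + c3)" "ennreal c2 \<le> ennreal (c1 + c2 + c3)" "ennreal c3 \<le> ennreal (c1 + c2 + c3)"
      using c1(1) c by (auto intro: ennreal_leI)
    ultimately show "(\<integral>\<^sub>+z. (Psi \<mu> R z)\<^sup>2) \<le> ennreal (c1 + c2 + c3) \<and> (\<integral>\<^sub>+z. (G \<mu> R z)\<^sup>2) \<le> ennreal (c1 + c2 + c3)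
      \<and> (\<integral>\<^sub>+z. (Sigma_pot \<mu> R z)\<^sup>2) \<le> ennreal (c1 + c2 + c3)"
      using c1(2)[OF d] by (meson order_trans)
  qed
qed

section \<open>The interaction identity\<close>

lemma derivative_bound_compact:
  fixes f :: "'a::euclidean_space \<Rightarrow> 'b::euclidean_space"
  assumes d: "\<And>x. (f has_derivative f' x) (at x)" and c: "\<And>v. continuous_on UNIV (\<lambda>x. f' x v)" and S: "compact S"
  obtains C where "C > 0" "\<And>x h. x \<in> S \<Longrightarrow> norm (f' x h) \<le> C * norm h"
proof -
  have "\<exists>B. \<forall>x\<in>S. norm (f' x b) \<le> B" for b
  proof -
    have "bounded ((\<lambda>x. f' x b) ` S)"
      by (intro compact_imp_bounded compact_continuous_image continuous_on_subset[OF c] S) auto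
    then show ?thesis by (auto simp: bounded_iff)
  qed
  then obtain B where B: "\<And>b x. x \<in> S \<Longrightarrow> norm (f' x b) \<le> B b" by metis
  define C where "C = (\<Sum>b\<in>Basis. \<bar>B b\<bar>) + 1"
  show ?thesis
  proof (rule that[of C])
    show "C > 0" unfolding C_def by (intro add_nonneg_pos sum_nonneg) auto
    fix x h assume x: "x \<in> S"
    have lin: "linear (f' x)" using d has_derivative_linear by blast
    have "f' x h = f' x (\<Sum>b\<in>Basis. (h \<bullet> b) *\<^sub>R b)" by (simp add: euclidean_representation)
    also have "\<dots> = (\<Sum>b\<in>Basis. (h \<bullet> b) *\<^sub>R f' x b)"
      using linear_sum[OF lin, of "\<lambda>b. (h \<bullet> b) *\<^sub>R b" Basis] linear_scale[OF lin] by simp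
    also have "norm \<dots> \<le> (\<Sum>b\<in>Basis. norm ((h \<bullet> b) *\<^sub>R f' x b))" by (rule norm_sum)
    also have "\<dots> \<le> (\<Sum>b\<in>Basis. norm h * \<bar>B b\<bar>)"
      unfolding norm_scaleR using B[OF x]
      by (intro sum_mono mult_mono Basis_le_norm) (auto intro: order_trans[OF _ abs_ge_self])
    also have "\<dots> = norm h * (\<Sum>b\<in>Basis. \<bar>B b\<bar>)" by (simp add: sum_distrib_left)
    also have "\<dots> \<le> norm h * C" unfolding C_def by (intro mult_left_mono) auto
    also have "\<dots> = C * norm h" by (rule mult.commute)
    finally show "norm (f' x h) \<le> C * norm h" .
  qed
qed

lemma supp_notin: "z \<notin> supp f \<Longrightarrow> f z = 0"
  unfolding supp_def using closure_subset[of "{x. f x \<noteq> 0}"] by auto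

lemma frechet_derivative_outside_supp:
  fixes f :: "'a::euclidean_space \<Rightarrow> 'b::real_normed_vector"
  assumes "z \<notin> supp f" shows "frechet_derivative f (at z) h = 0"
proof -
  have op: "open (- supp f)" unfolding supp_def by (intro open_Compl closed_closure)
  have "(f has_derivative (\<lambda>h. 0)) (at z)"
  proof (rule has_derivative_transform_within_open[of "\<lambda>_. 0" "\<lambda>h. 0" z UNIV])
    show "((\<lambda>_. 0) has_derivative (\<lambda>h. 0)) (at z)" by (rule has_derivative_const)
    show "open (- supp f)" by (rule op)
    show "z \<in> - supp f" using assms by simp
    show "0 = f y" if "y \<in> - supp f" for y using that supp_notin[of y f] by simp
  qed
  from frechet_derivative_at[OF this] have "frechet_derivative f (at z) = (\<lambda>h. 0)" by (rule sym)
  then show ?thesis by simp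
qed

lemma integrable_pair_product:
  fixes f :: "'a::euclidean_space \<Rightarrow> real" and g :: "'b::euclidean_space \<Rightarrow> real"
  assumes f: "integrable lborel f" and g: "integrable lborel g"
  shows "integrable (lborel \<Otimes>\<^sub>M lborel) (\<lambda>(z, z'). f z * g z')"
proof (rule lborel_pair.Fubini_integrable)
  have [measurable]: "Borel f" "Borel g" using f g by auto
  show "(\<lambda>(z, z'). f z * g z') \<in> borel_measurable (lborel \<Otimes>\<^sub>M lborel)" by measurable
  have "(\<lambda>x. \<integral>\<^sub>1y. norm (case (x, y) of (z, z') \<Rightarrow> f z * g z')) = (\<lambda>x. \<bar>f x\<bar> * (\<integral>\<^sub>1y. \<bar>g y\<bar>))"
    by (simp add: abs_mult)
  then show "integrable lborel (\<lambda>x. \<integral>\<^sub>1y. norm (case (x, y) of (z, z') \<Rightarrow> f z * g z'))"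
    using f by simp
  show "AE x in lborel. integrable lborel (\<lambda>y. case (x, y) of (z, z') \<Rightarrow> f z * g z')" using g by simp
qed

text \<open>The equations for fields on the whole space, with momentum \<open>M\<close>, flux
  \<open>A\<close> and force \<open>H\<close> treated as given functions, so that all integrals are
  over \<open>lborel\<close>.\<close>

definition momentum_identity where
  "momentum_identity S M A H \<longleftrightarrow> (\<forall>\<xi> :: point \<Rightarrow> real^3. test_function S \<xi> \<longrightarrow>
    (\<integral>\<^sub>1z. M z \<bullet> dt \<xi> z) + (\<integral>\<^sub>1z. (A z :: real^3^3) \<bullet> Grad \<xi> z) + (\<integral>\<^sub>1z. (H z :: real^3) \<bullet> \<xi> z) = 0)"

definition continuity_identity where
  "continuity_identity S R M \<longleftrightarrow> (\<forall>\<psi> :: point \<Rightarrow> real. test_function S \<psi> \<longrightarrow>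
    (\<integral>\<^sub>1z. R z * dt \<psi> z + (M z :: real^3) \<bullet> grad \<psi> z) = 0)"

definition dx :: "(point \<Rightarrow> real^3) \<Rightarrow> point \<Rightarrow> 3 \<Rightarrow> real^3" where
  "dx k z j = frechet_derivative k (at z) (axis j 1, 0)"

text \<open>The integrand of the momentum equation tested with \<open>w V\<close>, where \<open>V = k * (w R)\<close>; the time derivative of
  \<open>V\<close> has been removed by testing the continuity equation at the second point.\<close>

definition interaction ::
    "(point \<Rightarrow> real) \<Rightarrow> (point \<Rightarrow> real^3) \<Rightarrow> (point \<Rightarrow> real) \<Rightarrow> (point \<Rightarrow> real^3)
      \<Rightarrow> (point \<Rightarrow> real^3^3) \<Rightarrow> (point \<Rightarrow> real^3) \<Rightarrow> point \<Rightarrow> point \<Rightarrow> real" where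
  "interaction w k R M A H z z' =
     w z' * R z' * (dt w z * (M z \<bullet> k (z - z')))
   + w z * ((M z \<bullet> k (z - z')) * (R z' * dt w z' + M z' \<bullet> grad w z') - w z' * (\<Sum>j\<in>UNIV. M z' $ j * (M z \<bullet> dx k (z - z') j)))
   + w z' * R z' * (k (z - z') \<bullet> (A z *v grad w z))
   + w z * (w z' * R z') * (\<Sum>j\<in>UNIV. dx k (z - z') j \<bullet> column j (A z))
   + w z * (w z' * R z') * (H z \<bullet> k (z - z'))"

lemma Grad_inner:
  fixes \<xi> :: "point \<Rightarrow> real^3"
  shows "A \<bullet> Grad \<xi> z = (\<Sum>j\<in>UNIV. column j A \<bullet> frechet_derivative \<xi> (at z) (axis j 1, 0))"
proof -
  have "A \<bullet> Grad \<xi> z = (\<Sum>i\<in>UNIV. \<Sum>j\<in>UNIV. A $ i $ j * frechet_derivative \<xi> (at z) (axis j 1, 0) $ i)"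
    by (simp add: inner_vec_def Grad_def)
  also have "\<dots> = (\<Sum>j\<in>UNIV. \<Sum>i\<in>UNIV. A $ i $ j * frechet_derivative \<xi> (at z) (axis j 1, 0) $ i)"
    by (rule sum.swap)
  finally show ?thesis by (simp add: inner_vec_def column_def)
qed

lemma matrix_vector_inner: "v \<bullet> (A *v g) = (\<Sum>j\<in>UNIV. g $ j * (v \<bullet> column j (A :: real^3^3)))"
proof -
  have "A *v g = (\<Sum>j\<in>UNIV. g $ j *\<^sub>R column j A)"
    by (simp add: matrix_mult_sum scalar_mult_eq_scaleR)
  then show ?thesis by (simp add: inner_sum_right)
qed

lemma smooth_weight_bound:
  fixes w :: "point \<Rightarrow> real"
  assumes w: "smooth w" "compact (supp w)"
  obtains C where "C > 0" "\<And>z. \<bar>w z\<bar> \<le> C" "\<And>z. \<bar>dt w z\<bar> \<le> C" "\<And>z. norm (grad w z) \<le> C"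
proof -
  have c: "continuous_on UNIV (\<lambda>x. frechet_derivative w (at x) v)" for v
    by (intro smooth_continuous smooth_derivative w)
  obtain C where C: "C > 0" "\<And>x h. x \<in> supp w \<Longrightarrow> norm (frechet_derivative w (at x) h) \<le> C * norm h"
    using derivative_bound_compact[OF smooth_derivative(1)[OF w(1)] c w(2)] by blast
  have C': "norm (frechet_derivative w (at x) h) \<le> C * norm h" for x h
    using C(2)[of x h] frechet_derivative_outside_supp[of x w h] C(1) by (cases "x \<in> supp w") auto
  have "bounded (w ` supp w)" by (intro compact_imp_bounded compact_continuous_image smooth_continuous w)
  then obtain B where B: "\<And>z. z \<in> supp w \<Longrightarrow> \<bar>w z\<bar> \<le> B" by (auto simp: bounded_iff)
  show ?thesis
  proof (rule that[of "\<bar>B\<bar> + 3 * C"])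
    show "\<bar>B\<bar> + 3 * C > 0" using C by simp
    show "\<bar>w z\<bar> \<le> \<bar>B\<bar> + 3 * C" for z
      using B[of z] supp_notin[of z w] C(1) by (cases "z \<in> supp w") auto
    show "\<bar>dt w z\<bar> \<le> \<bar>B\<bar> + 3 * C" for z
      using C'[of z "(0, 1)"] C(1) by (simp add: dt_def norm_Pair)
    show "norm (grad w z) \<le> \<bar>B\<bar> + 3 * C" for z
    proof -
      have "norm (grad w z) \<le> (\<Sum>j\<in>UNIV. \<bar>grad w z $ j\<bar>)" by (rule norm_le_l1_cart)
      also have "\<dots> \<le> (\<Sum>j\<in>(UNIV :: 3 set). C)"
      proof (intro sum_mono)
        fix j :: 3
        show "\<bar>grad w z $ j\<bar> \<le> C" using C'[of z "(axis j 1, 0)"] by (simp add: grad_def norm_Pair norm_axis_1)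
      qed
      also have "\<dots> = 3 * C" by simp
      finally show ?thesis by simp
    qed
  qed
qed

text \<open>The linear part of the setting: integrable fields supported in the cylinder and linked
  by the two identities. The dependence of momentum and flux on density and velocity is added in
  \<open>flow\<close>.\<close>

locale weak_form =
  fixes \<Omega> :: "(real^3) set" and T :: real and w R :: "point \<Rightarrow> real" and M H :: "point \<Rightarrow> real^3"
    and A :: "point \<Rightarrow> real^3^3"
  assumes bounded: "bounded \<Omega>"
    and w: "smooth w" "compact (supp w)" "supp w \<subseteq> Q \<Omega> T"
    and int: "integrable lborel R" "integrable lborel M" "integrable lborel A" "integrable lborel H"
    and zero: "\<And>z. z \<notin> Q \<Omega> T \<Longrightarrow> R z = 0" "\<And>z. z \<notin> Q \<Omega> T \<Longrightarrow> M z = 0" "\<And>z. z \<notin> Q \<Omega> T \<Longrightarrow> A z = 0" "\<And>z. z \<notin> Q \<Omega> T \<Longrightarrow> H z = 0"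
    and momentum: "momentum_identity (Q \<Omega> T) M A H"
    and continuity: "continuity_identity (Q \<Omega> T) R M"
begin

lemma bounded_Q: "bounded (Q \<Omega> T)"
proof -
  have "bounded (\<Omega> \<times> {0..T})" using bounded by (intro bounded_Times) auto
  then show ?thesis unfolding Q_def by (rule bounded_subset) auto
qed

lemma measurable_data[measurable]:
  "Borel R" "Borel M" "Borel A" "Borel H"
  "Borel w"
  using int by (auto intro: borel_measurable_continuous_onI smooth_continuous[OF w(1)])

lemma weight_bound:
  obtains C where "C > 0" "\<And>z. \<bar>w z\<bar> \<le> C" "\<And>z. \<bar>dt w z\<bar> \<le> C" "\<And>z. norm (grad w z) \<le> C"
  using smooth_weight_bound[OF w(1,2)] by metis

lemma measurable_weight_derivatives[measurable]:
  "Borel (dt w)" "Borel (grad w)"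
proof -
  have c: "continuous_on UNIV (\<lambda>x. frechet_derivative w (at x) v)" for v
    by (intro smooth_continuous smooth_derivative w)
  show "Borel (dt w)" "Borel (grad w)"
    unfolding dt_def[abs_def] grad_def[abs_def]
    by (intro borel_measurable_continuous_onI c continuous_on_vec_lambda)+
qed

lemma test_function_weight:
  fixes V :: "point \<Rightarrow> 'b::real_normed_vector"
  assumes "smooth V" shows "test_function (Q \<Omega> T) (\<lambda>z. w z *\<^sub>R V z)"
proof -
  have "{z. w z *\<^sub>R V z \<noteq> 0} \<subseteq> {z. w z \<noteq> 0}" by auto
  then have s: "supp (\<lambda>z. w z *\<^sub>R V z) \<subseteq> supp w" unfolding supp_def by (rule closure_mono)
  have "compact (supp (\<lambda>z. w z *\<^sub>R V z))"
    using compact_Int_closed[OF w(2), of "supp (\<lambda>z. w z *\<^sub>R V z)"] s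
    by (simp add: supp_def Int_absorb1)
  then show ?thesis unfolding test_function_def
    using s w(3) smooth_scaleR[OF w(1) assms] unfolding smooth_def by auto
qed

definition b where "b z = w z * R z"

lemma b_integrable: "integrable lborel b"
proof -
  obtain C where C: "\<And>z. \<bar>w z\<bar> \<le> C" using weight_bound by metis
  show ?thesis unfolding b_def[abs_def]
    by (rule Bochner_Integration.integrable_bound[of _ "\<lambda>z. C * R z"])
      (use int C in \<open>auto simp: abs_mult intro!: mult_right_mono order_trans[OF C abs_ge_self]\<close>)
qed

lemma b_zero: "z \<notin> Q \<Omega> T \<Longrightarrow> b z = 0"
  by (simp add: b_def zero)

lemma integrable_times_continuous:
  fixes g :: "point \<Rightarrow> real" and \<phi> :: "point \<Rightarrow> 'b::euclidean_space"
  assumes "integrable lborel g" "\<And>z. z \<notin> Q \<Omega> T \<Longrightarrow> g z = 0" "continuous_on UNIV \<phi>"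
  shows "integrable lborel (\<lambda>z. g z *\<^sub>R \<phi> z)"
  by (rule integrable_scaleR_continuous[OF assms(1) bounded_Q assms(2) assms(3)])

lemma integrable_inner_continuous:
  fixes g \<phi> :: "point \<Rightarrow> 'b::euclidean_space"
  assumes g: "integrable lborel g" "\<And>z. z \<notin> Q \<Omega> T \<Longrightarrow> g z = 0" and c: "continuous_on UNIV \<phi>"
  shows "integrable lborel (\<lambda>z. g z \<bullet> \<phi> z)"
proof -
  have "integrable lborel (\<lambda>z. \<Sum>i\<in>Basis. (g z \<bullet> i) *\<^sub>R (\<phi> z \<bullet> i))"
  proof (rule Bochner_Integration.integrable_sum, rule integrable_times_continuous)
    show "integrable lborel (\<lambda>z. g z \<bullet> i)" for i using g(1) by (intro integrable_inner_left)
    show "g z \<bullet> i = 0" if "z \<notin> Q \<Omega> T" for i z using g(2)[OF that] by simp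
    show "continuous_on UNIV (\<lambda>z. \<phi> z \<bullet> i)" for i by (intro continuous_on_inner c continuous_on_const)
  qed
  moreover have "(\<lambda>z. g z \<bullet> \<phi> z) = (\<lambda>z. \<Sum>i\<in>Basis. (g z \<bullet> i) *\<^sub>R (\<phi> z \<bullet> i))"
    by (rule ext, subst euclidean_inner) simp
  ultimately show ?thesis by simp
qed

text \<open>The inner integral over the second point. Apart from the time derivative of V,
  everything comes from the product rule for w V. That derivative falls on the time argument of k(z
  - z'), and the continuity equation in the second point trades it for spatial derivatives and
  derivatives of the weight.\<close>

lemma interaction_slice:
  assumes k: "smooth k"
  defines "V \<equiv> conv k b"
  shows "has_bochner_integral lborel (interaction w k R M A H z)
    (M z \<bullet> dt (\<lambda>z. w z *\<^sub>R V z) z + A z \<bullet> Grad (\<lambda>z. w z *\<^sub>R V z) z + H z \<bullet> (w z *\<^sub>R V z))"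
proof -
  define k' where "k' = (\<lambda>x. frechet_derivative k (at x))"
  define w' where "w' = (\<lambda>x. frechet_derivative w (at x))"
  have dk: "(k has_derivative k' x) (at x)" for x unfolding k'_def by (rule smooth_derivative(1)[OF k])
  have dw: "(w has_derivative w' x) (at x)" for x unfolding w'_def by (rule smooth_derivative(1)[OF w(1)])
  have ck: "continuous_on UNIV k" and ck': "continuous_on UNIV (\<lambda>x. k' x v)" for v
    unfolding k'_def by (intro smooth_continuous smooth_derivative k)+
  have cw': "continuous_on UNIV (\<lambda>x. w' x v)" for v
    unfolding w'_def by (intro smooth_continuous smooth_derivative w)
  have linw: "linear (w' x)" "linear (k' x)" for x using dw dk has_derivative_linear by blast+
  define V' where "V' = (\<lambda>h z. conv (\<lambda>x. k' x h) b z)"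
  have dV: "(V has_derivative (\<lambda>h. V' h z)) (at z)" for z
    unfolding V_def V'_def k'_def by (rule smooth_conv_has_derivative[OF b_integrable bounded_Q b_zero k])
  have hV: "has_bochner_integral lborel (\<lambda>z'. b z' *\<^sub>R k (z - z')) (V z)"
    unfolding V_def conv_def
    by (intro has_bochner_integral_integrable integrable_times_continuous b_integrable b_zero continuous_on_reflect ck)
  have hV': "has_bochner_integral lborel (\<lambda>z'. b z' *\<^sub>R k' (z - z') h) (V' h z)" for h
    unfolding V'_def conv_def
    by (intro has_bochner_integral_integrable integrable_times_continuous b_integrable b_zero continuous_on_reflect[OF ck'])
  have bl1: "bounded_linear (\<lambda>v. c * (a \<bullet> v))" for c :: real and a :: "real^3"
    by (intro bounded_linear_const_mult bounded_linear_inner_right)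
  have d\<xi>: "frechet_derivative (\<lambda>z. w z *\<^sub>R V z) (at z) = (\<lambda>h. w z *\<^sub>R V' h z + w' z h *\<^sub>R V z)"
    by (rule frechet_derivative_at[symmetric]) (intro has_derivative_scaleR dw dV)
  have wdt: "dt w x = w' x (0, 1)" for x by (simp add: dt_def w'_def)
  have wgrad: "grad w x $ j = w' x (axis j 1, 0)" for x j by (simp add: grad_def w'_def)
  have dxk: "dx k x j = k' x (axis j 1, 0)" for x j by (simp add: dx_def k'_def)
  define a where "a = M z"
  \<comment> \<open>Test function for the continuity equation in the second point, with z fixed and
    the momentum at z a constant vector.\<close>
  define \<psi> where "\<psi> = (\<lambda>y. w y *\<^sub>R (a \<bullet> k (z - y)))"
  have s\<psi>: "smooth (\<lambda>y. a \<bullet> k (z - y))"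
    using smooth_affine_comp[OF bounded_linear_minus[OF bounded_linear_ident] k, of z]
    by (intro smooth_inner smooth_const) simp
  have d\<psi>: "frechet_derivative \<psi> (at y) = (\<lambda>h. w y * - (a \<bullet> k' (z - y) h) + w' y h * (a \<bullet> k (z - y)))" for y
  proof (rule frechet_derivative_at[symmetric])
    have "((\<lambda>y. k (z - y)) has_derivative (\<lambda>h. k' (z - y) (- h))) (at y)"
      by (rule has_derivative_compose[OF _ dk]) (auto intro!: derivative_eq_intros)
    then have "((\<lambda>y. a \<bullet> k (z - y)) has_derivative (\<lambda>h. a \<bullet> k' (z - y) (- h))) (at y)"
      by (rule has_derivative_inner_right)
    from has_derivative_scaleR[OF dw[of y] this]
    show "(\<psi> has_derivative (\<lambda>h. w y * - (a \<bullet> k' (z - y) h) + w' y h * (a \<bullet> k (z - y)))) (at y)"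
      unfolding \<psi>_def by (simp add: linear_neg[OF linw(2)])
  qed
  have c\<psi>: "(\<integral>\<^sub>1y. R y * dt \<psi> y + M y \<bullet> grad \<psi> y) = 0"
    using continuity test_function_weight[OF s\<psi>] unfolding continuity_identity_def \<psi>_def by blast
  have cd\<psi>: "continuous_on UNIV (\<lambda>x. frechet_derivative \<psi> (at x) v)" for v
    using test_function_weight[OF s\<psi>] unfolding test_function_def \<psi>_def
    by (intro smooth_continuous smooth_derivative) (simp add: smooth_def)
  have "integrable lborel (\<lambda>y. R y * dt \<psi> y + M y \<bullet> grad \<psi> y)"
    using integrable_times_continuous[OF int(1) zero(1), of "dt \<psi>"] integrable_inner_continuous[OF int(2) zero(2), of "grad \<psi>"]
    by (simp add: dt_def[abs_def] grad_def[abs_def] cd\<psi> continuous_on_vec_lambda)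
  then have hc: "has_bochner_integral lborel (\<lambda>y. R y * dt \<psi> y + M y \<bullet> grad \<psi> y) 0"
    using has_bochner_integral_integrable[of lborel "\<lambda>y. R y * dt \<psi> y + M y \<bullet> grad \<psi> y"] c\<psi> by simp
  \<comment> \<open>Differentiating k(z - y) in y reverses the sign, so the integrand is the tested
    continuity equation, which integrates to 0 by \<open>hc\<close>, plus the term that integrates
    to the time derivative of V.\<close>
  have conteq: "(a \<bullet> k (z - y)) * (R y * dt w y + M y \<bullet> grad w y) - w y * (\<Sum>j\<in>UNIV. M y $ j * (a \<bullet> dx k (z - y) j))
     = (R y * dt \<psi> y + M y \<bullet> grad \<psi> y) + (a \<bullet> (b y *\<^sub>R k' (z - y) (0, 1)))" for y
  proof -
    have g: "grad \<psi> y $ j = (a \<bullet> k (z - y)) * grad w y $ j - w y * (a \<bullet> dx k (z - y) j)" for j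
    proof -
      have "grad \<psi> y $ j = frechet_derivative \<psi> (at y) (axis j 1, 0)" by (simp add: grad_def)
      then show ?thesis by (simp add: d\<psi> wgrad dxk)
    qed
    have e1: "M y \<bullet> grad \<psi> y = (\<Sum>j\<in>UNIV. M y $ j * grad \<psi> y $ j)" "M y \<bullet> grad w y = (\<Sum>j\<in>UNIV. M y $ j * grad w y $ j)"
      by (simp_all add: inner_vec_def)
    have "M y \<bullet> grad \<psi> y = (a \<bullet> k (z - y)) * (M y \<bullet> grad w y) - w y * (\<Sum>j\<in>UNIV. M y $ j * (a \<bullet> dx k (z - y) j))"
      unfolding e1 g by (simp add: right_diff_distrib sum_subtractf sum_distrib_left mult_ac)
    moreover have "R y * dt \<psi> y = (a \<bullet> k (z - y)) * (R y * dt w y) - a \<bullet> (b y *\<^sub>R k' (z - y) (0, 1))"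
      unfolding wdt by (simp add: dt_def d\<psi> b_def algebra_simps)
    ultimately show ?thesis by (simp add: algebra_simps)
  qed
  have h23: "has_bochner_integral lborel (\<lambda>y. w z * ((M z \<bullet> k (z - y)) * (R y * dt w y + M y \<bullet> grad w y) - w y * (\<Sum>j\<in>UNIV. M y $ j * (M z \<bullet> dx k (z - y) j))))
      (w z * (0 + M z \<bullet> V' (0, 1) z))"
    unfolding a_def[symmetric] conteq
    by (intro has_bochner_integral_mult_right has_bochner_integral_add hc
        has_bochner_integral_bounded_linear[OF bounded_linear_inner_right hV'])
  have h1: "has_bochner_integral lborel (\<lambda>y. w y * R y * (dt w z * (M z \<bullet> k (z - y)))) (dt w z * (M z \<bullet> V z))"
    using has_bochner_integral_bounded_linear[OF bl1[of "dt w z" "M z"] hV] by (simp add: b_def mult_ac)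
  have h4: "has_bochner_integral lborel (\<lambda>y. w y * R y * (k (z - y) \<bullet> (A z *v grad w z))) (V z \<bullet> (A z *v grad w z))"
    using has_bochner_integral_bounded_linear[OF bounded_linear_inner_left[of "A z *v grad w z"] hV] by (simp add: b_def)
  have h5: "has_bochner_integral lborel (\<lambda>y. w z * (w y * R y) * (\<Sum>j\<in>UNIV. dx k (z - y) j \<bullet> column j (A z))) (w z * (\<Sum>j\<in>UNIV. V' (axis j 1, 0) z \<bullet> column j (A z)))"
  proof -
    have "has_bochner_integral lborel (\<lambda>y. w z * (\<Sum>j\<in>UNIV. (b y *\<^sub>R k' (z - y) (axis j 1, 0)) \<bullet> column j (A z))) (w z * (\<Sum>j\<in>UNIV. V' (axis j 1, 0) z \<bullet> column j (A z)))"
      by (intro has_bochner_integral_mult_right has_bochner_integral_sum has_bochner_integral_bounded_linear[OF bounded_linear_inner_left hV'])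
    then show ?thesis by (simp add: dxk b_def sum_distrib_left mult_ac)
  qed
  have h6: "has_bochner_integral lborel (\<lambda>y. w z * (w y * R y) * (H z \<bullet> k (z - y))) (w z * (H z \<bullet> V z))"
    using has_bochner_integral_bounded_linear[OF bl1[of "w z" "H z"] hV] by (simp add: b_def mult_ac)
  have "has_bochner_integral lborel (interaction w k R M A H z)
    (dt w z * (M z \<bullet> V z) + w z * (0 + M z \<bullet> V' (0, 1) z) + V z \<bullet> (A z *v grad w z) + w z * (\<Sum>j\<in>UNIV. V' (axis j 1, 0) z \<bullet> column j (A z)) + w z * (H z \<bullet> V z))"
    unfolding interaction_def by (intro has_bochner_integral_add h1 h23 h4 h5 h6)
  also have "dt w z * (M z \<bullet> V z) + w z * (0 + M z \<bullet> V' (0, 1) z) + V z \<bullet> (A z *v grad w z) + w z * (\<Sum>j\<in>UNIV. V' (axis j 1, 0) z \<bullet> column j (A z)) + w z * (H z \<bullet> V z)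
    = M z \<bullet> dt (\<lambda>z. w z *\<^sub>R V z) z + A z \<bullet> Grad (\<lambda>z. w z *\<^sub>R V z) z + H z \<bullet> (w z *\<^sub>R V z)"
  proof -
    have "A z \<bullet> Grad (\<lambda>z. w z *\<^sub>R V z) z = V z \<bullet> (A z *v grad w z) + w z * (\<Sum>j\<in>UNIV. V' (axis j 1, 0) z \<bullet> column j (A z))"
      unfolding Grad_inner d\<xi> matrix_vector_inner
      by (simp add: wgrad inner_add_right sum.distrib sum_distrib_left inner_commute)
    moreover have "M z \<bullet> dt (\<lambda>z. w z *\<^sub>R V z) z = dt w z * (M z \<bullet> V z) + w z * (M z \<bullet> V' (0, 1) z)"
      unfolding dt_def d\<xi> by (simp add: w'_def inner_add_right)
    ultimately show ?thesis by simp
  qed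
  finally show ?thesis .
qed

text \<open>The kernel and its derivatives are evaluated only at differences of points of the
  bounded cylinder. The product form of the bound gives integrability over pairs of points, as
  Fubini's theorem requires.\<close>

lemma interaction_bound:
  assumes k: "smooth k"
  obtains C where "C > 0" "\<And>z z'. \<bar>interaction w k R M A H z z'\<bar> \<le> C * ((norm (M z) + norm (A z) + norm (H z)) * (\<bar>R z'\<bar> + norm (M z')))"
proof -
  obtain c where c: "c > 0" "\<And>z. \<bar>w z\<bar> \<le> c" "\<And>z. \<bar>dt w z\<bar> \<le> c" "\<And>z. norm (grad w z) \<le> c"
    using weight_bound by metis
  define S where "S = {x - y |x y. x \<in> closure (Q \<Omega> T) \<and> y \<in> closure (Q \<Omega> T)}"
  have S: "compact S" unfolding S_def using bounded_Q by (intro compact_differences) auto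
  have ck: "continuous_on UNIV k" and ck': "continuous_on UNIV (\<lambda>x. frechet_derivative k (at x) v)" for v
    by (intro smooth_continuous smooth_derivative k)+
  obtain c1 where c1: "c1 > 0" "\<And>x h. x \<in> S \<Longrightarrow> norm (frechet_derivative k (at x) h) \<le> c1 * norm h"
    using derivative_bound_compact[OF smooth_derivative(1)[OF k] ck' S] by blast
  have "bounded (k ` S)" by (intro compact_imp_bounded compact_continuous_image smooth_continuous k S)
  then obtain c2 where c2: "\<And>z. z \<in> S \<Longrightarrow> norm (k z) \<le> c2" by (auto simp: bounded_iff)
  define d where "d = c1 + \<bar>c2\<bar>"
  have d: "d > 0" using c1 by (simp add: d_def)
  have dk: "norm (k x) \<le> d" "norm (dx k x j) \<le> d" if "x \<in> S" for x j
    using c2[OF that] c1(1) c1(2)[OF that, of "(axis j 1, 0)"] by (auto simp: d_def dx_def norm_Pair norm_axis_1)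
  \<comment> \<open>The terms below add up to 13 c^2 d (m r); 20 leaves room.\<close>
  define C where "C = (c + c * c) * d * 20"
  show ?thesis
  proof (rule that[of C])
    show "C > 0" unfolding C_def using c(1) d by (intro mult_pos_pos add_pos_pos) auto
    fix z z'
    show "\<bar>interaction w k R M A H z z'\<bar> \<le> C * ((norm (M z) + norm (A z) + norm (H z)) * (\<bar>R z'\<bar> + norm (M z')))"
    proof (cases "z \<in> Q \<Omega> T \<and> z' \<in> Q \<Omega> T")
      case False
      then have "interaction w k R M A H z z' = 0"
        by (auto simp: interaction_def zero column_def zero_vec_def[symmetric])
      then show ?thesis using \<open>C > 0\<close> by simp
    next
      case True
      then have x: "z - z' \<in> S" unfolding S_def using closure_subset[of "Q \<Omega> T"] by blast
      define m where "m = norm (M z) + norm (A z) + norm (H z)"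
      define r where "r = \<bar>R z'\<bar> + norm (M z')"
      have m: "norm (M z) \<le> m" "norm (A z) \<le> m" "norm (H z) \<le> m" "0 \<le> m" by (auto simp: m_def)
      have r: "\<bar>R z'\<bar> \<le> r" "norm (M z') \<le> r" "0 \<le> r" by (auto simp: r_def)
      note K = dk[OF x]
      have Mk: "\<bar>M z \<bullet> k (z - z')\<bar> \<le> m * d"
        by (rule order_trans[OF Cauchy_Schwarz_ineq2]) (intro mult_mono m K norm_ge_zero)
      have Hk: "\<bar>H z \<bullet> k (z - z')\<bar> \<le> m * d"
        by (rule order_trans[OF Cauchy_Schwarz_ineq2]) (intro mult_mono m K norm_ge_zero)
      have Mdk: "\<bar>M z \<bullet> dx k (z - z') j\<bar> \<le> m * d" for j
        by (rule order_trans[OF Cauchy_Schwarz_ineq2]) (intro mult_mono m K norm_ge_zero)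
      have wR: "\<bar>w z' * R z'\<bar> \<le> c * r" unfolding abs_mult by (intro mult_mono c r) (use c in auto)
      have colA: "norm (column j (A z)) \<le> norm (A z)" for j
      proof -
        have "norm (column j (A z)) = L2_set (\<lambda>i. norm (A z $ i $ j)) UNIV"
          by (simp add: norm_vec_def column_def)
        also have "\<dots> \<le> L2_set (\<lambda>i. norm (A z $ i)) UNIV"
          by (rule L2_set_mono) (auto simp: component_le_norm_cart)
        finally show ?thesis by (simp add: norm_vec_def)
      qed
      have t1: "\<bar>w z' * R z' * (dt w z * (M z \<bullet> k (z - z')))\<bar> \<le> (c * r) * (c * (m * d))"
        unfolding abs_mult[of "w z' * R z'"] abs_mult[of "dt w z"] using c(1) d m r
        by (intro mult_mono wR c Mk) auto
      have t2: "\<bar>(M z \<bullet> k (z - z')) * (R z' * dt w z' + M z' \<bullet> grad w z')\<bar> \<le> (m * d) * (r * c + r * c)"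
        unfolding abs_mult[of "M z \<bullet> k (z - z')"]
      proof (intro mult_mono Mk)
        have "\<bar>R z' * dt w z'\<bar> \<le> r * c" unfolding abs_mult by (intro mult_mono c r) (use r in auto)
        moreover have "\<bar>M z' \<bullet> grad w z'\<bar> \<le> r * c"
          by (rule order_trans[OF Cauchy_Schwarz_ineq2]) (intro mult_mono r c norm_ge_zero)
        ultimately show "\<bar>R z' * dt w z' + M z' \<bullet> grad w z'\<bar> \<le> r * c + r * c" by linarith
      qed (use m d in auto)
      have t3: "\<bar>\<Sum>j\<in>UNIV. M z' $ j * (M z \<bullet> dx k (z - z') j)\<bar> \<le> 3 * (r * (m * d))"
      proof -
        have "\<bar>\<Sum>j\<in>UNIV. M z' $ j * (M z \<bullet> dx k (z - z') j)\<bar> \<le> (\<Sum>j\<in>(UNIV::3 set). \<bar>M z' $ j * (M z \<bullet> dx k (z - z') j)\<bar>)"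
          by (rule sum_abs)
        also have "\<dots> \<le> (\<Sum>j\<in>(UNIV::3 set). r * (m * d))"
          unfolding abs_mult by (intro sum_mono mult_mono Mdk r order_trans[OF component_le_norm_cart r(2)]) auto
        finally show ?thesis by simp
      qed
      have t3': "\<bar>w z' * (\<Sum>j\<in>UNIV. M z' $ j * (M z \<bullet> dx k (z - z') j))\<bar> \<le> c * (3 * (r * (m * d)))"
        unfolding abs_mult[of "w z'"] using c(1) by (intro mult_mono c t3) auto
      have t23: "\<bar>w z * ((M z \<bullet> k (z - z')) * (R z' * dt w z' + M z' \<bullet> grad w z') - w z' * (\<Sum>j\<in>UNIV. M z' $ j * (M z \<bullet> dx k (z - z') j)))\<bar>
         \<le> c * ((m * d) * (r * c + r * c) + c * (3 * (r * (m * d))))"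
        unfolding abs_mult[of "w z"]
      proof (intro mult_mono c(2))
        show "\<bar>(M z \<bullet> k (z - z')) * (R z' * dt w z' + M z' \<bullet> grad w z') - w z' * (\<Sum>j\<in>UNIV. M z' $ j * (M z \<bullet> dx k (z - z') j))\<bar>
            \<le> (m * d) * (r * c + r * c) + c * (3 * (r * (m * d)))"
          using t2 t3' by linarith
      qed (use c(1) in auto)
      have t4: "\<bar>w z' * R z' * (k (z - z') \<bullet> (A z *v grad w z))\<bar> \<le> (c * r) * (3 * (c * (d * m)))"
        unfolding abs_mult[of "w z' * R z'"]
      proof (intro mult_mono wR)
        have "\<bar>k (z - z') \<bullet> (A z *v grad w z)\<bar> \<le> (\<Sum>j\<in>(UNIV::3 set). \<bar>grad w z $ j * (k (z - z') \<bullet> column j (A z))\<bar>)"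
          unfolding matrix_vector_inner by (rule sum_abs)
        also have "\<dots> \<le> (\<Sum>j\<in>(UNIV::3 set). c * (d * m))"
          unfolding abs_mult
        proof (intro sum_mono mult_mono)
          show "\<bar>grad w z $ j\<bar> \<le> c" for j using component_le_norm_cart[of "grad w z" j] c(4)[of z] by simp
          show "\<bar>k (z - z') \<bullet> column j (A z)\<bar> \<le> d * m" for j
            by (rule order_trans[OF Cauchy_Schwarz_ineq2]) (intro mult_mono K order_trans[OF colA m(2)] norm_ge_zero, use d in simp)
        qed (use c in auto)
        finally show "\<bar>k (z - z') \<bullet> (A z *v grad w z)\<bar> \<le> 3 * (c * (d * m))" by simp
      qed (use c r in auto)
      have t5: "\<bar>w z * (w z' * R z') * (\<Sum>j\<in>UNIV. dx k (z - z') j \<bullet> column j (A z))\<bar> \<le> c * (c * r) * (3 * (d * m))"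
        unfolding abs_mult[of "w z * (w z' * R z')"] abs_mult[of "w z"]
      proof (intro mult_mono wR c)
        have "\<bar>\<Sum>j\<in>UNIV. dx k (z - z') j \<bullet> column j (A z)\<bar> \<le> (\<Sum>j\<in>(UNIV::3 set). \<bar>dx k (z - z') j \<bullet> column j (A z)\<bar>)"
          by (rule sum_abs)
        also have "\<dots> \<le> (\<Sum>j\<in>(UNIV::3 set). d * m)"
          by (intro sum_mono order_trans[OF Cauchy_Schwarz_ineq2] mult_mono K order_trans[OF colA m(2)] norm_ge_zero) (use d in simp)
        finally show "\<bar>\<Sum>j\<in>UNIV. dx k (z - z') j \<bullet> column j (A z)\<bar> \<le> 3 * (d * m)" by simp
      qed (use c r in auto)
      have t6: "\<bar>w z * (w z' * R z') * (H z \<bullet> k (z - z'))\<bar> \<le> c * (c * r) * (m * d)"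
        unfolding abs_mult[of "w z * (w z' * R z')"] abs_mult[of "w z"]
        by (intro mult_mono wR c Hk) (use c r in auto)
      have "\<bar>interaction w k R M A H z z'\<bar> \<le> (c * r) * (c * (m * d)) + c * ((m * d) * (r * c + r * c) + c * (3 * (r * (m * d))))
         + (c * r) * (3 * (c * (d * m))) + c * (c * r) * (3 * (d * m)) + c * (c * r) * (m * d)"
        unfolding interaction_def using t1 t23 t4 t5 t6 by linarith
      also have "\<dots> = 13 * (c * c * d) * (m * r)" by (simp add: algebra_simps)
      also have "\<dots> \<le> C * (m * r)"
        unfolding C_def using c(1) d m r by (intro mult_right_mono) (auto simp: algebra_simps)
      finally show ?thesis by (simp add: m_def r_def)
    qed
  qed
qed

lemma measurable_interaction[measurable]:
  assumes k: "smooth k"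
  shows "(\<lambda>(z, z'). interaction w k R M A H z z') \<in> borel_measurable (lborel \<Otimes>\<^sub>M lborel)"
proof -
  have [measurable]: "Borel k"
    by (intro borel_measurable_continuous_onI smooth_continuous k)
  have d: "Borel (\<lambda>x. dx k x j)" for j
    unfolding dx_def by (intro borel_measurable_continuous_onI smooth_continuous smooth_derivative k)
  have [measurable]: "(\<lambda>x. dx k (fst x - snd x) j) \<in> borel_measurable (lborel \<Otimes>\<^sub>M lborel)" for j
    by (rule measurable_compose[OF _ d]) measurable
  have [measurable]: "(\<lambda>x. M (snd x) $ j) \<in> borel_measurable (lborel \<Otimes>\<^sub>M lborel)"
    "(\<lambda>x. grad w (fst x) $ j) \<in> borel_measurable (lborel \<Otimes>\<^sub>M lborel)" for j
    unfolding cart_eq_inner_axis by measurable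
  have [measurable]: "(\<lambda>x. column j (A (fst x))) \<in> borel_measurable (lborel \<Otimes>\<^sub>M lborel)" for j
  proof -
    have "continuous_on UNIV (column j :: real^3^3 \<Rightarrow> real^3)"
      unfolding column_def by (intro continuous_intros)
    from measurable_compose[OF _ borel_measurable_continuous_onI[OF this], of "\<lambda>x. A (fst x)"] show ?thesis by measurable
  qed
  show ?thesis
    unfolding interaction_def matrix_vector_inner split_beta' by measurable
qed

text \<open>Integrating \<open>interaction_slice\<close> over the first point reproduces the
  momentum identity tested with w V, now as one integral over pairs of points.\<close>

theorem interaction_identity:
  assumes k: "smooth k"
  shows "integrable (lborel \<Otimes>\<^sub>M lborel) (\<lambda>(z, z'). interaction w k R M A H z z')"
    "(\<integral>p. (\<lambda>(z, z'). interaction w k R M A H z z') p \<partial>(lborel \<Otimes>\<^sub>M lborel)) = 0"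
proof -
  obtain C where C: "C > 0" "\<And>z z'. \<bar>interaction w k R M A H z z'\<bar> \<le> C * ((norm (M z) + norm (A z) + norm (H z)) * (\<bar>R z'\<bar> + norm (M z')))"
    using interaction_bound[OF k] by metis
  show I: "integrable (lborel \<Otimes>\<^sub>M lborel) (\<lambda>(z, z'). interaction w k R M A H z z')"
  proof (rule Bochner_Integration.integrable_bound)
    have "integrable (lborel \<Otimes>\<^sub>M lborel) (\<lambda>(z, z'). (norm (M z) + norm (A z) + norm (H z)) * (\<bar>R z'\<bar> + norm (M z')))"
      using int by (intro integrable_pair_product Bochner_Integration.integrable_add integrable_norm integrable_abs)
    then show "integrable (lborel \<Otimes>\<^sub>M lborel) (\<lambda>p. C * (\<lambda>(z, z'). (norm (M z) + norm (A z) + norm (H z)) * (\<bar>R z'\<bar> + norm (M z'))) p)"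
      by (rule integrable_mult_right)
    show "AE p in lborel \<Otimes>\<^sub>M lborel. norm ((\<lambda>(z, z'). interaction w k R M A H z z') p)
       \<le> norm (C * (\<lambda>(z, z'). (norm (M z) + norm (A z) + norm (H z)) * (\<bar>R z'\<bar> + norm (M z'))) p)"
      using C by (intro AE_I2) (auto intro: order_trans[OF C(2)])
  qed (rule measurable_interaction[OF k])
  define \<xi> where "\<xi> = (\<lambda>z. w z *\<^sub>R conv k b z)"
  have t\<xi>: "test_function (Q \<Omega> T) \<xi>"
    unfolding \<xi>_def by (rule test_function_weight[OF smooth_conv[OF b_integrable bounded_Q b_zero k]])
  then have s\<xi>: "smooth \<xi>" by (simp add: test_function_def smooth_def)
  have c: "continuous_on UNIV (\<lambda>x. frechet_derivative \<xi> (at x) v)" "continuous_on UNIV \<xi>" for v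
    by (intro smooth_continuous smooth_derivative s\<xi>)+
  have i: "integrable lborel (\<lambda>z. M z \<bullet> dt \<xi> z)" "integrable lborel (\<lambda>z. A z \<bullet> Grad \<xi> z)" "integrable lborel (\<lambda>z. H z \<bullet> \<xi> z)"
    unfolding dt_def Grad_def
    by (intro integrable_inner_continuous int zero c continuous_on_vec_lambda continuous_on_component; assumption)+
  have "(\<integral>p. (\<lambda>(z, z'). interaction w k R M A H z z') p \<partial>(lborel \<Otimes>\<^sub>M lborel)) = (\<integral>\<^sub>1z. (\<integral>\<^sub>1z'. interaction w k R M A H z z'))"
    using lborel_pair.integral_fst'[OF I] by simp
  also have "\<dots> = (\<integral>\<^sub>1z. M z \<bullet> dt \<xi> z + A z \<bullet> Grad \<xi> z + H z \<bullet> \<xi> z)"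
    unfolding \<xi>_def by (intro Bochner_Integration.integral_cong refl has_bochner_integral_integral_eq interaction_slice[OF k])
  also have "\<dots> = 0"
    using momentum t\<xi> i unfolding momentum_identity_def by (simp add: Bochner_Integration.integral_add)
  finally show "(\<integral>p. (\<lambda>(z, z'). interaction w k R M A H z z') p \<partial>(lborel \<Otimes>\<^sub>M lborel)) = 0" .
qed

end

section \<open>The test field\<close>

text \<open>For \<open>s = |x|\<^sup>2 + d\<close> the Jacobian of the field \<open>x \<mapsto> kap s x\<close> is \<open>kap s I + gp s x x\<^sup>T\<close>. Up to the
  logarithmically smaller \<open>lo s\<close> it is nonnegative, and its trace is at least \<open>kap s\<close>.\<close>

definition lo :: "real \<Rightarrow> real" where
  "lo s = ell s powr (1/3) * s powr (-1/2)"

text \<open>Twice the derivative of \<open>kap\<close>, the 2 coming from the gradient of |x|^2. The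
  first summand differentiates s^(-1/2), the second the logarithm.\<close>

definition gp :: "real \<Rightarrow> real" where
  "gp s = - (ell s powr (4/3) * s powr (-3/2)) - 8/3 * (ell s powr (1/3) * s powr (-3/2) / (exp 3 * s + 1))"

lemma measurable_lo[measurable]: "Borel lo"
  unfolding lo_def[abs_def] by measurable

lemma kap_eq_lo: "s > 0 \<Longrightarrow> kap s = ell s * lo s"
proof -
  assume "s > 0"
  then have "ell s > 0" using ell_ge_3[of s] by simp
  then have "ell s powr (4/3) = ell s powr 1 * ell s powr (1/3)" unfolding powr_add[symmetric] by simp
  then show ?thesis using \<open>ell s > 0\<close> by (simp add: kap_def lo_def)
qed

lemma lo_nonneg: "lo s \<ge> 0"
  by (simp add: lo_def)

text \<open>The factor 3 from \<open>ell >= 3\<close> makes 3 kap - (kap + 8/3 lo) at least kap,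
  which is the positivity of the pressure term.\<close>

lemma lo_le_kap: "s > 0 \<Longrightarrow> 3 * lo s \<le> kap s"
  using ell_ge_3[of s] lo_nonneg[of s] by (simp add: kap_eq_lo mult_right_mono)

lemma gp_nonpos: "s > 0 \<Longrightarrow> gp s \<le> 0"
  unfolding gp_def by (smt (verit) divide_nonneg_nonneg exp_ge_zero mult_nonneg_nonneg powr_ge_zero)

text \<open>The first summand of \<open>gp\<close> times s is exactly \<open>kap\<close>, so in the
  radial direction it is compensated by the identity part of the Jacobian. Only the derivative of
  the logarithm, of size \<open>lo\<close>, is left over.\<close>

lemma gp_bound: assumes s: "s > 0" shows "- gp s * s \<le> kap s + 8/3 * lo s"
proof -
  have p: "s powr (-3/2) * s = s powr (-1/2)"
  proof -
    have "s powr (-3/2) * s powr 1 = s powr (-1/2)" unfolding powr_add[symmetric] by simp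
    then show ?thesis using s by simp
  qed
  have "- gp s * s = ell s powr (4/3) * (s powr (-3/2) * s) + 8/3 * (ell s powr (1/3) * (s powr (-3/2) * s) / (exp 3 * s + 1))"
    unfolding gp_def by (simp add: algebra_simps)
  also have "\<dots> = kap s + 8/3 * (lo s / (exp 3 * s + 1))" unfolding p kap_def lo_def by simp
  also have "lo s / (exp 3 * s + 1) \<le> lo s / 1"
  proof (rule divide_left_mono)
    have "0 \<le> exp 3 * s" using s by (intro mult_nonneg_nonneg) auto
    then show "1 \<le> exp 3 * s + 1" by linarith
    then show "0 < (exp 3 * s + 1) * 1" by (metis mult_1_right less_le_trans zero_less_one)
  qed (rule lo_nonneg)
  finally show ?thesis by simp
qed

lemma gp_bound2: assumes s: "s > 0" "0 \<le> q" "q \<le> s" shows "0 \<le> - gp s * q" "- gp s * q \<le> 2 * kap s"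
proof -
  show "0 \<le> - gp s * q" using gp_nonpos[OF s(1)] s by (intro mult_nonneg_nonneg) auto
  have "- gp s * q \<le> - gp s * s" using gp_nonpos[OF s(1)] s by (intro mult_left_mono) auto
  then show "- gp s * q \<le> 2 * kap s" using gp_bound[OF s(1)] lo_le_kap[OF s(1)] kap_nonneg[of s] lo_nonneg[of s] by linarith
qed

lemma kap_deriv: assumes s: "s > 0" shows "(kap has_real_derivative gp s / 2) (at s)"
proof -
  have e: "exp 3 + 1 / s > 0" using s by (simp add: add_pos_pos)
  have l: "ell s > 0" using ell_ge_3[OF s] by simp
  have dell: "(ell has_real_derivative (- 1 / (s * (exp 3 * s + 1)))) (at s)"
  proof -
    have ne: "exp 3 * s + 1 \<noteq> 0" using s by (smt (verit) exp_gt_zero mult_pos_pos)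
    have "((\<lambda>s. ln (exp 3 + 1 / s)) has_real_derivative (- 1 / s\<^sup>2) / (exp 3 + 1 / s)) (at s)"
      using s e by (auto intro!: derivative_eq_intros simp: power2_eq_square)
    moreover have "(- 1 / s\<^sup>2) / (exp 3 + 1 / s) = - 1 / (s * (exp 3 * s + 1))"
      using s ne by (simp add: field_simps power2_eq_square)
    ultimately show ?thesis unfolding ell_def[abs_def] by simp
  qed
  have D: "((\<lambda>s. ell s powr (4/3) * s powr (-1/2)) has_real_derivative
     (ell s powr (4/3) * ((-1/2) * s powr (-1/2 - 1)) + ((4/3) * ell s powr (4/3 - 1) * (- 1 / (s * (exp 3 * s + 1)))) * s powr (-1/2))) (at s)"
  proof (rule DERIV_mult')
    show "((\<lambda>s. ell s powr (4/3)) has_real_derivative ((4/3) * ell s powr (4/3 - 1) * (- 1 / (s * (exp 3 * s + 1))))) (at s)"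
      using DERIV_fun_powr[OF dell l, of "4/3"] by simp
    show "((\<lambda>s. s powr (-1/2)) has_real_derivative ((-1/2) * s powr (-1/2 - 1))) (at s)"
      using has_real_derivative_powr[OF s, of "-1/2"] by simp
  qed
  have eq: "(ell s powr (4/3) * ((-1/2) * s powr (-1/2 - 1)) + ((4/3) * ell s powr (4/3 - 1) * (- 1 / (s * (exp 3 * s + 1)))) * s powr (-1/2)) = gp s / 2"
  proof -
    have "s powr (-1/2) / s = s powr (-1/2) / s powr 1" using s by simp
    also have "\<dots> = s powr (-3/2)" unfolding powr_diff[symmetric] by simp
    finally have p: "s powr (-1/2) / s = s powr (-3/2)" .
    have "(4/3) * ell s powr (4/3 - 1) * (- 1 / (s * (exp 3 * s + 1))) * s powr (-1/2)
      = - (4/3) * (ell s powr (1/3) * (s powr (-1/2) / s) / (exp 3 * s + 1))" by simp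
    then show ?thesis unfolding p gp_def by simp
  qed
  show ?thesis unfolding kap_def[abs_def] using D unfolding eq .
qed

definition kern :: "(real \<Rightarrow> real) \<Rightarrow> real \<Rightarrow> point \<Rightarrow> real^3" where
  "kern \<eta> d z = (\<eta> (snd z) * kap ((norm (fst z))\<^sup>2 + d)) *\<^sub>R fst z"

text \<open>The summand d > 0 keeps s positive, so the powers and the logarithm are smooth across
  the origin.\<close>

lemma smooth_kern:
  assumes \<eta>: "smooth \<eta>" and d: "d > 0" shows "smooth (kern \<eta> d)"
proof -
  let ?s = "\<lambda>z::point. fst z \<bullet> fst z + d"
  have f: "smooth (fst :: point \<Rightarrow> real^3)" by (rule smooth_bounded_linear[OF bounded_linear_fst])
  have s: "smooth ?s" by (intro smooth_add smooth_inner f smooth_const)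
  have s0: "?s z > 0" for z using d by (simp add: add_nonneg_pos)
  have e0: "exp 3 + inverse (?s z) > 0" for z using s0[of z] by (simp add: add_pos_pos)
  have l: "ell (?s z) = ln (exp 3 + inverse (?s z))" for z by (simp add: ell_def inverse_eq_divide)
  have l0: "ln (exp 3 + inverse (?s z)) > 0" for z using ell_ge_3[OF s0[of z]] by (simp add: l)
  have "smooth (\<lambda>z. (\<eta> (snd z) * (ln (exp 3 + inverse (?s z)) powr (4/3) * ?s z powr (-1/2))) *\<^sub>R fst z)"
    using smooth_affine_comp[OF bounded_linear_snd \<eta>, of 0]
    by (intro smooth_scaleR smooth_mult smooth_powr[OF l0] smooth_powr[OF s0] smooth_ln[OF e0] smooth_add smooth_const smooth_inverse[OF s0] s f) simp
  then show ?thesis unfolding kern_def[abs_def] kap_def by (simp add: l power2_norm_eq_inner)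
qed

text \<open>The space-time derivative restricted to spatial directions is a derivative of y ->
  \<open>kern \<eta> d (y, t)\<close>; by uniqueness it agrees with the one from the chain
  rule.\<close>

lemma dx_kern:
  assumes d: "d > 0"
  assumes \<eta>: "smooth \<eta>"
  shows "dx (kern \<eta> d) (x, t) j = \<eta> t *\<^sub>R (kap ((norm x)\<^sup>2 + d) *\<^sub>R axis j 1 + (gp ((norm x)\<^sup>2 + d) * x $ j) *\<^sub>R x)"
proof -
  define s where "s = (norm x)\<^sup>2 + d"
  have s: "s > 0" using d by (simp add: s_def add_nonneg_pos)
  have D: "(kern \<eta> d has_derivative frechet_derivative (kern \<eta> d) (at (x, t))) (at (x, t))"
    by (rule smooth_derivative(1)[OF smooth_kern[OF \<eta> d]])
  have "((\<lambda>y. kern \<eta> d (y, t)) has_derivative (\<lambda>h. frechet_derivative (kern \<eta> d) (at (x, t)) (h, 0))) (at x)"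
  proof -
    have "((\<lambda>y. (y, t)) has_derivative (\<lambda>h. (h, 0))) (at x)" by (auto intro!: derivative_eq_intros)
    from has_derivative_compose[OF this D] show ?thesis .
  qed
  moreover have "((\<lambda>y. kern \<eta> d (y, t)) has_derivative (\<lambda>h. (\<eta> t * kap s) *\<^sub>R h + (\<eta> t * (gp s / 2 * (2 * (x \<bullet> h)))) *\<^sub>R x)) (at x)"
  proof -
    have q: "((\<lambda>y. (norm y)\<^sup>2 + d) has_derivative (\<lambda>h. 2 * (x \<bullet> h))) (at x)"
      unfolding power2_norm_eq_inner by (auto intro!: derivative_eq_intros simp: inner_commute)
    have "(kap has_derivative (*) (gp s / 2)) (at ((norm x)\<^sup>2 + d))"
      using kap_deriv[OF s] unfolding has_field_derivative_def s_def by simp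
    from has_derivative_compose[OF q this]
    have "((\<lambda>y. kap ((norm y)\<^sup>2 + d)) has_derivative (\<lambda>h. gp s / 2 * (2 * (x \<bullet> h)))) (at x)" .
    then have "((\<lambda>y. \<eta> t * kap ((norm y)\<^sup>2 + d)) has_derivative (\<lambda>h. \<eta> t * (gp s / 2 * (2 * (x \<bullet> h))))) (at x)"
      by (rule has_derivative_mult_right)
    from has_derivative_scaleR[OF this has_derivative_ident] show ?thesis
      unfolding kern_def fst_conv snd_conv s_def .
  qed
  ultimately have "(\<lambda>h. frechet_derivative (kern \<eta> d) (at (x, t)) (h, 0)) = (\<lambda>h. (\<eta> t * kap s) *\<^sub>R h + (\<eta> t * (gp s / 2 * (2 * (x \<bullet> h)))) *\<^sub>R x)"
    by (rule has_derivative_unique)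
  from fun_cong[OF this, of "axis j 1"] show ?thesis
    unfolding dx_def s_def by (simp add: inner_axis scaleR_add_right mult_ac)
qed

section \<open>Norms of stress and flux, and their contractions with the Jacobian of the test
  field\<close>

lemma norm_transpose: "norm (transpose A) = norm (A :: real^3^3)"
proof -
  have "(norm (transpose A))\<^sup>2 = (norm A)\<^sup>2"
    by (simp add: power2_norm_eq_inner inner_vec_def transpose_def sum.swap[of "\<lambda>i j. A $ j $ i * A $ j $ i" UNIV UNIV])
  then show ?thesis by (simp add: power2_eq_iff_nonneg)
qed

lemma abs_trace_le: "\<bar>trace A\<bar> \<le> 3 * norm (A :: real^3^3)"
proof -
  have "\<bar>trace A\<bar> \<le> (\<Sum>i\<in>UNIV. \<bar>A $ i $ i\<bar>)" unfolding trace_def by (rule sum_abs)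
  also have "\<dots> \<le> (\<Sum>i\<in>(UNIV :: 3 set). norm A)"
    by (intro sum_mono order_trans[OF component_le_norm_cart]) (auto simp: component_le_norm_cart Finite_Cartesian_Product.norm_nth_le)
  finally show ?thesis by simp
qed

lemma norm_mat_1: "norm (mat 1 :: real^3^3) \<le> 2"
proof -
  have "(norm (mat 1 :: real^3^3))\<^sup>2 = 3"
    by (simp add: power2_norm_eq_inner inner_vec_def mat_def if_distrib[of "\<lambda>x. x * _"] sum.delta cong: if_cong)
  then have "(norm (mat 1 :: real^3^3))\<^sup>2 \<le> 2\<^sup>2" by simp
  then show ?thesis by (rule power2_le_imp_le) simp
qed

lemma norm_stress_le: "norm (stress \<nu>1 \<nu>2 D) \<le> (2 * \<bar>\<nu>1\<bar> + 6 * \<bar>\<nu>2\<bar>) * norm D"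
proof -
  have "norm (stress \<nu>1 \<nu>2 D) \<le> \<bar>\<nu>1\<bar> * (norm D + norm (transpose D)) + \<bar>\<nu>2\<bar> * \<bar>trace D\<bar> * norm (mat 1 :: real^3^3)"
    unfolding stress_def
    by (intro order_trans[OF norm_triangle_ineq] add_mono) (auto simp: abs_mult intro!: mult_left_mono norm_triangle_ineq)
  also have "\<dots> \<le> \<bar>\<nu>1\<bar> * (norm D + norm D) + \<bar>\<nu>2\<bar> * (3 * norm D) * 2"
    unfolding norm_transpose by (intro add_mono mult_mono abs_trace_le norm_mat_1) auto
  finally show ?thesis by (simp add: algebra_simps)
qed

lemma norm_tensor: "norm (tensor a b) = norm a * norm b"
proof -
  have "(norm (tensor a b))\<^sup>2 = (norm a * norm b)\<^sup>2"
    by (simp add: power2_norm_eq_inner inner_vec_def tensor_def power_mult_distrib sum_product mult_ac)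
  then show ?thesis by (simp add: power2_eq_iff_nonneg)
qed

lemma norm_matrix_vector_le: "norm (A *v x) \<le> norm (A :: real^3^3) * norm x"
proof (rule power2_le_imp_le)
  have e: "(A *v x) $ i = A $ i \<bullet> x" for i by (simp add: matrix_vector_mult_def inner_vec_def)
  have "(norm (A *v x))\<^sup>2 = (\<Sum>i\<in>UNIV. (A $ i \<bullet> x)\<^sup>2)"
    unfolding power2_norm_eq_inner inner_vec_def[of "A *v x" "A *v x"] e by (simp add: power2_eq_square)
  also have "\<dots> \<le> (\<Sum>i\<in>UNIV. (norm (A $ i) * norm x)\<^sup>2)"
    by (intro sum_mono) (metis Cauchy_Schwarz_ineq2 abs_ge_zero power2_abs power_mono)
  also have "\<dots> = (norm A * norm x)\<^sup>2"
  proof -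
    have "(norm A)\<^sup>2 = (\<Sum>i\<in>UNIV. (norm (A $ i))\<^sup>2)" by (simp add: power2_norm_eq_inner inner_vec_def)
    then show ?thesis by (simp add: power_mult_distrib sum_distrib_right)
  qed
  finally show "(norm (A *v x))\<^sup>2 \<le> (norm A * norm x)\<^sup>2" .
qed simp

text \<open>The Jacobian contracted with two vectors, as in the convective term, and with a matrix,
  as in the flux term.\<close>

lemma sum_dx_kern:
  assumes d: "d > 0" and \<eta>: "smooth \<eta>" and s: "s = (norm x)\<^sup>2 + d"
  shows "(\<Sum>j\<in>UNIV. v $ j * (u \<bullet> dx (kern \<eta> d) (x, t) j)) = \<eta> t * (kap s * (u \<bullet> v) + gp s * ((x \<bullet> u) * (x \<bullet> v)))"
    "(\<Sum>j\<in>UNIV. dx (kern \<eta> d) (x, t) j \<bullet> column j A) = \<eta> t * (kap s * trace A + gp s * (x \<bullet> (A *v x)))"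
proof -
  have 1: "(\<Sum>j\<in>UNIV. v $ j * (u \<bullet> dx (kern \<eta> d) (x, t) j)) = (\<Sum>j\<in>UNIV. \<eta> t * (kap s * (u $ j * v $ j) + gp s * (x \<bullet> u) * (x $ j * v $ j)))"
    unfolding dx_kern[OF d \<eta>] s
    by (intro sum.cong) (auto simp: inner_add_right inner_axis algebra_simps inner_commute)
  have uv: "u \<bullet> v = (\<Sum>j\<in>UNIV. u $ j * v $ j)" "x \<bullet> v = (\<Sum>j\<in>UNIV. x $ j * v $ j)" by (simp_all add: inner_vec_def)
  show "(\<Sum>j\<in>UNIV. v $ j * (u \<bullet> dx (kern \<eta> d) (x, t) j)) = \<eta> t * (kap s * (u \<bullet> v) + gp s * ((x \<bullet> u) * (x \<bullet> v)))"
    unfolding 1 uv by (simp add: sum_distrib_left[symmetric] sum.distrib mult.assoc)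
  have 2: "(\<Sum>j\<in>UNIV. dx (kern \<eta> d) (x, t) j \<bullet> column j A) = (\<Sum>j\<in>UNIV. \<eta> t * (kap s * A $ j $ j + gp s * (x $ j * (x \<bullet> column j A))))"
    unfolding dx_kern[OF d \<eta>] s
    by (intro sum.cong) (auto simp: inner_add_left inner_axis' column_def algebra_simps)
  show "(\<Sum>j\<in>UNIV. dx (kern \<eta> d) (x, t) j \<bullet> column j A) = \<eta> t * (kap s * trace A + gp s * (x \<bullet> (A *v x)))"
    unfolding 2 matrix_vector_inner trace_def by (simp add: sum_distrib_left[symmetric] sum.distrib)
qed

lemma flux_contractions:
  fixes U x :: "real^3" and S :: "real^3^3"
  shows "trace (r *\<^sub>R tensor U U + p *\<^sub>R mat 1 - S) = r * (norm U)\<^sup>2 + 3 * p - trace S"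
    "x \<bullet> ((r *\<^sub>R tensor U U + p *\<^sub>R mat 1 - S) *v x) = r * (x \<bullet> U)\<^sup>2 + p * (norm x)\<^sup>2 - x \<bullet> (S *v x)"
proof -
  have t: "trace (tensor U U) = (norm U)\<^sup>2" "trace (mat 1 :: real^3^3) = 3"
    by (simp_all add: trace_def tensor_def mat_def power2_norm_eq_inner inner_vec_def)
  show "trace (r *\<^sub>R tensor U U + p *\<^sub>R mat 1 - S) = r * (norm U)\<^sup>2 + 3 * p - trace S"
  proof -
    have "trace (r *\<^sub>R tensor U U + p *\<^sub>R mat 1 - S) = r * trace (tensor U U) + p * trace (mat 1 :: real^3^3) - trace S"
      by (simp add: trace_def sum.distrib sum_subtractf sum_distrib_left)
    then show ?thesis by (simp add: t)
  qed
  have v: "tensor U U *v x = (x \<bullet> U) *\<^sub>R U"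
    by (simp add: vec_eq_iff tensor_def matrix_vector_mult_def inner_vec_def sum_distrib_left sum_distrib_right mult_ac)
  show "x \<bullet> ((r *\<^sub>R tensor U U + p *\<^sub>R mat 1 - S) *v x) = r * (x \<bullet> U)\<^sup>2 + p * (norm x)\<^sup>2 - x \<bullet> (S *v x)"
    by (simp add: matrix_vector_mult_add_rdistrib matrix_vector_mult_diff_rdistrib scaleR_matrix_vector_assoc[symmetric] v
        inner_add_right inner_diff_right power2_eq_square power2_norm_eq_inner flip: power2_norm_eq_inner)
qed

section \<open>The leading part of the interaction\<close>

text \<open>K, g, L stand for \<open>kap\<close>, \<open>gp\<close>, \<open>lo\<close>. After
  symmetrisation the kinetic terms are r r' times K |U - U'|^2 + g (x . (U - U'))^2, which
  Cauchy-Schwarz and the bound on g q keep above -8/3 L |U - U'|^2; then |U - U'|^2 <= 2 |U|^2 + 2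
  |U'|^2 produces 16/3. The pressure factor 3 K + g q is at least K because 3 L <= K.\<close>

lemma kinetic_pressure_lower_bound:
  fixes U U' x :: "'a::real_inner"
  assumes nn: "r \<ge> 0" "r' \<ge> 0" "p \<ge> 0" "p' \<ge> 0" "L \<ge> 0" "3 * L \<le> K"
    and q: "q = (norm x)\<^sup>2" and g: "g \<le> 0" "- g * q \<le> K + 8/3 * L"
  shows "(p * r' * K + p' * r * K) - 16/3 * (r * r' * (norm U)\<^sup>2 * L) - 16/3 * (r * r' * (norm U')\<^sup>2 * L)
    \<le> (r * r' * (K * (norm U)\<^sup>2 + g * (x \<bullet> U)\<^sup>2) - r * r' * (K * (U \<bullet> U') + g * ((x \<bullet> U) * (x \<bullet> U'))) + r' * p * (3 * K + g * q))
     + (r' * r * (K * (norm U')\<^sup>2 + g * (x \<bullet> U')\<^sup>2) - r' * r * (K * (U' \<bullet> U) + g * ((x \<bullet> U') * (x \<bullet> U))) + r * p' * (3 * K + g * q))"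
proof -
  have K0: "K \<ge> 0" using nn by linarith
  have xd: "(x \<bullet> (U - U'))\<^sup>2 \<le> q * (norm (U - U'))\<^sup>2"
    unfolding q using Cauchy_Schwarz_ineq[of x "U - U'"] by (simp add: power2_norm_eq_inner)
  have d2: "(norm (U - U'))\<^sup>2 \<le> 2 * (norm U)\<^sup>2 + 2 * (norm U')\<^sup>2"
    using zero_le_power2[of "norm (U + U')"] by (simp add: power2_norm_eq_inner inner_add inner_diff inner_commute)
  have "- (8/3 * L) * (norm (U - U'))\<^sup>2 \<le> K * (norm (U - U'))\<^sup>2 + g * (x \<bullet> (U - U'))\<^sup>2"
  proof -
    have "g * (q * (norm (U - U'))\<^sup>2) \<le> g * (x \<bullet> (U - U'))\<^sup>2" using xd g by (intro mult_left_mono_neg) auto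
    moreover have "(- g * q) * (norm (U - U'))\<^sup>2 \<le> (K + 8/3 * L) * (norm (U - U'))\<^sup>2" using g(2) by (intro mult_right_mono) auto
    ultimately show ?thesis by (simp add: algebra_simps)
  qed
  moreover have "(8/3 * L) * (norm (U - U'))\<^sup>2 \<le> (8/3 * L) * (2 * (norm U)\<^sup>2 + 2 * (norm U')\<^sup>2)"
    using d2 nn by (intro mult_left_mono) auto
  ultimately have "- (8/3 * L) * (2 * (norm U)\<^sup>2 + 2 * (norm U')\<^sup>2) \<le> K * (norm (U - U'))\<^sup>2 + g * (x \<bullet> (U - U'))\<^sup>2" by linarith
  then have kin: "r * r' * (- (8/3 * L) * (2 * (norm U)\<^sup>2 + 2 * (norm U')\<^sup>2)) \<le> r * r' * (K * (norm (U - U'))\<^sup>2 + g * (x \<bullet> (U - U'))\<^sup>2)"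
    using nn by (intro mult_left_mono) auto
  have "K \<le> 3 * K + g * q" using g(2) nn by linarith
  then have press: "(r' * p + r * p') * K \<le> (r' * p + r * p') * (3 * K + g * q)" using nn by (intro mult_left_mono) auto
  have id: "K * (norm (U - U'))\<^sup>2 + g * (x \<bullet> (U - U'))\<^sup>2
     = K * (norm U)\<^sup>2 + g * (x \<bullet> U)\<^sup>2 + K * (norm U')\<^sup>2 + g * (x \<bullet> U')\<^sup>2 - 2 * (K * (U \<bullet> U') + g * ((x \<bullet> U) * (x \<bullet> U')))"
  proof -
    have nd: "(norm (U - U'))\<^sup>2 = (norm U)\<^sup>2 + (norm U')\<^sup>2 - 2 * (U \<bullet> U')"
      by (simp add: power2_norm_eq_inner inner_diff inner_commute)
    have xd': "(x \<bullet> (U - U'))\<^sup>2 = (x \<bullet> U)\<^sup>2 + (x \<bullet> U')\<^sup>2 - 2 * ((x \<bullet> U) * (x \<bullet> U'))"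
      by (simp add: inner_diff_right power2_diff)
    show ?thesis unfolding nd xd' by (simp add: algebra_simps)
  qed
  show ?thesis using kin[unfolded id] press by (simp add: algebra_simps inner_commute)
qed

text \<open>Here u is a squared velocity, e the logarithm, and e L the weight \<open>kap\<close>.
  Outside the exceptional set 32/3 u < e sqrt r, and the defect lies below half of r^(3/2) r' e L;
  the number 32/3 = 2 * 16/3 is set by this half.\<close>

lemma bad_absorb:
  assumes nn: "r \<ge> 0" "r' \<ge> 0" "u \<ge> 0" "L \<ge> 0" "e > 0" and p: "p \<ge> r powr (3/2)"
  shows "16/3 * (r * r' * u * L) \<le> 1/2 * (p * r' * (e * L)) + (if e * sqrt r \<le> 32/3 * u then 16/3 * (r * r' * u * L) else 0)"
proof (cases "e * sqrt r \<le> 32/3 * u")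
  case True
  have "p \<ge> 0" using p by (meson order_trans powr_ge_zero)
  then have "0 \<le> p * r' * (e * L)" using nn by (intro mult_nonneg_nonneg) auto
  then show ?thesis using True by simp
next
  case False
  have "r powr (3/2) = r * sqrt r"
  proof (cases "r = 0")
    case False
    have "r powr (3/2) = r powr 1 * r powr (1/2)" unfolding powr_add[symmetric] by simp
    then show ?thesis using nn by (simp add: powr_half_sqrt)
  qed simp
  then have "r * sqrt r \<le> p" using p by simp
  have "16/3 * (r * r' * u * L) = 1/2 * (r * (32/3 * u)) * (r' * L)" by simp
  also have "\<dots> \<le> 1/2 * (r * (e * sqrt r)) * (r' * L)"
    using False nn by (intro mult_right_mono mult_left_mono) auto
  also have "\<dots> = 1/2 * ((r * sqrt r) * (r' * (e * L)))" by simp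
  also have "\<dots> \<le> 1/2 * (p * (r' * (e * L)))"
    using \<open>r * sqrt r \<le> p\<close> nn by (intro mult_left_mono mult_right_mono) auto
  finally show ?thesis using False by (simp add: mult.assoc)
qed

text \<open>\<open>P\<close> stands for the full pressure. It is known only through the lower bound
  by the 3/2 power of the density, and later through an energy bound, so no estimate can depend on
  \<epsilon> or on the exponent of the regularisation.\<close>

locale flow =
  fixes \<Omega> :: "(real^3) set" and T \<nu>1 \<nu>2 F :: real and w R P :: "point \<Rightarrow> real" and U f :: "point \<Rightarrow> real^3"
    and D :: "point \<Rightarrow> real^3^3"
  assumes weak: "weak_form \<Omega> T w R (\<lambda>z. R z *\<^sub>R U z) (\<lambda>z. R z *\<^sub>R f z) (\<lambda>z. R z *\<^sub>R tensor (U z) (U z) + P z *\<^sub>R mat 1 - stress \<nu>1 \<nu>2 (D z))"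
    and w0: "\<And>z. w z \<ge> 0" and R0: "\<And>z. R z \<ge> 0" and PR: "\<And>z. P z \<ge> R z powr (3/2)" and F: "\<And>z. norm (f z) \<le> F"
    and meas: "Borel P" "Borel U" "Borel D"

sublocale flow \<subseteq> weak_form \<Omega> T w R "\<lambda>z. R z *\<^sub>R U z" "\<lambda>z. R z *\<^sub>R f z" "\<lambda>z. R z *\<^sub>R tensor (U z) (U z) + P z *\<^sub>R mat 1 - stress \<nu>1 \<nu>2 (D z)"
  by (rule weak)

context flow
begin

abbreviation "flux \<equiv> \<lambda>z. R z *\<^sub>R tensor (U z) (U z) + P z *\<^sub>R mat 1 - stress \<nu>1 \<nu>2 (D z)"
abbreviation "mom \<equiv> \<lambda>z. R z *\<^sub>R U z"
abbreviation "force \<equiv> \<lambda>z. R z *\<^sub>R f z"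

lemma P0: "P z \<ge> 0"
  using PR[of z] by (meson order_trans powr_ge_zero)

definition sep :: "real \<Rightarrow> point \<Rightarrow> point \<Rightarrow> real" where
  "sep d z z' = (norm (fst z - fst z'))\<^sup>2 + d"

text \<open>\<open>main\<close> collects the terms in which neither weight is differentiated and the viscous stress is absent, \<open>err\<close> dominates
  all the others. Of \<open>main\<close> there remain the pressure term \<open>good\<close> and the defect \<open>rem\<close> of the kinetic terms, which
  the pressure absorbs except where the density is small compared with the velocity.\<close>

definition main :: "(real \<Rightarrow> real) \<Rightarrow> real \<Rightarrow> point \<Rightarrow> point \<Rightarrow> real" where
  "main \<eta> d z z' = w z * w z' * \<eta> (snd z - snd z') *
    (R z * R z' * (kap (sep d z z') * (norm (U z))\<^sup>2 + gp (sep d z z') * ((fst z - fst z') \<bullet> U z)\<^sup>2)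
     - R z * R z' * (kap (sep d z z') * (U z \<bullet> U z') + gp (sep d z z') * (((fst z - fst z') \<bullet> U z) * ((fst z - fst z') \<bullet> U z')))
     + R z' * P z * (3 * kap (sep d z z') + gp (sep d z z') * (norm (fst z - fst z'))\<^sup>2))"

definition err :: "(real \<Rightarrow> real) \<Rightarrow> real \<Rightarrow> point \<Rightarrow> point \<Rightarrow> real" where
  "err \<eta> d z z' = \<eta> (snd z - snd z') *
    ((R z + R z * (norm (U z))\<^sup>2 + P z + norm (D z)) * (ell (sep d z z') powr (4/3) * (R z' + R z' * norm (U z')))
      + R z' * norm (D z) * kap (sep d z z'))"

definition good :: "(real \<Rightarrow> real) \<Rightarrow> real \<Rightarrow> point \<Rightarrow> point \<Rightarrow> real" where
  "good \<eta> d z z' = w z * w z' * \<eta> (snd z - snd z') * (P z * R z' * kap (sep d z z'))"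

definition rem :: "(real \<Rightarrow> real) \<Rightarrow> real \<Rightarrow> point \<Rightarrow> point \<Rightarrow> real" where
  "rem \<eta> d z z' = w z * w z' * \<eta> (snd z - snd z') *
    (if ell (sep d z z') * sqrt (R z) \<le> 32/3 * (norm (U z))\<^sup>2 then 16/3 * (R z * R z' * (norm (U z))\<^sup>2 * lo (sep d z z')) else 0)"

lemma sep_pos: "d > 0 \<Longrightarrow> sep d z z' > 0"
  by (simp add: sep_def add_nonneg_pos)

lemma sep_commute: "sep d z z' = sep d z' z"
  by (simp add: sep_def norm_minus_commute)

text \<open>The kinetic defect is treated by \<open>bad_absorb\<close> at each of the two points:
  half of the pressure term pays for it, half remains.\<close>

lemma main_lower_bound:
  assumes d: "d > 0" and \<eta>: "\<And>t. \<eta> t \<ge> 0" "\<And>t. \<eta> (- t) = \<eta> t"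
  shows "1/2 * (good \<eta> d z z' + good \<eta> d z' z) \<le> main \<eta> d z z' + main \<eta> d z' z + rem \<eta> d z z' + rem \<eta> d z' z"
proof -
  define s where "s = sep d z z'"
  have s: "s > 0" "(norm (fst z - fst z'))\<^sup>2 \<le> s" using sep_pos[OF d] d by (auto simp: s_def sep_def)
  define x where "x = fst z - fst z'"
  define c where "c = w z * w z' * \<eta> (snd z - snd z')"
  have c: "c \<ge> 0" unfolding c_def using w0 \<eta> by auto
  have sym: "sep d z' z = s" "\<eta> (snd z' - snd z) = \<eta> (snd z - snd z')" "w z' * w z = w z * w z'"
    using \<eta>(2)[of "snd z - snd z'"] by (auto simp: s_def sep_commute)
  have xx: "fst z' - fst z = - x" by (simp add: x_def)
  have L: "lo s \<ge> 0" "3 * lo s \<le> kap s" by (rule lo_nonneg) (rule lo_le_kap[OF s(1)])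
  have g: "gp s \<le> 0" "- gp s * (norm x)\<^sup>2 \<le> kap s + 8/3 * lo s"
  proof -
    show "gp s \<le> 0" by (rule gp_nonpos[OF s(1)])
    then have "- gp s * (norm x)\<^sup>2 \<le> - gp s * s" using s by (intro mult_left_mono) (auto simp: x_def)
    then show "- gp s * (norm x)\<^sup>2 \<le> kap s + 8/3 * lo s" using gp_bound[OF s(1)] by linarith
  qed
  note kp = kinetic_pressure_lower_bound[OF R0[of z] R0[of z'] P0[of z] P0[of z'] L refl g, of "U z" "U z'"]
  have kap: "kap s = ell s * lo s" by (rule kap_eq_lo[OF s(1)])
  have e: "ell s > 0" using ell_ge_3[OF s(1)] by simp
  note b1 = bad_absorb[OF R0[of z] R0[of z'] zero_le_power2[of "norm (U z)"] L(1) e PR[of z]]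
  note b2 = bad_absorb[OF R0[of z'] R0[of z] zero_le_power2[of "norm (U z')"] L(1) e PR[of z']]
  let ?m1 = "R z * R z' * (kap s * (norm (U z))\<^sup>2 + gp s * (x \<bullet> U z)\<^sup>2) - R z * R z' * (kap s * (U z \<bullet> U z') + gp s * ((x \<bullet> U z) * (x \<bullet> U z'))) + R z' * P z * (3 * kap s + gp s * (norm x)\<^sup>2)"
  let ?m2 = "R z' * R z * (kap s * (norm (U z'))\<^sup>2 + gp s * (x \<bullet> U z')\<^sup>2) - R z' * R z * (kap s * (U z' \<bullet> U z) + gp s * ((x \<bullet> U z') * (x \<bullet> U z))) + R z * P z' * (3 * kap s + gp s * (norm x)\<^sup>2)"
  let ?r1 = "(if ell s * sqrt (R z) \<le> 32/3 * (norm (U z))\<^sup>2 then 16/3 * (R z * R z' * (norm (U z))\<^sup>2 * lo s) else 0)"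
  let ?r2 = "(if ell s * sqrt (R z') \<le> 32/3 * (norm (U z'))\<^sup>2 then 16/3 * (R z' * R z * (norm (U z'))\<^sup>2 * lo s) else 0)"
  have "1/2 * (P z * R z' * kap s + P z' * R z * kap s) \<le> ?m1 + ?m2 + ?r1 + ?r2"
  proof -
    have c1: "R z' * R z * (norm (U z'))\<^sup>2 * lo s = R z * R z' * (norm (U z'))\<^sup>2 * lo s" by simp
    show ?thesis using kp b1 b2 unfolding kap[symmetric] c1 by argo
  qed
  from mult_left_mono[OF this c]
  have "1/2 * (c * (P z * R z' * kap s) + c * (P z' * R z * kap s)) \<le> c * ?m1 + c * ?m2 + c * ?r1 + c * ?r2"
    by (simp only: distrib_left mult.left_commute[of c])
  moreover have "good \<eta> d z z' = c * (P z * R z' * kap s)" "good \<eta> d z' z = c * (P z' * R z * kap s)"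
    unfolding good_def sym by (simp_all add: c_def s_def)
  moreover have "rem \<eta> d z z' = c * ?r1" "rem \<eta> d z' z = c * ?r2"
    unfolding rem_def sym by (simp_all add: c_def s_def)
  moreover have "main \<eta> d z z' = c * ?m1" unfolding main_def by (simp add: c_def s_def x_def)
  moreover have "main \<eta> d z' z = c * ?m2"
    unfolding main_def sym xx by (simp add: c_def)
  ultimately show ?thesis by simp
qed

text \<open>Terms with a differentiated weight, and the force term, carry the undifferentiated
  field, whose singularity is only logarithmic. The stress meets the Jacobian and keeps the
  singularity of \<open>kap\<close>. In \<open>C\<close> the 4 is 1 + 1 from the weights of the
  momentum terms and 2 from the norm of the identity matrix in the flux.\<close>

lemma interaction_main:
  assumes d: "d > 0" and \<eta>: "smooth \<eta>" "\<And>t. \<eta> t \<ge> 0"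
    and c: "\<And>z. \<bar>w z\<bar> \<le> c" "\<And>z. \<bar>dt w z\<bar> \<le> c" "\<And>z. norm (grad w z) \<le> c"
    and C: "C = c\<^sup>2 * (4 + 5 * (2 * \<bar>\<nu>1\<bar> + 6 * \<bar>\<nu>2\<bar>) + F)"
  shows "main \<eta> d z z' \<le> interaction w (kern \<eta> d) R mom flux force z z' + C * err \<eta> d z z'"
proof -
  define Cs where "Cs = 2 * \<bar>\<nu>1\<bar> + 6 * \<bar>\<nu>2\<bar>"
  define S where "S = stress \<nu>1 \<nu>2 (D z)"
  define x where "x = fst z - fst z'"
  define s where "s = sep d z z'"
  have s: "s > 0" "s = (norm x)\<^sup>2 + d" "(norm x)\<^sup>2 \<le> s" using sep_pos[OF d] d by (auto simp: s_def sep_def x_def)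
  define h where "h = \<eta> (snd z - snd z')"
  define e where "e = ell s powr (4/3)"
  define a where "a = R z + R z * (norm (U z))\<^sup>2 + P z + norm (D z)"
  define b where "b = R z' + R z' * norm (U z')"
  have h: "h \<ge> 0" by (simp add: h_def \<eta>)
  have e0: "e \<ge> 0" by (simp add: e_def)
  have K0: "kap s \<ge> 0" by (rule kap_nonneg)
  have c0: "c \<ge> 0" using c(1)[of z] abs_ge_zero[of "w z"] by linarith
  have F0: "F \<ge> 0" using F[of z] norm_ge_zero[of "f z"] by linarith
  have Cs0: "Cs \<ge> 0" by (simp add: Cs_def)
  have nS: "norm S \<le> Cs * norm (D z)" unfolding S_def Cs_def by (rule norm_stress_le)
  have RU2: "0 \<le> R z * (norm (U z))\<^sup>2" using R0 by auto
  have a0: "a \<ge> 0" "R z \<le> a" "norm (D z) \<le> a" using R0[of z] RU2 P0[of z] by (auto simp: a_def)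
  have RUa: "R z * norm (U z) \<le> a"
  proof -
    have "norm (U z) \<le> 1 + (norm (U z))\<^sup>2" using zero_le_power2[of "norm (U z) - 1"] by (simp add: power2_diff) (smt (verit) norm_ge_zero)
    from mult_left_mono[OF this R0[of z]] show ?thesis using P0[of z] norm_ge_zero[of "D z"] unfolding a_def distrib_left by linarith
  qed
  have b0: "b \<ge> 0" "R z' \<le> b" using R0[of z'] by (auto simp: b_def)
  have zz: "z - z' = (x, snd z - snd z')" by (simp add: x_def prod_eq_iff)
  have k: "kern \<eta> d (z - z') = (h * kap s) *\<^sub>R x" by (simp add: kern_def zz h_def s(2))
  \<comment> \<open>The factor |x| <= sqrt s cancels s^(-1/2) and leaves ell^(4/3) alone.\<close>
  have nx: "kap s * norm x \<le> e"
  proof -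
    have "norm x \<le> sqrt s" using s(3) by (intro real_le_rsqrt) auto
    then have "kap s * norm x \<le> kap s * sqrt s" using K0 by (intro mult_left_mono) auto
    also have "kap s * sqrt s = e * (s powr (-1/2) * s powr (1/2))" using s(1) by (simp add: kap_def e_def powr_half_sqrt)
    also have "\<dots> = e" using s(1) unfolding powr_add[symmetric] by simp
    finally show ?thesis .
  qed
  have nk: "norm (kern \<eta> d (z - z')) \<le> h * e"
    unfolding k using mult_left_mono[OF nx h] h K0 by (simp add: mult.assoc)
  have Mk: "\<bar>mom z \<bullet> kern \<eta> d (z - z')\<bar> \<le> a * (h * e)"
  proof -
    have "\<bar>mom z \<bullet> kern \<eta> d (z - z')\<bar> \<le> norm (mom z) * norm (kern \<eta> d (z - z'))" by (rule Cauchy_Schwarz_ineq2)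
    also have "\<dots> \<le> a * (h * e)" using RUa R0[of z] a0 by (intro mult_mono nk) auto
    finally show ?thesis .
  qed
  have wR: "\<bar>w z' * R z'\<bar> \<le> c * b" unfolding abs_mult by (intro mult_mono c) (use b0 c0 R0[of z'] in auto)
  have t1: "\<bar>w z' * R z' * (dt w z * (mom z \<bullet> kern \<eta> d (z - z')))\<bar> \<le> (c * b) * (c * (a * (h * e)))"
    unfolding abs_mult[of "w z' * R z'"] abs_mult[of "dt w z"]
    by (intro mult_mono wR c Mk) (use c0 b0 a0 h e0 in auto)
  have t2: "\<bar>w z * ((mom z \<bullet> kern \<eta> d (z - z')) * (R z' * dt w z' + mom z' \<bullet> grad w z'))\<bar> \<le> c * ((a * (h * e)) * (c * b))"
    unfolding abs_mult[of "w z"] abs_mult[of "mom z \<bullet> kern \<eta> d (z - z')"]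
  proof (intro mult_mono c Mk)
    have "\<bar>R z' * dt w z'\<bar> \<le> R z' * c" unfolding abs_mult using R0[of z'] by (simp add: mult_left_mono c)
    moreover have "\<bar>mom z' \<bullet> grad w z'\<bar> \<le> (R z' * norm (U z')) * c"
      by (rule order_trans[OF Cauchy_Schwarz_ineq2]) (use R0[of z'] c0 in \<open>auto intro!: mult_left_mono c\<close>)
    moreover have "R z' * c + (R z' * norm (U z')) * c = c * b" by (simp add: b_def algebra_simps)
    ultimately show "\<bar>R z' * dt w z' + mom z' \<bullet> grad w z'\<bar> \<le> c * b" by linarith
  qed (use c0 a0 h e0 b0 in auto)
  have nA: "norm (flux z) \<le> (2 + Cs) * a"
  proof -
    have "norm (flux z) \<le> R z * (norm (U z))\<^sup>2 + P z * norm (mat 1 :: real^3^3) + norm S"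
      unfolding S_def using R0[of z] P0[of z]
      by (intro order_trans[OF norm_triangle_ineq4] add_mono order_trans[OF norm_triangle_ineq]) (auto simp: norm_tensor power2_eq_square)
    also have "\<dots> \<le> R z * (norm (U z))\<^sup>2 + P z * 2 + Cs * norm (D z)"
      by (intro add_mono mult_left_mono norm_mat_1 nS P0 order_refl)
    also have "\<dots> \<le> 2 * a + Cs * a"
      using R0[of z] RU2 P0[of z] mult_left_mono[OF a0(3) Cs0] by (intro add_mono) (auto simp: a_def)
    finally show ?thesis by (simp add: distrib_right)
  qed
  have t4: "\<bar>w z' * R z' * (kern \<eta> d (z - z') \<bullet> (flux z *v grad w z))\<bar> \<le> (c * b) * ((h * e) * ((2 + Cs) * a * c))"
    unfolding abs_mult[of "w z' * R z'"]
  proof (intro mult_mono wR)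
    have "\<bar>kern \<eta> d (z - z') \<bullet> (flux z *v grad w z)\<bar> \<le> norm (kern \<eta> d (z - z')) * norm (flux z *v grad w z)"
      by (rule Cauchy_Schwarz_ineq2)
    also have "\<dots> \<le> (h * e) * ((2 + Cs) * a * c)"
    proof (intro mult_mono nk)
      show "norm (flux z *v grad w z) \<le> (2 + Cs) * a * c"
        by (rule order_trans[OF norm_matrix_vector_le]) (use Cs0 a0 in \<open>auto intro!: mult_mono nA c\<close>)
    qed (use h e0 in auto)
    finally show "\<bar>kern \<eta> d (z - z') \<bullet> (flux z *v grad w z)\<bar> \<le> (h * e) * ((2 + Cs) * a * c)" .
  qed (use c0 b0 in auto)
  have t6: "\<bar>w z * (w z' * R z') * (force z \<bullet> kern \<eta> d (z - z'))\<bar> \<le> c * (c * b) * (a * F * (h * e))"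
    unfolding abs_mult[of "w z * (w z' * R z')"] abs_mult[of "w z"]
  proof (intro mult_mono wR c)
    have "\<bar>force z \<bullet> kern \<eta> d (z - z')\<bar> \<le> norm (force z) * norm (kern \<eta> d (z - z'))" by (rule Cauchy_Schwarz_ineq2)
    also have "\<dots> \<le> (a * F) * (h * e)"
      using R0[of z] a0 F0 F[of z] by (intro mult_mono nk) (auto intro!: mult_mono)
    finally show "\<bar>force z \<bullet> kern \<eta> d (z - z')\<bar> \<le> a * F * (h * e)" .
  qed (use c0 b0 in auto)
  define q where "q = kap s * trace S + gp s * (x \<bullet> (S *v x))"
  have q: "\<bar>q\<bar> \<le> 5 * Cs * (norm (D z) * kap s)"
  proof -
    have "\<bar>kap s * trace S\<bar> \<le> kap s * (3 * norm S)" unfolding abs_mult using K0 by (simp add: mult_left_mono abs_trace_le)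
    moreover have "\<bar>gp s * (x \<bullet> (S *v x))\<bar> \<le> 2 * kap s * norm S"
    proof -
      have "\<bar>x \<bullet> (S *v x)\<bar> \<le> norm x * (norm S * norm x)"
        by (rule order_trans[OF Cauchy_Schwarz_ineq2]) (intro mult_left_mono norm_matrix_vector_le norm_ge_zero)
      also have "\<dots> = (norm x)\<^sup>2 * norm S" by (simp add: power2_eq_square)
      finally have "- gp s * \<bar>x \<bullet> (S *v x)\<bar> \<le> - gp s * ((norm x)\<^sup>2 * norm S)"
        using gp_nonpos[OF s(1)] by (intro mult_left_mono) auto
      also have "\<dots> \<le> (2 * kap s) * norm S"
        using mult_right_mono[OF gp_bound2(2)[OF s(1) _ s(3)], of "norm S"] by (simp add: mult.assoc)
      finally show ?thesis using gp_nonpos[OF s(1)] by (simp add: abs_mult)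
    qed
    ultimately have "\<bar>q\<bar> \<le> 5 * kap s * norm S" unfolding q_def by linarith
    also have "\<dots> \<le> 5 * kap s * (Cs * norm (D z))" using K0 by (intro mult_left_mono nS) auto
    finally show ?thesis by (simp add: mult_ac)
  qed
  have t5: "\<bar>w z * (w z' * R z') * (h * q)\<bar> \<le> c * c * (R z' * (h * (5 * Cs * (norm (D z) * kap s))))"
  proof -
    have "\<bar>w z * (w z' * R z') * (h * q)\<bar> = \<bar>w z\<bar> * \<bar>w z'\<bar> * (R z' * (h * \<bar>q\<bar>))"
      using R0[of z'] h by (simp add: abs_mult mult.assoc)
    also have "\<dots> \<le> c * c * (R z' * (h * (5 * Cs * (norm (D z) * kap s))))"
      using R0[of z'] h c0 by (intro mult_mono c q mult_left_mono) auto
    finally show ?thesis .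
  qed
  have sum1: "(\<Sum>j\<in>UNIV. mom z' $ j * (mom z \<bullet> dx (kern \<eta> d) (z - z') j)) = h * (kap s * (mom z \<bullet> mom z') + gp s * ((x \<bullet> mom z) * (x \<bullet> mom z')))"
    unfolding zz using sum_dx_kern(1)[OF d \<eta>(1) s(2), of "mom z'" "mom z" "snd z - snd z'"] by (simp add: h_def)
  have sum2: "(\<Sum>j\<in>UNIV. dx (kern \<eta> d) (z - z') j \<bullet> column j (flux z)) = h * (kap s * trace (flux z) + gp s * (x \<bullet> (flux z *v x)))"
    unfolding zz using sum_dx_kern(2)[OF d \<eta>(1) s(2), of "snd z - snd z'" "flux z"] by (simp add: h_def)
  have split: "interaction w (kern \<eta> d) R mom flux force z z' = main \<eta> d z z'
     + w z' * R z' * (dt w z * (mom z \<bullet> kern \<eta> d (z - z')))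
     + w z * ((mom z \<bullet> kern \<eta> d (z - z')) * (R z' * dt w z' + mom z' \<bullet> grad w z'))
     + w z' * R z' * (kern \<eta> d (z - z') \<bullet> (flux z *v grad w z))
     - w z * (w z' * R z') * (h * q)
     + w z * (w z' * R z') * (force z \<bullet> kern \<eta> d (z - z'))"
    unfolding interaction_def sum1 sum2
    unfolding flux_contractions main_def q_def S_def s_def[symmetric] x_def[symmetric] h_def[symmetric]
    by (simp add: algebra_simps)
  have "main \<eta> d z z' \<le> interaction w (kern \<eta> d) R mom flux force z z'
     + ((c * b) * (c * (a * (h * e))) + c * ((a * (h * e)) * (c * b)) + (c * b) * ((h * e) * ((2 + Cs) * a * c))
       + c * c * (R z' * (h * (5 * Cs * (norm (D z) * kap s)))) + c * (c * b) * (a * F * (h * e)))"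
    unfolding split using t1 t2 t4 t5 t6 by (simp only: abs_le_iff) linarith
  also have "(c * b) * (c * (a * (h * e))) + c * ((a * (h * e)) * (c * b)) + (c * b) * ((h * e) * ((2 + Cs) * a * c))
       + c * c * (R z' * (h * (5 * Cs * (norm (D z) * kap s)))) + c * (c * b) * (a * F * (h * e))
     = c\<^sup>2 * (4 + Cs + F) * (h * (a * (e * b))) + c\<^sup>2 * (5 * Cs) * (h * (R z' * norm (D z) * kap s))"
    by (simp add: algebra_simps power2_eq_square)
  also have "\<dots> \<le> C * (h * (a * (e * b))) + C * (h * (R z' * norm (D z) * kap s))"
    unfolding C Cs_def[symmetric]
    by (intro add_mono mult_right_mono mult_left_mono mult_nonneg_nonneg) (use Cs0 F0 h a0 e0 b0 R0[of z'] K0 in auto)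
  also have "\<dots> = C * err \<eta> d z z'"
    by (simp add: err_def h_def s_def e_def a_def b_def algebra_simps)
  finally show ?thesis by simp
qed

end

text \<open>The second point is integrated in space first, with a bound valid for almost every time
  s; only then is \<eta> integrated, which has mass 1. The result is therefore independent of how
  concentrated \<eta> is.\<close>

lemma nn_integral_time_coupled:
  fixes h :: "point \<Rightarrow> point \<Rightarrow> ennreal" and \<eta> :: "real \<Rightarrow> real"
  assumes [measurable]: "(\<lambda>(z, z'). h z z') \<in> borel_measurable (lborel \<Otimes>\<^sub>M lborel)" "Borel \<eta>"
    and \<eta>: "(\<integral>\<^sub>+t. ennreal (\<eta> t)) = 1"
    and le: "\<And>z. AE s in lborel. (\<integral>\<^sub>+y. h z (y, s)) \<le> a z"
  shows "(\<integral>\<^sub>+z z'. ennreal (\<eta> (snd z - snd z')) * h z z') \<le> (\<integral>\<^sub>+z. a z)"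
proof (rule nn_integral_mono)
  fix z :: "point"
  have hz: "Borel (h z)"
    using measurable_compose[OF measurable_Pair1'[of z lborel lborel] assms(1)] by simp
  then have "h z \<in> borel_measurable (borel \<Otimes>\<^sub>M borel)" by (simp add: borel_prod)
  note [measurable] = hz this
  have sndm[measurable]: "(snd :: point \<Rightarrow> _) \<in> borel_measurable borel"
    by (intro borel_measurable_continuous_onI continuous_intros)
  have "(\<integral>\<^sub>+z'. ennreal (\<eta> (snd z - snd z')) * h z z') = (\<integral>\<^sub>+s y. ennreal (\<eta> (snd z - s)) * h z (y, s))"
    by (subst nn_integral_time_slices) auto
  also have "\<dots> = (\<integral>\<^sub>+s. ennreal (\<eta> (snd z - s)) * (\<integral>\<^sub>+y. h z (y, s)))"
    by (intro nn_integral_cong nn_integral_cmult) measurable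
  also have "\<dots> \<le> (\<integral>\<^sub>+s. ennreal (\<eta> (snd z - s)) * a z)"
    using le[of z] by (intro nn_integral_mono_AE) (auto elim!: eventually_mono intro: mult_left_mono)
  also have "\<dots> = a z"
    using nn_integral_reflect[of "\<lambda>s. ennreal (\<eta> s)" "snd z"] \<eta> by (simp add: nn_integral_multc)
  finally show "(\<integral>\<^sub>+z'. ennreal (\<eta> (snd z - snd z')) * h z z') \<le> a z" .
qed

text \<open>The same with the first point integrated first; evenness of \<eta> makes the coupling
  symmetric in the two times.\<close>

lemma nn_integral_time_coupled_swap:
  fixes h :: "point \<Rightarrow> point \<Rightarrow> ennreal" and \<eta> :: "real \<Rightarrow> real"
  assumes [measurable]: "(\<lambda>(z, z'). h z z') \<in> borel_measurable (lborel \<Otimes>\<^sub>M lborel)" "Borel \<eta>"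
    and \<eta>: "(\<integral>\<^sub>+t. ennreal (\<eta> t)) = 1" "\<And>t. \<eta> (- t) = \<eta> t"
    and le: "\<And>z'. AE s in lborel. (\<integral>\<^sub>+x. h (x, s) z') \<le> a z'"
  shows "(\<integral>\<^sub>+z z'. ennreal (\<eta> (snd z - snd z')) * h z z') \<le> (\<integral>\<^sub>+z. a z)"
proof -
  have sndm[measurable]: "(snd :: point \<Rightarrow> _) \<in> borel_measurable borel"
    by (intro borel_measurable_continuous_onI continuous_intros)
  have hs[measurable]: "(\<lambda>(z, z'). h z' z) \<in> borel_measurable (lborel \<Otimes>\<^sub>M lborel)"
    using measurable_compose[OF measurable_pair_swap' assms(1)] by (simp add: split_beta')
  have "(\<integral>\<^sub>+z z'. ennreal (\<eta> (snd z - snd z')) * h z z')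
      = (\<integral>\<^sub>+z' z. ennreal (\<eta> (snd z - snd z')) * h z z')"
    by (rule lborel_pair.Fubini') measurable
  also have "\<dots> = (\<integral>\<^sub>+z' z. ennreal (\<eta> (snd z' - snd z)) * h z z')"
    by (intro nn_integral_cong) (metis \<eta>(2) minus_diff_eq)
  also have "\<dots> \<le> (\<integral>\<^sub>+z. a z)"
    by (rule nn_integral_time_coupled[where h="\<lambda>z z'. h z' z", OF hs assms(2) \<eta>(1) le])
  finally show ?thesis .
qed

section \<open>Integration of the pointwise inequality over pairs of points\<close>

context flow
begin

lemma measurable_flow[measurable]:
  "Borel P" "Borel U" "Borel D"
  by (rule meas)+

lemma measurable_fst_snd[measurable]:
  "(fst :: point \<Rightarrow> _) \<in> borel_measurable borel" "(snd :: point \<Rightarrow> _) \<in> borel_measurable borel"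
  by (intro borel_measurable_continuous_onI continuous_intros)+

lemma measurable_sep[measurable]: "(\<lambda>(z, z'). sep d z z') \<in> borel_measurable (lborel \<Otimes>\<^sub>M lborel)"
  unfolding sep_def by measurable

lemma measurable_sep'[measurable]: "(\<lambda>p. sep d (fst p) (snd p)) \<in> borel_measurable (lborel \<Otimes>\<^sub>M lborel)"
  using measurable_sep[of d] by (simp add: split_beta')

lemma measurable_pair_terms:
  assumes [measurable]: "Borel \<eta>"
  shows "(\<lambda>(z, z'). good \<eta> d z z') \<in> borel_measurable (lborel \<Otimes>\<^sub>M lborel)"
    "(\<lambda>(z, z'). err \<eta> d z z') \<in> borel_measurable (lborel \<Otimes>\<^sub>M lborel)"
    "(\<lambda>(z, z'). rem \<eta> d z z') \<in> borel_measurable (lborel \<Otimes>\<^sub>M lborel)"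
  unfolding good_def err_def rem_def split_beta' by measurable

lemma pair_terms_nonneg:
  assumes d: "d > 0" and \<eta>: "\<And>t. \<eta> t \<ge> 0"
  shows "good \<eta> d z z' \<ge> 0" "err \<eta> d z z' \<ge> 0" "rem \<eta> d z z' \<ge> 0"
  unfolding good_def err_def rem_def
  by (auto intro!: mult_nonneg_nonneg add_nonneg_nonneg simp: w0 \<eta> R0 P0 kap_nonneg lo_nonneg)

text \<open>The interaction integrates to 0 over pairs, also after exchanging the two points. Adding
  both copies to the pointwise lower bound leaves the good term against error and remainder, each
  counted for both orders; this is the factor 2.\<close>

theorem good_integral_le:
  assumes d: "d > 0" and \<eta>: "smooth \<eta>" "\<And>t. \<eta> t \<ge> 0" "\<And>t. \<eta> (- t) = \<eta> t"
    and c: "\<And>z. \<bar>w z\<bar> \<le> c" "\<And>z. \<bar>dt w z\<bar> \<le> c" "\<And>z. norm (grad w z) \<le> c"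
    and C: "C = c\<^sup>2 * (4 + 5 * (2 * \<bar>\<nu>1\<bar> + 6 * \<bar>\<nu>2\<bar>) + F)"
  shows "(\<integral>\<^sub>+z z'. ennreal (good \<eta> d z z'))
    \<le> 2 * (ennreal C * (\<integral>\<^sub>+z z'. ennreal (err \<eta> d z z')) + (\<integral>\<^sub>+z z'. ennreal (rem \<eta> d z z')))"
proof -
  define N where "N = (lborel \<Otimes>\<^sub>M lborel :: (point \<times> point) measure)"
  have [measurable]: "Borel \<eta>"
    by (intro borel_measurable_continuous_onI smooth_continuous \<eta>)
  note [measurable] = measurable_pair_terms[OF this]
  have F0: "F \<ge> 0" using F[of 0] norm_ge_zero[of "f 0"] by linarith
  have C0: "C \<ge> 0" unfolding C using F0 by (intro mult_nonneg_nonneg add_nonneg_nonneg) auto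
  define X where "X = (\<lambda>z z'. C * err \<eta> d z z' + rem \<eta> d z z')"
  have X0: "X z z' \<ge> 0" for z z'
    unfolding X_def using C0 pair_terms_nonneg[where \<eta>=\<eta>, OF d \<eta>(2)] by auto
  have Xm[measurable]: "(\<lambda>(z, z'). X z z') \<in> borel_measurable (lborel \<Otimes>\<^sub>M lborel)"
    using borel_measurable_add[OF borel_measurable_times[OF borel_measurable_const[of C] measurable_pair_terms(2)] measurable_pair_terms(3)]
    unfolding X_def by (simp add: split_beta')
  have Xint: "(\<integral>\<^sub>+z z'. ennreal (X z z'))
      = ennreal C * (\<integral>\<^sub>+z z'. ennreal (err \<eta> d z z')) + (\<integral>\<^sub>+z z'. ennreal (rem \<eta> d z z'))"
  proof -
    have "ennreal (X z z') = ennreal C * ennreal (err \<eta> d z z') + ennreal (rem \<eta> d z z')" for z z'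
      unfolding X_def using C0 pair_terms_nonneg[where \<eta>=\<eta>, OF d \<eta>(2)] by (simp add: ennreal_mult)
    then show ?thesis by (simp add: nn_integral_add nn_integral_cmult)
  qed
  have prod: "(\<integral>\<^sub>+z z'. g z z') = (\<integral>\<^sup>+p. (\<lambda>(z, z'). g z z') p \<partial>N)"
    if "(\<lambda>(z, z'). g z z') \<in> borel_measurable (lborel \<Otimes>\<^sub>M lborel)" for g :: "point \<Rightarrow> point \<Rightarrow> ennreal"
    unfolding N_def using lborel.nn_integral_fst[OF that] by simp
  show ?thesis
  proof (cases "(\<integral>\<^sub>+z z'. ennreal (X z z')) = \<infinity>")
    \<comment> \<open>An infinite right-hand side leaves nothing to show; otherwise X is integrable
      and may be combined with the signed interaction.\<close>
    case True
    then show ?thesis unfolding Xint[symmetric] by (simp add: ennreal_mult_top)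
  next
    case False
    let ?\<Phi> = "\<lambda>(z, z'). interaction w (kern \<eta> d) R mom flux force z z'"
    note \<Phi> = interaction_identity[OF smooth_kern[OF \<eta>(1) d], folded N_def]
    have Xi: "integrable N (\<lambda>(z, z'). X z z')"
      unfolding integrable_iff_bounded
    proof
      show "(\<lambda>(z, z'). X z z') \<in> borel_measurable N" unfolding N_def by (rule Xm)
      have "(\<integral>\<^sup>+p. ennreal (norm ((\<lambda>(z, z'). X z z') p)) \<partial>N) = (\<integral>\<^sup>+p. (\<lambda>(z, z'). ennreal (X z z')) p \<partial>N)"
        using X0 by (intro nn_integral_cong) auto
      also have "\<dots> = (\<integral>\<^sub>+z z'. ennreal (X z z'))" by (rule prod[symmetric]) measurable
      finally show "(\<integral>\<^sup>+p. ennreal (norm ((\<lambda>(z, z'). X z z') p)) \<partial>N) < \<infinity>" using False by (simp add: less_top)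
    qed
    have sw: "integrable N (\<lambda>p. g (snd p, fst p))" "(\<integral>p. g (snd p, fst p) \<partial>N) = (\<integral>p. g p \<partial>N)"
      if "integrable N g" for g :: "_ \<Rightarrow> real"
    proof -
      show "integrable N (\<lambda>p. g (snd p, fst p))"
        using lborel_pair.integrable_product_swap[OF that[unfolded N_def]] unfolding N_def by (simp add: split_beta')
      show "(\<integral>p. g (snd p, fst p) \<partial>N) = (\<integral>p. g p \<partial>N)"
        using lborel_pair.integral_product_swap[of g] that unfolding N_def by (simp add: split_beta')
    qed
    \<comment> \<open>Since Y >= h >= 0, the Bochner integral of Y, computed from the identity, is
      also its nonnegative integral and bounds that of h.\<close>
    define Y where "Y = (\<lambda>p. ?\<Phi> p + ?\<Phi> (snd p, fst p) + (\<lambda>(z, z'). X z z') p + (\<lambda>(z, z'). X z z') (snd p, fst p))"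
    have Yi: "integrable N Y" unfolding Y_def
      by (intro Bochner_Integration.integrable_add sw \<Phi>(1) Xi)
    have "(\<integral>p. Y p \<partial>N) = (\<integral>p. ?\<Phi> p \<partial>N) + (\<integral>p. ?\<Phi> (snd p, fst p) \<partial>N) + (\<integral>p. (\<lambda>(z, z'). X z z') p \<partial>N) + (\<integral>p. (\<lambda>(z, z'). X z z') (snd p, fst p) \<partial>N)"
      unfolding Y_def
      by (simp only: Bochner_Integration.integral_add Bochner_Integration.integrable_add sw(1)[OF \<Phi>(1)] sw(1)[OF Xi] \<Phi>(1) Xi)
    then have Yv: "(\<integral>p. Y p \<partial>N) = 2 * (\<integral>p. (\<lambda>(z, z'). X z z') p \<partial>N)"
      unfolding sw(2)[OF \<Phi>(1)] sw(2)[OF Xi] \<Phi>(2) by simp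
    define h where "h = (\<lambda>p. 1/2 * ((\<lambda>(z, z'). good \<eta> d z z') p + (\<lambda>(z, z'). good \<eta> d z z') (snd p, fst p)))"
    have hY: "h p \<le> Y p" for p
    proof -
      obtain z z' where p: "p = (z, z')" by (cases p)
      have "1/2 * (good \<eta> d z z' + good \<eta> d z' z) \<le> main \<eta> d z z' + main \<eta> d z' z + rem \<eta> d z z' + rem \<eta> d z' z"
        by (rule main_lower_bound[where \<eta>=\<eta>, OF d \<eta>(2) \<eta>(3)])
      also have "\<dots> \<le> (interaction w (kern \<eta> d) R mom flux force z z' + C * err \<eta> d z z')
          + (interaction w (kern \<eta> d) R mom flux force z' z + C * err \<eta> d z' z) + rem \<eta> d z z' + rem \<eta> d z' z"
        by (intro add_right_mono add_mono interaction_main[OF d \<eta>(1,2) c C])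
      finally show ?thesis by (simp add: p h_def Y_def X_def)
    qed
    have "(\<integral>\<^sub>+z z'. ennreal (good \<eta> d z z')) = (\<integral>\<^sup>+p. ennreal (h p) \<partial>N)"
    proof -
      let ?g = "\<lambda>z z'. ennreal (1/2) * ennreal (good \<eta> d z z')"
      have gm[measurable]: "(\<lambda>(z, z'). ?g z z') \<in> borel_measurable (lborel \<Otimes>\<^sub>M lborel)" by measurable
      have gs[measurable]: "(\<lambda>(z, z'). ?g z' z) \<in> borel_measurable (lborel \<Otimes>\<^sub>M lborel)"
        using measurable_compose[OF measurable_pair_swap' gm] by (simp add: split_beta')
      have "(\<integral>\<^sup>+p. ennreal (h p) \<partial>N) = (\<integral>\<^sup>+p. (\<lambda>(z, z'). ?g z z') p + (\<lambda>(z, z'). ?g z' z) p \<partial>N)"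
      proof (intro nn_integral_cong)
        fix p :: "point \<times> point"
        obtain z z' where p: "p = (z, z')" by (cases p)
        have e: "ennreal (1/2 * (a + b)) = ennreal (1/2) * ennreal a + ennreal (1/2) * ennreal b" if "a \<ge> 0" "b \<ge> 0" for a b :: real
          using ennreal_plus[of "1/2 * a" "1/2 * b"] ennreal_mult[of "1/2" a] ennreal_mult[of "1/2" b] that
          unfolding distrib_left by simp
        show "ennreal (h p) = (\<lambda>(z, z'). ?g z z') p + (\<lambda>(z, z'). ?g z' z) p"
          unfolding h_def p prod.case fst_conv snd_conv by (intro e pair_terms_nonneg(1)[where \<eta>=\<eta>, OF d \<eta>(2)])
      qed
      also have "\<dots> = (\<integral>\<^sup>+p. (\<lambda>(z, z'). ?g z z') p \<partial>N) + (\<integral>\<^sup>+p. (\<lambda>(z, z'). ?g z' z) p \<partial>N)"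
        unfolding N_def by (rule nn_integral_add[OF gm gs])
      also have "(\<integral>\<^sup>+p. (\<lambda>(z, z'). ?g z' z) p \<partial>N) = (\<integral>\<^sub>+z z'. ?g z' z)"
        by (rule prod[OF gs, symmetric])
      also have "\<dots> = (\<integral>\<^sub>+z' z. ?g z' z)"
        by (rule lborel_pair.Fubini') (rule gm)
      also have "\<dots> = (\<integral>\<^sup>+p. (\<lambda>(z, z'). ?g z z') p \<partial>N)" by (rule prod[OF gm])
      also have "(\<integral>\<^sup>+p. (\<lambda>(z, z'). ?g z z') p \<partial>N) + (\<integral>\<^sup>+p. (\<lambda>(z, z'). ?g z z') p \<partial>N)
          = (\<integral>\<^sup>+p. (\<lambda>(z, z'). ennreal (good \<eta> d z z')) p \<partial>N)"
      proof -
        have "(\<integral>\<^sup>+p. (\<lambda>(z, z'). ?g z z') p \<partial>N) + (\<integral>\<^sup>+p. (\<lambda>(z, z'). ?g z z') p \<partial>N) = (\<integral>\<^sup>+p. (\<lambda>(z, z'). ?g z z') p + (\<lambda>(z, z'). ?g z z') p \<partial>N)"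
          unfolding N_def by (rule nn_integral_add[OF gm gm, symmetric])
        also have "\<dots> = (\<integral>\<^sup>+p. (\<lambda>(z, z'). ennreal (good \<eta> d z z')) p \<partial>N)"
        proof (intro nn_integral_cong)
          fix p :: "point \<times> point"
          obtain z z' where p: "p = (z, z')" by (cases p)
          have e: "ennreal (1/2) * ennreal a + ennreal (1/2) * ennreal a = ennreal a" if "a \<ge> 0" for a :: real
            using ennreal_plus[of "1/2 * a" "1/2 * a"] ennreal_mult[of "1/2" a] that by simp
          show "(\<lambda>(z, z'). ?g z z') p + (\<lambda>(z, z'). ?g z z') p = (\<lambda>(z, z'). ennreal (good \<eta> d z z')) p"
            unfolding p prod.case by (intro e pair_terms_nonneg(1)[where \<eta>=\<eta>, OF d \<eta>(2)])
        qed
        finally show ?thesis .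
      qed
      finally show ?thesis using prod[of "\<lambda>z z'. ennreal (good \<eta> d z z')"] by simp
    qed
    also have "\<dots> \<le> (\<integral>\<^sup>+p. ennreal (Y p) \<partial>N)" by (intro nn_integral_mono ennreal_leI hY)
    also have "\<dots> = ennreal (\<integral>p. Y p \<partial>N)"
    proof (rule nn_integral_eq_integral[OF Yi])
      have "0 \<le> h p" for p unfolding h_def using pair_terms_nonneg(1)[where \<eta>=\<eta>, OF d \<eta>(2)] by (auto simp: split_beta')
      then show "AE p in N. 0 \<le> Y p" using hY by (intro AE_I2) (meson order_trans)
    qed
    also have "\<dots> = 2 * ennreal (\<integral>p. (\<lambda>(z, z'). X z z') p \<partial>N)"
      unfolding Yv using X0 by (subst ennreal_mult) (auto intro!: integral_nonneg_AE)
    also have "ennreal (\<integral>p. (\<lambda>(z, z'). X z z') p \<partial>N) = (\<integral>\<^sup>+p. ennreal ((\<lambda>(z, z'). X z z') p) \<partial>N)"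
      using X0 by (intro nn_integral_eq_integral[symmetric] Xi) auto
    also have "\<dots> = (\<integral>\<^sub>+z z'. ennreal (X z z'))"
      by (subst prod) (auto intro!: nn_integral_cong)
    finally show ?thesis unfolding Xint .
  qed
qed

end

section \<open>Bounds for the error terms\<close>

text \<open>The exponent 3 is dual to 3/2, and the cube of \<open>lo\<close> has exactly the
  borderline singularity treated in \<open>nn_integral_ell_cutoff\<close>.\<close>

lemma lo_cube: assumes "s > 0" shows "lo s ^ 3 = ell s * s powr (-3/2)"
proof -
  have e: "ell s > 0" using ell_ge_3[OF assms] by simp
  have "lo s ^ 3 = (ell s powr (1/3)) ^ 3 * (s powr (-1/2)) ^ 3" by (simp add: lo_def power_mult_distrib)
  also have "(ell s powr (1/3)) ^ 3 = ell s" using e by (subst powr_power) auto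
  also have "(s powr (-1/2)) ^ 3 = s powr (-3/2)" using assms by (subst powr_power) auto
  finally show ?thesis .
qed

text \<open>Points of the ball are at most 2B apart, so after the substitution z = x - y the bound
  no longer depends on x.\<close>

lemma nn_integral_reflect_ball:
  fixes g :: "real^3 \<Rightarrow> ennreal"
  assumes [measurable]: "Borel g" and x: "norm x \<le> B"
  shows "(\<integral>\<^sub>+y. g (x - y) * indicator (cball 0 B) y) \<le> (\<integral>\<^sub>+z. g z * indicator {..2 * B} (norm z))"
proof -
  have "(\<integral>\<^sub>+y. g (x - y) * indicator (cball 0 B) y) \<le> (\<integral>\<^sub>+y. g (x - y) * indicator {..2 * B} (norm (x - y)))"
  proof (intro nn_integral_mono mult_left_mono)
    fix y
    have "norm (x - y) \<le> 2 * B" if "norm y \<le> B" using norm_triangle_ineq4[of x y] x that by linarith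
    then show "(indicator (cball 0 B) y :: ennreal) \<le> indicator {..2 * B} (norm (x - y))" by (auto simp: indicator_def)
  qed simp
  also have "\<dots> = (\<integral>\<^sub>+z. g z * indicator {..2 * B} (norm z))"
    using nn_integral_reflect[of "\<lambda>z. g z * indicator {..2 * B} (norm z)" x] by simp
  finally show ?thesis .
qed

text \<open>The constant is chosen before g, so it serves all integrands below the same power; the
  singular point z = 0 is a null set.\<close>

lemma nn_integral_le_powr_ball:
  assumes D: "D > 0" and p: "p < 3" and K: "K \<ge> 0"
  obtains M where "M > 0" "\<And>g :: real^3 \<Rightarrow> real. (\<And>z. z \<noteq> 0 \<Longrightarrow> norm z \<le> D \<Longrightarrow> g z \<le> K * norm z powr - p) \<Longrightarrow>
    (\<integral>\<^sub>+z. ennreal (g z) * indicator {..D} (norm z)) \<le> ennreal M"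
proof -
  define I where "I = (\<integral>\<^sub>+(z::real^3). ennreal (norm z powr - p) * indicator {..D} (norm z))"
  have I: "I < \<infinity>" unfolding I_def by (rule nn_integral_ball_powr[OF D p])
  show ?thesis
  proof (rule that[of "K * enn2real I + 1"])
    show "K * enn2real I + 1 > 0" using K by (intro add_nonneg_pos mult_nonneg_nonneg) auto
    fix g :: "real^3 \<Rightarrow> real"
    assume g: "\<And>z. z \<noteq> 0 \<Longrightarrow> norm z \<le> D \<Longrightarrow> g z \<le> K * norm z powr - p"
    have "(\<integral>\<^sub>+z. ennreal (g z) * indicator {..D} (norm z)) \<le> (\<integral>\<^sub>+(z::real^3). ennreal K * (ennreal (norm z powr - p) * indicator {..D} (norm z)))"
    proof (rule nn_integral_mono_AE)
      have "AE z in lborel. z \<noteq> (0::real^3)" by (rule AE_lborel_singleton)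
      then show "AE z in lborel. ennreal (g z) * indicator {..D} (norm z) \<le> ennreal K * (ennreal (norm z powr - p) * indicator {..D} (norm z))"
      proof eventually_elim
        case (elim z)
        then show ?case using g[of z] K by (auto simp: indicator_def simp flip: ennreal_mult intro!: ennreal_leI)
      qed
    qed
    also have "\<dots> = ennreal K * I" unfolding I_def by (rule nn_integral_cmult) measurable
    also have "\<dots> = ennreal (K * enn2real I)" using I K by (simp add: ennreal_mult)
    also have "\<dots> \<le> ennreal (K * enn2real I + 1)" by (intro ennreal_leI) simp
    finally show "(\<integral>\<^sub>+z. ennreal (g z) * indicator {..D} (norm z)) \<le> ennreal (K * enn2real I + 1)" .
  qed
qed

text \<open>Stated as a predicate so that \<open>M\<close>, chosen from B alone, can be a parameter
  of a locale and of the constants defined there.\<close>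

definition kernel_const :: "real \<Rightarrow> real \<Rightarrow> bool" where
  "kernel_const B M \<longleftrightarrow> M > 0 \<and> (\<forall>d x. 0 < d \<longrightarrow> norm x \<le> B \<longrightarrow>
     (d \<le> 1 \<longrightarrow> (\<integral>\<^sub>+(y::real^3). ennreal ((ell ((norm (x - y))\<^sup>2 + d) powr (4/3)) ^ 6) * indicator (cball 0 B) y) \<le> ennreal M) \<and>
     (d \<le> 1 \<longrightarrow> (\<integral>\<^sub>+(y::real^3). ennreal ((kap ((norm (x - y))\<^sup>2 + d))\<^sup>2) * indicator (cball 0 B) y) \<le> ennreal M) \<and>
     (\<forall>L\<ge>3. (\<integral>\<^sub>+(y::real^3). ennreal (lo ((norm (x - y))\<^sup>2 + d) ^ 3) * indicator {..L} (ell ((norm (x - y))\<^sup>2 + d)) * indicator (cball 0 B) y)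
        \<le> ennreal (M * L\<^sup>2)))"

text \<open>The first two bounds are subcritical: for d <= 1 all arguments satisfy s <= 4 B^2 + 1,
  and \<open>ell_powr_le\<close> trades the logarithm for a small power. The third is critical and
  owes its finiteness to the cutoff ell <= L.\<close>

lemma kernel_moments:
  assumes B: "B \<ge> 1"
  obtains M where "M > 0"
    "\<And>d x. 0 < d \<Longrightarrow> d \<le> 1 \<Longrightarrow> norm x \<le> B \<Longrightarrow>
      (\<integral>\<^sub>+(y::real^3). ennreal ((ell ((norm (x - y))\<^sup>2 + d) powr (4/3)) ^ 6) * indicator (cball 0 B) y) \<le> ennreal M"
    "\<And>d x. 0 < d \<Longrightarrow> d \<le> 1 \<Longrightarrow> norm x \<le> B \<Longrightarrow>
      (\<integral>\<^sub>+(y::real^3). ennreal ((kap ((norm (x - y))\<^sup>2 + d))\<^sup>2) * indicator (cball 0 B) y) \<le> ennreal M"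
    "\<And>d x L. 0 < d \<Longrightarrow> norm x \<le> B \<Longrightarrow> L \<ge> 3 \<Longrightarrow>
      (\<integral>\<^sub>+(y::real^3). ennreal (lo ((norm (x - y))\<^sup>2 + d) ^ 3) * indicator {..L} (ell ((norm (x - y))\<^sup>2 + d)) * indicator (cball 0 B) y) \<le> ennreal (M * L\<^sup>2)"
proof -
  define S where "S = 4 * B\<^sup>2 + 1"
  have S: "S > 0" by (simp add: S_def add_nonneg_pos)
  obtain C where C: "C > 0" "\<And>s. 0 < s \<Longrightarrow> s \<le> S \<Longrightarrow> ell s powr (4/3) \<le> C * s powr (-1/8)"
    using ell_powr_le[OF S] by metis
  have sS: "(norm z)\<^sup>2 + d \<le> S" if "d \<le> 1" "norm z \<le> 2 * B" for z :: "real^3" and d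
    using power_mono[OF that(2), of 2] that(1) by (simp add: S_def power2_eq_square)
  have ps: "((norm z)\<^sup>2 + d) powr - q \<le> norm z powr - (2 * q)" if "z \<noteq> 0" "d > 0" "q > 0" for z :: "real^3" and d q
  proof -
    have "((norm z)\<^sup>2 + d) powr - q \<le> ((norm z)\<^sup>2) powr - q" using that by (intro powr_mono2') auto
    also have "((norm z)\<^sup>2) powr - q = norm z powr - (2 * q)"
      using powr_powr[of "norm z" 2 "- q"] that(1) by (simp add: powr_numeral[of "norm z"])
    finally show ?thesis .
  qed
  have B2: "2 * B > 0" using B by simp
  have "C ^ 6 \<ge> 0" "C\<^sup>2 \<ge> 0" using C(1) by simp_all
  note K = this
  have p: "3/2 < (3::real)" "5/2 < (3::real)" by simp_all
  obtain M1 where M1: "M1 > 0" "\<And>g :: real^3 \<Rightarrow> real. (\<And>z. z \<noteq> 0 \<Longrightarrow> norm z \<le> 2 * B \<Longrightarrow> g z \<le> C ^ 6 * norm z powr - (3/2)) \<Longrightarrow>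
    (\<integral>\<^sub>+z. ennreal (g z) * indicator {..2 * B} (norm z)) \<le> ennreal M1"
    using nn_integral_le_powr_ball[OF B2 p(1) K(1)] by blast
  obtain M2 where M2: "M2 > 0" "\<And>g :: real^3 \<Rightarrow> real. (\<And>z. z \<noteq> 0 \<Longrightarrow> norm z \<le> 2 * B \<Longrightarrow> g z \<le> C\<^sup>2 * norm z powr - (5/2)) \<Longrightarrow>
    (\<integral>\<^sub>+z. ennreal (g z) * indicator {..2 * B} (norm z)) \<le> ennreal M2"
    using nn_integral_le_powr_ball[OF B2 p(2) K(2)] by blast
  define M3 where "M3 = 4 * pi * (ln (2 * B) + 2)"
  have M3: "M3 > 0" unfolding M3_def using B by (intro mult_pos_pos add_nonneg_pos) auto
  show ?thesis
  proof (rule that[of "M1 + M2 + M3"])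
    show "M1 + M2 + M3 > 0" using M1 M2 M3 by simp
    fix d :: real and x :: "real^3" assume d: "0 < d" and x: "norm x \<le> B"
    have pos: "(norm z)\<^sup>2 + d > 0" for z :: "real^3" using d by (simp add: add_nonneg_pos)
    {
      assume d1: "d \<le> 1"
      have "(\<integral>\<^sub>+(y::real^3). ennreal ((ell ((norm (x - y))\<^sup>2 + d) powr (4/3)) ^ 6) * indicator (cball 0 B) y)
         \<le> (\<integral>\<^sub>+(z::real^3). ennreal ((ell ((norm z)\<^sup>2 + d) powr (4/3)) ^ 6) * indicator {..2 * B} (norm z))"
        by (rule nn_integral_reflect_ball[where g="\<lambda>z. ennreal ((ell ((norm z)\<^sup>2 + d) powr (4/3)) ^ 6)", OF _ x]) measurable
      also have "\<dots> \<le> ennreal M1"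
      proof (rule M1(2))
        fix z :: "real^3" assume z: "z \<noteq> 0" "norm z \<le> 2 * B"
        have "(ell ((norm z)\<^sup>2 + d) powr (4/3)) ^ 6 \<le> (C * ((norm z)\<^sup>2 + d) powr (-1/8)) ^ 6"
          by (intro power_mono C(2) pos sS d1 z) simp
        also have "\<dots> = C ^ 6 * ((norm z)\<^sup>2 + d) powr - (3/4)"
          unfolding power_mult_distrib using pos[of z] by (subst powr_power) auto
        also have "\<dots> \<le> C ^ 6 * norm z powr - (3/2)" using ps[OF z(1) d, of "3/4"] K by (intro mult_left_mono) auto
        finally show "(ell ((norm z)\<^sup>2 + d) powr (4/3)) ^ 6 \<le> C ^ 6 * norm z powr - (3/2)" .
      qed
      also have "\<dots> \<le> ennreal (M1 + M2 + M3)" using M2 M3 by (intro ennreal_leI) simp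
      finally show "(\<integral>\<^sub>+(y::real^3). ennreal ((ell ((norm (x - y))\<^sup>2 + d) powr (4/3)) ^ 6) * indicator (cball 0 B) y) \<le> ennreal (M1 + M2 + M3)" .
      have "(\<integral>\<^sub>+(y::real^3). ennreal ((kap ((norm (x - y))\<^sup>2 + d))\<^sup>2) * indicator (cball 0 B) y)
         \<le> (\<integral>\<^sub>+(z::real^3). ennreal ((kap ((norm z)\<^sup>2 + d))\<^sup>2) * indicator {..2 * B} (norm z))"
        by (rule nn_integral_reflect_ball[where g="\<lambda>z. ennreal ((kap ((norm z)\<^sup>2 + d))\<^sup>2)", OF _ x]) measurable
      also have "\<dots> \<le> ennreal M2"
      proof (rule M2(2))
        fix z :: "real^3" assume z: "z \<noteq> 0" "norm z \<le> 2 * B"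
        let ?s = "(norm z)\<^sup>2 + d"
        have "kap ?s \<le> (C * ?s powr (-1/8)) * ?s powr (-1/2)"
          unfolding kap_def by (intro mult_right_mono C(2) pos sS d1 z) simp
        also have "\<dots> = C * ?s powr (-5/8)" unfolding mult.assoc powr_add[symmetric] by simp
        finally have "(kap ?s)\<^sup>2 \<le> (C * ?s powr (-5/8))\<^sup>2" by (intro power_mono kap_nonneg)
        also have "\<dots> = C\<^sup>2 * ?s powr - (5/4)"
          unfolding power_mult_distrib using pos[of z] by (subst powr_power) auto
        also have "\<dots> \<le> C\<^sup>2 * norm z powr - (5/2)" using ps[OF z(1) d, of "5/4"] K by (intro mult_left_mono) auto
        finally show "(kap ?s)\<^sup>2 \<le> C\<^sup>2 * norm z powr - (5/2)" .
      qed
      also have "\<dots> \<le> ennreal (M1 + M2 + M3)" using M1 M3 by (intro ennreal_leI) simp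
      finally show "(\<integral>\<^sub>+(y::real^3). ennreal ((kap ((norm (x - y))\<^sup>2 + d))\<^sup>2) * indicator (cball 0 B) y) \<le> ennreal (M1 + M2 + M3)" .
    }
    fix L :: real assume L: "L \<ge> 3"
    let ?g = "\<lambda>z::real^3. ennreal (lo ((norm z)\<^sup>2 + d) ^ 3) * indicator {..L} (ell ((norm z)\<^sup>2 + d))"
    have [measurable]: "Borel (?g)"
      by measurable
    have "(\<integral>\<^sub>+(y::real^3). ?g (x - y) * indicator (cball 0 B) y) \<le> (\<integral>\<^sub>+(z::real^3). ?g z * indicator {..2 * B} (norm z))"
      by (rule nn_integral_reflect_ball[OF _ x]) measurable
    also have "\<dots> = (\<integral>\<^sub>+(z::real^3). ennreal (ell ((norm z)\<^sup>2 + d) * ((norm z)\<^sup>2 + d) powr (-3/2)) * indicator {z. norm z \<le> 2 * B \<and> ell ((norm z)\<^sup>2 + d) \<le> L} z)"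
      unfolding lo_cube[OF pos] by (intro nn_integral_cong) (auto simp: indicator_def)
    also have "\<dots> \<le> ennreal (M3 * L\<^sup>2)" unfolding M3_def using B by (intro nn_integral_ell_cutoff L d) simp
    also have "\<dots> \<le> ennreal ((M1 + M2 + M3) * L\<^sup>2)" using M1 M2 by (intro ennreal_leI mult_right_mono) auto
    finally show "(\<integral>\<^sub>+(y::real^3). ?g (x - y) * indicator (cball 0 B) y) \<le> ennreal ((M1 + M2 + M3) * L\<^sup>2)" .
  qed
qed

lemma kernel_const_exists: "B \<ge> 1 \<Longrightarrow> \<exists>M. kernel_const B M"
  unfolding kernel_const_def by (rule kernel_moments[of B]) blast+

section \<open>Young's inequality for the exponents 3/2 and 3\<close>

lemma square_mult_le_cubes:
  fixes a b :: real assumes "a \<ge> 0" "b \<ge> 0" shows "a\<^sup>2 * b \<le> a ^ 3 + b ^ 3"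
proof (cases "b \<le> a")
  case True
  then have "a\<^sup>2 * b \<le> a\<^sup>2 * a" by (intro mult_left_mono) auto
  then show ?thesis using assms zero_le_power[OF assms(2), of 3] unfolding power2_eq_square power3_eq_cube by linarith
next
  case False
  then have "a\<^sup>2 * b \<le> b\<^sup>2 * b" using assms by (intro mult_right_mono power_mono) auto
  then show ?thesis using assms zero_le_power[OF assms(1), of 3] unfolding power2_eq_square power3_eq_cube by linarith
qed

lemma powr_three_halves: "r \<ge> 0 \<Longrightarrow> r powr (3/2) = sqrt r ^ 3" for r :: real
proof (cases "r = 0")
  case False
  assume "r \<ge> 0"
  then have "sqrt r ^ 3 = (r powr (1/2)) ^ 3" by (simp add: powr_half_sqrt)
  also have "\<dots> = r powr (3/2)" using False by (subst powr_power) auto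
  finally show ?thesis by simp
qed simp

lemma mult_le_powr_three_halves:
  fixes r e :: real
  assumes "r \<ge> 0" "e \<ge> 0" shows "r * e \<le> r powr (3/2) + e ^ 3"
  using square_mult_le_cubes[of "sqrt r" e] assms by (simp add: powr_three_halves)

lemma Young_scaled:
  fixes r e \<tau> :: real
  assumes "r \<ge> 0" "e \<ge> 0" "\<tau> > 0" shows "r * e \<le> \<tau> * r powr (3/2) + e ^ 3 / \<tau>\<^sup>2"
proof -
  have "r * (e / \<tau>) \<le> r powr (3/2) + (e / \<tau>) ^ 3" using assms by (intro mult_le_powr_three_halves) auto
  then have "\<tau> * (r * (e / \<tau>)) \<le> \<tau> * (r powr (3/2) + (e / \<tau>) ^ 3)" using assms by (intro mult_left_mono) auto
  also have "\<tau> * (r powr (3/2) + (e / \<tau>) ^ 3) = \<tau> * r powr (3/2) + e ^ 3 / \<tau>\<^sup>2"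
    using assms(3) by (simp add: distrib_left power3_eq_cube power2_eq_square)
  finally show ?thesis using assms(3) by simp
qed

text \<open>All quantitative data are parameters: \<open>E2\<close> bounds the gradient norm over
  space and time, \<open>CS\<close> is the constant in Sobolev's inequality for the sixth power,
  \<open>c\<close> bounds the weight and its first derivatives. Constants defined from these
  parameters are the same for all solutions.\<close>

locale bounded_flow = flow +
  fixes B E E2 CS c M :: real
  assumes B: "B \<ge> 1" "\<Omega> \<subseteq> cball 0 B" and T: "T \<ge> 0" and E: "E \<ge> 0" "E2 \<ge> 0" "CS \<ge> 0"
    and outside: "\<And>z. z \<notin> Q \<Omega> T \<Longrightarrow> P z = 0" "\<And>z. z \<notin> Q \<Omega> T \<Longrightarrow> U z = 0" "\<And>z. z \<notin> Q \<Omega> T \<Longrightarrow> D z = 0"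
    and slice_P: "AE t in lborel. (\<integral>\<^sub>+x. ennreal (P (x, t))) \<le> ennreal E"
    and slice_RU: "AE t in lborel. (\<integral>\<^sub>+x. ennreal (R (x, t) * (norm (U (x, t)))\<^sup>2)) \<le> ennreal E"
    and gradient: "(\<integral>\<^sub>+z. ennreal ((norm (U z))\<^sup>2 + (norm (D z))\<^sup>2)) \<le> ennreal E2"
    and Sobolev: "AE t in lborel. (\<integral>\<^sub>+x. ennreal (w (x, t) ^ 3 * norm (U (x, t)) ^ 6))
      \<le> ennreal CS * (\<integral>\<^sub>+x. ennreal ((norm (U (x, t)))\<^sup>2 + (norm (D (x, t)))\<^sup>2)) ^ 3"
    and c: "\<And>z. \<bar>w z\<bar> \<le> c" "\<And>z. \<bar>dt w z\<bar> \<le> c" "\<And>z. norm (grad w z) \<le> c"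
    and M: "kernel_const B M"
begin

lemma M_pos: "M > 0" and
  ell_moment: "0 < d \<Longrightarrow> d \<le> 1 \<Longrightarrow> norm x \<le> B \<Longrightarrow>
    (\<integral>\<^sub>+(y::real^3). ennreal ((ell ((norm (x - y))\<^sup>2 + d) powr (4/3)) ^ 6) * indicator (cball 0 B) y) \<le> ennreal M" and
  kap_moment: "0 < d \<Longrightarrow> d \<le> 1 \<Longrightarrow> norm x \<le> B \<Longrightarrow>
    (\<integral>\<^sub>+(y::real^3). ennreal ((kap ((norm (x - y))\<^sup>2 + d))\<^sup>2) * indicator (cball 0 B) y) \<le> ennreal M" and
  lo_moment: "0 < d \<Longrightarrow> norm x \<le> B \<Longrightarrow> 3 \<le> L \<Longrightarrow>
    (\<integral>\<^sub>+(y::real^3). ennreal (lo ((norm (x - y))\<^sup>2 + d) ^ 3) * indicator {..L} (ell ((norm (x - y))\<^sup>2 + d)) * indicator (cball 0 B) y)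
      \<le> ennreal (M * L\<^sup>2)"
  using M unfolding kernel_const_def by blast+

lemma QD: "z \<in> Q \<Omega> T \<Longrightarrow> norm (fst z) \<le> B \<and> 0 < snd z \<and> snd z < T"
  using B(2) by (auto simp: Q_def)

lemma c_nonneg: "c \<ge> 0"
  using c(1)[of 0] abs_ge_zero[of "w 0"] by linarith

lemma measurable_slices[measurable]:
  "Borel (\<lambda>x. R (x, t))" "Borel (\<lambda>x. P (x, t))"
  "Borel (\<lambda>x. U (x, t))" "Borel (\<lambda>x. D (x, t))" "Borel (\<lambda>x. w (x, t))"
proof -
  have p: "(\<lambda>x::real^3. (x, t)) \<in> borel_measurable borel" by (intro borel_measurable_continuous_onI continuous_intros)
  show "Borel (\<lambda>x. R (x, t))" "Borel (\<lambda>x. P (x, t))"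
    "Borel (\<lambda>x. U (x, t))" "Borel (\<lambda>x. D (x, t))" "Borel (\<lambda>x. w (x, t))"
    by (rule measurable_compose[OF p]; measurable)+
qed

lemma measurable_cball[measurable]: "cball (0::real^3) r \<in> sets borel"
  by simp

lemma slice_R: "AE t in lborel. (\<integral>\<^sub>+x. ennreal (R (x, t) powr (3/2))) \<le> ennreal E"
  using slice_P
proof eventually_elim
  case (elim t)
  have "(\<integral>\<^sub>+x. ennreal (R (x, t) powr (3/2))) \<le> (\<integral>\<^sub>+x. ennreal (P (x, t)))"
    by (intro nn_integral_mono ennreal_leI PR)
  then show ?case using elim by (rule order_trans)
qed

text \<open>With e = ell^(4/3), the splitting r u e <= r u^2 + r e^2 brings in the kinetic energy,
  and r e^2 <= r^(3/2) + e^6 the pressure; this is why the sixth moment of e is prepared in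
  \<open>kernel_const\<close>.\<close>

lemma err_slice:
  assumes d: "0 < d" "d \<le> 1" and x: "norm x \<le> B"
  shows "AE s in lborel. (\<integral>\<^sub>+y. ennreal (ell (sep d (x, t) (y, s)) powr (4/3) * (R (y, s) + R (y, s) * norm (U (y, s))))) \<le> ennreal (3 * E + 2 * M)"
  using slice_R slice_RU
proof eventually_elim
  case (elim s)
  define e where "e = (\<lambda>y. ell ((norm (x - y))\<^sup>2 + d) powr (4/3))"
  have [measurable]: "Borel e" unfolding e_def by measurable
  have s: "sep d (x, t) (y, s) = (norm (x - y))\<^sup>2 + d" for y by (simp add: sep_def)
  have e1: "e y \<ge> 1" for y
    unfolding e_def using ell_ge_3[of "(norm (x - y))\<^sup>2 + d"] d by (intro ge_one_powr_ge_zero) (auto simp: add_nonneg_pos)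
  define g where "g = (\<lambda>y. 2 * (R (y, s) powr (3/2)) + R (y, s) * (norm (U (y, s)))\<^sup>2)"
  have g0: "R (y, s) powr (3/2) \<ge> 0" "R (y, s) * (norm (U (y, s)))\<^sup>2 \<ge> 0" for y using R0 by auto
  have le: "e y * (R (y, s) + R (y, s) * norm (U (y, s))) \<le> g y + 2 * e y ^ 6 * indicator (cball 0 B) y" for y
  proof (cases "(y, s) \<in> Q \<Omega> T")
    case False
    then show ?thesis using g0[of y] e1[of y] zero(1)[OF False] by (simp add: g_def)
  next
    case True
    then have yB: "y \<in> cball 0 B" using QD[OF True] by simp
    let ?r = "R (y, s)" and ?u = "norm (U (y, s))"
    have a: "?r * e y \<le> ?r powr (3/2) + e y ^ 3" "?r * (e y)\<^sup>2 \<le> ?r powr (3/2) + (e y)\<^sup>2 ^ 3"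
      using e1[of y] by (intro mult_le_powr_three_halves R0; simp)+
    have b: "e y ^ 3 \<le> e y ^ 6" using e1[of y] by (intro power_increasing) auto
    have "(e y)\<^sup>2 ^ 3 = e y ^ 6" by (simp flip: power_mult)
    moreover have "?r * (?u * e y) \<le> ?r * (?u\<^sup>2 + (e y)\<^sup>2)"
    proof (rule mult_left_mono[OF _ R0])
      have "2 * (?u * e y) \<le> ?u\<^sup>2 + (e y)\<^sup>2" using sum_squares_bound[of ?u "e y"] by simp
      moreover have "0 \<le> ?u * e y" using e1[of y] by (intro mult_nonneg_nonneg) auto
      ultimately show "?u * e y \<le> ?u\<^sup>2 + (e y)\<^sup>2" by linarith
    qed
    ultimately have "e y * (?r + ?r * ?u) \<le> 2 * ?r powr (3/2) + ?r * ?u\<^sup>2 + 2 * e y ^ 6"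
      using a b by (simp only: distrib_left mult_ac)
    then show ?thesis using yB by (simp add: g_def)
  qed
  have "(\<integral>\<^sub>+y. ennreal (e y * (R (y, s) + R (y, s) * norm (U (y, s)))))
    \<le> (\<integral>\<^sub>+y. (2 * ennreal (R (y, s) powr (3/2)) + ennreal (R (y, s) * (norm (U (y, s)))\<^sup>2)) + 2 * (ennreal (e y ^ 6) * indicator (cball 0 B) y))"
  proof (intro nn_integral_mono)
    fix y
    have "ennreal (e y * (R (y, s) + R (y, s) * norm (U (y, s)))) \<le> ennreal (g y + 2 * e y ^ 6 * indicator (cball 0 B) y)"
      by (intro ennreal_leI le)
    also have "\<dots> = ennreal (g y) + ennreal (2 * (e y ^ 6 * indicator (cball 0 B) y))"
      using g0[of y] e1[of y] by (subst ennreal_plus[symmetric]) (auto simp: g_def)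
    also have "ennreal (g y) = 2 * ennreal (R (y, s) powr (3/2)) + ennreal (R (y, s) * (norm (U (y, s)))\<^sup>2)"
      using g0[of y] by (simp add: g_def ennreal_plus ennreal_mult)
    also have "ennreal (2 * (e y ^ 6 * indicator (cball 0 B) y)) = 2 * (ennreal (e y ^ 6) * indicator (cball 0 B) y)"
      by (auto simp: indicator_def ennreal_mult')
    finally show "ennreal (e y * (R (y, s) + R (y, s) * norm (U (y, s))))
      \<le> (2 * ennreal (R (y, s) powr (3/2)) + ennreal (R (y, s) * (norm (U (y, s)))\<^sup>2)) + 2 * (ennreal (e y ^ 6) * indicator (cball 0 B) y)" .
  qed
  also have "\<dots> = 2 * (\<integral>\<^sub>+y. ennreal (R (y, s) powr (3/2))) + (\<integral>\<^sub>+y. ennreal (R (y, s) * (norm (U (y, s)))\<^sup>2))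
      + 2 * (\<integral>\<^sub>+y. ennreal (e y ^ 6) * indicator (cball 0 B) y)"
    by (simp add: nn_integral_add nn_integral_cmult)
  also have "\<dots> \<le> 2 * ennreal E + ennreal E + 2 * ennreal M"
    using elim ell_moment[OF d x] unfolding e_def by (intro add_mono mult_left_mono) auto
  also have "\<dots> = ennreal (3 * E + 2 * M)"
    using E M_pos by (simp add: ennreal_plus[symmetric] ennreal_mult[symmetric] flip: ennreal_numeral del: ennreal_plus)
  finally show ?case by (simp add: s e_def)
qed

text \<open>Where the integrand \<open>rem\<close> at the first point \<open>z\<close> does not vanish, the logarithm \<open>ell\<close> is at most \<open>\<Lambda> z\<close>.\<close>

definition \<Lambda> where "\<Lambda> z = 32/3 * (norm (U z))\<^sup>2 / sqrt (R z)"
text \<open>The parameter for \<open>Young_scaled\<close>: with \<tau>^3 = \<Lambda>^2 the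
  quantities \<tau> and \<Lambda>^2 / \<tau>^2 coincide.\<close>

definition \<tau> where "\<tau> z = \<Lambda> z powr (2/3)"

lemma \<Lambda>_nonneg: "\<Lambda> z \<ge> 0"
  by (simp add: \<Lambda>_def R0)

lemma \<tau>_cube: "\<tau> z ^ 3 = (\<Lambda> z)\<^sup>2"
proof (cases "\<Lambda> z = 0")
  case False
  then have "\<Lambda> z > 0" using \<Lambda>_nonneg[of z] by simp
  then show ?thesis unfolding \<tau>_def by (subst powr_power) (auto simp: powr_numeral)
qed (simp add: \<tau>_def)

text \<open>The cube of \<open>lo\<close>, cut off at \<Lambda>, has integral at most M \<Lambda>^2.
  Young's inequality therefore gives E \<tau> + M \<Lambda>^2 / \<tau>^2, and the choice of \<tau>
  makes both terms multiples of \<tau>.\<close>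

lemma rem_slice:
  assumes d: "0 < d" and x: "norm x \<le> B"
  shows "AE s in lborel. (\<integral>\<^sub>+y. ennreal (R (y, s) * lo (sep d (x, t) (y, s))) * indicator {..\<Lambda> z} (ell (sep d (x, t) (y, s))))
    \<le> ennreal ((E + M) * \<tau> z)"
  using slice_R
proof eventually_elim
  case (elim s)
  have s: "sep d (x, t) (y, s) = (norm (x - y))\<^sup>2 + d" for y by (simp add: sep_def)
  have pos: "(norm (x - y))\<^sup>2 + d > 0" for y using d by (simp add: add_nonneg_pos)
  let ?l = "\<lambda>y. lo ((norm (x - y))\<^sup>2 + d)" and ?e = "\<lambda>y. ell ((norm (x - y))\<^sup>2 + d)"
  show ?case
  proof (cases "\<Lambda> z \<ge> 3")
    \<comment> \<open>\<open>ell\<close> is at least 3, so the indicator vanishes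
      identically.\<close>
    case False
    have "ennreal (R (y, s) * lo (sep d (x, t) (y, s))) * indicator {..\<Lambda> z} (ell (sep d (x, t) (y, s))) = 0" for y
      using ell_ge_3[OF pos, of y] False unfolding s by (simp add: indicator_def)
    then show ?thesis by (simp only:) simp
  next
    case True
    have t0: "\<tau> z > 0" unfolding \<tau>_def using True by simp
    have "(\<integral>\<^sub>+y. ennreal (R (y, s) * ?l y) * indicator {..\<Lambda> z} (?e y))
      \<le> (\<integral>\<^sub>+y. ennreal (\<tau> z) * ennreal (R (y, s) powr (3/2)) + ennreal (1 / (\<tau> z)\<^sup>2) * (ennreal (?l y ^ 3) * indicator {..\<Lambda> z} (?e y) * indicator (cball 0 B) y))"
    proof (intro nn_integral_mono)
      fix y
      show "ennreal (R (y, s) * ?l y) * indicator {..\<Lambda> z} (?e y)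
        \<le> ennreal (\<tau> z) * ennreal (R (y, s) powr (3/2)) + ennreal (1 / (\<tau> z)\<^sup>2) * (ennreal (?l y ^ 3) * indicator {..\<Lambda> z} (?e y) * indicator (cball 0 B) y)"
      proof (cases "(y, s) \<in> Q \<Omega> T \<and> ?e y \<le> \<Lambda> z")
        case False
        then show ?thesis using zero(1)[of "(y, s)"] by (auto simp: indicator_def)
      next
        case True
        then have yB: "y \<in> cball 0 B" using QD[of "(y, s)"] by simp
        have "ennreal (R (y, s) * ?l y) \<le> ennreal (\<tau> z * R (y, s) powr (3/2) + ?l y ^ 3 / (\<tau> z)\<^sup>2)"
          by (intro ennreal_leI Young_scaled R0 lo_nonneg t0)
        also have "\<dots> = ennreal (\<tau> z) * ennreal (R (y, s) powr (3/2)) + ennreal (1 / (\<tau> z)\<^sup>2 * ?l y ^ 3)"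
          using t0 lo_nonneg by (subst ennreal_plus) (auto simp: ennreal_mult)
        also have "ennreal (1 / (\<tau> z)\<^sup>2 * ?l y ^ 3) = ennreal (1 / (\<tau> z)\<^sup>2) * ennreal (?l y ^ 3)"
          using lo_nonneg by (intro ennreal_mult) auto
        finally show ?thesis using True yB by simp
      qed
    qed
    also have "\<dots> = ennreal (\<tau> z) * (\<integral>\<^sub>+y. ennreal (R (y, s) powr (3/2)))
        + ennreal (1 / (\<tau> z)\<^sup>2) * (\<integral>\<^sub>+y. ennreal (?l y ^ 3) * indicator {..\<Lambda> z} (?e y) * indicator (cball 0 B) y)"
      by (simp add: nn_integral_add nn_integral_cmult)
    also have "\<dots> \<le> ennreal (\<tau> z) * ennreal E + ennreal (1 / (\<tau> z)\<^sup>2) * ennreal (M * (\<Lambda> z)\<^sup>2)"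
      by (intro add_mono mult_left_mono elim lo_moment[OF d x True]) auto
    also have "\<dots> = ennreal (\<tau> z * E + 1 / (\<tau> z)\<^sup>2 * (M * (\<Lambda> z)\<^sup>2))"
    proof -
      have nn: "0 \<le> \<tau> z" "0 \<le> 1 / (\<tau> z)\<^sup>2" "0 \<le> M * (\<Lambda> z)\<^sup>2" using t0 M_pos by auto
      show ?thesis using nn E(1) by (simp only: ennreal_mult[symmetric] ennreal_plus[symmetric] mult_nonneg_nonneg)
    qed
    also have "\<tau> z * E + 1 / (\<tau> z)\<^sup>2 * (M * (\<Lambda> z)\<^sup>2) = (E + M) * \<tau> z"
      unfolding \<tau>_cube[symmetric] using t0 by (simp add: distrib_right power2_eq_square power3_eq_cube)
    finally show ?thesis unfolding s .
  qed
qed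


section \<open>From bounds on time slices to bounds on the cylinder, and the total error\<close>

lemma nn_integral_Q_le:
  fixes g :: "point \<Rightarrow> ennreal"
  assumes [measurable]: "Borel g" and z: "\<And>z. z \<notin> Q \<Omega> T \<Longrightarrow> g z = 0"
    and le: "AE t in lborel. (\<integral>\<^sub>+x. g (x, t)) \<le> a t"
  shows "(\<integral>\<^sub>+z. g z) \<le> (\<integral>\<^sub>+t. a t * indicator {0..T} t)"
proof -
  have "(\<integral>\<^sub>+z. g z) = (\<integral>\<^sub>+t x. g (x, t))" by (rule nn_integral_time_slices) measurable
  also have "\<dots> \<le> (\<integral>\<^sub>+t. a t * indicator {0..T} t)"
  proof (rule nn_integral_mono_AE, use le in eventually_elim)
    case (elim t)
    have "(\<integral>\<^sub>+x. g (x, t)) = 0" if "t \<notin> {0..T}"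
    proof -
      have "g (x, t) = 0" for x using that by (intro z) (auto simp: Q_def)
      then show ?thesis by simp
    qed
    then show ?case using elim by (auto simp: indicator_def)
  qed
  finally show ?thesis .
qed

lemma nn_integral_Q_le_const:
  fixes g :: "point \<Rightarrow> ennreal"
  assumes "Borel g" "\<And>z. z \<notin> Q \<Omega> T \<Longrightarrow> g z = 0" "K \<ge> 0"
    "AE t in lborel. (\<integral>\<^sub>+x. g (x, t)) \<le> ennreal K"
  shows "(\<integral>\<^sub>+z. g z) \<le> ennreal (K * T)"
proof -
  have "(\<integral>\<^sub>+t. ennreal K * indicator {0..T} t) = ennreal K * ennreal T"
    using T by (subst nn_integral_cmult_indicator) auto
  then show ?thesis using nn_integral_Q_le[OF assms(1,2,4)] T assms(3) by (simp add: ennreal_mult)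
qed

definition vol :: real where "vol = measure lborel (cball (0::real^3) B)"

lemma vol: "vol \<ge> 0" "emeasure lborel (cball (0::real^3) B) = ennreal vol"
  unfolding vol_def using emeasure_lborel_cball_finite[of "0::real^3" B] by (auto simp: emeasure_eq_ennreal_measure)

lemma indicator_slice: "(\<integral>\<^sub>+x. indicator (cball (0::real^3) B) x) = ennreal vol"
  by (simp add: vol)

lemma slice_R1: "AE t in lborel. (\<integral>\<^sub>+x. ennreal (R (x, t))) \<le> ennreal (vol + E)"
  using slice_R
proof eventually_elim
  case (elim t)
  have "(\<integral>\<^sub>+x. ennreal (R (x, t))) \<le> (\<integral>\<^sub>+x. indicator (cball 0 B) x + ennreal (R (x, t) powr (3/2)))"
  proof (intro nn_integral_mono)
    fix x
    show "ennreal (R (x, t)) \<le> indicator (cball 0 B) x + ennreal (R (x, t) powr (3/2))"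
    proof (cases "(x, t) \<in> Q \<Omega> T")
      case False
      then show ?thesis using zero(1) by simp
    next
      case True
      then have "x \<in> cball 0 B" using QD[OF True] by simp
      moreover have "R (x, t) \<le> 1 + R (x, t) powr (3/2)"
      proof (cases "R (x, t) \<le> 1")
        case True
        then show ?thesis using powr_ge_zero[of "R (x, t)" "3/2"] by linarith
      next
        case False
        then have "R (x, t) powr 1 \<le> R (x, t) powr (3/2)" by (intro powr_mono) auto
        then show ?thesis using False by simp
      qed
      ultimately show ?thesis using ennreal_leI[of "R (x, t)" "1 + R (x, t) powr (3/2)"] by (simp add: ennreal_plus)
    qed
  qed
  also have "\<dots> = ennreal vol + (\<integral>\<^sub>+x. ennreal (R (x, t) powr (3/2)))"
    by (simp add: nn_integral_add indicator_slice)
  also have "\<dots> \<le> ennreal vol + ennreal E" by (intro add_mono elim order_refl)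
  finally show ?case using vol(1) E by (simp add: ennreal_plus)
qed

lemma total_R: "(\<integral>\<^sub>+z. ennreal (R z)) \<le> ennreal ((vol + E) * T)"
  by (rule nn_integral_Q_le_const[OF _ _ _ slice_R1]) (use zero vol E in auto)

lemma total_D2: "(\<integral>\<^sub>+z. ennreal ((norm (D z))\<^sup>2)) \<le> ennreal E2"
  by (rule order_trans[OF nn_integral_mono gradient]) (auto intro!: ennreal_leI)

lemma total_D: "(\<integral>\<^sub>+z. ennreal (norm (D z))) \<le> ennreal (vol * T + E2)"
proof -
  let ?i = "\<lambda>z::point. indicator (cball 0 B) (fst z) * indicator {0..T} (snd z) :: ennreal"
  have "(\<integral>\<^sub>+z. ennreal (norm (D z))) \<le> (\<integral>\<^sub>+z. ?i z + ennreal ((norm (D z))\<^sup>2))"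
  proof (intro nn_integral_mono)
    fix z
    show "ennreal (norm (D z)) \<le> ?i z + ennreal ((norm (D z))\<^sup>2)"
    proof (cases "z \<in> Q \<Omega> T")
      case False
      then show ?thesis using outside(3) by simp
    next
      case True
      have "norm (D z) \<le> 1 + (norm (D z))\<^sup>2" using zero_le_power2[of "norm (D z) - 1"] norm_ge_zero[of "D z"]
        unfolding power2_diff by (simp del: norm_ge_zero)
      then have "ennreal (norm (D z)) \<le> ennreal (1 + (norm (D z))\<^sup>2)" by (rule ennreal_leI)
      then show ?thesis using QD[OF True] by (simp add: ennreal_plus)
    qed
  qed
  also have "\<dots> = (\<integral>\<^sub>+z. ?i z) + (\<integral>\<^sub>+z. ennreal ((norm (D z))\<^sup>2))"
    by (rule nn_integral_add) measurable
  also have "(\<integral>\<^sub>+z. ?i z) = (\<integral>\<^sub>+t x. indicator (cball (0::real^3) B) x * indicator {0..T} t)"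
    by (subst nn_integral_time_slices) auto
  also have "\<dots> = ennreal (vol * T)"
    using T vol by (simp add: nn_integral_multc nn_integral_cmult ennreal_mult)
  finally show ?thesis using total_D2 vol T E
    by (simp add: ennreal_plus add_mono order_trans)
qed

definition source :: "point \<Rightarrow> real" where
  "source z = R z + R z * (norm (U z))\<^sup>2 + P z + norm (D z)"

lemma total_source: "(\<integral>\<^sub>+z. ennreal (source z)) \<le> ennreal ((vol + E) * T + E * T + E * T + (vol * T + E2))"
proof -
  have "(\<integral>\<^sub>+z. ennreal (source z))
    = (\<integral>\<^sub>+z. ennreal (R z) + ennreal (R z * (norm (U z))\<^sup>2) + ennreal (P z) + ennreal (norm (D z)))"
    unfolding source_def using R0 P0 by (intro nn_integral_cong) (simp add: ennreal_plus)
  also have "\<dots> = (\<integral>\<^sub>+z. ennreal (R z)) + (\<integral>\<^sub>+z. ennreal (R z * (norm (U z))\<^sup>2))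
      + (\<integral>\<^sub>+z. ennreal (P z)) + (\<integral>\<^sub>+z. ennreal (norm (D z)))"
    by (simp add: nn_integral_add)
  also have "\<dots> \<le> ennreal ((vol + E) * T) + ennreal (E * T) + ennreal (E * T) + ennreal (vol * T + E2)"
    by (intro add_mono total_R total_D nn_integral_Q_le_const[OF _ _ _ slice_RU] nn_integral_Q_le_const[OF _ _ _ slice_P])
      (use zero outside E in auto)
  also have "\<dots> = ennreal ((vol + E) * T + E * T + E * T + (vol * T + E2))"
  proof -
    have "0 \<le> (vol + E) * T" "0 \<le> E * T" "0 \<le> vol * T + E2" using vol E T by auto
    then show ?thesis by (simp only: ennreal_plus[symmetric] add_nonneg_nonneg)
  qed
  finally show ?thesis .
qed

lemma source_nonneg: "source z \<ge> 0"
  using R0[of z] P0[of z] by (simp add: source_def)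

lemma measurable_source[measurable]: "Borel source"
  unfolding source_def[abs_def] by measurable

definition err_const :: real where
  "err_const = (3 * E + 2 * M) * ((vol + E) * T + E * T + E * T + (vol * T + E2)) + (vol + E) * E2 + M * ((vol + E) * T)"

text \<open>In the viscous part the product of |D| and \<open>kap\<close> is dominated by the sum of
  their squares: |D|^2 is integrable over the cylinder and meets the mass at the second point, while
  the square of \<open>kap\<close> has to be integrated over the first point. Hence the exchanged
  order in the last of the three terms.\<close>

lemma err_total:
  assumes d: "0 < d" "d \<le> 1" and \<eta>[measurable]: "Borel \<eta>"
    and \<eta>': "\<And>t. \<eta> t \<ge> 0" "\<And>t. \<eta> (- t) = \<eta> t" "(\<integral>\<^sub>+t. ennreal (\<eta> t)) = 1"
  shows "(\<integral>\<^sub>+z z'. ennreal (err \<eta> d z z')) \<le> ennreal err_const"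
proof -
  let ?X = "\<lambda>z z'. ell (sep d z z') powr (4/3) * (R z' + R z' * norm (U z'))"
  define h1 where "h1 = (\<lambda>z z'. ennreal (source z) * ennreal (?X z z'))"
  define h2 where "h2 = (\<lambda>z z'. ennreal ((norm (D z))\<^sup>2) * ennreal (R z'))"
  define h3 where "h3 = (\<lambda>z z'. ennreal (R z') * (ennreal ((kap (sep d z z'))\<^sup>2) * indicator (cball 0 B) (fst z)))"
  have m1[measurable]: "(\<lambda>(z, z'). h1 z z') \<in> borel_measurable (lborel \<Otimes>\<^sub>M lborel)"
    unfolding h1_def split_beta' by measurable
  have m2[measurable]: "(\<lambda>(z, z'). h2 z z') \<in> borel_measurable (lborel \<Otimes>\<^sub>M lborel)"
    unfolding h2_def split_beta' by measurable
  have m3[measurable]: "(\<lambda>(z, z'). h3 z z') \<in> borel_measurable (lborel \<Otimes>\<^sub>M lborel)"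
    unfolding h3_def split_beta' by measurable
  let ?e = "\<lambda>(z :: point) (z' :: point). ennreal (\<eta> (snd z - snd z'))"
  have me[measurable]: "(\<lambda>(z, z'). ?e z z') \<in> borel_measurable (lborel \<Otimes>\<^sub>M lborel)"
    unfolding split_beta' by measurable
  have le: "ennreal (err \<eta> d z z') \<le> ?e z z' * h1 z z' + ?e z z' * h2 z z' + ?e z z' * h3 z z'" for z z'
  proof -
    have X0: "?X z z' \<ge> 0" using R0 by (intro mult_nonneg_nonneg add_nonneg_nonneg) auto
    have "R z' * norm (D z) * kap (sep d z z') \<le> (norm (D z))\<^sup>2 * R z' + R z' * ((kap (sep d z z'))\<^sup>2 * indicator (cball 0 B) (fst z))"
    proof (cases "z \<in> Q \<Omega> T")
      case False
      then show ?thesis using outside(3)[OF False] R0[of z'] by simp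
    next
      case True
      let ?k = "kap (sep d z z')"
      have "2 * (norm (D z) * ?k) \<le> (norm (D z))\<^sup>2 + ?k\<^sup>2" using sum_squares_bound[of "norm (D z)" ?k] by simp
      moreover have "0 \<le> norm (D z) * ?k" by (intro mult_nonneg_nonneg kap_nonneg norm_ge_zero)
      ultimately have "norm (D z) * ?k \<le> (norm (D z))\<^sup>2 + ?k\<^sup>2" by linarith
      from mult_left_mono[OF this R0[of z']] show ?thesis using QD[OF True] by (simp add: algebra_simps)
    qed
    then have "err \<eta> d z z' \<le> \<eta> (snd z - snd z') * (source z * ?X z z' + (norm (D z))\<^sup>2 * R z' + R z' * ((kap (sep d z z'))\<^sup>2 * indicator (cball 0 B) (fst z)))"
      unfolding err_def source_def[symmetric] by (intro mult_left_mono \<eta>'(1)) simp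
    then have "ennreal (err \<eta> d z z') \<le> ?e z z' * ennreal (source z * ?X z z' + (norm (D z))\<^sup>2 * R z' + R z' * ((kap (sep d z z'))\<^sup>2 * indicator (cball 0 B) (fst z)))"
      using \<eta>'(1) by (subst ennreal_mult'[symmetric]) (auto intro: ennreal_leI)
    also have "ennreal (source z * ?X z z' + (norm (D z))\<^sup>2 * R z' + R z' * ((kap (sep d z z'))\<^sup>2 * indicator (cball 0 B) (fst z)))
      = h1 z z' + h2 z z' + h3 z z'"
      using X0 source_nonneg[of z] R0[of z']
      unfolding h1_def h2_def h3_def by (auto simp: ennreal_mult ennreal_plus indicator_def)
    finally show ?thesis by (simp add: distrib_left)
  qed
  have "(\<integral>\<^sub>+z z'. ennreal (err \<eta> d z z'))
    \<le> (\<integral>\<^sub>+z z'. ?e z z' * h1 z z' + ?e z z' * h2 z z' + ?e z z' * h3 z z')"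
    by (intro nn_integral_mono le)
  also have "\<dots> = (\<integral>\<^sub>+z z'. ?e z z' * h1 z z') + (\<integral>\<^sub>+z z'. ?e z z' * h2 z z')
      + (\<integral>\<^sub>+z z'. ?e z z' * h3 z z')"
    by (simp add: nn_integral_add)
  also have "\<dots> \<le> (\<integral>\<^sub>+z. ennreal (source z) * ennreal (3 * E + 2 * M)) + (\<integral>\<^sub>+z. ennreal ((norm (D z))\<^sup>2) * ennreal (vol + E))
      + (\<integral>\<^sub>+z. ennreal (R z) * ennreal M)"
  proof (intro add_mono)
    show "(\<integral>\<^sub>+z z'. ?e z z' * h1 z z') \<le> (\<integral>\<^sub>+z. ennreal (source z) * ennreal (3 * E + 2 * M))"
    proof (rule nn_integral_time_coupled[OF m1 \<eta> \<eta>'(3)])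
      fix z :: "point"
      show "AE s in lborel. (\<integral>\<^sub>+y. h1 z (y, s)) \<le> ennreal (source z) * ennreal (3 * E + 2 * M)"
      proof (cases "z \<in> Q \<Omega> T")
        case False
        then have "source z = 0" using zero outside by (simp add: source_def)
        then show ?thesis by (simp add: h1_def)
      next
        case True
        obtain x t where z: "z = (x, t)" by (cases z)
        have x: "norm x \<le> B" using QD[OF True] by (simp add: z)
        show ?thesis
          using err_slice[OF d x, of t]
        proof eventually_elim
          case (elim s)
          have [measurable]: "Borel (\<lambda>y. sep d z (y, s))" unfolding sep_def by simp
          have "(\<integral>\<^sub>+y. h1 z (y, s)) = ennreal (source z) * (\<integral>\<^sub>+y. ennreal (?X z (y, s)))"
            unfolding h1_def by (rule nn_integral_cmult) measurable
          also have "\<dots> \<le> ennreal (source z) * ennreal (3 * E + 2 * M)"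
            using elim by (intro mult_left_mono) (auto simp: z)
          finally show ?case .
        qed
      qed
    qed
    show "(\<integral>\<^sub>+z z'. ?e z z' * h2 z z') \<le> (\<integral>\<^sub>+z. ennreal ((norm (D z))\<^sup>2) * ennreal (vol + E))"
    proof (rule nn_integral_time_coupled[OF m2 \<eta> \<eta>'(3)])
      fix z :: "point"
      show "AE s in lborel. (\<integral>\<^sub>+y. h2 z (y, s)) \<le> ennreal ((norm (D z))\<^sup>2) * ennreal (vol + E)"
        using slice_R1
      proof eventually_elim
        case (elim s)
        have "(\<integral>\<^sub>+y. h2 z (y, s)) = ennreal ((norm (D z))\<^sup>2) * (\<integral>\<^sub>+y. ennreal (R (y, s)))"
          unfolding h2_def by (rule nn_integral_cmult) measurable
        then show ?case using elim by (simp add: mult_left_mono)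
      qed
    qed
    show "(\<integral>\<^sub>+z z'. ?e z z' * h3 z z') \<le> (\<integral>\<^sub>+z. ennreal (R z) * ennreal M)"
    proof (rule nn_integral_time_coupled_swap[OF m3 \<eta> \<eta>'(3,2)])
      fix z' :: "point"
      show "AE s in lborel. (\<integral>\<^sub>+x. h3 (x, s) z') \<le> ennreal (R z') * ennreal M"
      proof (cases "z' \<in> Q \<Omega> T")
        case False
        then show ?thesis using zero(1) by (simp add: h3_def)
      next
        case True
        obtain y t where z': "z' = (y, t)" by (cases z')
        have y: "norm y \<le> B" using QD[OF True] by (simp add: z')
        have "(\<integral>\<^sub>+x. h3 (x, s) z') \<le> ennreal (R z') * ennreal M" for s
        proof -
          have s: "sep d (x, s) z' = (norm (y - x))\<^sup>2 + d" for x by (simp add: sep_def z' norm_minus_commute)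
          have "(\<integral>\<^sub>+x. h3 (x, s) z') = ennreal (R z') * (\<integral>\<^sub>+x. ennreal ((kap ((norm (y - x))\<^sup>2 + d))\<^sup>2) * indicator (cball 0 B) x)"
            unfolding h3_def s fst_conv by (rule nn_integral_cmult) measurable
          then show ?thesis using kap_moment[OF d y] by (simp add: mult_left_mono)
        qed
        then show ?thesis by simp
      qed
    qed
  qed
  also have "\<dots> = (\<integral>\<^sub>+z. ennreal (source z)) * ennreal (3 * E + 2 * M) + (\<integral>\<^sub>+z. ennreal ((norm (D z))\<^sup>2)) * ennreal (vol + E)
      + (\<integral>\<^sub>+z. ennreal (R z)) * ennreal M"
    by (simp add: nn_integral_multc)
  also have "\<dots> \<le> ennreal ((vol + E) * T + E * T + E * T + (vol * T + E2)) * ennreal (3 * E + 2 * M) + ennreal E2 * ennreal (vol + E)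
      + ennreal ((vol + E) * T) * ennreal M"
    by (intro add_mono mult_right_mono total_source total_D2 total_R) auto
  also have "\<dots> = ennreal err_const"
  proof -
    have "0 \<le> (vol + E) * T + E * T + E * T + (vol * T + E2)" "0 \<le> 3 * E + 2 * M" "0 \<le> vol + E" "0 \<le> (vol + E) * T"
      using vol E T M_pos by auto
    moreover have "ennreal p * ennreal q + ennreal r * ennreal s + ennreal u * ennreal v = ennreal (q * p + s * r + v * u)"
      if "0 \<le> p" "0 \<le> q" "0 \<le> r" "0 \<le> s" "0 \<le> u" "0 \<le> v" for p q r s u v :: real
      using that by (simp add: ennreal_mult ennreal_plus mult.commute)
    ultimately show ?thesis unfolding err_const_def using E(2) less_imp_le[OF M_pos] by blast
  qed
  finally show ?thesis .
qed


section \<open>The remainder where the density is small against the velocity\<close>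

definition grad_slice :: "real \<Rightarrow> ennreal" where
  "grad_slice t = (\<integral>\<^sub>+x. ennreal ((norm (U (x, t)))\<^sup>2 + (norm (D (x, t)))\<^sup>2))"

lemma measurable_grad_slice[measurable]: "Borel grad_slice"
proof -
  have [measurable]: "U \<in> borel_measurable (borel \<Otimes>\<^sub>M borel)" "D \<in> borel_measurable (borel \<Otimes>\<^sub>M borel)" by (simp_all add: borel_prod)
  show ?thesis unfolding grad_slice_def[abs_def] by measurable
qed

lemma grad_slice_total: "(\<integral>\<^sub>+t. grad_slice t) \<le> ennreal E2"
proof -
  have "(\<integral>\<^sub>+t. grad_slice t) = (\<integral>\<^sub>+z. ennreal ((norm (U z))\<^sup>2 + (norm (D z))\<^sup>2))"
    unfolding grad_slice_def by (subst nn_integral_time_slices) auto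
  then show ?thesis using gradient by simp
qed

text \<open>What is left of \<open>rem\<close> after integration over the second point, up to
  constants. Up to a numerical factor it is w R^(2/3) |U|^(10/3).\<close>

definition stretch where "stretch z = w z * (R z * (norm (U z))\<^sup>2 * \<tau> z)"

lemma measurable_\<tau>[measurable]: "Borel \<tau>"
  unfolding \<tau>_def[abs_def] \<Lambda>_def by measurable

lemma stretch_nonneg: "stretch z \<ge> 0"
  by (simp add: stretch_def w0 R0 \<tau>_def)

text \<open>Hoelder's splitting with a free parameter: w \<tau> <= Y + (w \<tau>)^3 / Y^2 is
  multiplied by R |U|^2. The density cancels in R |U|^2 \<tau>^3 = (32/3)^2 |U|^6, and 114 rounds up
  (32/3)^2.\<close>

lemma stretch_le:
  assumes Y: "Y > 0"
  shows "stretch z \<le> Y * (R z * (norm (U z))\<^sup>2) + 114 / Y\<^sup>2 * (w z ^ 3 * norm (U z) ^ 6)"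
proof (cases "R z = 0")
  case True
  then show ?thesis using w0[of z] by (simp add: stretch_def)
next
  case False
  then have R: "R z > 0" using R0[of z] by simp
  define q where "q = w z * \<tau> z"
  define p where "p = R z * (norm (U z))\<^sup>2"
  have q0: "q \<ge> 0" and p0: "p \<ge> 0" unfolding q_def p_def using w0[of z] R by (auto simp: \<tau>_def)
  have "1\<^sup>2 * (q / Y) \<le> 1 ^ 3 + (q / Y) ^ 3" using q0 Y by (intro square_mult_le_cubes) auto
  then have "p * Y * (q / Y) \<le> p * Y * (1 + (q / Y) ^ 3)" using p0 Y by (intro mult_left_mono) auto
  also have "\<dots> = Y * p + p * q ^ 3 / Y\<^sup>2"
    using Y by (simp add: distrib_left power3_eq_cube power2_eq_square)
  also have "p * q ^ 3 = (32/3)\<^sup>2 * (w z ^ 3 * norm (U z) ^ 6)"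
  proof -
    have "q ^ 3 = w z ^ 3 * (\<Lambda> z)\<^sup>2" by (simp add: q_def power_mult_distrib \<tau>_cube)
    moreover have "(\<Lambda> z)\<^sup>2 = (32/3)\<^sup>2 * norm (U z) ^ 4 / R z"
      using R by (simp add: \<Lambda>_def power_divide power_mult_distrib flip: power_mult)
    moreover have "norm (U z) ^ 6 = (norm (U z))\<^sup>2 * norm (U z) ^ 4" by (simp flip: power_add)
    ultimately show ?thesis using R by (simp add: p_def)
  qed
  also have "Y * p + (32/3)\<^sup>2 * (w z ^ 3 * norm (U z) ^ 6) / Y\<^sup>2 \<le> Y * p + 114 / Y\<^sup>2 * (w z ^ 3 * norm (U z) ^ 6)"
  proof -
    have "(32/3)\<^sup>2 * (w z ^ 3 * norm (U z) ^ 6) \<le> 114 * (w z ^ 3 * norm (U z) ^ 6)"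
      using w0[of z] by (intro mult_right_mono) (auto simp: power2_eq_square)
    then have "(32/3)\<^sup>2 * (w z ^ 3 * norm (U z) ^ 6) / Y\<^sup>2 \<le> 114 * (w z ^ 3 * norm (U z) ^ 6) / Y\<^sup>2"
      by (rule divide_right_mono) simp
    then show ?thesis by simp
  qed
  finally have "p * Y * (q / Y) \<le> Y * p + 114 / Y\<^sup>2 * (w z ^ 3 * norm (U z) ^ 6)" .
  moreover have "p * Y * (q / Y) = stretch z" using Y by (simp add: stretch_def p_def q_def)
  ultimately show ?thesis by (simp add: p_def)
qed

lemma stretch_total: "(\<integral>\<^sub>+z. ennreal (stretch z)) \<le> ennreal ((E + 114 * CS) * (E2 + T))"
proof -
  \<comment> \<open>The splitting parameter is taken from the gradient norm of the slice, which must
    be finite for that.\<close>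
  have fin: "AE t in lborel. grad_slice t \<noteq> \<infinity>"
    by (rule nn_integral_PInf_AE) (use grad_slice_total in \<open>auto simp: top_unique\<close>)
  have "(\<integral>\<^sub>+z. ennreal (stretch z)) \<le> (\<integral>\<^sub>+t. (ennreal (E + 114 * CS) * (grad_slice t + 1)) * indicator {0..T} t)"
  proof (rule nn_integral_Q_le)
    show "Borel (\<lambda>z. ennreal (stretch z))" unfolding stretch_def by measurable
    show "ennreal (stretch z) = 0" if "z \<notin> Q \<Omega> T" for z using zero(1)[OF that] by (simp add: stretch_def)
    show "AE t in lborel. (\<integral>\<^sub>+x. ennreal (stretch (x, t))) \<le> ennreal (E + 114 * CS) * (grad_slice t + 1)"
      using fin slice_RU Sobolev
    proof eventually_elim
      case (elim t)
      define y where "y = enn2real (grad_slice t)"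
      have y: "grad_slice t = ennreal y" "y \<ge> 0" using elim(1) by (auto simp: y_def top.not_eq_extremum)
      \<comment> \<open>With this parameter in Young's inequality the cubic Sobolev bound becomes linear in the gradient norm.\<close>
      define Y where "Y = y + 1"
      have Y: "Y > 0" "y \<le> Y" using y(2) by (auto simp: Y_def)
      have nn: "0 \<le> R (x, t) * (norm (U (x, t)))\<^sup>2" "0 \<le> w (x, t) ^ 3 * norm (U (x, t)) ^ 6" for x
        using R0 w0 by auto
      have "(\<integral>\<^sub>+x. ennreal (stretch (x, t)))
        \<le> (\<integral>\<^sub>+x. ennreal Y * ennreal (R (x, t) * (norm (U (x, t)))\<^sup>2) + ennreal (114 / Y\<^sup>2) * ennreal (w (x, t) ^ 3 * norm (U (x, t)) ^ 6))"
      proof (intro nn_integral_mono)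
        fix x
        have "ennreal (stretch (x, t)) \<le> ennreal (Y * (R (x, t) * (norm (U (x, t)))\<^sup>2) + 114 / Y\<^sup>2 * (w (x, t) ^ 3 * norm (U (x, t)) ^ 6))"
          by (intro ennreal_leI stretch_le Y)
        also have "\<dots> = ennreal (Y * (R (x, t) * (norm (U (x, t)))\<^sup>2)) + ennreal (114 / Y\<^sup>2 * (w (x, t) ^ 3 * norm (U (x, t)) ^ 6))"
          using nn[of x] Y by (intro ennreal_plus mult_nonneg_nonneg nn) auto
        also have "\<dots> = ennreal Y * ennreal (R (x, t) * (norm (U (x, t)))\<^sup>2) + ennreal (114 / Y\<^sup>2) * ennreal (w (x, t) ^ 3 * norm (U (x, t)) ^ 6)"
          using nn[of x] Y by (intro arg_cong2[where f="(+)"] ennreal_mult nn) auto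
        finally show "ennreal (stretch (x, t)) \<le> ennreal Y * ennreal (R (x, t) * (norm (U (x, t)))\<^sup>2) + ennreal (114 / Y\<^sup>2) * ennreal (w (x, t) ^ 3 * norm (U (x, t)) ^ 6)" .
      qed
      also have "\<dots> = ennreal Y * (\<integral>\<^sub>+x. ennreal (R (x, t) * (norm (U (x, t)))\<^sup>2)) + ennreal (114 / Y\<^sup>2) * (\<integral>\<^sub>+x. ennreal (w (x, t) ^ 3 * norm (U (x, t)) ^ 6))"
        by (simp add: nn_integral_add nn_integral_cmult)
      also have "\<dots> \<le> ennreal Y * ennreal E + ennreal (114 / Y\<^sup>2) * (ennreal CS * grad_slice t ^ 3)"
        using elim(2,3) unfolding grad_slice_def by (intro add_mono mult_left_mono) auto
      also have "ennreal CS * grad_slice t ^ 3 = ennreal (CS * y ^ 3)" using y E by (simp add: ennreal_mult ennreal_power)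
      also have "ennreal Y * ennreal E = ennreal (Y * E)" using Y E by (intro ennreal_mult[symmetric]) auto
      also have "ennreal (114 / Y\<^sup>2) * ennreal (CS * y ^ 3) = ennreal (114 / Y\<^sup>2 * (CS * y ^ 3))" using Y E y by (intro ennreal_mult[symmetric]) auto
      also have "ennreal (Y * E) + ennreal (114 / Y\<^sup>2 * (CS * y ^ 3)) = ennreal (Y * E + 114 / Y\<^sup>2 * (CS * y ^ 3))"
        using Y E y by (intro ennreal_plus[symmetric] mult_nonneg_nonneg) auto
      also have "\<dots> \<le> ennreal ((E + 114 * CS) * Y)"
      proof (rule ennreal_leI)
        have "y ^ 3 \<le> Y ^ 3" using Y y by (intro power_mono) auto
        then have "114 / Y\<^sup>2 * (CS * y ^ 3) \<le> 114 / Y\<^sup>2 * (CS * Y ^ 3)" using E by (intro mult_left_mono) auto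
        also have "\<dots> = 114 * CS * Y" using Y by (simp add: power2_eq_square power3_eq_cube)
        finally show "Y * E + 114 / Y\<^sup>2 * (CS * y ^ 3) \<le> (E + 114 * CS) * Y"
          unfolding distrib_right mult.commute[of Y E] by linarith
      qed
      also have "\<dots> = ennreal (E + 114 * CS) * (grad_slice t + 1)"
        using E y by (simp add: Y_def ennreal_mult ennreal_plus)
      finally show ?case .
    qed
  qed
  also have "\<dots> = ennreal (E + 114 * CS) * (\<integral>\<^sub>+t. (grad_slice t + 1) * indicator {0..T} t)"
    by (subst nn_integral_cmult[symmetric]) (auto simp: mult.assoc)
  also have "(\<integral>\<^sub>+t. (grad_slice t + 1) * indicator {0..T} t) \<le> (\<integral>\<^sub>+t. grad_slice t + indicator {0..T} t)"
    by (intro nn_integral_mono) (auto simp: indicator_def)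
  also have "\<dots> \<le> ennreal E2 + ennreal T"
    using grad_slice_total T by (simp add: nn_integral_add add_right_mono)
  also have "ennreal (E + 114 * CS) * (ennreal E2 + ennreal T) = ennreal ((E + 114 * CS) * (E2 + T))"
    using E T by (simp add: ennreal_mult ennreal_plus)
  finally show ?thesis by (simp add: mult_left_mono)
qed

definition rem_const :: real where
  "rem_const = 16/3 * c * (E + M) * ((E + 114 * CS) * (E2 + T))"

text \<open>The weight at the second point is bounded by \<open>c\<close>; the weight at the first
  point is kept, because Sobolev's inequality is assumed only for the localised velocity.\<close>

lemma rem_total:
  assumes d: "0 < d" and \<eta>[measurable]: "Borel \<eta>"
    and \<eta>': "\<And>t. \<eta> t \<ge> 0" "(\<integral>\<^sub>+t. ennreal (\<eta> t)) = 1"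
  shows "(\<integral>\<^sub>+z z'. ennreal (rem \<eta> d z z')) \<le> ennreal rem_const"
proof -
  define a where "a = (\<lambda>z. 16/3 * c * (w z * (R z * (norm (U z))\<^sup>2)))"
  have a0: "a z \<ge> 0" for z unfolding a_def using c_nonneg w0 R0 by (intro mult_nonneg_nonneg) auto
  have [measurable]: "Borel a" unfolding a_def by measurable
  have [measurable]: "Borel \<Lambda>" unfolding \<Lambda>_def[abs_def] by measurable
  define h where "h = (\<lambda>z z'. ennreal (a z) * (ennreal (R z' * lo (sep d z z')) * indicator {..\<Lambda> z} (ell (sep d z z'))))"
  have i[measurable]: "(\<lambda>p. indicator {..\<Lambda> (fst p)} (ell (sep d (fst p) (snd p))) :: ennreal) \<in> borel_measurable (lborel \<Otimes>\<^sub>M lborel)"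
    unfolding indicator_def atMost_iff by measurable
  have hm: "(\<lambda>(z, z'). h z z') \<in> borel_measurable (lborel \<Otimes>\<^sub>M lborel)"
    unfolding h_def split_beta' by measurable
  have "(\<integral>\<^sub>+z z'. ennreal (rem \<eta> d z z')) \<le> (\<integral>\<^sub>+z z'. ennreal (\<eta> (snd z - snd z')) * h z z')"
  proof (intro nn_integral_mono)
    fix z z' :: "point"
    show "ennreal (rem \<eta> d z z') \<le> ennreal (\<eta> (snd z - snd z')) * h z z'"
    proof (cases "ell (sep d z z') * sqrt (R z) \<le> 32/3 * (norm (U z))\<^sup>2 \<and> R z \<noteq> 0")
      case False
      then have "rem \<eta> d z z' = 0" by (auto simp: rem_def)
      then show ?thesis by simp
    next
      case True
      then have R: "sqrt (R z) > 0" using R0[of z] by simp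
      then have L: "ell (sep d z z') \<le> \<Lambda> z" using True unfolding \<Lambda>_def by (simp add: pos_le_divide_eq)
      have nn: "0 \<le> R z' * lo (sep d z z')" using R0 lo_nonneg by (intro mult_nonneg_nonneg)
      have "w z' \<le> c" using c(1)[of z'] by simp
      have X: "0 \<le> \<eta> (snd z - snd z') * (w z * (16/3 * (R z * (norm (U z))\<^sup>2) * (R z' * lo (sep d z z'))))"
        using \<eta>'(1) w0 R0 by (intro mult_nonneg_nonneg nn) auto
      have "rem \<eta> d z z' = w z' * (\<eta> (snd z - snd z') * (w z * (16/3 * (R z * (norm (U z))\<^sup>2) * (R z' * lo (sep d z z')))))"
        using True by (simp add: rem_def)
      also have "\<dots> \<le> c * (\<eta> (snd z - snd z') * (w z * (16/3 * (R z * (norm (U z))\<^sup>2) * (R z' * lo (sep d z z')))))"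
        by (rule mult_right_mono[OF \<open>w z' \<le> c\<close> X])
      also have "\<dots> = \<eta> (snd z - snd z') * (a z * (R z' * lo (sep d z z')))"
        by (simp add: a_def)
      finally have "ennreal (rem \<eta> d z z') \<le> ennreal (\<eta> (snd z - snd z') * (a z * (R z' * lo (sep d z z'))))" by (rule ennreal_leI)
      also have "\<dots> = ennreal (\<eta> (snd z - snd z')) * (ennreal (a z) * ennreal (R z' * lo (sep d z z')))"
        using \<eta>'(1) a0[of z] nn by (simp only: ennreal_mult mult_nonneg_nonneg)
      finally show ?thesis using L by (simp add: h_def)
    qed
  qed
  also have "\<dots> \<le> (\<integral>\<^sub>+z. ennreal (16/3 * c * (E + M)) * ennreal (stretch z))"
  proof (rule nn_integral_time_coupled[OF hm \<eta> \<eta>'(2)])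
    fix z :: "point"
    show "AE s in lborel. (\<integral>\<^sub>+y. h z (y, s)) \<le> ennreal (16/3 * c * (E + M)) * ennreal (stretch z)"
    proof (cases "z \<in> Q \<Omega> T")
      case False
      then have "a z = 0" using zero(1) by (simp add: a_def)
      then show ?thesis by (simp add: h_def)
    next
      case True
      obtain x t where z: "z = (x, t)" by (cases z)
      have x: "norm x \<le> B" using QD[OF True] by (simp add: z)
      show ?thesis
        using rem_slice[OF d x, of t z]
      proof eventually_elim
        case (elim s)
        have [measurable]: "Borel (\<lambda>y. sep d z (y, s))" unfolding sep_def by simp
        have "(\<integral>\<^sub>+y. h z (y, s)) = ennreal (a z) * (\<integral>\<^sub>+y. ennreal (R (y, s) * lo (sep d z (y, s))) * indicator {..\<Lambda> z} (ell (sep d z (y, s))))"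
          unfolding h_def by (rule nn_integral_cmult) measurable
        also have "\<dots> \<le> ennreal (a z) * ennreal ((E + M) * \<tau> z)"
          using elim by (intro mult_left_mono) (auto simp: z)
        also have "\<dots> = ennreal (a z * ((E + M) * \<tau> z))"
          using a0 E M_pos by (intro ennreal_mult[symmetric] mult_nonneg_nonneg) (auto simp: \<tau>_def)
        also have "a z * ((E + M) * \<tau> z) = 16/3 * c * (E + M) * stretch z" by (simp add: a_def stretch_def)
        also have "ennreal (16/3 * c * (E + M) * stretch z) = ennreal (16/3 * c * (E + M)) * ennreal (stretch z)"
          using c_nonneg E M_pos stretch_nonneg by (intro ennreal_mult mult_nonneg_nonneg) auto
        finally show ?case .
      qed
    qed
  qed
  also have "\<dots> = ennreal (16/3 * c * (E + M)) * (\<integral>\<^sub>+z. ennreal (stretch z))"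
    by (rule nn_integral_cmult) (simp add: stretch_def)
  also have "\<dots> \<le> ennreal (16/3 * c * (E + M)) * ennreal ((E + 114 * CS) * (E2 + T))"
    by (intro mult_left_mono stretch_total) simp
  also have "\<dots> = ennreal rem_const"
    unfolding rem_const_def using c_nonneg E M_pos T by (intro ennreal_mult[symmetric] mult_nonneg_nonneg) auto
  finally show ?thesis .
qed

definition good_const :: real where
  "good_const = 2 * (c\<^sup>2 * (4 + 5 * (2 * \<bar>\<nu>1\<bar> + 6 * \<bar>\<nu>2\<bar>) + F) * err_const + rem_const)"

lemma const_nonneg: "F \<ge> 0" "err_const \<ge> 0" "rem_const \<ge> 0" "good_const \<ge> 0"
proof -
  show F0: "F \<ge> 0" using F[of 0] norm_ge_zero[of "f 0"] by linarith
  show e: "err_const \<ge> 0" unfolding err_const_def using E M_pos T vol by auto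
  show r: "rem_const \<ge> 0" unfolding rem_const_def using E M_pos T c_nonneg by auto
  show "good_const \<ge> 0" unfolding good_const_def using e r F0 by auto
qed

theorem good_bound:
  assumes d: "0 < d" "d \<le> 1" and \<eta>: "smooth \<eta>" "\<And>t. \<eta> t \<ge> 0" "\<And>t. \<eta> (- t) = \<eta> t" "(\<integral>\<^sub>+t. ennreal (\<eta> t)) = 1"
  shows "(\<integral>\<^sub>+z z'. ennreal (good \<eta> d z z')) \<le> ennreal good_const"
proof -
  have m: "Borel \<eta>"
    by (intro borel_measurable_continuous_onI smooth_continuous \<eta>)
  define C where "C = c\<^sup>2 * (4 + 5 * (2 * \<bar>\<nu>1\<bar> + 6 * \<bar>\<nu>2\<bar>) + F)"
  have C0: "C \<ge> 0" unfolding C_def using const_nonneg by auto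
  have "(\<integral>\<^sub>+z z'. ennreal (good \<eta> d z z'))
    \<le> 2 * (ennreal C * (\<integral>\<^sub>+z z'. ennreal (err \<eta> d z z')) + (\<integral>\<^sub>+z z'. ennreal (rem \<eta> d z z')))"
    by (rule good_integral_le[where \<eta>=\<eta>, OF d(1) \<eta>(1) \<eta>(2) \<eta>(3) c C_def])
  also have "\<dots> \<le> 2 * (ennreal C * ennreal err_const + ennreal rem_const)"
    by (intro mult_left_mono add_mono err_total[where \<eta>=\<eta>, OF d m \<eta>(2) \<eta>(3) \<eta>(4)] rem_total[where \<eta>=\<eta>, OF d(1) m \<eta>(2) \<eta>(4)]) auto
  also have "\<dots> = ennreal good_const"
    unfolding good_const_def C_def[symmetric] using C0 const_nonneg
    by (simp add: ennreal_mult ennreal_plus)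
  finally show ?thesis .
qed

end

section \<open>Concentration in time\<close>

text \<open>Otherwise there would be translations tending to 0 along which the L^1 distance stays
  above e.\<close>

lemma L1_continuousD:
  fixes g :: "'a::euclidean_space \<Rightarrow> real"
  assumes g: "integrable lborel g" and e: "e > 0"
  obtains \<delta> where "\<delta> > 0" "\<And>h. norm h < \<delta> \<Longrightarrow> (\<integral>\<^sub>1x. \<bar>g (x + h) - g x\<bar>) \<le> e"
proof (rule ccontr)
  assume "\<not> thesis"
  then have "\<not> (\<forall>h. norm h < 1 / Suc n \<longrightarrow> (\<integral>\<^sub>1x. \<bar>g (x + h) - g x\<bar>) \<le> e)" for n
    using that[of "1 / Suc n"] by auto
  then have "\<exists>h. norm h < 1 / Suc n \<and> (\<integral>\<^sub>1x. \<bar>g (x + h) - g x\<bar>) > e" for n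
    by (auto simp: not_le)
  then obtain h where h: "\<And>n. norm (h n) < 1 / Suc n" "\<And>n. (\<integral>\<^sub>1x. \<bar>g (x + h n) - g x\<bar>) > e" by metis
  have "h \<longlonglongrightarrow> 0"
    by (rule Lim_null_comparison[OF _ LIMSEQ_inverse_real_of_nat]) (use h(1) in \<open>auto intro!: always_eventually less_imp_le simp: inverse_eq_divide\<close>)
  then have "(\<lambda>n. \<integral>\<^sub>1x. \<bar>g (x + h n) - g x\<bar>) \<longlonglongrightarrow> 0"
    using integrable_L1_continuous[OF g] unfolding L1_continuous_def by blast
  from order_tendstoD(2)[OF this e] obtain n where "(\<integral>\<^sub>1x. \<bar>g (x + h n) - g x\<bar>) < e"
    by (auto simp: eventually_sequentially)
  then show False using h(2)[of n] by simp
qed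

text \<open>With g and k bounded, replacing the time of one factor costs at most a constant times
  the L^1 distance of two slices of g. Averaged with \<eta>, these distances become L^1 distances
  between g and its time translates by less than \<delta>, which are small.\<close>

lemma time_localization_limit:
  fixes g :: "point \<Rightarrow> real" and k :: "real^3 \<Rightarrow> real"
  assumes [measurable]: "Borel g" "Borel k"
    and g: "\<And>z. 0 \<le> g z" "\<And>z. g z \<le> N" "\<And>x t. norm x > B \<or> t \<notin> {0..T} \<Longrightarrow> g (x, t) = 0"
    and k: "\<And>x. 0 \<le> k x" "\<And>x. k x \<le> Kb"
    and approx: "\<And>\<delta>. \<delta> > 0 \<Longrightarrow> \<exists>\<eta>. \<eta> \<in> borel_measurable borel \<and> (\<forall>t. \<eta> t \<ge> 0) \<and> (\<integral>\<^sub>+t. ennreal (\<eta> t)) = 1 \<and>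
      (\<forall>t. \<bar>t\<bar> \<ge> \<delta> \<longrightarrow> \<eta> t = 0) \<and>
      (\<integral>\<^sub>+z z'. ennreal (\<eta> (snd z - snd z') * (g z * g z' * k (fst z - fst z')))) \<le> J"
  shows "(\<integral>\<^sub>+t x y. ennreal (g (x, t) * g (y, t) * k (x - y))) \<le> J"
proof -
  have [measurable]: "g \<in> borel_measurable (borel \<Otimes>\<^sub>M borel)" by (simp add: borel_prod)
  have [measurable]: "cball (0::real^3) B \<in> sets borel" by simp
  have N: "N \<ge> 0" using g(1,2)[of 0] by linarith
  have Kb: "Kb \<ge> 0" using k[of 0] by linarith
  define V where "V = measure lborel (cball (0::real^3) B)"
  have V: "emeasure lborel (cball (0::real^3) B) = ennreal V" "V \<ge> 0"
    unfolding V_def using emeasure_lborel_cball_finite[of "0::real^3" B] by (auto simp: emeasure_eq_ennreal_measure)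
  have gi: "integrable lborel g"
  proof (rule Bochner_Integration.integrable_bound[where f="\<lambda>z. N * indicator (cball (0::real^3) B \<times> {0..T}) z"])
    have "emeasure lborel (cball (0::real^3) B \<times> {0..T}) < \<infinity>"
      by (intro emeasure_bounded_finite bounded_Times) auto
    moreover have "cball (0::real^3) B \<times> {0..T} \<in> sets borel" by (intro borel_closed closed_Times) auto
    ultimately show "integrable lborel (\<lambda>z. N * indicator (cball (0::real^3) B \<times> {0..T}) z)"
      by (intro integrable_mult_right) simp
    show "AE z in lborel. norm (g z) \<le> norm (N * indicator (cball (0::real^3) B \<times> {0..T}) z)"
    proof (intro AE_I2)
      fix z :: "point"
      show "norm (g z) \<le> norm (N * indicator (cball (0::real^3) B \<times> {0..T}) z)"
        using g(1,2)[of z] N g(3)[of "fst z" "snd z"] by (cases z) (auto simp: indicator_def)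
    qed
  qed simp
  define H where "H = (\<lambda>t s. \<integral>\<^sub>+x y. ennreal (g (x, t) * g (y, s) * k (x - y)))"
  define q where "q = (\<lambda>t s. \<integral>\<^sub>+y. ennreal \<bar>g (y, t) - g (y, s)\<bar>)"
  \<comment> \<open>Supremum of k times supremum of g times the volume of the ball that carries the
    slices.\<close>
  define C where "C = Kb * N * V"
  have C: "C \<ge> 0" using Kb N V by (simp add: C_def)
  have Hm[measurable]: "(\<lambda>p. H (fst p) (snd p)) \<in> borel_measurable (borel \<Otimes>\<^sub>M borel)" unfolding H_def by measurable
  have qm[measurable]: "(\<lambda>p. q (fst p) (snd p)) \<in> borel_measurable (borel \<Otimes>\<^sub>M borel)" unfolding q_def by measurable
  have [measurable]: "Borel (H t)" "Borel (q t)" for t unfolding H_def q_def by measurable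
  have [measurable]: "Borel (\<lambda>t. H t t)" "Borel (\<lambda>t. q t (t - r))" for r unfolding H_def q_def by measurable
  have [measurable]: "(\<lambda>p. q (fst p) (fst p - snd p)) \<in> borel_measurable (borel \<Otimes>\<^sub>M borel)"
    "(\<lambda>p. q (snd p) (snd p - fst p)) \<in> borel_measurable (borel \<Otimes>\<^sub>M borel)" unfolding q_def by measurable
  have Hq: "H t t \<le> H t s + ennreal C * q t s" for t s
  proof -
    have "H t t \<le> (\<integral>\<^sub>+x y. ennreal (g (x, t) * g (y, s) * k (x - y)) + ennreal (Kb * N) * indicator (cball 0 B) x * ennreal \<bar>g (y, t) - g (y, s)\<bar>)"
      unfolding H_def
    proof (intro nn_integral_mono)
      fix x y
      show "ennreal (g (x, t) * g (y, t) * k (x - y)) \<le> ennreal (g (x, t) * g (y, s) * k (x - y)) + ennreal (Kb * N) * indicator (cball 0 B) x * ennreal \<bar>g (y, t) - g (y, s)\<bar>"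
      proof (cases "norm x > B")
        case True
        then show ?thesis using g(3)[of x t] by simp
      next
        case False
        have "g (x, t) * k (x - y) \<le> N * Kb" using g k N by (intro mult_mono) auto
        then have "(g (x, t) * k (x - y)) * \<bar>g (y, t) - g (y, s)\<bar> \<le> (N * Kb) * \<bar>g (y, t) - g (y, s)\<bar>"
          by (intro mult_right_mono) auto
        moreover have "(g (x, t) * k (x - y)) * g (y, t) \<le> (g (x, t) * k (x - y)) * (g (y, s) + \<bar>g (y, t) - g (y, s)\<bar>)"
          using g(1)[of "(x, t)"] k(1)[of "x - y"] by (intro mult_left_mono) auto
        ultimately have "g (x, t) * g (y, t) * k (x - y) \<le> g (x, t) * g (y, s) * k (x - y) + Kb * N * \<bar>g (y, t) - g (y, s)\<bar>"
          unfolding distrib_left by (simp only: mult_ac)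
        from ennreal_leI[OF this] show ?thesis
          using False g(1) k(1) Kb N by (simp add: ennreal_plus ennreal_mult)
      qed
    qed
    also have "\<dots> = (\<integral>\<^sub>+x. (\<integral>\<^sub>+y. ennreal (g (x, t) * g (y, s) * k (x - y))) + ennreal (Kb * N) * indicator (cball 0 B) x * q t s)"
      unfolding q_def by (intro nn_integral_cong) (simp add: nn_integral_add nn_integral_cmult)
    also have "\<dots> = H t s + ennreal (Kb * N) * emeasure lborel (cball (0::real^3) B) * q t s"
      unfolding H_def by (simp add: nn_integral_add nn_integral_multc nn_integral_cmult)
    also have "ennreal (Kb * N) * emeasure lborel (cball (0::real^3) B) = ennreal C"
      using Kb N V by (simp add: C_def ennreal_mult)
    finally show ?thesis .
  qed
  show ?thesis
  proof (rule ennreal_le_epsilon)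
    fix e :: real assume e: "e > 0"
    define e' where "e' = e / (C + 1)"
    have e': "e' > 0" using e C by (simp add: e'_def)
    obtain \<delta> where \<delta>: "\<delta> > 0" "\<And>h. norm h < \<delta> \<Longrightarrow> (\<integral>\<^sub>1x. \<bar>g (x + h) - g x\<bar>) \<le> e'"
      using L1_continuousD[OF gi e'] by metis
    obtain \<eta> where \<eta>: "Borel \<eta>" "\<And>t. \<eta> t \<ge> 0" "(\<integral>\<^sub>+t. ennreal (\<eta> t)) = 1" "\<And>t. \<bar>t\<bar> \<ge> \<delta> \<Longrightarrow> \<eta> t = 0"
        "(\<integral>\<^sub>+z z'. ennreal (\<eta> (snd z - snd z') * (g z * g z' * k (fst z - fst z')))) \<le> J"
      using approx[OF \<delta>(1)] by blast
    note [measurable] = \<eta>(1)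
    have one: "(\<integral>\<^sub>+s. ennreal (\<eta> (t - s))) = 1" for t
      using nn_integral_reflect[of "\<lambda>s. ennreal (\<eta> s)" t] \<eta>(3) by simp
    have "(\<integral>\<^sub>+t. H t t) = (\<integral>\<^sub>+t s. ennreal (\<eta> (t - s)) * H t t)"
      by (intro nn_integral_cong) (simp add: nn_integral_multc one)
    also have "\<dots> \<le> (\<integral>\<^sub>+t s. ennreal (\<eta> (t - s)) * H t s + ennreal C * (ennreal (\<eta> (t - s)) * q t s))"
    proof (intro nn_integral_mono)
      fix t s
      show "ennreal (\<eta> (t - s)) * H t t \<le> ennreal (\<eta> (t - s)) * H t s + ennreal C * (ennreal (\<eta> (t - s)) * q t s)"
        using mult_left_mono[OF Hq[of t s], of "ennreal (\<eta> (t - s))"] by (simp add: distrib_left mult_ac)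
    qed
    also have "\<dots> = (\<integral>\<^sub>+t s. ennreal (\<eta> (t - s)) * H t s) + ennreal C * (\<integral>\<^sub>+t s. ennreal (\<eta> (t - s)) * q t s)"
      by (simp add: nn_integral_add nn_integral_cmult)
    also have "(\<integral>\<^sub>+t s. ennreal (\<eta> (t - s)) * H t s) \<le> J"
    proof -
      have [measurable]: "(fst :: point \<Rightarrow> _) \<in> borel_measurable borel" "(snd :: point \<Rightarrow> _) \<in> borel_measurable borel"
        by (intro borel_measurable_continuous_onI continuous_intros)+
      have m: "Borel (\<lambda>z. \<integral>\<^sub>+z'. ennreal (\<eta> (snd z - snd z') * (g z * g z' * k (fst z - fst z'))))"
        by measurable
      have "(\<integral>\<^sub>+z z'. ennreal (\<eta> (snd z - snd z') * (g z * g z' * k (fst z - fst z'))))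
        = (\<integral>\<^sub>+t x s y. ennreal (\<eta> (t - s)) * ennreal (g (x, t) * g (y, s) * k (x - y)))"
      proof (subst nn_integral_time_slices[OF m], intro nn_integral_cong)
        fix t x
        show "(\<integral>\<^sub>+z'. ennreal (\<eta> (snd (x, t) - snd z') * (g (x, t) * g z' * k (fst (x, t) - fst z'))))
          = (\<integral>\<^sub>+s y. ennreal (\<eta> (t - s)) * ennreal (g (x, t) * g (y, s) * k (x - y)))"
          using \<eta>(2) by (subst nn_integral_time_slices) (auto simp: ennreal_mult')
      qed
      also have "\<dots> = (\<integral>\<^sub>+t s x y. ennreal (\<eta> (t - s)) * ennreal (g (x, t) * g (y, s) * k (x - y)))"
        by (intro nn_integral_cong lborel_pair.Fubini') measurable
      also have "\<dots> = (\<integral>\<^sub>+t s. ennreal (\<eta> (t - s)) * H t s)"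
        unfolding H_def by (simp add: nn_integral_cmult)
      finally show ?thesis using \<eta>(5) by simp
    qed
    also have "(\<integral>\<^sub>+t s. ennreal (\<eta> (t - s)) * q t s) \<le> ennreal e'"
    proof -
      have "(\<integral>\<^sub>+t s. ennreal (\<eta> (t - s)) * q t s) = (\<integral>\<^sub>+t r. ennreal (\<eta> r) * q t (t - r))"
      proof (rule nn_integral_cong)
        fix t
        show "(\<integral>\<^sub>+s. ennreal (\<eta> (t - s)) * q t s) = (\<integral>\<^sub>+r. ennreal (\<eta> r) * q t (t - r))"
          using nn_integral_reflect[of "\<lambda>s. ennreal (\<eta> (t - s)) * q t s" t] by simp
      qed
      also have "\<dots> = (\<integral>\<^sub>+r t. ennreal (\<eta> r) * q t (t - r))"
        by (rule lborel_pair.Fubini') measurable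
      also have "\<dots> = (\<integral>\<^sub>+r. ennreal (\<eta> r) * (\<integral>\<^sub>+t. q t (t - r)))"
        by (intro nn_integral_cong nn_integral_cmult) measurable
      also have "\<dots> \<le> (\<integral>\<^sub>+r. ennreal (\<eta> r) * ennreal e')"
      proof (intro nn_integral_mono)
        fix r
        show "ennreal (\<eta> r) * (\<integral>\<^sub>+t. q t (t - r)) \<le> ennreal (\<eta> r) * ennreal e'"
        proof (cases "\<bar>r\<bar> < \<delta>")
          case False
          then show ?thesis using \<eta>(4)[of r] by simp
        next
          case True
          have i: "integrable lborel (\<lambda>z. \<bar>g (z + (0, - r)) - g z\<bar>)"
            by (intro integrable_abs Bochner_Integration.integrable_diff integrable_translation gi)
          have "(\<integral>\<^sub>+t. q t (t - r)) = (\<integral>\<^sub>+z. ennreal \<bar>g (z + (0, - r)) - g z\<bar>)"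
            unfolding q_def using i by (subst nn_integral_time_slices) (auto simp: abs_minus_commute)
          also have "\<dots> = ennreal (\<integral>\<^sub>1z. \<bar>g (z + (0, - r)) - g z\<bar>)"
            by (rule nn_integral_eq_integral[OF i]) simp
          also have "\<dots> \<le> ennreal e'" using True by (intro ennreal_leI \<delta>(2)) (simp add: norm_Pair)
          finally show ?thesis by (rule mult_left_mono) simp
        qed
      qed
      also have "\<dots> = ennreal e'" by (simp add: nn_integral_multc \<eta>(3))
      finally show ?thesis .
    qed
    also have "J + ennreal C * ennreal e' \<le> J + ennreal e"
    proof -
      have "C * e' \<le> e" using e C by (simp add: e'_def divide_simps mult_right_mono)
      then show ?thesis using C e' by (simp add: ennreal_mult[symmetric] add_left_mono ennreal_leI)
    qed
    finally show "(\<integral>\<^sub>+t x y. ennreal (g (x, t) * g (y, t) * k (x - y))) \<le> J + ennreal e"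
      unfolding H_def by (simp add: add_left_mono add_right_mono mult_left_mono)
  qed
qed

lemma kap_antimono: assumes "0 < s" "s \<le> s'" shows "kap s' \<le> kap s"
proof -
  have "ell s' powr (4/3) \<le> ell s powr (4/3)"
    using ell_ge_3[of s'] assms by (intro powr_mono2 ell_antimono) auto
  moreover have "s' powr (-1/2) \<le> s powr (-1/2)" using assms by (intro powr_mono2') auto
  ultimately show ?thesis unfolding kap_def by (intro mult_mono) auto
qed

definition even_bump :: "real \<Rightarrow> (real \<Rightarrow> real) \<Rightarrow> bool" where
  "even_bump \<delta> \<eta> \<longleftrightarrow> smooth \<eta> \<and> (\<forall>t. \<eta> t \<ge> 0) \<and> (\<forall>t. \<eta> (- t) = \<eta> t) \<and> (\<integral>\<^sub>+t. ennreal (\<eta> t)) = 1 \<and> (\<forall>t. \<bar>t\<bar> \<ge> \<delta> \<longrightarrow> \<eta> t = 0)"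

text \<open>The arithmetic-geometric mean of r^(1/2) and r'^(1/2), multiplied by r r'.\<close>

lemma powr_five_quarters_product:
  fixes r r' :: real assumes "r \<ge> 0" "r' \<ge> 0"
  shows "r powr (5/4) * r' powr (5/4) \<le> 1/2 * (r powr (3/2) * r' + r' powr (3/2) * r)"
proof (cases "r = 0 \<or> r' = 0")
  case False
  then have rr: "r > 0" "r' > 0" using assms by auto
  have e: "x powr (5/4) = x * x powr (1/4)" "x powr (3/2) = x * (x powr (1/4))\<^sup>2" if "x > 0" for x :: real
  proof -
    have "x powr (5/4) = x powr 1 * x powr (1/4)" unfolding powr_add[symmetric] by simp
    then show "x powr (5/4) = x * x powr (1/4)" using that by simp
    have "(x powr (1/4))\<^sup>2 = x powr (1/2)" using that by (subst powr_power) auto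
    moreover have "x powr (3/2) = x powr 1 * x powr (1/2)" unfolding powr_add[symmetric] by simp
    ultimately show "x powr (3/2) = x * (x powr (1/4))\<^sup>2" using that by simp
  qed
  let ?a = "r powr (1/4)" and ?b = "r' powr (1/4)"
  have "2 * (?a * ?b) \<le> ?a\<^sup>2 + ?b\<^sup>2" using sum_squares_bound[of ?a ?b] by simp
  then have "(r * r') * (2 * (?a * ?b)) \<le> (r * r') * (?a\<^sup>2 + ?b\<^sup>2)" using rr by (intro mult_left_mono) auto
  then show ?thesis unfolding e[OF rr(1)] e[OF rr(2)] by (simp add: algebra_simps)
qed auto

section \<open>Passage to equal times and to the singular kernel\<close>

context bounded_flow
begin

definition g where "g z = w z * R z powr (5/4)"

lemma g_nonneg: "g z \<ge> 0"
  by (simp add: g_def w0)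

lemma measurable_g[measurable]: "Borel g"
  unfolding g_def[abs_def] by measurable

lemma g_product_le:
  assumes "\<And>t. \<eta> t \<ge> 0" "\<And>t. \<eta> (- t) = \<eta> t"
  shows "\<eta> (snd z - snd z') * (g z * g z' * kap (sep d z z')) \<le> 1/2 * (good \<eta> d z z' + good \<eta> d z' z)"
proof -
  define A where "A = w z * w z' * \<eta> (snd z - snd z') * kap (sep d z z')"
  have A: "A \<ge> 0" unfolding A_def using w0 assms kap_nonneg by (intro mult_nonneg_nonneg)
  have sym: "sep d z' z = sep d z z'" "\<eta> (snd z' - snd z) = \<eta> (snd z - snd z')"
    using assms(2)[of "snd z - snd z'"] sep_commute by auto
  have "R z powr (5/4) * R z' powr (5/4) \<le> 1/2 * (R z powr (3/2) * R z' + R z' powr (3/2) * R z)"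
    by (intro powr_five_quarters_product R0)
  also have "\<dots> \<le> 1/2 * (P z * R z' + P z' * R z)"
    by (intro mult_left_mono add_mono mult_right_mono PR R0) simp
  finally have "A * (R z powr (5/4) * R z' powr (5/4)) \<le> A * (1/2 * (P z * R z' + P z' * R z))" by (rule mult_left_mono[OF _ A])
  then show ?thesis by (simp add: A_def g_def good_def sym algebra_simps)
qed

lemma g_interaction_bound:
  assumes d: "0 < d" "d \<le> 1" and \<eta>: "even_bump \<delta> \<eta>"
  shows "(\<integral>\<^sub>+z z'. ennreal (\<eta> (snd z - snd z') * (g z * g z' * kap (sep d z z')))) \<le> ennreal good_const"
proof -
  have \<eta>': "smooth \<eta>" "\<And>t. \<eta> t \<ge> 0" "\<And>t. \<eta> (- t) = \<eta> t" "(\<integral>\<^sub>+t. ennreal (\<eta> t)) = 1"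
    using \<eta> unfolding even_bump_def by auto
  have [measurable]: "Borel \<eta>"
    by (intro borel_measurable_continuous_onI smooth_continuous \<eta>'(1))
  have gm[measurable]: "(\<lambda>(z, z'). good \<eta> d z z') \<in> borel_measurable (lborel \<Otimes>\<^sub>M lborel)"
    by (rule measurable_pair_terms) measurable
  have gs[measurable]: "(\<lambda>(z, z'). good \<eta> d z' z) \<in> borel_measurable (lborel \<Otimes>\<^sub>M lborel)"
    using measurable_compose[OF measurable_pair_swap' gm] by (simp add: split_beta')
  have g0: "0 \<le> good \<eta> d z z'" for z z' by (rule pair_terms_nonneg(1)[where \<eta>=\<eta>, OF d(1) \<eta>'(2)])
  have "(\<integral>\<^sub>+z z'. ennreal (\<eta> (snd z - snd z') * (g z * g z' * kap (sep d z z'))))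
     \<le> (\<integral>\<^sub>+z z'. ennreal (1/2) * (ennreal (good \<eta> d z z') + ennreal (good \<eta> d z' z)))"
  proof (intro nn_integral_mono)
    fix z z' :: "point"
    have "ennreal (\<eta> (snd z - snd z') * (g z * g z' * kap (sep d z z'))) \<le> ennreal (1/2 * (good \<eta> d z z' + good \<eta> d z' z))"
      by (intro ennreal_leI g_product_le[where \<eta>=\<eta>, OF \<eta>'(2) \<eta>'(3)])
    also have "\<dots> = ennreal (1/2) * ennreal (good \<eta> d z z' + good \<eta> d z' z)"
      using g0 by (intro ennreal_mult add_nonneg_nonneg) auto
    also have "ennreal (good \<eta> d z z' + good \<eta> d z' z) = ennreal (good \<eta> d z z') + ennreal (good \<eta> d z' z)"
      by (intro ennreal_plus g0)
    finally show "ennreal (\<eta> (snd z - snd z') * (g z * g z' * kap (sep d z z'))) \<le> ennreal (1/2) * (ennreal (good \<eta> d z z') + ennreal (good \<eta> d z' z))" .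
  qed
  also have "\<dots> = ennreal (1/2) * ((\<integral>\<^sub>+z z'. ennreal (good \<eta> d z z')) + (\<integral>\<^sub>+z z'. ennreal (good \<eta> d z' z)))"
    by (simp add: nn_integral_cmult nn_integral_add)
  also have "(\<integral>\<^sub>+z z'. ennreal (good \<eta> d z' z)) = (\<integral>\<^sub>+z' z. ennreal (good \<eta> d z' z))"
    by (rule lborel_pair.Fubini') measurable
  also have "ennreal (1/2) * ((\<integral>\<^sub>+z z'. ennreal (good \<eta> d z z')) + (\<integral>\<^sub>+z' z. ennreal (good \<eta> d z' z)))
     \<le> ennreal (1/2) * (ennreal good_const + ennreal good_const)"
    by (intro mult_left_mono add_mono good_bound[where \<eta>=\<eta>, OF d \<eta>'(1) \<eta>'(2) \<eta>'(3) \<eta>'(4)]) auto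
  also have "\<dots> = ennreal good_const"
  proof -
    have "ennreal good_const + ennreal good_const = ennreal (good_const + good_const)"
      using const_nonneg by (intro ennreal_plus[symmetric])
    moreover have "ennreal (1/2) * ennreal (good_const + good_const) = ennreal (1/2 * (good_const + good_const))"
      using const_nonneg by (intro ennreal_mult[symmetric]) auto
    ultimately show ?thesis by simp
  qed
  finally show ?thesis .
qed

text \<open>Truncating g at n and taking d = 1/(n+1) makes density and kernel bounded, so
  \<open>time_localization_limit\<close> applies for every n with the same right-hand side. Both
  modifications increase to the original quantities, and monotone convergence removes them.\<close>

theorem density_interaction_bound:
  assumes bumps: "\<And>\<delta>. \<delta> > 0 \<Longrightarrow> \<exists>\<eta>. even_bump \<delta> \<eta>"
  shows "(\<integral>\<^sub>+t x y. ennreal (g (x, t) * g (y, t) * kap ((norm (x - y))\<^sup>2))) \<le> ennreal good_const"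
proof -
  have [measurable]: "g \<in> borel_measurable (borel \<Otimes>\<^sub>M borel)" by (simp add: borel_prod)
  define d where "d = (\<lambda>n. 1 / real (Suc n))"
  define G where "G = (\<lambda>n z. min (real n) (g z))"
  have d: "0 < d n" "d n \<le> 1" for n by (auto simp: d_def)
  have Gm[measurable]: "Borel (G n)" for n unfolding G_def by measurable
  then have [measurable]: "G n \<in> borel_measurable (borel \<Otimes>\<^sub>M borel)" for n by (simp add: borel_prod)
  have G: "0 \<le> G n z" "G n z \<le> g z" "G n z \<le> real n" for n z unfolding G_def using g_nonneg by auto
  define F where "F = (\<lambda>n t x y. ennreal (G n (x, t) * G n (y, t) * kap ((norm (x - y))\<^sup>2 + d n)))"
  have [measurable]: "Borel (\<lambda>y. F n t x y)" "Borel (\<lambda>x. \<integral>\<^sub>+y. F n t x y)"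
    "Borel (\<lambda>t. \<integral>\<^sub>+x y. F n t x y)" for n t x
    unfolding F_def by measurable
  have Fle: "(\<integral>\<^sub>+t x y. F n t x y) \<le> ennreal good_const" for n
    unfolding F_def
  proof (rule time_localization_limit[where N="real n" and B=B and T=T and k="\<lambda>x. kap ((norm x)\<^sup>2 + d n)" and Kb="kap (d n)"])
    show "G n (x, t) = 0" if "norm x > B \<or> t \<notin> {0..T}" for x t
    proof -
      have "(x, t) \<notin> Q \<Omega> T" using QD[of "(x, t)"] that by auto
      then show ?thesis using zero(1) by (simp add: G_def g_def)
    qed
    show "kap ((norm x)\<^sup>2 + d n) \<le> kap (d n)" for x :: "real^3" using d by (intro kap_antimono) auto
    fix \<delta> :: real assume "\<delta> > 0"
    then obtain \<eta> where \<eta>: "even_bump \<delta> \<eta>" using bumps by blast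
    then have \<eta>': "smooth \<eta>" "\<And>t. \<eta> t \<ge> 0" unfolding even_bump_def by auto
    have m: "Borel \<eta>" by (intro borel_measurable_continuous_onI smooth_continuous \<eta>'(1))
    have "(\<integral>\<^sub>+z z'. ennreal (\<eta> (snd z - snd z') * (G n z * G n z' * kap ((norm (fst z - fst z'))\<^sup>2 + d n))))
      \<le> (\<integral>\<^sub>+z z'. ennreal (\<eta> (snd z - snd z') * (g z * g z' * kap (sep (d n) z z'))))"
      unfolding sep_def using \<eta>'(2) G g_nonneg kap_nonneg
      by (intro nn_integral_mono ennreal_leI mult_left_mono mult_right_mono mult_mono) auto
    also have "\<dots> \<le> ennreal good_const" by (rule g_interaction_bound[OF d \<eta>])
    finally show "\<exists>\<eta>. \<eta> \<in> borel_measurable borel \<and> (\<forall>t. \<eta> t \<ge> 0) \<and> (\<integral>\<^sub>+t. ennreal (\<eta> t)) = 1 \<and>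
      (\<forall>t. \<bar>t\<bar> \<ge> \<delta> \<longrightarrow> \<eta> t = 0) \<and>
      (\<integral>\<^sub>+z z'. ennreal (\<eta> (snd z - snd z') * (G n z * G n z' * kap ((norm (fst z - fst z'))\<^sup>2 + d n)))) \<le> ennreal good_const"
      using m \<eta> unfolding even_bump_def by blast
  qed (use G kap_nonneg in auto)
  have Gs: "G n z \<le> G (Suc n) z" for n z by (auto simp: G_def)
  have inc: "F n t x y \<le> F (Suc n) t x y" for n t x y
    unfolding F_def
  proof (intro ennreal_leI mult_mono kap_antimono Gs)
    show "0 < (norm (x - y))\<^sup>2 + d (Suc n)" using d by (simp add: add_nonneg_pos)
    show "(norm (x - y))\<^sup>2 + d (Suc n) \<le> (norm (x - y))\<^sup>2 + d n" by (simp add: d_def frac_le)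
  qed (use G kap_nonneg in auto)
  then have incs: "incseq (\<lambda>n. F n t x y)" for t x y by (rule incseq_SucI)
  have lim: "ennreal (g (x, t) * g (y, t) * kap ((norm (x - y))\<^sup>2)) \<le> (SUP n. F n t x y)" for t x y
  proof (cases "x = y")
    \<comment> \<open>On the diagonal the left side is 0, because \<open>0 powr a\<close> is
      0.\<close>
    case True
    then show ?thesis by (simp add: kap_def)
  next
    case False
    then have s: "(norm (x - y))\<^sup>2 > 0" by simp
    have "isCont kap ((norm (x - y))\<^sup>2)" using kap_deriv[OF s] by (rule DERIV_isCont)
    moreover have "(\<lambda>n. (norm (x - y))\<^sup>2 + d n) \<longlonglongrightarrow> (norm (x - y))\<^sup>2"
      using tendsto_add[OF tendsto_const LIMSEQ_inverse_real_of_nat, of "(norm (x - y))\<^sup>2"] unfolding d_def inverse_eq_divide by simp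
    ultimately have k: "(\<lambda>n. kap ((norm (x - y))\<^sup>2 + d n)) \<longlonglongrightarrow> kap ((norm (x - y))\<^sup>2)"
      by (rule isCont_tendsto_compose)
    have Gl: "(\<lambda>n. G n z) \<longlonglongrightarrow> g z" for z
    proof (rule tendsto_eventually, rule eventually_sequentiallyI)
      fix n assume "nat \<lceil>g z\<rceil> \<le> n"
      then show "G n z = g z" unfolding G_def by (simp add: nat_le_iff ceiling_le_iff min_absorb2)
    qed
    have "(\<lambda>n. F n t x y) \<longlonglongrightarrow> ennreal (g (x, t) * g (y, t) * kap ((norm (x - y))\<^sup>2))"
      unfolding F_def by (intro tendsto_ennrealI tendsto_mult Gl k)
    from LIMSEQ_unique[OF this LIMSEQ_SUP[OF incs]] show ?thesis by (rule eq_refl)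
  qed
  have "(\<integral>\<^sub>+t x y. ennreal (g (x, t) * g (y, t) * kap ((norm (x - y))\<^sup>2)))
    \<le> (\<integral>\<^sub>+t x y. (SUP n. F n t x y))"
    by (intro nn_integral_mono lim)
  also have "\<dots> = (\<integral>\<^sub>+t x. (SUP n. \<integral>\<^sub>+y. F n t x y))"
    by (intro nn_integral_cong nn_integral_monotone_convergence_SUP) (auto intro!: incseq_SucI le_funI inc)
  also have "\<dots> = (\<integral>\<^sub>+t. (SUP n. \<integral>\<^sub>+x y. F n t x y))"
    by (intro nn_integral_cong nn_integral_monotone_convergence_SUP) (auto intro!: incseq_SucI le_funI nn_integral_mono inc)
  also have "\<dots> = (SUP n. \<integral>\<^sub>+t x y. F n t x y)"
    by (intro nn_integral_monotone_convergence_SUP) (auto intro!: incseq_SucI le_funI nn_integral_mono inc)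
  also have "\<dots> \<le> ennreal good_const" by (intro SUP_least Fle)
  finally show ?thesis .
qed

text \<open>With w = l^2 one has (l^4 R)^(5/4) = l^5 R^(5/4) = l^3 g, so a factor l^3 is bounded at
  each of the two points; the power 3/2 leaves l^6.\<close>

corollary localized_density_bounds:
  assumes bumps: "\<And>\<delta>. \<delta> > 0 \<Longrightarrow> \<exists>\<eta>. even_bump \<delta> \<eta>"
    and l: "Borel l" "\<And>z. 0 \<le> l z" "\<And>z. l z \<le> lmax" "\<And>z. w z = (l z)\<^sup>2"
  shows "density_bounds B T (lmax ^ 6 * E) (lmax ^ 6 * good_const) (\<lambda>z. l z ^ 4 * R z)"
proof -
  note [measurable] = l(1)
  have [measurable]: "l \<in> borel_measurable (borel \<Otimes>\<^sub>M borel)" "R \<in> borel_measurable (borel \<Otimes>\<^sub>M borel)" "g \<in> borel_measurable (borel \<Otimes>\<^sub>M borel)"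
    by (simp_all add: borel_prod)
  have lmax: "lmax \<ge> 0" using l(2,3)[of 0] by linarith
  have p: "(l z ^ 4 * R z) powr q = (l z ^ 4) powr q * R z powr q" for z q by (rule powr_mult)
  have p4: "(l z ^ 4) powr (5/4) = l z ^ 5" "(l z ^ 4) powr (3/2) = l z ^ 6" for z
  proof -
    have "(l z ^ 4) powr (n/4) = l z ^ m" if "l z > 0" "real m = n" for n m
    proof -
      have "l z ^ 4 = l z powr 4" using that(1) by (simp add: powr_numeral)
      then have "(l z ^ 4) powr (n/4) = l z powr (real m)" unfolding that(2) by (simp only: powr_powr) simp
      then show ?thesis using that(1) by (simp add: powr_realpow)
    qed
    from this[of 5 5] this[of 6 6] show "(l z ^ 4) powr (5/4) = l z ^ 5" "(l z ^ 4) powr (3/2) = l z ^ 6"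
      using l(2)[of z] by (cases "l z = 0"; simp)+
  qed
  show ?thesis unfolding density_bounds_def
  proof (intro conjI allI impI)
    show "Borel (\<lambda>z. l z ^ 4 * R z)" by measurable
    show "l z ^ 4 * R z \<ge> 0" for z using R0 l(2) by auto
    show "l (x, t) ^ 4 * R (x, t) = 0" if "norm x > B \<or> t \<notin> {0..T}" for x t
    proof -
      have "(x, t) \<notin> Q \<Omega> T" using QD[of "(x, t)"] that by auto
      then show ?thesis using zero(1) by simp
    qed
    show "AE t in lborel. (\<integral>\<^sub>+x. ennreal ((l (x, t) ^ 4 * R (x, t)) powr (3/2))) \<le> ennreal (lmax ^ 6 * E)"
      using slice_R
    proof eventually_elim
      case (elim t)
      have "(\<integral>\<^sub>+x. ennreal ((l (x, t) ^ 4 * R (x, t)) powr (3/2))) \<le> (\<integral>\<^sub>+x. ennreal (lmax ^ 6) * ennreal (R (x, t) powr (3/2)))"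
      proof (intro nn_integral_mono)
        fix x
        have "l (x, t) ^ 6 * R (x, t) powr (3/2) \<le> lmax ^ 6 * R (x, t) powr (3/2)"
          using l by (intro mult_right_mono power_mono) auto
        then show "ennreal ((l (x, t) ^ 4 * R (x, t)) powr (3/2)) \<le> ennreal (lmax ^ 6) * ennreal (R (x, t) powr (3/2))"
          unfolding p p4 using lmax by (simp add: ennreal_leI flip: ennreal_mult)
      qed
      also have "\<dots> = ennreal (lmax ^ 6) * (\<integral>\<^sub>+x. ennreal (R (x, t) powr (3/2)))" by (rule nn_integral_cmult) measurable
      also have "\<dots> \<le> ennreal (lmax ^ 6) * ennreal E" by (intro mult_left_mono elim) simp
      also have "\<dots> = ennreal (lmax ^ 6 * E)" using lmax E by (simp add: ennreal_mult)
      finally show ?case .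
    qed
    have le: "(l z ^ 4 * R z) powr (5/4) \<le> lmax ^ 3 * g z" for z
    proof -
      have "l z ^ 3 * (l z ^ 2 * R z powr (5/4)) \<le> lmax ^ 3 * (l z ^ 2 * R z powr (5/4))"
        using l by (intro mult_right_mono power_mono) auto
      moreover have "l z ^ 5 = l z ^ 3 * l z ^ 2" using power_add[of "l z" 3 2] by simp
      ultimately show ?thesis unfolding p p4 g_def l(4) by (simp only: mult.assoc)
    qed
    have "(\<integral>\<^sub>+t x y. ennreal ((l (x, t) ^ 4 * R (x, t)) powr (5/4) * (l (y, t) ^ 4 * R (y, t)) powr (5/4) * kap ((norm (x - y))\<^sup>2)))
       \<le> (\<integral>\<^sub>+t x y. ennreal (lmax ^ 6) * ennreal (g (x, t) * g (y, t) * kap ((norm (x - y))\<^sup>2)))"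
    proof (intro nn_integral_mono)
      fix t x y
      have "(l (x, t) ^ 4 * R (x, t)) powr (5/4) * (l (y, t) ^ 4 * R (y, t)) powr (5/4) * kap ((norm (x - y))\<^sup>2)
        \<le> (lmax ^ 3 * g (x, t)) * (lmax ^ 3 * g (y, t)) * kap ((norm (x - y))\<^sup>2)"
        using lmax g_nonneg kap_nonneg by (intro mult_right_mono mult_mono le) auto
      also have "\<dots> = lmax ^ 6 * (g (x, t) * g (y, t) * kap ((norm (x - y))\<^sup>2))" 
        using power_add[of lmax 3 3] by (simp add: mult_ac)
      finally show "ennreal ((l (x, t) ^ 4 * R (x, t)) powr (5/4) * (l (y, t) ^ 4 * R (y, t)) powr (5/4) * kap ((norm (x - y))\<^sup>2))
        \<le> ennreal (lmax ^ 6) * ennreal (g (x, t) * g (y, t) * kap ((norm (x - y))\<^sup>2))"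
        using lmax g_nonneg kap_nonneg by (simp add: ennreal_leI flip: ennreal_mult)
    qed
    also have "\<dots> = ennreal (lmax ^ 6) * (\<integral>\<^sub>+t x y. ennreal (g (x, t) * g (y, t) * kap ((norm (x - y))\<^sup>2)))"
      by (simp add: nn_integral_cmult)
    also have "\<dots> \<le> ennreal (lmax ^ 6) * ennreal good_const" by (intro mult_left_mono density_interaction_bound bumps) auto
    also have "\<dots> = ennreal (lmax ^ 6 * good_const)" using lmax const_nonneg by (simp add: ennreal_mult)
    finally show "(\<integral>\<^sub>+t x y. ennreal ((l (x, t) ^ 4 * R (x, t)) powr (5/4) * (l (y, t) ^ 4 * R (y, t)) powr (5/4) * kap ((norm (x - y))\<^sup>2))) \<le> ennreal (lmax ^ 6 * good_const)" .
  qed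
qed

end

section \<open>The Sobolev inequality on time slices\<close>

text \<open>If the integral vanished, the nonempty open set where f is nonzero would be a null
  set.\<close>

lemma bump_integral_pos:
  fixes f :: "'a::euclidean_space \<Rightarrow> real"
  assumes f: "continuous_on UNIV f" "\<And>x. f x \<ge> 0" and W: "bounded W" "\<And>x. x \<notin> W \<Longrightarrow> f x = 0" and x0: "f x0 \<noteq> 0"
  shows "integrable lborel f" "(\<integral>\<^sub>1x. f x) > 0"
proof -
  obtain r where r: "\<And>x. x \<in> W \<Longrightarrow> norm x \<le> r" using W(1) by (auto simp: bounded_iff)
  have "integrable lborel (indicat_real (cball (0::'a) r))"
    using emeasure_lborel_cball_finite[of "0::'a" r] by (simp add: integrable_indicator_iff)
  then have "integrable lborel (\<lambda>x. indicat_real (cball (0::'a) r) x *\<^sub>R f x)"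
    by (rule integrable_scaleR_continuous[where W="cball 0 r"]) (use f in auto)
  moreover have "(\<lambda>x. indicat_real (cball (0::'a) r) x *\<^sub>R f x) = f"
    using W(2) r by (fastforce simp: indicator_def)
  ultimately show i: "integrable lborel f" by simp
  have "(\<integral>\<^sub>1x. f x) \<noteq> 0"
  proof
    assume "(\<integral>\<^sub>1x. f x) = 0"
    then have "AE x in lborel. f x = 0" using f(2) i by (subst (asm) integral_nonneg_eq_0_iff_AE) auto
    moreover have op: "open {x. f x \<noteq> 0}" by (intro open_Collect_neq f continuous_on_const)
    ultimately have "{x. f x \<noteq> 0} \<in> null_sets lborel" using AE_iff_null_sets[of "{x. f x \<noteq> 0}" lborel] by simp
    then have "negligible {x. f x \<noteq> 0}" by (simp add: negligible_iff_null_sets null_sets_completionI)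
    then show False using open_not_negligible[OF op] x0 by auto
  qed
  moreover have "(\<integral>\<^sub>1x. f x) \<ge> 0" using f(2) by (intro integral_nonneg_AE) auto
  ultimately show "(\<integral>\<^sub>1x. f x) > 0" by simp
qed

lemma compact_support_bounds:
  fixes l :: "'a::euclidean_space \<Rightarrow> real"
  assumes "compact (supp l)"
  obtains r where "r > 0" "\<And>z. norm z \<ge> r \<Longrightarrow> l z = 0"
proof -
  obtain r where r: "\<And>z. z \<in> supp l \<Longrightarrow> norm z \<le> r" using compact_imp_bounded[OF assms] by (auto simp: bounded_iff)
  show ?thesis
  proof (rule that[of "\<bar>r\<bar> + 1"])
    fix z :: 'a assume "norm z \<ge> \<bar>r\<bar> + 1"
    then have "z \<notin> supp l" using r[of z] by linarith
    then show "l z = 0" by (rule supp_notin)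
  qed simp
qed

text \<open>The given weight itself serves as a bump: its restriction to the time line through z0 is
  symmetrised about that point, squeezed into the interval of radius \<delta> and
  normalised.\<close>

lemma even_bump_exists:
  fixes l :: "point \<Rightarrow> real"
  assumes l: "smooth l" "compact (supp l)" "\<And>z. l z \<ge> 0" "l z0 \<noteq> 0" and \<delta>: "\<delta> > 0"
  shows "\<exists>\<eta>. even_bump \<delta> \<eta>"
proof -
  obtain r where r: "r > 0" "\<And>z. norm z \<ge> r \<Longrightarrow> l z = 0" using compact_support_bounds[OF l(2)] by metis
  obtain x0 t0 where z0: "z0 = (x0, t0)" by (cases z0)
  define h where "h = (\<lambda>t. l ((0, t) + z0) + l ((0, - t) + z0))"
  define a where "a = r + \<bar>t0\<bar>"
  have a: "a > 0" using r by (simp add: a_def)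
  have hs: "smooth h" unfolding h_def
    by (intro smooth_add smooth_affine_comp[OF _ l(1)]) (intro bounded_linear_Pair bounded_linear_zero bounded_linear_ident bounded_linear_minus)+
  have h0: "h t \<ge> 0" "h (- t) = h t" for t by (simp_all add: h_def l add.commute)
  have ha: "h t = 0" if "\<bar>t\<bar> \<ge> a" for t
  proof -
    have "l ((0, s) + z0) = 0" if "\<bar>s\<bar> \<ge> a" for s
    proof (rule r(2))
      have "r \<le> \<bar>s + t0\<bar>" using that by (simp add: a_def)
      also have "\<dots> \<le> norm ((0, s) + z0)" using norm_snd_le[of "s + t0" x0] by (simp add: z0)
      finally show "r \<le> norm ((0, s) + z0)" .
    qed
    from this[of t] this[of "- t"] that show ?thesis by (simp add: h_def)
  qed
  have hz: "h 0 \<noteq> 0" using l(4) l(3)[of z0] by (simp add: h_def flip: zero_prod_def)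
  have hi: "integrable lborel h" "(\<integral>\<^sub>1t. h t) > 0"
  proof -
    have "h t = 0" if "t \<notin> {-a..a}" for t using that by (intro ha) auto
    from bump_integral_pos[OF smooth_continuous[OF hs] h0(1) bounded_closed_interval this hz]
    show "integrable lborel h" "(\<integral>\<^sub>1t. h t) > 0" by auto
  qed
  define c where "c = (\<integral>\<^sub>1t. h t)"
  \<comment> \<open>The scaling takes the radius \<delta> to \<open>a\<close>, from which on h
    vanishes.\<close>
  define k where "k = a / \<delta>"
  have k: "k > 0" using a \<delta> by (simp add: k_def)
  have c: "c > 0" using hi by (simp add: c_def)
  define \<eta> where "\<eta> = (\<lambda>t. k / c * h (k * t))"
  have "smooth \<eta>" unfolding \<eta>_def
    using smooth_mult[OF smooth_const smooth_affine_comp[OF bounded_linear_mult_right hs, of _ 0], of "k / c" k] by simp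
  moreover have "\<eta> t \<ge> 0" "\<eta> (- t) = \<eta> t" for t using h0 k c by (simp_all add: \<eta>_def)
  moreover have "\<eta> t = 0" if "\<bar>t\<bar> \<ge> \<delta>" for t
  proof -
    have "a = k * \<delta>" using \<delta> by (simp add: k_def)
    also have "\<dots> \<le> \<bar>k * t\<bar>" using that k by (simp add: abs_mult)
    finally show ?thesis by (simp add: \<eta>_def ha)
  qed
  moreover have "(\<integral>\<^sub>+t. ennreal (\<eta> t)) = 1"
  proof -
    have [measurable]: "Borel h" using hi by auto
    have "ennreal c = (\<integral>\<^sub>+t. ennreal (h t))"
      unfolding c_def using hi h0 by (simp add: nn_integral_eq_integral)
    also have "\<dots> = ennreal k * (\<integral>\<^sub>+t. ennreal (h (k * t)))"
      using nn_integral_scale[of "\<lambda>t. ennreal (h t)" k 0] k by simp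
    finally have e: "ennreal k * (\<integral>\<^sub>+t. ennreal (h (k * t))) = ennreal c" by simp
    have "(\<integral>\<^sub>+t. ennreal (\<eta> t)) = (\<integral>\<^sub>+t. ennreal (1 / c) * (ennreal k * ennreal (h (k * t))))"
      unfolding \<eta>_def using k c h0 by (intro nn_integral_cong) (simp flip: ennreal_mult)
    also have "\<dots> = ennreal (1 / c) * (ennreal k * (\<integral>\<^sub>+t. ennreal (h (k * t))))"
      by (simp add: nn_integral_cmult)
    also have "\<dots> = 1" unfolding e using c by (simp flip: ennreal_mult)
    finally show ?thesis .
  qed
  ultimately show ?thesis unfolding even_bump_def by blast
qed

text \<open>The slice of l cuts an arbitrary smooth \<psi> off inside \<Omega>.
  \<open>Sobolev_weak\<close> asks for all smooth \<psi>, whereas the weak gradient is tested only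
  by functions supported in \<Omega>.\<close>

lemma slice_test_function:
  fixes l :: "point \<Rightarrow> real"
  assumes l: "smooth l" "compact (supp l)" "supp l \<subseteq> Q \<Omega> T" and \<psi>: "smooth \<psi>"
  shows "test_function \<Omega> (\<lambda>y. l (y, t) * \<psi> y)"
proof -
  define S where "S = (\<lambda>y. (y, t)) -` supp l"
  have "closed S" unfolding S_def supp_def by (intro closed_vimage closed_closure continuous_intros)
  moreover have "bounded S"
  proof (rule bounded_subset)
    show "bounded (fst ` supp l)" by (intro bounded_fst compact_imp_bounded l)
    show "S \<subseteq> fst ` supp l" unfolding S_def by force
  qed
  ultimately have cS: "compact S" by (simp add: compact_eq_bounded_closed)
  have sub: "supp (\<lambda>y. l (y, t) * \<psi> y) \<subseteq> S"
    unfolding supp_def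
  proof (rule closure_minimal[OF _ \<open>closed S\<close>])
    show "{y. l (y, t) * \<psi> y \<noteq> 0} \<subseteq> S" unfolding S_def using supp_notin[of _ l] by auto
  qed
  have "S \<subseteq> \<Omega>" unfolding S_def using l(3) by (auto simp: Q_def)
  moreover have "compact (supp (\<lambda>y. l (y, t) * \<psi> y))"
    using compact_Int_closed[OF cS, of "supp (\<lambda>y. l (y, t) * \<psi> y)"] sub by (simp add: supp_def Int_absorb1)
  moreover have "smooth (\<lambda>y. l (y, t) * \<psi> y)"
  proof (rule smooth_mult[OF _ \<psi>])
    have "bounded_linear (\<lambda>y::real^3. (y, 0::real))" by (intro bounded_linear_Pair bounded_linear_ident bounded_linear_zero)
    from smooth_affine_comp[OF this l(1), of "(0, t)"] show "smooth (\<lambda>y. l (y, t))" by simp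
  qed
  ultimately show ?thesis using sub unfolding test_function_def smooth_def by auto
qed

lemma slice_product_derivative:
  fixes l :: "point \<Rightarrow> real" and \<psi> :: "real^3 \<Rightarrow> real"
  assumes "smooth l" "smooth \<psi>"
  shows "frechet_derivative (\<lambda>y. l (y, t) * \<psi> y) (at y) h = l (y, t) * frechet_derivative \<psi> (at y) h + frechet_derivative l (at (y, t)) (h, 0) * \<psi> y"
proof -
  have p: "((\<lambda>y. (y, t)) has_derivative (\<lambda>h. (h, 0))) (at y)" by (auto intro!: derivative_eq_intros)
  have "((\<lambda>y. l (y, t) * \<psi> y) has_derivative (\<lambda>h. l (y, t) * frechet_derivative \<psi> (at y) h + frechet_derivative l (at (y, t)) (h, 0) * \<psi> y)) (at y)"
    by (rule has_derivative_mult[OF has_derivative_compose[OF p smooth_derivative(1)[OF assms(1)]] smooth_derivative(1)[OF assms(2)]])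
  from frechet_derivative_at[OF this, symmetric] show ?thesis by (rule fun_cong)
qed

text \<open>Some component is at least a third of the norm in absolute value, and 729 = 3^6.\<close>

lemma norm_power6_le: "norm x ^ 6 \<le> 729 * (\<Sum>i\<in>UNIV. (x $ i) ^ 6)" for x :: "real^3"
proof -
  have "\<exists>i. norm x \<le> 3 * \<bar>x $ i\<bar>"
  proof (rule ccontr)
    assume "\<not> ?thesis"
    then have "\<bar>x $ i\<bar> < norm x / 3" for i by (simp add: not_le field_simps)
    then have "(\<Sum>i\<in>UNIV. \<bar>x $ i\<bar>) < (\<Sum>i\<in>(UNIV :: 3 set). norm x / 3)" by (intro sum_strict_mono) auto
    then show False using norm_le_l1_cart[of x] by simp
  qed
  then obtain i where i: "norm x \<le> 3 * \<bar>x $ i\<bar>" by blast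
  have "norm x ^ 6 \<le> (3 * \<bar>x $ i\<bar>) ^ 6" using i by (intro power_mono) auto
  also have "\<dots> = 729 * (x $ i) ^ 6" by (simp add: power_mult_distrib power_even_abs)
  also have "(x $ i) ^ 6 \<le> (\<Sum>i\<in>UNIV. (x $ i) ^ 6)" by (intro member_le_sum) auto
  finally show ?thesis by simp
qed

text \<open>The summand \<open>1\<close> keeps the constant positive, so that the bound also holds if the gradient integral is infinite.\<close>

definition Sobolev_const :: "real \<Rightarrow> real" where
  "Sobolev_const C = 729 * (3 * (4096 * (2 * C\<^sup>2) ^ 3)) + 1"

text \<open>Each component of l U has the weak gradient given by the product rule, as testing the
  weak formula for U with l \<psi> shows. \<open>Sobolev_weak\<close> is applied to the three
  components with S = 2 C^2 y, where y is the integral of |U|^2 + |D|^2.\<close>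

lemma Sobolev_slice:
  fixes U :: "real^3 \<Rightarrow> real^3" and D :: "real^3 \<Rightarrow> real^3^3" and l :: "point \<Rightarrow> real"
  assumes l: "smooth l" "compact (supp l)" "supp l \<subseteq> Q \<Omega> T" "\<And>z. l z \<ge> 0" "l z0 \<noteq> 0"
    and C: "\<And>z. \<bar>l z\<bar> \<le> C" "\<And>z. norm (grad l z) \<le> C"
    and \<Omega>: "bounded \<Omega>" "\<And>x. x \<notin> \<Omega> \<Longrightarrow> U x = 0" "\<And>x. x \<notin> \<Omega> \<Longrightarrow> D x = 0"
    and [measurable]: "Borel U" "Borel D"
    and weak: "\<And>\<phi> i j. test_function \<Omega> \<phi> \<Longrightarrow> (\<integral>\<^sub>1x. U x $ i * frechet_derivative \<phi> (at x) (axis j 1)) = - (\<integral>\<^sub>1x. D x $ i $ j * \<phi> x)"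
  shows "(\<integral>\<^sub>+x. ennreal ((l (x, t) * norm (U x)) ^ 6))
    \<le> ennreal (Sobolev_const C) * (\<integral>\<^sub>+x. ennreal ((norm (U x))\<^sup>2 + (norm (D x))\<^sup>2)) ^ 3"
proof (cases "(\<integral>\<^sub>+x. ennreal ((norm (U x))\<^sup>2 + (norm (D x))\<^sup>2)) = \<infinity>")
  case True
  have "Sobolev_const C > 0" by (simp add: Sobolev_const_def add_nonneg_pos)
  then show ?thesis unfolding True by (simp add: ennreal_mult_top power3_eq_cube)
next
  case False
  define y where "y = enn2real (\<integral>\<^sub>+x. ennreal ((norm (U x))\<^sup>2 + (norm (D x))\<^sup>2))"
  have y: "(\<integral>\<^sub>+x. ennreal ((norm (U x))\<^sup>2 + (norm (D x))\<^sup>2)) = ennreal y" "y \<ge> 0"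
    using False by (auto simp: y_def top.not_eq_extremum)
  obtain r where r: "\<And>x. x \<in> \<Omega> \<Longrightarrow> norm x \<le> r" using \<Omega>(1) by (auto simp: bounded_iff)
  have sq: "integrable lborel (\<lambda>x. (norm (U x))\<^sup>2 + (norm (D x))\<^sup>2)"
    by (rule integrableI_nonneg) (use y in auto)
  have dom: "integrable lborel (\<lambda>x. indicat_real (cball 0 r) x + ((norm (U x))\<^sup>2 + (norm (D x))\<^sup>2))"
    by (rule Bochner_Integration.integrable_add[OF _ sq])
      (use emeasure_lborel_cball_finite[of "0::real^3" r] in \<open>simp add: integrable_indicator_iff\<close>)
  have le1: "n \<le> 1 + n\<^sup>2" for n :: real
  proof -
    have "0 \<le> (n - 1)\<^sup>2" "0 \<le> (n + 1)\<^sup>2" by auto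
    then show ?thesis unfolding power2_diff power2_sum by simp
  qed
  have cb: "norm (U x) \<le> indicat_real (cball 0 r) x + ((norm (U x))\<^sup>2 + (norm (D x))\<^sup>2)" "norm (D x) \<le> indicat_real (cball 0 r) x + ((norm (U x))\<^sup>2 + (norm (D x))\<^sup>2)" for x
  proof -
    show "norm (U x) \<le> indicat_real (cball 0 r) x + ((norm (U x))\<^sup>2 + (norm (D x))\<^sup>2)"
    proof (cases "x \<in> \<Omega>")
      case True
      then have i: "indicat_real (cball 0 r) x = 1" using r by simp
      show ?thesis unfolding i using le1[of "norm (U x)"] zero_le_power2[of "norm (D x)"] by linarith
    qed (simp add: \<Omega> indicator_def)
    show "norm (D x) \<le> indicat_real (cball 0 r) x + ((norm (U x))\<^sup>2 + (norm (D x))\<^sup>2)"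
    proof (cases "x \<in> \<Omega>")
      case True
      then have i: "indicat_real (cball 0 r) x = 1" using r by simp
      show ?thesis unfolding i using le1[of "norm (D x)"] zero_le_power2[of "norm (U x)"] by linarith
    qed (simp add: \<Omega> indicator_def)
  qed
  have Ui: "integrable lborel (\<lambda>x. U x $ i)" for i
  proof (rule Bochner_Integration.integrable_bound[OF dom])
    show "AE x in lborel. norm (U x $ i) \<le> norm (indicat_real (cball 0 r) x + ((norm (U x))\<^sup>2 + (norm (D x))\<^sup>2))"
      unfolding real_norm_def by (intro AE_I2 order_trans[OF order_trans[OF component_le_norm_cart cb(1)] abs_ge_self])
  qed (simp add: cart_eq_inner_axis)
  have Dn: "\<bar>D x $ i $ j\<bar> \<le> norm (D x)" for x i j
    using component_le_norm_cart[of "D x $ i" j] Finite_Cartesian_Product.norm_nth_le[of "D x" i] by linarith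
  have Dm[measurable]: "Borel (\<lambda>x. D x $ i $ j)" for i j
  proof -
    have "continuous_on UNIV (\<lambda>A::real^3^3. A $ i $ j)" by (intro continuous_intros)
    from measurable_compose[OF assms(12) borel_measurable_continuous_onI[OF this]] show ?thesis .
  qed
  have Um[measurable]: "Borel (\<lambda>x. U x $ i)" for i using Ui[of i] by auto
  have Di: "integrable lborel (\<lambda>x. D x $ i $ j)" for i j
  proof (rule Bochner_Integration.integrable_bound[OF dom])
    show "AE x in lborel. norm (D x $ i $ j) \<le> norm (indicat_real (cball 0 r) x + ((norm (U x))\<^sup>2 + (norm (D x))\<^sup>2))"
      unfolding real_norm_def by (intro AE_I2 order_trans[OF order_trans[OF Dn cb(2)] abs_ge_self])
  qed measurable
  have ix: "integrable lborel (\<lambda>x. U x $ i * \<phi> x)" "integrable lborel (\<lambda>x. D x $ i $ j * \<phi> x)" if "continuous_on UNIV \<phi>" for \<phi> :: "real^3 \<Rightarrow> real" and i j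
    using integrable_scaleR_continuous[OF Ui \<Omega>(1) _ that, of i] integrable_scaleR_continuous[OF Di \<Omega>(1) _ that, of i j] \<Omega> by auto
  define dl where "dl = (\<lambda>j x. frechet_derivative l (at (x, t)) (axis j 1, 0))"
  have dl: "frechet_derivative l (at (x, t)) (axis j 1, 0) = dl j x" for j x by (simp add: dl_def)
  have dlb: "\<bar>dl j x\<bar> \<le> C" for j x
    using component_le_norm_cart[of "grad l (x, t)" j] C(2)[of "(x, t)"] by (simp add: dl_def grad_def)
  have p: "continuous_on UNIV (\<lambda>x::real^3. (x, t))" by (intro continuous_intros)
  have cl: "continuous_on UNIV (\<lambda>x. l (x, t))"
    by (rule continuous_on_compose2[OF smooth_continuous[OF l(1), of UNIV] p]) simp
  have cdl: "continuous_on UNIV (dl j)" for j unfolding dl_def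
    by (rule continuous_on_compose2[OF smooth_continuous[OF smooth_derivative(2)[OF l(1)], of UNIV] p]) simp
  have [measurable]: "Borel (\<lambda>x. l (x, t))" "Borel (dl j)" for j
    by (intro borel_measurable_continuous_onI cl cdl)+
  define v where "v = (\<lambda>i x. l (x, t) * U x $ i)"
  define d where "d = (\<lambda>i j x. dl j x * U x $ i + l (x, t) * D x $ i $ j)"
  have vi: "integrable lborel (v i)" for i unfolding v_def using ix(1)[OF cl, of i] by (simp add: mult.commute)
  obtain x0 t0 where z0: "z0 = (x0, t0)" by (cases z0)
  \<comment> \<open>The mollifier is again made from the weight: its spatial slice through z0,
    normalised.\<close>
  obtain \<phi> :: "real^3 \<Rightarrow> real" and W where \<phi>: "smooth \<phi>" "\<And>x. \<phi> x \<ge> 0" "bounded W" "\<And>x. x \<notin> W \<Longrightarrow> \<phi> x = 0" "integrable lborel \<phi>" "(\<integral>\<^sub>1x. \<phi> x) = 1"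
  proof -
    define k where "k = (\<lambda>x. l (x, t0) * 1)"
    have tk: "test_function \<Omega> k" unfolding k_def by (rule slice_test_function[OF l(1,2,3) smooth_const])
    then have k: "smooth k" "bounded (supp k)" by (auto simp: test_function_def smooth_def compact_imp_bounded)
    have k0: "k x \<ge> 0" for x using l(4) by (simp add: k_def)
    have "integrable lborel k" "(\<integral>\<^sub>1x. k x) > 0"
    proof -
      have "k x0 \<noteq> 0" using l(5) by (simp add: k_def z0)
      then show "integrable lborel k" "(\<integral>\<^sub>1x. k x) > 0"
        using bump_integral_pos[where f=k and W="supp k" and ?x0.0=x0] smooth_continuous[OF k(1)] k0 k(2) supp_notin[of _ k] by blast+
    qed
    note ki = this
    define c where "c = (\<integral>\<^sub>1x. k x)"
    show ?thesis
    proof (rule that[of "\<lambda>x. 1 / c * k x" "supp k"])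
      show "smooth (\<lambda>x. 1 / c * k x)" by (intro smooth_mult smooth_const k)
      show "integrable lborel (\<lambda>x. 1 / c * k x)" using ki by simp
      show "(\<integral>\<^sub>1x. 1 / c * k x) = 1" using ki by (simp add: c_def)
    qed (use k0 ki k supp_notin[of _ k] in \<open>auto simp: c_def\<close>)
  qed
  have six: "(\<integral>\<^sub>+x. ennreal (v i x ^ 6)) \<le> ennreal (4096 * (2 * C\<^sup>2 * y) ^ 3)" for i
  proof (rule Sobolev_weak[OF \<phi> vi \<Omega>(1), where D="d i"])
    show "v i x = 0" if "x \<notin> \<Omega>" for x using \<Omega>(2)[OF that] by (simp add: v_def)
    show "Borel (d i j)" for j unfolding d_def by measurable
    show "2 * C\<^sup>2 * y \<ge> 0" using y by simp
    show "(\<integral>\<^sub>+x. ennreal ((d i j x)\<^sup>2)) \<le> ennreal (2 * C\<^sup>2 * y)" for j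
    proof -
      have dle: "(d i j x)\<^sup>2 \<le> 2 * C\<^sup>2 * ((norm (U x))\<^sup>2 + (norm (D x))\<^sup>2)" for x
      proof -
        have a: "\<bar>dl j x * U x $ i\<bar> \<le> C * norm (U x)"
          unfolding abs_mult using dlb[of j x] component_le_norm_cart[of "U x" i] by (intro mult_mono) auto
        have b: "\<bar>l (x, t) * D x $ i $ j\<bar> \<le> C * norm (D x)"
          unfolding abs_mult using C(1)[of "(x, t)"] Dn by (intro mult_mono) auto
        have sq: "(p + q)\<^sup>2 \<le> 2 * p\<^sup>2 + 2 * q\<^sup>2" for p q :: real
          using zero_le_power2[of "p - q"] unfolding power2_diff power2_sum by linarith
        have "(d i j x)\<^sup>2 \<le> 2 * (dl j x * U x $ i)\<^sup>2 + 2 * (l (x, t) * D x $ i $ j)\<^sup>2" unfolding d_def by (rule sq)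
        also have "(dl j x * U x $ i)\<^sup>2 \<le> (C * norm (U x))\<^sup>2" using power_mono[OF a abs_ge_zero, of 2] by simp
        also have "(l (x, t) * D x $ i $ j)\<^sup>2 \<le> (C * norm (D x))\<^sup>2" using power_mono[OF b abs_ge_zero, of 2] by simp
        finally show ?thesis by (simp add: power_mult_distrib algebra_simps)
      qed
      have "(\<integral>\<^sub>+x. ennreal ((d i j x)\<^sup>2)) \<le> (\<integral>\<^sub>+x. ennreal (2 * C\<^sup>2) * ennreal ((norm (U x))\<^sup>2 + (norm (D x))\<^sup>2))"
        by (intro nn_integral_mono, subst ennreal_mult[symmetric], simp, simp, rule ennreal_leI[OF dle])
      also have "\<dots> = ennreal (2 * C\<^sup>2) * ennreal y" unfolding y(1)[symmetric] by (rule nn_integral_cmult) measurable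
      also have "\<dots> = ennreal (2 * C\<^sup>2 * y)" using y(2) by (intro ennreal_mult[symmetric]) auto
      finally show ?thesis .
    qed
    fix \<psi> :: "real^3 \<Rightarrow> real" and j assume \<psi>: "smooth \<psi>"
    have c\<psi>: "continuous_on UNIV \<psi>" "continuous_on UNIV (\<lambda>x. frechet_derivative \<psi> (at x) (axis j 1))"
      by (intro smooth_continuous smooth_derivative \<psi>)+
    note i1 = ix(1)[OF continuous_on_mult[OF cl c\<psi>(2)], of i]
    note i2 = ix(1)[OF continuous_on_mult[OF cdl c\<psi>(1)], of i j]
    note i3 = ix(2)[OF continuous_on_mult[OF cl c\<psi>(1)], of i j]
    have "(\<integral>\<^sub>1x. U x $ i * (l (x, t) * frechet_derivative \<psi> (at x) (axis j 1))) + (\<integral>\<^sub>1x. U x $ i * (dl j x * \<psi> x))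
      = - (\<integral>\<^sub>1x. D x $ i $ j * (l (x, t) * \<psi> x))"
      using weak[OF slice_test_function[where t=t, OF l(1,2,3) \<psi>], of i j] i1 i2
      unfolding slice_product_derivative[OF l(1) \<psi>] dl
      by (simp add: distrib_left)
    moreover have "(\<integral>\<^sub>1x. d i j x * \<psi> x) = (\<integral>\<^sub>1x. U x $ i * (dl j x * \<psi> x)) + (\<integral>\<^sub>1x. D x $ i $ j * (l (x, t) * \<psi> x))"
      unfolding d_def using i2 i3 by (subst Bochner_Integration.integral_add[symmetric]) (auto simp: algebra_simps)
    ultimately show "(\<integral>\<^sub>1x. v i x * frechet_derivative \<psi> (at x) (axis j 1)) = - (\<integral>\<^sub>1x. d i j x * \<psi> x)"
      unfolding v_def by (simp add: mult_ac)
  qed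
  have "(\<integral>\<^sub>+x. ennreal ((l (x, t) * norm (U x)) ^ 6)) \<le> (\<integral>\<^sub>+x. ennreal 729 * (\<Sum>i\<in>UNIV. ennreal (v i x ^ 6)))"
  proof (intro nn_integral_mono)
    fix x
    have "(l (x, t) * norm (U x)) ^ 6 = norm (l (x, t) *\<^sub>R U x) ^ 6" using l(4) by simp
    also have "\<dots> \<le> 729 * (\<Sum>i\<in>UNIV. v i x ^ 6)" using norm_power6_le[of "l (x, t) *\<^sub>R U x"] by (simp add: v_def)
    finally have "ennreal ((l (x, t) * norm (U x)) ^ 6) \<le> ennreal (729 * (\<Sum>i\<in>UNIV. v i x ^ 6))" by (rule ennreal_leI)
    also have "\<dots> = ennreal 729 * (\<Sum>i\<in>UNIV. ennreal (v i x ^ 6))"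
      by (subst ennreal_mult) (auto intro!: sum_nonneg simp: sum_ennreal)
    finally show "ennreal ((l (x, t) * norm (U x)) ^ 6) \<le> ennreal 729 * (\<Sum>i\<in>UNIV. ennreal (v i x ^ 6))" .
  qed
  also have "\<dots> = ennreal 729 * (\<Sum>i\<in>UNIV. \<integral>\<^sub>+x. ennreal (v i x ^ 6))"
  proof -
    have [measurable]: "Borel (v i)" for i using vi[of i] by auto
    have "(\<integral>\<^sub>+x. (\<Sum>i\<in>UNIV. ennreal (v i x ^ 6))) = (\<Sum>i\<in>UNIV. \<integral>\<^sub>+x. ennreal (v i x ^ 6))"
      by (rule nn_integral_sum) measurable
    moreover have "(\<integral>\<^sub>+x. ennreal 729 * (\<Sum>i\<in>UNIV. ennreal (v i x ^ 6))) = ennreal 729 * (\<integral>\<^sub>+x. (\<Sum>i\<in>UNIV. ennreal (v i x ^ 6)))"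
      by (rule nn_integral_cmult) measurable
    ultimately show ?thesis by simp
  qed
  also have "\<dots> \<le> ennreal 729 * (\<Sum>i\<in>(UNIV :: 3 set). ennreal (4096 * (2 * C\<^sup>2 * y) ^ 3))"
    by (intro mult_left_mono sum_mono six) simp
  also have "\<dots> = ennreal (729 * (3 * (4096 * (2 * C\<^sup>2 * y) ^ 3)))"
  proof -
    have "(\<Sum>i\<in>(UNIV :: 3 set). ennreal (4096 * (2 * C\<^sup>2 * y) ^ 3)) = ennreal (\<Sum>i\<in>(UNIV :: 3 set). 4096 * (2 * C\<^sup>2 * y) ^ 3)"
      using y(2) by (intro sum_ennreal) auto
    also have "(\<Sum>i\<in>(UNIV :: 3 set). 4096 * (2 * C\<^sup>2 * y) ^ 3) = 3 * (4096 * (2 * C\<^sup>2 * y) ^ 3)" by simp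
    finally show ?thesis using y(2) ennreal_mult[of 729 "3 * (4096 * (2 * C\<^sup>2 * y) ^ 3)"] by simp
  qed
  also have "\<dots> \<le> ennreal (Sobolev_const C * y ^ 3)"
    using y(2) by (intro ennreal_leI) (simp add: Sobolev_const_def power_mult_distrib distrib_right)
  also have "\<dots> = ennreal (Sobolev_const C) * ennreal (y ^ 3)"
    using y(2) by (intro ennreal_mult) (auto simp: Sobolev_const_def)
  also have "ennreal (y ^ 3) = ennreal y ^ 3" using y(2) by (simp add: ennreal_power)
  finally show ?thesis unfolding y(1) .
qed

section \<open>Borel representatives\<close>

text \<open>Completeness of Lebesgue measure. The potentials of a solution are compared with Borel
  functions only up to null sets, yet \<open>L2_norm\<close> is finite only for measurable
  functions.\<close>

lemma borel_measurable_lebesgue_AE_eq: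
  fixes f g :: "'a::euclidean_space \<Rightarrow> 'b::topological_space"
  assumes g: "Borel g" and eq: "AE x in lborel. f x = g x"
  shows "f \<in> borel_measurable lebesgue"
proof (rule measurableI)
  fix A :: "'b set" assume A: "A \<in> sets borel"
  have "g -` A \<in> sets borel" using measurable_sets[OF g A] by simp
  then have 1: "g -` A \<in> sets lebesgue" by simp
  have 2: "AE x in lebesgue. x \<in> g -` A \<longleftrightarrow> x \<in> f -` A"
    using eq unfolding AE_completion_iff by eventually_elim simp
  have "f -` A \<in> sets lebesgue"
    by (rule completion.in_sets_AE[OF 2 1]) (simp only: space_completion space_lborel space_borel subset_UNIV)
  then show "f -` A \<inter> space lebesgue \<in> sets lebesgue"
    by (simp only: space_completion space_lborel space_borel Int_UNIV_right)
qed (simp only: space_borel UNIV_I)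

lemma integral_lebesgue_AE_eq:
  fixes f g :: "'a::euclidean_space \<Rightarrow> 'b::euclidean_space"
  assumes g: "Borel g" and eq: "AE x in lborel. f x = g x"
  shows "(\<integral>x. f x \<partial>lebesgue) = (\<integral>\<^sub>1x. g x)"
proof -
  have "(\<integral>x. f x \<partial>lebesgue) = (\<integral>x. g x \<partial>lebesgue)"
    by (rule integral_cong_AE[OF borel_measurable_lebesgue_AE_eq[OF g eq] _ AE_completion[OF eq]])
      (use g in \<open>simp add: measurable_completion\<close>)
  then show ?thesis using g by (simp add: integral_completion)
qed

lemma nn_integral_lebesgue_AE_eq:
  assumes "AE x in lborel. f x = g x"
  shows "(\<integral>\<^sup>+x. f x \<partial>lebesgue) = (\<integral>\<^sub>+x. g x)"
  using assms by (simp add: nn_integral_completion nn_integral_cong_AE)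

lemma set_integral_lebesgue_AE_eq:
  fixes f g :: "'a::euclidean_space \<Rightarrow> 'b::euclidean_space"
  assumes "Borel g" "AE x in lborel. x \<in> S \<longrightarrow> f x = g x" "\<And>x. x \<notin> S \<Longrightarrow> g x = 0"
  shows "(LINT x:S|lebesgue. f x) = (\<integral>\<^sub>1x. g x)"
  unfolding set_lebesgue_integral_def
proof (rule integral_lebesgue_AE_eq[OF assms(1)])
  show "AE x in lborel. indicat_real S x *\<^sub>R f x = g x"
    using assms(2) by eventually_elim (use assms(3) in \<open>auto simp: indicator_def\<close>)
qed

text \<open>Solutions are Lebesgue measurable on the cylinder, whereas the integrations over slices
  and the translations above are carried out for Borel functions on the whole space. The
  representative is assembled coordinate by coordinate.\<close>

lemma borel_representative:
  fixes h :: "'a::euclidean_space \<Rightarrow> 'b::euclidean_space"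
  assumes h: "h \<in> borel_measurable (lebesgue_on S)" and S: "S \<in> sets borel"
  obtains g where "Borel g" "\<And>z. z \<notin> S \<Longrightarrow> g z = 0" "AE z in lborel. z \<in> S \<longrightarrow> h z = g z"
proof -
  let ?h = "\<lambda>x. if x \<in> S then h x else 0"
  have hm: "?h \<in> borel_measurable lebesgue" by (rule borel_measurable_if_I[OF h]) (use S in simp)
  have "\<exists>g. g \<in> borel_measurable borel \<and> (AE x in lborel. ?h x \<bullet> b = g x)" for b
    using completion_ex_borel_measurable_real[OF borel_measurable_inner[OF hm borel_measurable_const[of b]]]
    unfolding Bex_def measurable_lborel2 .
  then have "\<exists>g. \<forall>b. g b \<in> borel_measurable borel \<and> (AE x in lborel. ?h x \<bullet> b = g b x)" by (intro choice allI)
  then obtain g where g: "\<And>b. g b \<in> borel_measurable borel" "\<And>b. AE x in lborel. ?h x \<bullet> b = g b x" by blast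
  define k where "k x = (if x \<in> S then \<Sum>b\<in>Basis. g b x *\<^sub>R b else 0)" for x
  show ?thesis
  proof (rule that[of k])
    show "Borel k" unfolding k_def using g(1) S by measurable
    show "k z = 0" if "z \<notin> S" for z using that by (simp add: k_def)
    have "AE x in lborel. \<forall>b\<in>Basis. ?h x \<bullet> b = g b x"
      using g(2) by (intro AE_finite_allI) auto
    then show "AE x in lborel. x \<in> S \<longrightarrow> h x = k x"
    proof eventually_elim
      case (elim x)
      show ?case
      proof
        assume x: "x \<in> S"
        have "h x = (\<Sum>b\<in>Basis. (h x \<bullet> b) *\<^sub>R b)" by (simp add: euclidean_representation)
        also have "\<dots> = k x" using elim x by (simp add: k_def cong: sum.cong)
        finally show "h x = k x" .
      qed
    qed
  qed
qed

text \<open>Fubini's theorem for null sets, after exchanging the factors so that time becomes the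
  outer variable.\<close>

lemma AE_time_slices:
  fixes P :: "point \<Rightarrow> bool"
  assumes "AE z in lborel. P z" shows "AE t in lborel. AE x in lborel. P (x, t)"
proof -
  define N where "N = (lborel :: (real^3) measure) \<Otimes>\<^sub>M (lborel :: real measure)"
  have "N = lborel" unfolding N_def by (rule lborel_prod)
  then have "AE z in N. P z" using assms by (rule ssubst)
  also have "N = distr (lborel \<Otimes>\<^sub>M lborel) N (\<lambda>(x, y). (y, x))"
    unfolding N_def by (rule lborel_pair.distr_pair_swap)
  finally have "AE p in lborel \<Otimes>\<^sub>M lborel. P ((\<lambda>(x, y). (y, x)) p)"
    by (rule AE_distrD[rotated]) (simp add: N_def measurable_pair_swap')
  from lborel_pair.AE_pair[OF this] show ?thesis by simp
qed

lemma AE_snd: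
  fixes P :: "real \<Rightarrow> bool"
  assumes "AE t in lborel. P t" shows "AE z in (lborel :: point measure). P (snd z)"
proof -
  obtain N where N: "N \<in> null_sets lborel" "{t. \<not> P t} \<subseteq> N" using assms unfolding eventually_ae_filter by auto
  have "UNIV \<times> N \<in> null_sets (lborel \<Otimes>\<^sub>M lborel :: point measure)"
    using N(1) by (auto simp: null_sets_def lborel.emeasure_pair_measure_Times)
  then have "UNIV \<times> N \<in> null_sets (lborel :: point measure)" by (simp add: lborel_prod)
  then show ?thesis by (rule AE_I') (use N(2) in auto)
qed

lemma L2_norm_le:
  assumes g: "Borel g" "AE z in lborel. h z = g z" "(\<integral>\<^sub>+z. (g z)\<^sup>2) \<le> ennreal c" and c: "c \<ge> 0"
  shows "L2_norm h \<le> ennreal (sqrt c)"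
proof -
  have "h \<in> borel_measurable lebesgue" by (rule borel_measurable_lebesgue_AE_eq[OF g(1,2)])
  moreover have "(\<integral>\<^sup>+z. (h z)\<^sup>2 \<partial>lebesgue) = (\<integral>\<^sub>+z. (g z)\<^sup>2)"
    by (rule nn_integral_lebesgue_AE_eq) (use g(2) in \<open>auto elim: eventually_mono\<close>)
  ultimately have "L2_norm h = ennreal_sqrt (\<integral>\<^sub>+z. (g z)\<^sup>2)" by (simp add: L2_norm_def)
  also have "\<dots> \<le> ennreal_sqrt (ennreal c)" by (rule ennreal_sqrt_mono[OF g(3)])
  also have "\<dots> = ennreal (sqrt c)" using c by (simp add: ennreal_sqrt_def)
  finally show ?thesis .
qed

text \<open>For almost every time the two densities agree almost everywhere in space, and then the
  potentials agree at every x of that slice.\<close>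

lemma potentials_AE_eq:
  assumes "AE z in lborel. \<rho> z = R z"
  shows "AE z in lborel. Psi \<mu> \<rho> z = Psi \<mu> R z" "AE z in lborel. G \<mu> \<rho> z = G \<mu> R z" "AE z in lborel. Sigma_pot \<mu> \<rho> z = Sigma_pot \<mu> R z"
proof -
  note s = AE_snd[OF AE_time_slices[OF assms]]
  have e: "Psi \<mu> \<rho> z = Psi \<mu> R z \<and> G \<mu> \<rho> z = G \<mu> R z \<and> G0 \<rho> z = G0 R z" if "AE x in lborel. \<rho> (x, snd z) = R (x, snd z)" for z
  proof -
    obtain x t where z: "z = (x, t)" by (cases z)
    have ae: "AE y in lebesgue. \<rho> (y, t) = R (y, t)" using that by (simp add: z AE_completion_iff)
    show ?thesis unfolding z Psi_def G_def G0_def prod.case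
      by (intro conjI nn_integral_cong_AE; use ae in eventually_elim; simp)
  qed
  show "AE z in lborel. Psi \<mu> \<rho> z = Psi \<mu> R z" using s by eventually_elim (use e in blast)
  show "AE z in lborel. G \<mu> \<rho> z = G \<mu> R z" using s by eventually_elim (use e in blast)
  show "AE z in lborel. Sigma_pot \<mu> \<rho> z = Sigma_pot \<mu> R z"
    using s by eventually_elim (use e in \<open>simp add: Sigma_pot_def\<close>)
qed

theorem potential_bounds:
  assumes B: "B \<ge> 1" and \<mu>: "0 \<le> \<mu>" "\<mu> \<le> 2/3" and Z: "Z \<ge> 0" and E: "E \<ge> 0" and T: "T \<ge> 0"
  obtains c where "c > 0" "\<And>R \<rho>. density_bounds B T E Z R \<Longrightarrow> AE z in lborel. \<rho> z = R z \<Longrightarrow>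
    L2_norm (Psi \<mu> \<rho>) \<le> ennreal c \<and> L2_norm (G \<mu> \<rho>) \<le> ennreal c \<and> L2_norm (Sigma_pot \<mu> \<rho>) \<le> ennreal c"
proof -
  obtain c where c: "c > 0" "\<And>R. density_bounds B T E Z R \<Longrightarrow>
    (\<integral>\<^sub>+z. (Psi \<mu> R z)\<^sup>2) \<le> ennreal c \<and> (\<integral>\<^sub>+z. (G \<mu> R z)\<^sup>2) \<le> ennreal c \<and> (\<integral>\<^sub>+z. (Sigma_pot \<mu> R z)\<^sup>2) \<le> ennreal c"
    using potential_square_bounds[OF assms] by blast
  then have c0: "c \<ge> 0" by simp
  show ?thesis
  proof (rule that[of "sqrt c"])
    show "sqrt c > 0" using c(1) by simp
    fix R \<rho> assume R: "density_bounds B T E Z R" and ae: "AE z in lborel. \<rho> z = R z"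
    note m = measurable_potentials[OF density_boundsD(1)[OF R]]
    show "L2_norm (Psi \<mu> \<rho>) \<le> ennreal (sqrt c) \<and> L2_norm (G \<mu> \<rho>) \<le> ennreal (sqrt c) \<and> L2_norm (Sigma_pot \<mu> \<rho>) \<le> ennreal (sqrt c)"
      using c(2)[OF R] L2_norm_le[OF m(1) potentials_AE_eq(1)[OF ae] _ c0] L2_norm_le[OF m(2) potentials_AE_eq(2)[OF ae] _ c0]
        L2_norm_le[OF m(4) potentials_AE_eq(3)[OF ae] _ c0] by blast
  qed
qed

lemma AE_lebesgue_on_iff:
  assumes "S \<in> sets borel"
  shows "(AE x in lebesgue_on S. P x) \<longleftrightarrow> (AE x in lborel. x \<in> S \<longrightarrow> P x)"
proof -
  have "S \<inter> space lebesgue \<in> sets lebesgue" using assms by simp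
  from AE_restrict_space_iff[OF this, of P] show ?thesis by (simp only: AE_completion_iff)
qed

text \<open>An essential supremum bounds almost every slice; for times outside (0,T) the extension
  by zero takes over.\<close>

lemma Linf_L1_slices:
  fixes h g :: "point \<Rightarrow> real"
  assumes le: "Linf_L1_norm \<Omega> T h \<le> ennreal E"
    and eq: "AE z in lborel. z \<in> Q \<Omega> T \<longrightarrow> h z = g z" and g: "\<And>z. z \<notin> Q \<Omega> T \<Longrightarrow> g z = 0" "\<And>z. g z \<ge> 0"
  shows "AE t in lborel. (\<integral>\<^sub>+x. ennreal (g (x, t))) \<le> ennreal E"
proof -
  have "AE t in lebesgue_on {0<..<T}. (\<integral>\<^sup>+x\<in>\<Omega>. ennreal \<bar>h (x, t)\<bar> \<partial>lebesgue) \<le> Linf_L1_norm \<Omega> T h"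
    unfolding Linf_L1_norm_def by (rule esssup_AE)
  then have "AE t in lborel. t \<in> {0<..<T} \<longrightarrow> (\<integral>\<^sup>+x\<in>\<Omega>. ennreal \<bar>h (x, t)\<bar> \<partial>lebesgue) \<le> Linf_L1_norm \<Omega> T h"
    by (subst (asm) AE_lebesgue_on_iff) auto
  with AE_time_slices[OF eq] show ?thesis
  proof eventually_elim
    case (elim t)
    show ?case
    proof (cases "t \<in> {0<..<T}")
      case False
      then have "g (x, t) = 0" for x by (intro g(1)) (auto simp: Q_def)
      then show ?thesis by simp
    next
      case True
      have "(\<integral>\<^sup>+x\<in>\<Omega>. ennreal \<bar>h (x, t)\<bar> \<partial>lebesgue) = (\<integral>\<^sub>+x. ennreal (g (x, t)))"
      proof (rule nn_integral_lebesgue_AE_eq, use elim(1) in eventually_elim)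
        case (elim x)
        then show ?case using True g(1)[of "(x, t)"] g(2)[of "(x, t)"] by (auto simp: Q_def indicator_def)
      qed
      then show ?thesis using elim(2) True le by (metis order_trans)
    qed
  qed
qed

lemma integrable_of_slices:
  fixes g :: "point \<Rightarrow> real"
  assumes [measurable]: "Borel g" and g: "\<And>z. z \<notin> Q \<Omega> T \<Longrightarrow> g z = 0" "\<And>z. g z \<ge> 0"
    and le: "AE t in lborel. (\<integral>\<^sub>+x. ennreal (g (x, t))) \<le> ennreal E"
  shows "integrable lborel g"
proof (rule integrableI_nonneg)
  have "(\<integral>\<^sub>+z. ennreal (g z)) = (\<integral>\<^sub>+t x. ennreal (g (x, t)))"
    by (rule nn_integral_time_slices) measurable
  also have "\<dots> \<le> (\<integral>\<^sub>+t. ennreal E * indicator {0..T} t)"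
  proof (rule nn_integral_mono_AE, use le in eventually_elim)
    case (elim t)
    have "(\<integral>\<^sub>+x. ennreal (g (x, t))) = 0" if "t \<notin> {0..T}"
    proof -
      have "g (x, t) = 0" for x using that by (intro g(1)) (auto simp: Q_def)
      then show ?thesis by simp
    qed
    then show ?case using elim by (auto simp: indicator_def)
  qed
  also have "\<dots> < \<infinity>" 
    using emeasure_bounded_finite[of "{0..T}"] by (simp add: nn_integral_cmult_indicator ennreal_mult_less_top)
  finally show "(\<integral>\<^sub>+z. ennreal (g z)) < \<infinity>" .
qed (use g in auto)

lemma L2_W12_total:
  assumes le: "L2_W12_norm \<Omega> T u Du \<le> ennreal E" and E: "E \<ge> 0"
    and [measurable]: "Borel U" "Borel D"
    and eq: "AE z in lborel. z \<in> Q \<Omega> T \<longrightarrow> u z = U z \<and> Du z = D z"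
    and z: "\<And>z. z \<notin> Q \<Omega> T \<Longrightarrow> U z = 0" "\<And>z. z \<notin> Q \<Omega> T \<Longrightarrow> D z = 0"
  shows "(\<integral>\<^sub>+z. ennreal ((norm (U z))\<^sup>2 + (norm (D z))\<^sup>2)) \<le> ennreal (E\<^sup>2)"
proof -
  have "(\<integral>\<^sub>+z. ennreal ((norm (U z))\<^sup>2 + (norm (D z))\<^sup>2)) = (\<integral>\<^sub>+t x. ennreal ((norm (U (x, t)))\<^sup>2 + (norm (D (x, t)))\<^sup>2))"
    by (rule nn_integral_time_slices) measurable
  also have "\<dots> = (\<integral>\<^sup>+t\<in>{0<..<T}. (W12_norm \<Omega> (\<lambda>x. u (x, t)) (\<lambda>x. Du (x, t)))\<^sup>2 \<partial>lebesgue)"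
  proof (rule nn_integral_lebesgue_AE_eq[symmetric], use AE_time_slices[OF eq] in eventually_elim)
    case (elim t)
    show ?case
    proof (cases "t \<in> {0<..<T}")
      case False
      then have "U (x, t) = 0 \<and> D (x, t) = 0" for x by (intro conjI z) (auto simp: Q_def)
      then show ?thesis using False by simp
    next
      case True
      have "(\<integral>\<^sup>+x\<in>\<Omega>. ennreal ((norm (u (x, t)))\<^sup>2 + (norm (Du (x, t)))\<^sup>2) \<partial>lebesgue)
        = (\<integral>\<^sub>+x. ennreal ((norm (U (x, t)))\<^sup>2 + (norm (D (x, t)))\<^sup>2))"
      proof (rule nn_integral_lebesgue_AE_eq, use elim in eventually_elim)
        case (elim x)
        then show ?case using True z[of "(x, t)"] by (auto simp: Q_def indicator_def)
      qed
      then show ?thesis using True by (simp add: W12_norm_def power2_ennreal_sqrt)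
    qed
  qed
  also have "\<dots> = (L2_W12_norm \<Omega> T u Du)\<^sup>2" by (simp add: L2_W12_norm_def power2_ennreal_sqrt)
  also have "\<dots> \<le> (ennreal E)\<^sup>2" by (intro power_mono le) simp
  also have "\<dots> = ennreal (E\<^sup>2)" using E by (simp add: ennreal_power)
  finally show ?thesis .
qed

lemma measurable_test_function:
  assumes "test_function S \<xi>"
  shows "Borel \<xi>" "Borel (\<lambda>z. frechet_derivative \<xi> (at z) v)"
  using assms smooth_continuous[of \<xi>] smooth_continuous[OF smooth_derivative(2)[of \<xi>]] unfolding test_function_def smooth_def[symmetric]
  by (auto intro!: borel_measurable_continuous_onI)

lemma measurable_Grad:
  assumes "test_function S \<xi>" shows "Borel (Grad \<xi>)" "Borel (dt \<xi>)"
proof -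
  have s: "smooth \<xi>" using assms by (simp add: test_function_def smooth_def)
  have c: "continuous_on UNIV (\<lambda>x. frechet_derivative \<xi> (at x) v)" for v
    by (intro smooth_continuous smooth_derivative s)
  show "Borel (Grad \<xi>)" "Borel (dt \<xi>)"
    unfolding dt_def[abs_def] Grad_def[abs_def]
    by (intro borel_measurable_continuous_onI c continuous_on_vec_lambda continuous_on_component)+
qed

lemma measurable_grad:
  assumes "test_function S \<psi>" shows "Borel (grad \<psi>)" "Borel (dt \<psi>)"
proof -
  have s: "smooth \<psi>" using assms by (simp add: test_function_def smooth_def)
  have c: "continuous_on UNIV (\<lambda>x. frechet_derivative \<psi> (at x) v)" for v
    by (intro smooth_continuous smooth_derivative s)
  show "Borel (grad \<psi>)" "Borel (dt \<psi>)"
    unfolding dt_def[abs_def] grad_def[abs_def]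
    by (intro borel_measurable_continuous_onI c continuous_on_vec_lambda)+
qed

section \<open>Uniform bounds for solutions\<close>

lemma measurable_flux:
  assumes [measurable]: "Borel R" "Borel P" "Borel U" "Borel D"
  shows "Borel (\<lambda>z. R z *\<^sub>R tensor (U z) (U z) + P z *\<^sub>R mat 1 - stress \<nu>1 \<nu>2 (D z))"
proof -
  have "continuous_on UNIV (\<lambda>v. tensor v v)" unfolding tensor_def by (intro continuous_intros)
  from measurable_compose[OF assms(3) borel_measurable_continuous_onI[OF this]]
  have [measurable]: "Borel (\<lambda>z. tensor (U z) (U z))" .
  have "continuous_on UNIV (stress \<nu>1 \<nu>2)" unfolding stress_def[abs_def] transpose_def trace_def by (intro continuous_intros)
  from measurable_compose[OF assms(4) borel_measurable_continuous_onI[OF this]]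
  have [measurable]: "Borel (\<lambda>z. stress \<nu>1 \<nu>2 (D z))" .
  show ?thesis by measurable
qed

text \<open>Low powers are compared with the energy on the bounded cylinder: R <= 1 + P and |D| <= 1
  + |D|^2, where the 1 is the indicator of the compact set \<open>q\<close>.\<close>

lemma flow_integrability:
  fixes R P :: "point \<Rightarrow> real" and U f :: "point \<Rightarrow> real^3" and D :: "point \<Rightarrow> real^3^3"
  assumes \<Omega>: "bounded \<Omega>"
    and [measurable]: "Borel R" "Borel P" "Borel U" "Borel D" "Borel f"
    and z: "\<And>z. z \<notin> Q \<Omega> T \<Longrightarrow> R z = 0" "\<And>z. z \<notin> Q \<Omega> T \<Longrightarrow> D z = 0"
    and R: "\<And>z. R z \<ge> 0" "\<And>z. R z powr (3/2) \<le> P z" and F: "\<And>z. norm (f z) \<le> F"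
    and i: "integrable lborel P" "integrable lborel (\<lambda>z. R z * (norm (U z))\<^sup>2)" "integrable lborel (\<lambda>z. (norm (D z))\<^sup>2)"
  shows "integrable lborel R" "integrable lborel (\<lambda>z. R z *\<^sub>R U z)" "integrable lborel (\<lambda>z. R z *\<^sub>R f z)"
    "integrable lborel (\<lambda>z. R z *\<^sub>R tensor (U z) (U z) + P z *\<^sub>R mat 1 - stress \<nu>1 \<nu>2 (D z))"
proof -
  define q where "q = closure (\<Omega> \<times> {0..T})"
  have bq: "bounded q" unfolding q_def using \<Omega> by (intro bounded_closure bounded_Times) auto
  have sq: "q \<in> sets borel" unfolding q_def by (intro borel_closed) simp
  have qQ: "z \<in> q" if "z \<in> Q \<Omega> T" for z
    using that closure_subset[of "\<Omega> \<times> {0..T}"] by (auto simp: q_def Q_def)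
  have iq: "integrable lborel (indicat_real q)"
    using emeasure_bounded_finite[OF bq] sq by (simp add: integrable_indicator_iff)
  have P0: "P z \<ge> 0" for z using R(2)[of z] by (meson order_trans powr_ge_zero)
  have RP: "R z \<le> indicat_real q z + P z" for z
  proof (cases "R z \<le> 1")
    case True
    then show ?thesis using z(1)[of z] qQ[of z] P0[of z] by (cases "z \<in> Q \<Omega> T") auto
  next
    case False
    then have "R z powr 1 \<le> R z powr (3/2)" by (intro powr_mono) auto
    then show ?thesis using False R(2)[of z] by (simp add: indicator_def)
  qed
  show iR: "integrable lborel R"
    by (rule Bochner_Integration.integrable_bound[OF Bochner_Integration.integrable_add[OF iq i(1)]])
      (use R(1) RP P0 in \<open>auto intro!: AE_I2 simp: indicator_def\<close>)
  have le1: "n \<le> 1 + n\<^sup>2" for n :: real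
  proof -
    have "0 \<le> (n - 1)\<^sup>2" "0 \<le> (n + 1)\<^sup>2" by auto
    then show ?thesis unfolding power2_diff power2_sum by simp
  qed
  show "integrable lborel (\<lambda>z. R z *\<^sub>R U z)"
  proof (rule Bochner_Integration.integrable_bound[OF Bochner_Integration.integrable_add[OF iR i(2)]])
    show "AE z in lborel. norm (R z *\<^sub>R U z) \<le> norm (R z + R z * (norm (U z))\<^sup>2)"
    proof (intro AE_I2)
      fix z
      have "R z * norm (U z) \<le> R z * (1 + (norm (U z))\<^sup>2)" using R(1) by (intro mult_left_mono le1)
      then show "norm (R z *\<^sub>R U z) \<le> norm (R z + R z * (norm (U z))\<^sup>2)" using R(1)[of z] by (simp add: distrib_left)
    qed
  qed measurable
  show "integrable lborel (\<lambda>z. R z *\<^sub>R f z)"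
    by (rule Bochner_Integration.integrable_bound[OF integrable_mult_left[OF iR, of F]])
      (use R(1) F in \<open>auto intro!: AE_I2 mult_left_mono order_trans[OF F abs_ge_self] simp: abs_mult\<close>)
  have iD: "integrable lborel (\<lambda>z. norm (D z))"
  proof (rule Bochner_Integration.integrable_bound[OF Bochner_Integration.integrable_add[OF iq i(3)]])
    show "AE x in lborel. norm (norm (D x)) \<le> norm (indicat_real q x + (norm (D x))\<^sup>2)"
    proof (intro AE_I2)
      fix x
      show "norm (norm (D x)) \<le> norm (indicat_real q x + (norm (D x))\<^sup>2)"
        using le1[of "norm (D x)"] z(2)[of x] qQ[of x] by (cases "x \<in> Q \<Omega> T") auto
    qed
  qed measurable
  define C where "C = 2 * \<bar>\<nu>1\<bar> + 6 * \<bar>\<nu>2\<bar>"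
  show "integrable lborel (\<lambda>z. R z *\<^sub>R tensor (U z) (U z) + P z *\<^sub>R mat 1 - stress \<nu>1 \<nu>2 (D z))"
  proof (rule Bochner_Integration.integrable_bound)
    show "integrable lborel (\<lambda>z. R z * (norm (U z))\<^sup>2 + P z * 2 + C * norm (D z))"
      by (intro Bochner_Integration.integrable_add i integrable_mult_left integrable_mult_right iD)
    show "AE z in lborel. norm (R z *\<^sub>R tensor (U z) (U z) + P z *\<^sub>R mat 1 - stress \<nu>1 \<nu>2 (D z)) \<le> norm (R z * (norm (U z))\<^sup>2 + P z * 2 + C * norm (D z))"
    proof (intro AE_I2)
      fix z
      have "norm (R z *\<^sub>R tensor (U z) (U z) + P z *\<^sub>R mat 1 - stress \<nu>1 \<nu>2 (D z))
        \<le> norm (R z *\<^sub>R tensor (U z) (U z)) + norm (P z *\<^sub>R (mat 1 :: real^3^3)) + norm (stress \<nu>1 \<nu>2 (D z))"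
        by (rule order_trans[OF norm_triangle_ineq4 add_right_mono[OF norm_triangle_ineq]])
      also have "\<dots> \<le> R z * (norm (U z))\<^sup>2 + P z * 2 + C * norm (D z)"
      proof (intro add_mono)
        show "norm (R z *\<^sub>R tensor (U z) (U z)) \<le> R z * (norm (U z))\<^sup>2" using R(1)[of z] by (simp add: norm_tensor power2_eq_square)
        show "norm (P z *\<^sub>R (mat 1 :: real^3^3)) \<le> P z * 2" using P0[of z] mult_left_mono[OF norm_mat_1 P0[of z]] by simp
        show "norm (stress \<nu>1 \<nu>2 (D z)) \<le> C * norm (D z)" unfolding C_def by (rule norm_stress_le)
      qed
      finally show "norm (R z *\<^sub>R tensor (U z) (U z) + P z *\<^sub>R mat 1 - stress \<nu>1 \<nu>2 (D z)) \<le> norm (R z * (norm (U z))\<^sup>2 + P z * 2 + C * norm (D z))" by simp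
    qed
  qed (use measurable_flux[of R P U D \<nu>1 \<nu>2] in simp)
qed

text \<open>Borel representatives of the solution satisfy the requirements of
  \<open>bounded_flow\<close>, whose constants are made from the data alone; interpreting the locale
  yields bounds common to all solutions.\<close>

lemma solution_density_bounds:
  fixes \<Omega> :: "(real^3) set" and l :: "point \<Rightarrow> real"
  assumes \<Omega>: "open \<Omega>" "\<Omega> \<subseteq> cball 0 B" and B: "B \<ge> 1" and T: "T > 0" and E: "E \<ge> 0" and F: "F \<ge> 0" and M: "kernel_const B M"
    and l: "smooth l" "compact (supp l)" "supp l \<subseteq> Q \<Omega> T" "\<And>z. l z \<ge> 0" "l z0 \<noteq> 0"
    and C: "\<And>z. \<bar>l z\<bar> \<le> C" "\<And>z. norm (grad l z) \<le> C"
    and c: "\<And>z. \<bar>(l z)\<^sup>2\<bar> \<le> c" "\<And>z. \<bar>dt (\<lambda>z. (l z)\<^sup>2) z\<bar> \<le> c" "\<And>z. norm (grad (\<lambda>z. (l z)\<^sup>2) z) \<le> c"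
    and \<epsilon>: "\<epsilon> > 0" and f: "f \<in> borel_measurable (lebesgue_on (Q \<Omega> T))" "Linf_norm \<Omega> T f = ennreal F"
    and sol: "bounded_solution \<Omega> T \<nu>1 \<nu>2 \<epsilon> m E f \<rho> u"
  shows "\<exists>R. density_bounds B T (C ^ 6 * E) (C ^ 6 * bounded_flow.good_const T \<nu>1 \<nu>2 F B E (E\<^sup>2) (Sobolev_const C) c M) R \<and>
    (AE z in lborel. localized_density \<Omega> T l \<rho> z = R z)"
proof -
  have Qb: "Q \<Omega> T \<in> sets borel" unfolding Q_def using \<Omega>(1) by (intro borel_open open_Times) auto
  have b\<Omega>: "bounded \<Omega>" by (rule bounded_subset[OF bounded_cball \<Omega>(2)])
  obtain Du where Du: "spatial_weak_gradient \<Omega> T u Du" "energy_bound \<Omega> T \<epsilon> m E \<rho> u Du" "momentum_equation \<Omega> T \<nu>1 \<nu>2 \<epsilon> m f \<rho> u Du"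
    and \<rho>: "\<rho> \<in> borel_measurable (lebesgue_on (Q \<Omega> T))" "AE z in lebesgue_on (Q \<Omega> T). 0 \<le> \<rho> z" and ce: "continuity_equation \<Omega> T \<rho> u"
    using sol unfolding bounded_solution_def by blast
  have um: "u \<in> borel_measurable (lebesgue_on (Q \<Omega> T))" "Du \<in> borel_measurable (lebesgue_on (Q \<Omega> T))"
    and wg: "AE t in lebesgue_on {0<..<T}. weak_gradient \<Omega> (\<lambda>x. u (x, t)) (\<lambda>x. Du (x, t))"
    using Du(1) unfolding spatial_weak_gradient_def by blast+
  obtain R0 where R0: "Borel R0" "\<And>z. z \<notin> Q \<Omega> T \<Longrightarrow> R0 z = 0" "AE z in lborel. z \<in> Q \<Omega> T \<longrightarrow> \<rho> z = R0 z"
    by (rule borel_representative[OF \<rho>(1) Qb]) (rule that)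
  obtain U where U[measurable]: "Borel U" and U0: "\<And>z. z \<notin> Q \<Omega> T \<Longrightarrow> U z = 0" and Ue: "AE z in lborel. z \<in> Q \<Omega> T \<longrightarrow> u z = U z"
    by (rule borel_representative[OF um(1) Qb]) (rule that)
  obtain D where D[measurable]: "Borel D" and D0: "\<And>z. z \<notin> Q \<Omega> T \<Longrightarrow> D z = 0" and De: "AE z in lborel. z \<in> Q \<Omega> T \<longrightarrow> Du z = D z"
    by (rule borel_representative[OF um(2) Qb]) (rule that)
  obtain f0 where f0[measurable]: "Borel f0" and f00: "\<And>z. z \<notin> Q \<Omega> T \<Longrightarrow> f0 z = 0" and f0e: "AE z in lborel. z \<in> Q \<Omega> T \<longrightarrow> f z = f0 z"
    by (rule borel_representative[OF f(1) Qb]) (rule that)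
  \<comment> \<open>The sign of the density and the bound on the force hold only almost everywhere.
    The modified functions \<open>R\<close> and \<open>f'\<close> satisfy them at every point, as
    \<open>flow\<close> requires, and \<open>P\<close> is formed from \<open>R\<close>.\<close>
  define R where "R z = max 0 (R0 z)" for z
  define f' where "f' z = (if norm (f0 z) \<le> F then f0 z else 0)" for z
  define P where "P z = R z powr (3/2) * Pfun \<epsilon> m R z" for z
  have R[measurable]: "Borel R" unfolding R_def[abs_def] using R0(1) by measurable
  have f'[measurable]: "Borel f'" unfolding f'_def[abs_def] by measurable
  have P[measurable]: "Borel P" unfolding P_def[abs_def] Pfun_def by measurable
  have Rn: "R z \<ge> 0" for z by (simp add: R_def)
  have Rz: "R z = 0" if "z \<notin> Q \<Omega> T" for z using R0(2)[OF that] by (simp add: R_def)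
  have Pz: "P z = 0" if "z \<notin> Q \<Omega> T" for z using Rz[OF that] by (simp add: P_def)
  \<comment> \<open>The regularisation contributes only \<open>Pfun \<ge> 1\<close>, which makes the
    lower bound uniform in \<epsilon> and m.\<close>
  have PR: "R z powr (3/2) \<le> P z" for z
  proof -
    have "R z powr (3/2) * 1 \<le> R z powr (3/2) * Pfun \<epsilon> m R z" unfolding Pfun_def using \<epsilon> by (intro mult_left_mono) auto
    then show ?thesis by (simp add: P_def)
  qed
  have Pn: "P z \<ge> 0" for z using PR[of z] by (meson order_trans powr_ge_zero)
  have f'F: "norm (f' z) \<le> F" for z using F by (simp add: f'_def)
  have fF: "AE z in lborel. z \<in> Q \<Omega> T \<longrightarrow> norm (f z) \<le> F"
  proof -
    have "AE z in lebesgue_on (Q \<Omega> T). ennreal (norm (f z)) \<le> ennreal F"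
      using esssup_AE[of "\<lambda>z. ennreal (norm (f z))" "lebesgue_on (Q \<Omega> T)"] f(2) unfolding Linf_norm_def by simp
    then show ?thesis unfolding AE_lebesgue_on_iff[OF Qb] using F by (auto elim!: eventually_mono)
  qed
  have \<rho>0: "AE z in lborel. z \<in> Q \<Omega> T \<longrightarrow> 0 \<le> \<rho> z" using \<rho>(2) unfolding AE_lebesgue_on_iff[OF Qb] .
  have eq: "AE z in lborel. z \<in> Q \<Omega> T \<longrightarrow> \<rho> z = R z \<and> u z = U z \<and> Du z = D z \<and> f z = f' z"
    using R0(3) Ue De f0e fF \<rho>0
  proof eventually_elim
    case (elim z)
    then show ?case by (auto simp: R_def f'_def)
  qed
  have eqP: "P z = \<rho> z powr (3/2) * Pfun \<epsilon> m \<rho> z" if "\<rho> z = R z" for z using that by (simp add: P_def Pfun_def)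
  have Ele: "Linf_L1_norm \<Omega> T (\<lambda>z. \<rho> z powr (3/2) * Pfun \<epsilon> m \<rho> z) \<le> ennreal E"
    "Linf_L1_norm \<Omega> T (\<lambda>z. \<rho> z * (norm (u z))\<^sup>2) \<le> ennreal E" "L2_W12_norm \<Omega> T u Du \<le> ennreal E"
    using Du(2) unfolding energy_bound_def by (meson add_increasing add_increasing2 order_trans order_refl zero_le le_add1 le_add2)+
  have sP: "AE t in lborel. (\<integral>\<^sub>+x. ennreal (P (x, t))) \<le> ennreal E"
    by (rule Linf_L1_slices[OF Ele(1) _ Pz Pn]) (use eq eqP in \<open>auto elim!: eventually_mono\<close>)
  have sU: "AE t in lborel. (\<integral>\<^sub>+x. ennreal (R (x, t) * (norm (U (x, t)))\<^sup>2)) \<le> ennreal E"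
    by (rule Linf_L1_slices[OF Ele(2), where g="\<lambda>z. R z * (norm (U z))\<^sup>2"]) (use eq Rz Rn in \<open>auto elim!: eventually_mono\<close>)
  have gr: "(\<integral>\<^sub>+z. ennreal ((norm (U z))\<^sup>2 + (norm (D z))\<^sup>2)) \<le> ennreal (E\<^sup>2)"
    by (rule L2_W12_total[OF Ele(3) E U D _ U0 D0]) (use eq in \<open>auto elim!: eventually_mono\<close>)
  have iD: "integrable lborel (\<lambda>z. (norm (D z))\<^sup>2)"
  proof (rule integrableI_nonneg)
    have "(\<integral>\<^sub>+z. ennreal ((norm (D z))\<^sup>2)) \<le> ennreal (E\<^sup>2)"
      by (rule order_trans[OF nn_integral_mono gr]) (auto intro!: ennreal_leI)
    then show "(\<integral>\<^sub>+z. ennreal ((norm (D z))\<^sup>2)) < \<infinity>" by (rule le_less_trans) simp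
  qed auto
  have iP: "integrable lborel P" by (rule integrable_of_slices[OF P Pz Pn sP])
  have iU: "integrable lborel (\<lambda>z. R z * (norm (U z))\<^sup>2)"
    by (rule integrable_of_slices[OF _ _ _ sU]) (use Rz Rn in auto)
  note int = flow_integrability[OF b\<Omega> R P U D f' Rz D0 Rn PR f'F iP iU iD]
  let ?M = "\<lambda>z. R z *\<^sub>R U z" and ?A = "\<lambda>z. R z *\<^sub>R tensor (U z) (U z) + P z *\<^sub>R mat 1 - stress \<nu>1 \<nu>2 (D z)" and ?H = "\<lambda>z. R z *\<^sub>R f' z"
  have Az: "?A z = 0" if "z \<notin> Q \<Omega> T" for z
    using Rz[OF that] Pz[OF that] D0[OF that] by (simp add: stress_def transpose_def trace_def vec_eq_iff)
  note Am[measurable] = measurable_flux[OF R P U D, of \<nu>1 \<nu>2]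
  define w where "w z = (l z)\<^sup>2" for z
  have ws: "smooth w" unfolding w_def[abs_def] power2_eq_square by (intro smooth_mult l)
  have wsub: "supp w \<subseteq> supp l" unfolding supp_def w_def by (intro closure_mono) auto
  have wc: "compact (supp w)" using compact_Int_closed[OF l(2), of "supp w"] wsub by (simp add: supp_def Int_absorb1)
  have mom: "momentum_identity (Q \<Omega> T) ?M ?A ?H"
    unfolding momentum_identity_def
  proof (intro allI impI)
    fix \<xi> :: "point \<Rightarrow> real^3" assume \<xi>: "test_function (Q \<Omega> T) \<xi>"
    note [measurable] = measurable_Grad[OF \<xi>] measurable_test_function(1)[OF \<xi>]
    have 1: "(LINT z:Q \<Omega> T|lebesgue. (\<rho> z *\<^sub>R u z) \<bullet> dt \<xi> z) = (\<integral>\<^sub>1z. ?M z \<bullet> dt \<xi> z)"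
      by (rule set_integral_lebesgue_AE_eq) (use eq Rz in \<open>auto elim!: eventually_mono\<close>)
    have 2: "(LINT z:Q \<Omega> T|lebesgue. (\<rho> z *\<^sub>R tensor (u z) (u z) + (\<rho> z powr (3/2) * Pfun \<epsilon> m \<rho> z) *\<^sub>R mat 1 - stress \<nu>1 \<nu>2 (Du z)) \<bullet> Grad \<xi> z)
       = (\<integral>\<^sub>1z. ?A z \<bullet> Grad \<xi> z)"
    proof (rule set_integral_lebesgue_AE_eq)
      show "Borel (\<lambda>z. ?A z \<bullet> Grad \<xi> z)" by measurable
      show "?A z \<bullet> Grad \<xi> z = 0" if "z \<notin> Q \<Omega> T" for z unfolding Az[OF that] by simp
      show "AE z in lborel. z \<in> Q \<Omega> T \<longrightarrow> (\<rho> z *\<^sub>R tensor (u z) (u z) + (\<rho> z powr (3/2) * Pfun \<epsilon> m \<rho> z) *\<^sub>R mat 1 - stress \<nu>1 \<nu>2 (Du z)) \<bullet> Grad \<xi> z = ?A z \<bullet> Grad \<xi> z"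
        using eq
      proof eventually_elim
        case (elim z)
        then show ?case using eqP[of z] by auto
      qed
    qed
    have 3: "(LINT z:Q \<Omega> T|lebesgue. (\<rho> z *\<^sub>R f z) \<bullet> \<xi> z) = (\<integral>\<^sub>1z. ?H z \<bullet> \<xi> z)"
      by (rule set_integral_lebesgue_AE_eq) (use eq Rz in \<open>auto elim!: eventually_mono\<close>)
    show "(\<integral>\<^sub>1z. ?M z \<bullet> dt \<xi> z) + (\<integral>\<^sub>1z. ?A z \<bullet> Grad \<xi> z) + (\<integral>\<^sub>1z. ?H z \<bullet> \<xi> z) = 0"
      using Du(3) \<xi> unfolding momentum_equation_def 1[symmetric] 2[symmetric] 3[symmetric] by blast
  qed
  have cont: "continuity_identity (Q \<Omega> T) R ?M"
    unfolding continuity_identity_def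
  proof (intro allI impI)
    fix \<psi> :: "point \<Rightarrow> real" assume \<psi>: "test_function (Q \<Omega> T) \<psi>"
    note [measurable] = measurable_grad[OF \<psi>]
    have 1: "(LINT z:Q \<Omega> T|lebesgue. \<rho> z * dt \<psi> z + (\<rho> z *\<^sub>R u z) \<bullet> grad \<psi> z) = (\<integral>\<^sub>1z. R z * dt \<psi> z + ?M z \<bullet> grad \<psi> z)"
      by (rule set_integral_lebesgue_AE_eq) (use eq Rz in \<open>auto elim!: eventually_mono\<close>)
    show "(\<integral>\<^sub>1z. R z * dt \<psi> z + ?M z \<bullet> grad \<psi> z) = 0"
      using ce \<psi> unfolding continuity_equation_def 1[symmetric] by blast
  qed
  have Sob: "AE t in lborel. (\<integral>\<^sub>+x. ennreal (w (x, t) ^ 3 * norm (U (x, t)) ^ 6))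
      \<le> ennreal (Sobolev_const C) * (\<integral>\<^sub>+x. ennreal ((norm (U (x, t)))\<^sup>2 + (norm (D (x, t)))\<^sup>2)) ^ 3"
  proof -
    have "AE t in lborel. t \<in> {0<..<T} \<longrightarrow> weak_gradient \<Omega> (\<lambda>x. u (x, t)) (\<lambda>x. Du (x, t))"
      using wg by (subst (asm) AE_lebesgue_on_iff) auto
    with AE_time_slices[OF eq] show ?thesis
    proof eventually_elim
      case (elim t)
      have p: "(\<lambda>x::real^3. (x, t)) \<in> borel_measurable borel" by (intro borel_measurable_continuous_onI continuous_intros)
      note [measurable] = measurable_compose[OF p U] measurable_compose[OF p D]
      show ?case
      proof (cases "t \<in> {0<..<T}")
        case False
        then have "U (x, t) = 0" for x by (intro U0) (auto simp: Q_def)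
        then show ?thesis by simp
      next
        case True
        have wk: "weak_gradient \<Omega> (\<lambda>x. u (x, t)) (\<lambda>x. Du (x, t))" using elim(2) True by blast
        have xQ: "(x, t) \<in> Q \<Omega> T \<longleftrightarrow> x \<in> \<Omega>" for x using True by (simp add: Q_def)
        have "(\<integral>\<^sub>+x. ennreal ((l (x, t) * norm (U (x, t))) ^ 6))
          \<le> ennreal (Sobolev_const C) * (\<integral>\<^sub>+x. ennreal ((norm (U (x, t)))\<^sup>2 + (norm (D (x, t)))\<^sup>2)) ^ 3"
        proof (rule Sobolev_slice[OF l C b\<Omega>])
          show "U (x, t) = 0" "D (x, t) = 0" if "x \<notin> \<Omega>" for x using that U0[of "(x, t)"] D0[of "(x, t)"] xQ by auto
          fix \<phi> :: "real^3 \<Rightarrow> real" and i j assume \<phi>: "test_function \<Omega> \<phi>"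
          note [measurable] = measurable_test_function[OF \<phi>]
          have [measurable]: "Borel (\<lambda>x. U (x, t) $ i)" unfolding cart_eq_inner_axis by measurable
          have "continuous_on UNIV (\<lambda>A::real^3^3. A $ i $ j)" by (intro continuous_intros)
          from measurable_compose[OF measurable_compose[OF p D] borel_measurable_continuous_onI[OF this]]
          have [measurable]: "Borel (\<lambda>x. D (x, t) $ i $ j)" .
          have 1: "(LINT x:\<Omega>|lebesgue. u (x, t) $ i * frechet_derivative \<phi> (at x) (axis j 1)) = (\<integral>\<^sub>1x. U (x, t) $ i * frechet_derivative \<phi> (at x) (axis j 1))"
            by (rule set_integral_lebesgue_AE_eq) (use elim(1) xQ U0 in \<open>auto elim!: eventually_mono\<close>)
          have 2: "(LINT x:\<Omega>|lebesgue. Du (x, t) $ i $ j * \<phi> x) = (\<integral>\<^sub>1x. D (x, t) $ i $ j * \<phi> x)"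
            by (rule set_integral_lebesgue_AE_eq) (use elim(1) xQ D0 in \<open>auto elim!: eventually_mono\<close>)
          show "(\<integral>\<^sub>1x. U (x, t) $ i * frechet_derivative \<phi> (at x) (axis j 1)) = - (\<integral>\<^sub>1x. D (x, t) $ i $ j * \<phi> x)"
            using wk \<phi> unfolding weak_gradient_def 1[symmetric] 2[symmetric] by blast
        qed measurable
        moreover have "(l (x, t) * norm (U (x, t))) ^ 6 = w (x, t) ^ 3 * norm (U (x, t)) ^ 6" for x
          by (simp add: w_def power_mult_distrib flip: power_mult)
        ultimately show ?thesis by simp
      qed
    qed
  qed
  \<comment> \<open>The gradient bound is E^2, because the energy contains the norm of the velocity
    and not its square.\<close>
  interpret bounded_flow \<Omega> T \<nu>1 \<nu>2 F w R P U f' D B E "E\<^sup>2" "Sobolev_const C" c M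
  proof
    show "smooth w" "compact (supp w)" "supp w \<subseteq> Q \<Omega> T" using ws wc wsub l(3) by auto
    show "Sobolev_const C \<ge> 0" by (simp add: Sobolev_const_def)
    show "\<bar>w z\<bar> \<le> c" "\<bar>dt w z\<bar> \<le> c" "norm (grad w z) \<le> c" for z using c unfolding w_def[abs_def] by auto
  qed (use b\<Omega> int Rz Az mom cont Rn PR f'F P U D B \<Omega> T E Pz U0 D0 sP sU gr Sob M in \<open>auto simp: w_def\<close>)
  have lm: "Borel l" by (intro borel_measurable_continuous_onI smooth_continuous l)
  have "density_bounds B T (C ^ 6 * E) (C ^ 6 * good_const) (\<lambda>z. l z ^ 4 * R z)"
    by (rule localized_density_bounds[OF even_bump_exists[OF l(1,2,4,5)] lm l(4)]) (use C(1) in \<open>auto simp: w_def intro: order_trans[OF abs_ge_self]\<close>)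
  moreover have "AE z in lborel. localized_density \<Omega> T l \<rho> z = l z ^ 4 * R z"
    using eq by eventually_elim (use Rz in \<open>auto simp: localized_density_def\<close>)
  ultimately show ?thesis by blast
qed

theorem proposition5p1:
  fixes \<Omega> :: "(real^3) set" and T \<nu>1 \<nu>2 E F \<mu> :: real
    and K :: "((real^3) \<times> real) set" and l :: "(real^3) \<times> real \<Rightarrow> real"
  assumes "bounded_C2_domain \<Omega>" and "T > 0"
    and "\<nu>1 > 0" and "\<nu>1 + \<nu>2 \<ge> 0"
    and "E \<ge> 0" and "F \<ge> 0"
    and "compact K" and "K \<subseteq> Q \<Omega> T"
    and "test_function UNIV l" and "supp l \<subseteq> Q \<Omega> T" and "\<And>z. l z \<ge> 0"
    and "\<exists>U. open U \<and> K \<subseteq> U \<and> (\<forall>z\<in>U. l z = 1)"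
    and "0 < \<mu>" and "\<mu> < 2/3"
  shows "\<exists>c>0. \<forall>m \<epsilon> f \<rho> u.
    m > 1 \<and> 0 < \<epsilon> \<and> \<epsilon> \<le> 1 \<and>
    f \<in> borel_measurable (lebesgue_on (Q \<Omega> T)) \<and> Linf_norm \<Omega> T f = ennreal F \<and>
    bounded_solution \<Omega> T \<nu>1 \<nu>2 \<epsilon> m E f \<rho> u \<longrightarrow>
      L2_norm (Psi \<mu> (localized_density \<Omega> T l \<rho>)) \<le> ennreal c \<and>
      L2_norm (G \<mu> (localized_density \<Omega> T l \<rho>)) \<le> ennreal c \<and>
      L2_norm (Sigma_pot \<mu> (localized_density \<Omega> T l \<rho>)) \<le> ennreal c"
proof -
  have \<Omega>: "open \<Omega>" "bounded \<Omega>" using assms(1) by (auto simp: bounded_C2_domain_def)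
  obtain r where r: "\<And>x. x \<in> \<Omega> \<Longrightarrow> norm x \<le> r" using \<Omega>(2) by (auto simp: bounded_iff)
  define B where "B = max 1 r"
  have B: "B \<ge> 1" "\<Omega> \<subseteq> cball 0 B" using r by (fastforce simp: B_def)+
  have l: "smooth l" "compact (supp l)" using assms(9) by (auto simp: test_function_def smooth_def)
  have T: "T \<ge> 0" and \<mu>: "0 \<le> \<mu>" "\<mu> \<le> 2/3" using assms by auto
  have "\<exists>E' Z. E' \<ge> 0 \<and> Z \<ge> 0 \<and> (\<forall>m \<epsilon> f \<rho> u. 0 < \<epsilon> \<and> f \<in> borel_measurable (lebesgue_on (Q \<Omega> T)) \<and> Linf_norm \<Omega> T f = ennreal F \<and>
    bounded_solution \<Omega> T \<nu>1 \<nu>2 \<epsilon> m E f \<rho> u \<longrightarrow>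
    (\<exists>R. density_bounds B T E' Z R \<and> (AE z in lborel. localized_density \<Omega> T l \<rho> z = R z)))"
  proof (cases "\<forall>z. l z = 0")
    \<comment> \<open>A weight that vanishes identically, possible for empty \<open>K\<close>,
      provides no bump; but then the localised density is 0.\<close>
    case True
    have "density_bounds B T 0 0 (\<lambda>z. 0)" by (simp add: density_bounds_def)
    moreover have "localized_density \<Omega> T l \<rho> z = 0" for \<rho> z using True[rule_format, of z] by (simp add: localized_density_def)
    ultimately show ?thesis by (intro exI[of _ 0]) auto
  next
    case False
    then obtain z0 where z0: "l z0 \<noteq> 0" by blast
    obtain M where M: "kernel_const B M" using kernel_const_exists[OF B(1)] by blast
    obtain C where C: "C > 0" "\<And>z. \<bar>l z\<bar> \<le> C" "\<And>z. \<bar>dt l z\<bar> \<le> C" "\<And>z. norm (grad l z) \<le> C"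
      using smooth_weight_bound[OF l] by blast
    have w: "smooth (\<lambda>z. (l z)\<^sup>2)" "compact (supp (\<lambda>z. (l z)\<^sup>2))"
    proof -
      show "smooth (\<lambda>z. (l z)\<^sup>2)" unfolding power2_eq_square by (intro smooth_mult l)
      have "supp (\<lambda>z. (l z)\<^sup>2) = supp l" by (simp add: supp_def)
      then show "compact (supp (\<lambda>z. (l z)\<^sup>2))" using l by simp
    qed
    obtain c where c: "c > 0" "\<And>z. \<bar>(l z)\<^sup>2\<bar> \<le> c" "\<And>z. \<bar>dt (\<lambda>z. (l z)\<^sup>2) z\<bar> \<le> c" "\<And>z. norm (grad (\<lambda>z. (l z)\<^sup>2) z) \<le> c"
      using smooth_weight_bound[OF w] by blast
    define Z where "Z = C ^ 6 * bounded_flow.good_const T \<nu>1 \<nu>2 F B E (E\<^sup>2) (Sobolev_const C) c M"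
    \<comment> \<open>Nonnegativity of the constant is established only inside the locale, that is,
      for a given flow. Its positive part is used instead, which \<open>ennreal\<close> does not
      distinguish from it.\<close>
    have Z: "ennreal Z = ennreal (max 0 Z)" by (simp add: max_def ennreal_neg)
    have "\<exists>R. density_bounds B T (C ^ 6 * E) (max 0 Z) R \<and> (AE z in lborel. localized_density \<Omega> T l \<rho> z = R z)"
      if "0 < \<epsilon>" "f \<in> borel_measurable (lebesgue_on (Q \<Omega> T))" "Linf_norm \<Omega> T f = ennreal F" "bounded_solution \<Omega> T \<nu>1 \<nu>2 \<epsilon> m E f \<rho> u"
      for m \<epsilon> f \<rho> u
      using solution_density_bounds[OF \<Omega>(1) B(2,1) assms(2,5,6) M l assms(10,11) z0 C(2,4) c(2,3,4) that, folded Z_def]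
      unfolding density_bounds_def Z .
    then show ?thesis using C(1) assms(5) by (intro exI[of _ "C ^ 6 * E"] exI[of _ "max 0 Z"]) auto
  qed
  then obtain E' Z where EZ: "E' \<ge> 0" "Z \<ge> 0" "\<And>m \<epsilon> f \<rho> u. 0 < \<epsilon> \<Longrightarrow> f \<in> borel_measurable (lebesgue_on (Q \<Omega> T)) \<Longrightarrow> Linf_norm \<Omega> T f = ennreal F \<Longrightarrow>
    bounded_solution \<Omega> T \<nu>1 \<nu>2 \<epsilon> m E f \<rho> u \<Longrightarrow>
    \<exists>R. density_bounds B T E' Z R \<and> (AE z in lborel. localized_density \<Omega> T l \<rho> z = R z)" by blast
  obtain c where "c > 0" "\<And>R \<rho>. density_bounds B T E' Z R \<Longrightarrow> AE z in lborel. \<rho> z = R z \<Longrightarrow>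
    L2_norm (Psi \<mu> \<rho>) \<le> ennreal c \<and> L2_norm (G \<mu> \<rho>) \<le> ennreal c \<and> L2_norm (Sigma_pot \<mu> \<rho>) \<le> ennreal c"
    using potential_bounds[OF B(1) \<mu> EZ(2,1) T] by blast
  then show ?thesis using EZ(3) by blast
qed

end
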